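(* Let $\tilde h$ be a hybrid regulation function, $\{B_{\mathrm d}(\xi_j,\delta\tilde h(\xi_j))\}_{j\in J}$ a structured admissible covering of $\mathbb{R}^d\setminus\{0\}$, $\{\eta_{n,j}\}_{n\in\mathbb{Z}^d,j\in J}$ the associated frame system (see context), and let $\eta^p_{n,j}:=|T_j|^{1/2-1/p}\eta_{n,j}$ for $0<p\le\infty$. Every tempered distribution modulo polynomials $f\in\mathcal S'\backslash\mathcal P$ has the expansion $$f=\sum_{j\in J}\sum_{n\in\mathbb{Z}^d}\langle f,\eta^p_{n,j}\rangle\,|T_j|^{1/p-1/2}\eta_{n,j},$$ with convergence in $\mathcal S'\backslash\mathcal P$. Moreover, given $0<p,q\le\infty$ and $\beta\in\mathbb{R}$, we have $$\|f\|_{\dot M^\beta_{p,q}(\tilde h)}\asymp\Big\|\Big\{\tilde h(\xi_j)^\beta\Big(\sum_{n\in\mathbb{Z}^d}|\langle f,\eta^p_{n,j}\rangle|^p\Big)^{1/p}\Big\}_{j\in J}\Big\|_{\ell_q},$$ for $f\in\mathcal S'\backslash\mathcal P$ (both sides taking values in $[0,\infty]$), where the constants of the equivalence depend on $p$ and $q$ (and not on $f$). For $p=\infty$ the sum over $n\in\mathbb{Z}^d$ is replaced by a supremum.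
   Context: Fourier transform: $\hat f(\xi)=\mathcal F f(\xi)=(2\pi)^{-d/2}\int f(x)e^{-ix\cdot\xi}\,dx$, extended to distributions. $\mathcal S_0(\mathbb{R}^d)$ is the closed subspace of $\theta\in\mathcal S(\mathbb{R}^d)$ with $\|\theta\|_M=\sup_{|\beta|\le M}\sup_{\xi}|\partial^\beta\hat\theta(\xi)|(|\xi|^M+|\xi|^{-M})<\infty$ for all $M\in\mathbb{N}$; $\mathcal S'\backslash\mathcal P$ is the space of continuous linear functionals on $\mathcal S_0$ (tempered distributions modulo polynomials). The pairing $\langle f,\eta\rangle$ is linear in $f$ and conjugate linear in $\eta$, extending the $L_2$ inner product. $F\asymp G$ means $c_1F\le G\le c_2F$ for constants $0<c_1\le c_2<\infty$. Anisotropy: $\vec a=(a_1,\dots,a_d)$ is fixed with $a_i>0$, $\sum_i a_i=d$; $D_{\vec a}(t)=\mathrm{diag}(t^{a_1},\dots,t^{a_d})$; $|0|_{\vec a}=0$ and for $\xi\ne0$, $|\xi|_{\vec a}$ is the unique $t>0$ with $|D_{\vec a}(1/t)\xi|=1$. Quasi-distance $\mathrm d(\xi,\zeta)=|\xi-\zeta|_{\vec a}$, balls $B_{\mathrm d}(\xi,r)=\{\zeta:\mathrm d(\xi,\zeta)<r\}$. A function $h:\mathbb{R}^d\setminus\{0\}\to(0,\infty)$ is $\mathrm d$-moderate if there are constants $R,\delta_0>0$ such that for all $\xi,\zeta\in\mathbb{R}^d\setminus\{0\}$, $\mathrm d(\xi,\zeta)\le\delta_0h(\xi)$ implies $R^{-1}\le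 h(\xi)/h(\zeta)\le R$. Hybrid regulation function: $\tilde h=\rho h_1+(1-\rho)h_2:\mathbb{R}^d\setminus\{0\}\to(0,\infty)$, where $\rho$ is a $C^s$ ramp function ($s\ge1$) with values in $[0,1]$, $\rho(\xi)=1$ for $0<|\xi|_{\vec a}\le 2/3$ and $\rho(\xi)=0$ for $|\xi|_{\vec a}\ge 4/3$; $h_1,h_2$ are $\mathrm d$-moderate; $c_0|\xi|_{\vec a}^r\le h_1(\xi)\le c_1|\xi|_{\vec a}$ for $0<|\xi|_{\vec a}\le4/3$ with some $c_0,c_1>0$, $r\ge1$; and $c_2\le h_2(\xi)\le c_3|\xi|_{\vec a}$ for $|\xi|_{\vec a}\ge2/3$ with some $c_2,c_3>0$. $\tilde h$ is $\mathrm d$-moderate; let $\delta_0$ be its constant and $0<\delta<\delta_0$. An admissible covering of $\mathbb{R}^d\setminus\{0\}$ is a family $\{Q_j\}_{j\in J}$ of measurable subsets of $\mathbb{R}^d\setminus\{0\}$ with union $\mathbb{R}^d\setminus\{0\}$ and $\sup_j\#\{i:Q_i\cap Q_j\ne\emptyset\}<\infty$. A structured admissible covering: $J$ countable, $T_j=A_j\cdot+b_j$ invertible affine maps, $P\subset Q\subset\mathbb{R}^d\setminus\{0\}$ bounded open with $P$ compactly contained in $Q$, such that $\{T_jP\}_{j}$ and $\{Q_j\}_j:=\{T_jQ\}_{j}$ are admissible coverings, and a constant $K_0$ such that $T_jQ\cap T_kQ\ne\emptyset$ implies $\|A_k^{-1}A_j\|_{\ell_\infty}\le K_0$ (maximum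 of absolute values of entries). Here $Q_j=B_{\mathrm d}(\xi_j,\delta\tilde h(\xi_j))$, $A_j=D_{\vec a}(\delta\tilde h(\xi_j))$, $|T_j|:=|\det A_j|$. Square-root system: fix a non-negative $\Phi\in C^\infty(\mathbb{R}^d)$ with $\Phi=1$ on $P$, $\mathrm{supp}\,\Phi\subset Q$; set $g_j(\xi)=\Phi(T_j^{-1}\xi)$ and $\phi_j=g_j/\sqrt{\sum_{k\in J}g_k^2}$; then $\mathrm{supp}\,\phi_j\subset Q_j$ and $\sum_j\phi_j^2=1$ on $\mathbb{R}^d\setminus\{0\}$. For a multiplier $m$, $m(D)f=\mathcal F^{-1}(m\hat f)$. Frame system: $K_a$ is a cube aligned with the axes of side-length $2a$ with $Q\subseteq K_a$; $e_{n,j}(\xi)=(2a)^{-d/2}|T_j|^{-1/2}\chi_{K_a}(T_j^{-1}\xi)e^{i\frac{\pi}{a}n\cdot T_j^{-1}\xi}$ and $\hat\eta_{n,j}=\phi_je_{n,j}$. Homogeneous decomposition space: for $0<p,q\le\infty$, $\beta\in\mathbb{R}$, $\dot M^\beta_{p,q}(\tilde h)$ is the set of $f\in\mathcal S'\backslash\mathcal P$ with $\|f\|_{\dot M^\beta_{p,q}(\tilde h)}=\big(\sum_{j\in J}(\tilde h(\xi_j)^\beta\|\phi_j^2(D)f\|_{L_p})^q\big)^{1/q}<\infty$ (usual modification if $q=\infty$). Convergence of the double series in $\mathcal S'\backslash\mathcal P$ is understood as: inner sum over $n$ first, then sum over $j$. *)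

theory Defs
  imports "HOL-Analysis.Analysis" "HOL-Probability.Essential_Supremum"
begin

subsection \<open>Smoothness and Schwartz functions\<close>

definition partial_deriv :: "'d::finite \<Rightarrow> (real^'d \<Rightarrow> 'b::real_normed_vector) \<Rightarrow> real^'d \<Rightarrow> 'b"
  where "partial_deriv i f x = frechet_derivative f (at x) (axis i 1)"

text \<open>Meant for open \<open>U\<close> only.\<close>

primrec Ck_on :: "nat \<Rightarrow> (real^'d) set \<Rightarrow> (real^'d::finite \<Rightarrow> 'b::real_normed_vector) \<Rightarrow> bool" where
  "Ck_on 0 U f \<longleftrightarrow> continuous_on U f"
| "Ck_on (Suc k) U f \<longleftrightarrow>
     (\<forall>x\<in>U. f differentiable (at x)) \<and> (\<forall>i. Ck_on k U (partial_deriv i f))"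

definition smooth :: "(real^'d::finite \<Rightarrow> 'b::real_normed_vector) \<Rightarrow> bool"
  where "smooth f \<longleftrightarrow> (\<forall>k. Ck_on k UNIV f)"

text \<open>A derivative \<open>\<partial>\<^sup>\<beta>\<close> is indexed by the list of its successive directions. On smooth functions
  the order of the directions is immaterial, so the lists of length at most \<open>M\<close> give exactly
  the derivatives with multi-index of order at most \<open>M\<close>.\<close>

definition partials :: "'d::finite list \<Rightarrow> (real^'d \<Rightarrow> 'b::real_normed_vector) \<Rightarrow> real^'d \<Rightarrow> 'b"
  where "partials is f = foldr partial_deriv is f"

definition schwartz :: "(real^'d::finite \<Rightarrow> complex) set"
  where "schwartz = {f. smooth f \<and>
    (\<forall>k is. \<exists>C. \<forall>x. (1 + norm x) ^ k * norm (partials is f x) \<le> C)}"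

subsection \<open>Fourier transform\<close>

definition fourier :: "(real^'d::finite \<Rightarrow> complex) \<Rightarrow> real^'d \<Rightarrow> complex"
  where "fourier f \<xi> = of_real ((2 * pi) powr (- real CARD('d) / 2)) *
    (\<integral>x. f x * cis (- (x \<bullet> \<xi>)) \<partial>lborel)"

definition inv_fourier :: "(real^'d::finite \<Rightarrow> complex) \<Rightarrow> real^'d \<Rightarrow> complex"
  where "inv_fourier f x = of_real ((2 * pi) powr (- real CARD('d) / 2)) *
    (\<integral>\<xi>. f \<xi> * cis (x \<bullet> \<xi>) \<partial>lborel)"

subsection \<open>The space \<open>\<S>\<^sub>0\<close> and its dual, the tempered distributions modulo polynomials\<close>

definition S0_norm :: "nat \<Rightarrow> (real^'d::finite \<Rightarrow> complex) \<Rightarrow> ennreal"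
  where "S0_norm M \<theta> = (SUP is\<in>{is. length is \<le> M}. SUP \<xi>\<in>-{0}.
    ennreal (norm (partials is (fourier \<theta>) \<xi>) * (norm \<xi> ^ M + inverse (norm \<xi>) ^ M)))"

definition S0 :: "(real^'d::finite \<Rightarrow> complex) set"
  where "S0 = {\<theta>\<in>schwartz. \<forall>M. S0_norm M \<theta> < \<infinity>}"

text \<open>Functionals are total functions on \<open>real^'d \<Rightarrow> complex\<close>; only their values on \<^const>\<open>S0\<close>
  matter. Continuity refers to the topology of the family \<^const>\<open>S0_norm\<close>; one index \<open>M\<close>
  suffices for a neighbourhood because the norms increase with \<open>M\<close>.\<close>

type_synonym 'd functional = "(real^'d \<Rightarrow> complex) \<Rightarrow> complex"

definition dist_mod_poly :: "'d::finite functional set"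
  where "dist_mod_poly = {u.
    (\<forall>\<theta>\<in>S0. \<forall>\<psi>\<in>S0. u (\<lambda>x. \<theta> x + \<psi> x) = u \<theta> + u \<psi>) \<and>
    (\<forall>\<theta>\<in>S0. \<forall>c. u (\<lambda>x. c * \<theta> x) = c * u \<theta>) \<and>
    (\<forall>\<theta>\<in>S0. \<forall>\<epsilon>>0. \<exists>M. \<exists>r>0. \<forall>\<psi>\<in>S0.
       S0_norm M (\<lambda>x. \<psi> x - \<theta> x) < r \<longrightarrow> norm (u \<psi> - u \<theta>) < \<epsilon>)}"

definition pairing :: "'d::finite functional \<Rightarrow> (real^'d \<Rightarrow> complex) \<Rightarrow> complex"
  where "pairing f \<eta> = f (\<lambda>x. cnj (\<eta> x))"

definition dist_of_fun :: "(real^'d::finite \<Rightarrow> complex) \<Rightarrow> 'd functional"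
  where "dist_of_fun g = (\<lambda>\<psi>. \<integral>x. g x * \<psi> x \<partial>lborel)"

text \<open>Unordered convergence of a series in the (weak-star) topology of the dual of \<^const>\<open>S0\<close>.\<close>

definition dist_has_sum :: "('i \<Rightarrow> 'd::finite functional) \<Rightarrow> 'd functional \<Rightarrow> 'i set \<Rightarrow> bool"
  where "dist_has_sum F u I \<longleftrightarrow> (\<forall>\<theta>\<in>S0. ((\<lambda>i. F i \<theta>) has_sum u \<theta>) I)"

text \<open>Fourier multipliers \<open>m(D) f = \<F>\<^sup>-\<^sup>1 (m \<F> f)\<close> by transposition. If \<open>m\<close> is smooth with compact
  support away from the origin and \<open>f\<close> is a distribution modulo polynomials, then \<open>m(D) f\<close> is
  well defined on all Schwartz functions (it only evaluates \<open>f\<close> on \<^const>\<open>S0\<close>), i.e. it is a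
  genuine tempered distribution.\<close>

definition dist_fourier :: "'d::finite functional \<Rightarrow> 'd functional"
  where "dist_fourier u = (\<lambda>\<psi>. u (fourier \<psi>))"

definition dist_inv_fourier :: "'d::finite functional \<Rightarrow> 'd functional"
  where "dist_inv_fourier u = (\<lambda>\<psi>. u (inv_fourier \<psi>))"

definition dist_mult :: "(real^'d::finite \<Rightarrow> complex) \<Rightarrow> 'd functional \<Rightarrow> 'd functional"
  where "dist_mult m u = (\<lambda>\<psi>. u (\<lambda>\<xi>. m \<xi> * \<psi> \<xi>))"

definition multiplier :: "(real^'d::finite \<Rightarrow> complex) \<Rightarrow> 'd functional \<Rightarrow> 'd functional"
  where "multiplier m f = dist_inv_fourier (dist_mult m (dist_fourier f))"

subsection \<open>\<open>L\<^sub>p\<close> and \<open>\<ell>\<^sub>p\<close> quasi-norms with values in \<open>[0, \<infinity>]\<close>\<close>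

definition inv_exponent :: "ennreal \<Rightarrow> real"
  where "inv_exponent p = enn2real (inverse p)"

definition ennreal_powr :: "ennreal \<Rightarrow> real \<Rightarrow> ennreal"
  where "ennreal_powr x s = (if x = \<infinity> then \<infinity> else ennreal (enn2real x powr s))"

definition Lp_norm :: "ennreal \<Rightarrow> (real^'d::finite \<Rightarrow> complex) \<Rightarrow> ennreal"
  where "Lp_norm p g =
    (if p = \<infinity> then esssup lborel (\<lambda>x. ennreal (norm (g x)))
     else ennreal_powr (\<integral>\<^sup>+x. ennreal (norm (g x) powr enn2real p) \<partial>lborel) (inv_exponent p))"

definition lp_norm :: "ennreal \<Rightarrow> 'i set \<Rightarrow> ('i \<Rightarrow> ennreal) \<Rightarrow> ennreal"
  where "lp_norm p I c =
    (if p = \<infinity> then (SUP i\<in>I. c i)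
     else ennreal_powr (\<Sum>\<^sub>\<infinity>i\<in>I. ennreal_powr (c i) (enn2real p)) (inv_exponent p))"

definition represents :: "(real^'d::finite \<Rightarrow> complex) \<Rightarrow> 'd functional \<Rightarrow> bool"
  where "represents g u \<longleftrightarrow> g \<in> borel_measurable lborel \<and>
    (\<forall>\<psi>\<in>schwartz. integrable lborel (\<lambda>x. g x * \<psi> x) \<and> u \<psi> = dist_of_fun g \<psi>)"

text \<open>The \<open>L\<^sub>p\<close> quasi-norm of a tempered distribution is that of the function representing it. This
  function is unique up to null sets, so the infimum is over at most one value; it is \<open>\<infinity>\<close>
  if there is no such function.\<close>

definition dist_Lp_norm :: "ennreal \<Rightarrow> 'd::finite functional \<Rightarrow> ennreal"
  where "dist_Lp_norm p u = (INF g\<in>{g. represents g u}. Lp_norm p g)"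

subsection \<open>Anisotropic quasi-distance\<close>

definition anisotropy :: "real^'d::finite \<Rightarrow> bool"
  where "anisotropy a \<longleftrightarrow> (\<forall>i. 0 < a $ i) \<and> (\<Sum>i\<in>UNIV. a $ i) = real CARD('d)"

definition aniso_dil :: "real^'d::finite \<Rightarrow> real \<Rightarrow> real^'d^'d"
  where "aniso_dil a t = (\<chi> i k. if i = k then t powr (a $ i) else 0)"

definition aniso_norm :: "real^'d::finite \<Rightarrow> real^'d \<Rightarrow> real"
  where "aniso_norm a \<xi> =
    (if \<xi> = 0 then 0 else (THE t. 0 < t \<and> norm (aniso_dil a (1 / t) *v \<xi>) = 1))"

definition aniso_dist :: "real^'d::finite \<Rightarrow> real^'d \<Rightarrow> real^'d \<Rightarrow> real"
  where "aniso_dist a \<xi> \<zeta> = aniso_norm a (\<xi> - \<zeta>)"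

definition aniso_ball :: "real^'d::finite \<Rightarrow> real^'d \<Rightarrow> real \<Rightarrow> (real^'d) set"
  where "aniso_ball a \<xi> r = {\<zeta>. aniso_dist a \<xi> \<zeta> < r}"

subsection \<open>Moderate functions and hybrid regulation functions\<close>

text \<open>Functions on \<open>\<real>\<^sup>d - {0}\<close> are total functions whose value at the origin is irrelevant.\<close>

definition moderate_with :: "real^'d::finite \<Rightarrow> real \<Rightarrow> real \<Rightarrow> (real^'d \<Rightarrow> real) \<Rightarrow> bool"
  where "moderate_with a R \<delta>\<^sub>0 h \<longleftrightarrow> 0 < R \<and> 0 < \<delta>\<^sub>0 \<and> (\<forall>\<xi>. \<xi> \<noteq> 0 \<longrightarrow> 0 < h \<xi>) \<and>
    (\<forall>\<xi> \<zeta>. \<xi> \<noteq> 0 \<longrightarrow> \<zeta> \<noteq> 0 \<longrightarrow> aniso_dist a \<xi> \<zeta> \<le> \<delta>\<^sub>0 * h \<xi> \<longrightarrow>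
       1 / R \<le> h \<xi> / h \<zeta> \<and> h \<xi> / h \<zeta> \<le> R)"

definition moderate :: "real^'d::finite \<Rightarrow> (real^'d \<Rightarrow> real) \<Rightarrow> bool"
  where "moderate a h \<longleftrightarrow> (\<exists>R \<delta>\<^sub>0. moderate_with a R \<delta>\<^sub>0 h)"

definition ramp_function :: "real^'d::finite \<Rightarrow> nat \<Rightarrow> (real^'d \<Rightarrow> real) \<Rightarrow> bool"
  where "ramp_function a s \<rho> \<longleftrightarrow> Ck_on s (-{0}) \<rho> \<and>
    (\<forall>\<xi>. \<xi> \<noteq> 0 \<longrightarrow> 0 \<le> \<rho> \<xi> \<and> \<rho> \<xi> \<le> 1) \<and>
    (\<forall>\<xi>. 0 < aniso_norm a \<xi> \<and> aniso_norm a \<xi> \<le> 2/3 \<longrightarrow> \<rho> \<xi> = 1) \<and>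
    (\<forall>\<xi>. aniso_norm a \<xi> \<ge> 4/3 \<longrightarrow> \<rho> \<xi> = 0)"

definition hybrid_regulation :: "real^'d::finite \<Rightarrow> (real^'d \<Rightarrow> real) \<Rightarrow> bool"
  where "hybrid_regulation a h \<longleftrightarrow>
    (\<exists>s \<rho> h\<^sub>1 h\<^sub>2 c\<^sub>0 c\<^sub>1 c\<^sub>2 c\<^sub>3 r.
       1 \<le> s \<and> ramp_function a s \<rho> \<and> moderate a h\<^sub>1 \<and> moderate a h\<^sub>2 \<and>
       0 < c\<^sub>0 \<and> 0 < c\<^sub>1 \<and> 0 < c\<^sub>2 \<and> 0 < c\<^sub>3 \<and> 1 \<le> r \<and>
       (\<forall>\<xi>. 0 < aniso_norm a \<xi> \<and> aniso_norm a \<xi> \<le> 4/3 \<longrightarrow>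
          c\<^sub>0 * aniso_norm a \<xi> powr r \<le> h\<^sub>1 \<xi> \<and> h\<^sub>1 \<xi> \<le> c\<^sub>1 * aniso_norm a \<xi>) \<and>
       (\<forall>\<xi>. aniso_norm a \<xi> \<ge> 2/3 \<longrightarrow> c\<^sub>2 \<le> h\<^sub>2 \<xi> \<and> h\<^sub>2 \<xi> \<le> c\<^sub>3 * aniso_norm a \<xi>) \<and>
       (\<forall>\<xi>. \<xi> \<noteq> 0 \<longrightarrow> h \<xi> = \<rho> \<xi> * h\<^sub>1 \<xi> + (1 - \<rho> \<xi>) * h\<^sub>2 \<xi>))"

subsection \<open>Structured admissible coverings of \<open>\<real>\<^sup>d - {0}\<close>\<close>

definition admissible_covering :: "'j set \<Rightarrow> ('j \<Rightarrow> (real^'d::finite) set) \<Rightarrow> bool"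
  where "admissible_covering J Q \<longleftrightarrow>
    (\<forall>j\<in>J. Q j \<in> sets lebesgue \<and> Q j \<subseteq> -{0}) \<and>
    (\<Union>j\<in>J. Q j) = -{0} \<and>
    (\<exists>N. \<forall>j\<in>J. finite {i\<in>J. Q i \<inter> Q j \<noteq> {}} \<and> card {i\<in>J. Q i \<inter> Q j \<noteq> {}} \<le> N)"

definition affine_map :: "real^'d^'d \<Rightarrow> real^'d \<Rightarrow> real^'d::finite \<Rightarrow> real^'d"
  where "affine_map A b \<xi> = A *v \<xi> + b"

definition structured_covering ::
    "'j set \<Rightarrow> ('j \<Rightarrow> real^'d^'d) \<Rightarrow> ('j \<Rightarrow> real^'d) \<Rightarrow> (real^'d::finite) set \<Rightarrow> (real^'d) set \<Rightarrow> bool"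
  where "structured_covering J A b P Q \<longleftrightarrow>
    countable J \<and> (\<forall>j\<in>J. invertible (A j)) \<and>
    open P \<and> bounded P \<and> open Q \<and> bounded Q \<and>
    compact (closure P) \<and> closure P \<subseteq> Q \<and> Q \<subseteq> -{0} \<and>
    admissible_covering J (\<lambda>j. affine_map (A j) (b j) ` P) \<and>
    admissible_covering J (\<lambda>j. affine_map (A j) (b j) ` Q) \<and>
    (\<exists>K. \<forall>j\<in>J. \<forall>k\<in>J. affine_map (A j) (b j) ` Q \<inter> affine_map (A k) (b k) ` Q \<noteq> {} \<longrightarrow>
       (\<forall>i l. \<bar>(matrix_inv (A k) ** A j) $ i $ l\<bar> \<le> K))"

text \<open>The covering by anisotropic balls. The translations \<open>b j\<close> need not be the centres \<open>\<xi> j\<close>: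
  \<open>Q\<close> is a translate of the anisotropic unit ball that avoids the origin.\<close>

definition ball_covering ::
    "real^'d::finite \<Rightarrow> (real^'d \<Rightarrow> real) \<Rightarrow> real \<Rightarrow> 'j set \<Rightarrow> ('j \<Rightarrow> real^'d) \<Rightarrow>
     ('j \<Rightarrow> real^'d^'d) \<Rightarrow> ('j \<Rightarrow> real^'d) \<Rightarrow> (real^'d) set \<Rightarrow> (real^'d) set \<Rightarrow> bool"
  where "ball_covering a h \<delta> J \<xi> A b P Q \<longleftrightarrow>
    structured_covering J A b P Q \<and>
    (\<forall>j\<in>J. \<xi> j \<noteq> 0 \<and> A j = aniso_dil a (\<delta> * h (\<xi> j)) \<and>
       affine_map (A j) (b j) ` Q = aniso_ball a (\<xi> j) (\<delta> * h (\<xi> j)))"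

subsection \<open>Square-root system and frame system\<close>

definition bump :: "(real^'d) set \<Rightarrow> (real^'d) set \<Rightarrow> (real^'d::finite \<Rightarrow> real) \<Rightarrow> bool"
  where "bump P Q \<Phi> \<longleftrightarrow> smooth \<Phi> \<and> (\<forall>\<xi>. 0 \<le> \<Phi> \<xi>) \<and> (\<forall>\<xi>\<in>P. \<Phi> \<xi> = 1) \<and>
    closure {\<xi>. \<Phi> \<xi> \<noteq> 0} \<subseteq> Q"

definition sqrt_system ::
    "'j set \<Rightarrow> ('j \<Rightarrow> real^'d^'d) \<Rightarrow> ('j \<Rightarrow> real^'d) \<Rightarrow> (real^'d::finite \<Rightarrow> real) \<Rightarrow> 'j \<Rightarrow> real^'d \<Rightarrow> real"
  where "sqrt_system J A b \<Phi> j \<xi> =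
    (let g = (\<lambda>k. \<Phi> (inv (affine_map (A k) (b k)) \<xi>))
     in g j / sqrt (\<Sum>\<^sub>\<infinity>k\<in>J. (g k)\<^sup>2))"

text \<open>The closed cube with centre \<open>z\<close> and side length \<open>2 * l\<close>.\<close>

definition cube :: "real^'d::finite \<Rightarrow> real \<Rightarrow> (real^'d) set"
  where "cube z l = cbox (z - (\<chi> i. l)) (z + (\<chi> i. l))"

definition exp_system ::
    "('j \<Rightarrow> real^'d^'d) \<Rightarrow> ('j \<Rightarrow> real^'d) \<Rightarrow> real^'d \<Rightarrow> real \<Rightarrow> int^'d \<Rightarrow> 'j \<Rightarrow> real^'d::finite \<Rightarrow> complex"
  where "exp_system A b z l n j \<xi> =
    (let \<omega> = inv (affine_map (A j) (b j)) \<xi>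
     in of_real ((2 * l) powr (- real CARD('d) / 2) * \<bar>det (A j)\<bar> powr (- 1/2) *
                 indicator (cube z l) \<omega>) *
        cis (pi / l * ((\<chi> i. real_of_int (n $ i)) \<bullet> \<omega>)))"

definition frame_system ::
    "'j set \<Rightarrow> ('j \<Rightarrow> real^'d^'d) \<Rightarrow> ('j \<Rightarrow> real^'d) \<Rightarrow> (real^'d::finite \<Rightarrow> real) \<Rightarrow> real^'d \<Rightarrow> real \<Rightarrow>
     int^'d \<Rightarrow> 'j \<Rightarrow> real^'d \<Rightarrow> complex"
  where "frame_system J A b \<Phi> z l n j =
    inv_fourier (\<lambda>\<xi>. of_real (sqrt_system J A b \<Phi> j \<xi>) * exp_system A b z l n j \<xi>)"

definition frame_system_p ::
    "ennreal \<Rightarrow> 'j set \<Rightarrow> ('j \<Rightarrow> real^'d^'d) \<Rightarrow> ('j \<Rightarrow> real^'d) \<Rightarrow> (real^'d::finite \<Rightarrow> real) \<Rightarrow>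
     real^'d \<Rightarrow> real \<Rightarrow> int^'d \<Rightarrow> 'j \<Rightarrow> real^'d \<Rightarrow> complex"
  where "frame_system_p p J A b \<Phi> z l n j x =
    of_real (\<bar>det (A j)\<bar> powr (1/2 - inv_exponent p)) * frame_system J A b \<Phi> z l n j x"

subsection \<open>Homogeneous decomposition spaces\<close>

definition decomp_norm ::
    "ennreal \<Rightarrow> ennreal \<Rightarrow> real \<Rightarrow> (real^'d::finite \<Rightarrow> real) \<Rightarrow> 'j set \<Rightarrow> ('j \<Rightarrow> real^'d) \<Rightarrow>
     ('j \<Rightarrow> real^'d \<Rightarrow> real) \<Rightarrow> 'd functional \<Rightarrow> ennreal"
  where "decomp_norm p q \<beta> h J \<xi> \<phi> f =
    lp_norm q J (\<lambda>j. ennreal (h (\<xi> j) powr \<beta>) *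
      dist_Lp_norm p (multiplier (\<lambda>\<zeta>. of_real ((\<phi> j \<zeta>)\<^sup>2)) f))"

end

theory Submission
  imports Defs "HOL-Probability.Probability"
begin

text \<open>
  On the Fourier side the test functions are the Schwartz functions vanishing to infinite order at
  the origin. The regulation function is bounded below by a power of the anisotropic norm near the
  origin, so derivatives of the square-root system cost only powers of \<open>|\<xi>| + 1 / |\<xi>|\<close>, which such
  functions absorb; hence \<open>f\<close> is the sum of the pieces \<open>\<phi>\<^sub>j(D)\<^sup>2 f\<close>. In the coordinates given by \<open>T\<^sub>j\<close>, the product
  of \<open>\<phi>\<^sub>j\<close> with a test function is smooth with support inside the cube, and its Fourier series is the
  expansion of \<open>\<phi>\<^sub>j(D)\<^sup>2 f\<close>. This piece is therefore represented by the function
  \<open>G\<^sub>j = \<Sum>\<^sub>n \<langle>f, \<eta>\<^sub>n\<^sub>j\<rangle> \<eta>\<^sub>n\<^sub>j\<close>.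

  After a dilation the \<open>\<eta>\<^sub>n\<^sub>j\<close> are, up to modulation, lattice translates of rapidly decreasing profiles that
  are bounded uniformly in \<open>j\<close>. A Schur test (for \<open>p \<ge> 1\<close>) or the subadditivity of the \<open>p\<close>-th power (for \<open>p < 1\<close>)
  bounds the norm of \<open>G\<^sub>j\<close> by that of the coefficients. Conversely, the squares of the \<open>\<phi>\<^sub>k\<close> with \<open>k\<close>
  neighbouring \<open>j\<close> sum to 1 on the support of \<open>\<phi>\<^sub>j\<close>, so the coefficients are integrals of these \<open>G\<^sub>k\<close>
  against \<open>\<eta>\<^sub>n\<^sub>j\<close>; for \<open>p < 1\<close> one uses that \<open>G\<^sub>k\<close> has a Fourier transform of compact support and is dominated
  by its own convolution with a rapidly decreasing kernel. Since the number of neighbours is bounded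
  and their scales are comparable, summation over \<open>j\<close> preserves the estimates.
\<close>

section \<open>Families of functions with uniformly bounded derivatives\<close>

text \<open>Nothing may depend on the index of the covering, and uniformity cannot be recovered
  after a limit or a choice, so smoothness is asserted of a whole family at once. This is feasible
  because anisotropic dilations are diagonal: composing with \<open>T j\<close> multiplies a partial
  derivative by one number, and moderateness bounds the ratios of these numbers for neighbouring
  sets. The cube is closed but \<open>Q\<close> is open, so a function with compact support in
  \<open>Q\<close> vanishes on the boundary of the cube and its Fourier series represents it without
  boundary effects. The obstacle for exponents p < 1 is that an integral is not controlled by the
  integral of a p-th power. It becomes so when the integrand is pointwise at most a constant times
  its own integral; band limitation supplies this bound once a kernel with submultiplicative decay
  is inserted. A second obstacle is that the pieces of \<open>f\<close> are only known to grow
  polynomially, at a rate depending on \<open>f\<close>. That growth may be used qualitatively, to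
  ensure that integrals are finite, but it must never enter the constants.\<close>

lemma partial_deriv_eq: "(f has_derivative f') (at x) \<Longrightarrow> partial_deriv i f x = f' (axis i 1)"
  unfolding partial_deriv_def by (simp add: frechet_derivative_at[symmetric])

lemma has_derivative_cong_open:
  assumes "open U" "x \<in> U" "\<And>y. y \<in> U \<Longrightarrow> f y = g y"
  shows "(f has_derivative f') (at x) \<longleftrightarrow> (g has_derivative f') (at x)"
  using has_derivative_transform_within_open[OF _ assms(1,2), of f f' UNIV g]
    has_derivative_transform_within_open[OF _ assms(1,2), of g f' UNIV f] assms(3) by auto

lemma partial_deriv_cong:
  assumes "open U" "x \<in> U" "\<And>y. y \<in> U \<Longrightarrow> f y = g y"
  shows "partial_deriv i f x = partial_deriv i g x"
  unfolding partial_deriv_def frechet_derivative_def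
  using has_derivative_cong_open[of U x f g] assms by simp

lemma differentiable_cong_open:
  assumes "open U" "x \<in> U" "\<And>y. y \<in> U \<Longrightarrow> f y = g y"
  shows "f differentiable (at x) \<longleftrightarrow> g differentiable (at x)"
  unfolding differentiable_def using has_derivative_cong_open[of U x f g] assms by simp

lemma frechet_derivativeI: "f differentiable F \<Longrightarrow> (f has_derivative frechet_derivative f F) F"
  using frechet_derivative_works by blast

lemma partials_simps [simp]:
  "partials [] f = f" "partials (i # is) f = partial_deriv i (partials is f)"
  by (simp_all add: partials_def)

lemma partials_snoc: "partials (is @ [i]) f = partials is (partial_deriv i f)"
  by (induction "is") auto

text \<open>The constant \<open>C\<close> is common to all members of the family \<open>F\<close>; all estimates that have to be
  uniform in the index of the covering are expressed in this way.\<close>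

primrec dbounded :: "nat \<Rightarrow> ('i \<Rightarrow> (real^'d) set) \<Rightarrow> ('i \<Rightarrow> real^'d \<Rightarrow> real) \<Rightarrow>
    ('i \<Rightarrow> real^'d::finite \<Rightarrow> 'b::real_normed_vector) \<Rightarrow> bool" where
  "dbounded 0 D w F \<longleftrightarrow> (\<exists>C. \<forall>i. \<forall>x\<in>D i. norm (F i x) \<le> C * w i x)"
| "dbounded (Suc k) D w F \<longleftrightarrow> (\<exists>C. \<forall>i. \<forall>x\<in>D i. norm (F i x) \<le> C * w i x) \<and>
     (\<forall>i. \<forall>x\<in>D i. F i differentiable (at x)) \<and> (\<forall>l. dbounded k D w (\<lambda>i. partial_deriv l (F i)))"

lemma dbounded_SucI:
  "(\<And>i x. x \<in> D i \<Longrightarrow> norm (F i x) \<le> C * w i x) \<Longrightarrow> (\<And>i x. x \<in> D i \<Longrightarrow> F i differentiable (at x)) \<Longrightarrow>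
    (\<And>l. dbounded k D w (\<lambda>i. partial_deriv l (F i))) \<Longrightarrow> dbounded (Suc k) D w F"
  by auto

lemma dbounded_0: "dbounded k D w F \<Longrightarrow> \<exists>C. \<forall>i. \<forall>x\<in>D i. norm (F i x) \<le> C * w i x"
  by (cases k) simp_all

text \<open>The weight is nonnegative on the domains, so \<open>C\<close> may be replaced by its
  absolute value; products of estimates require a nonnegative constant.\<close>

lemma dbounded_bound:
  assumes "dbounded k D w F" "\<And>i x. x \<in> D i \<Longrightarrow> 0 \<le> w i x"
  obtains C where "0 \<le> C" "\<And>i x. x \<in> D i \<Longrightarrow> norm (F i x) \<le> C * w i x"
proof -
  from assms(1) obtain C where C: "\<And>i x. x \<in> D i \<Longrightarrow> norm (F i x) \<le> C * w i x"
    by (cases k) auto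
  have "norm (F i x) \<le> \<bar>C\<bar> * w i x" if "x \<in> D i" for i x
    using C[OF that] assms(2)[OF that] by (smt (verit) mult_right_mono)
  then show ?thesis using that[of "\<bar>C\<bar>"] by auto
qed

lemma dbounded_Suc_imp: "dbounded (Suc k) D w F \<Longrightarrow> dbounded k D w F"
  by (induction k arbitrary: F) auto

text \<open>The bound at a point sees only the value there, but derivatives see a neighbourhood;
  openness of each \<open>D i\<close> carries the agreement over to
  \<open>partial_deriv\<close>.\<close>

lemma dbounded_cong:
  assumes "\<And>i. open (D i)" "\<And>i x. x \<in> D i \<Longrightarrow> F i x = G i x"
  shows "dbounded k D w F \<Longrightarrow> dbounded k D w G"
  using assms(2)
proof (induction k arbitrary: F G)
  case 0 then show ?case by auto
next
  case (Suc k)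
  have d: "\<forall>i. \<forall>x\<in>D i. G i differentiable (at x)"
    using Suc.prems differentiable_cong_open[OF assms(1), of _ _ "F _" "G _"] by (metis dbounded.simps(2))
  have ds: "dbounded k D w (\<lambda>i. partial_deriv l (G i))" for l
    by (rule Suc.IH[of "\<lambda>i. partial_deriv l (F i)"])
      (use Suc.prems partial_deriv_cong[OF assms(1), of _ _ "F _" "G _"] in auto)
  with Suc.prems d show ?case by simp
qed

lemma dbounded_subset:
  "dbounded k D w F \<Longrightarrow> (\<And>i. D' i \<subseteq> D i) \<Longrightarrow> dbounded k D' w F"
proof (induction k arbitrary: F)
  case 0 then show ?case by simp (meson subsetD)
next
  case (Suc k) then show ?case by simp (meson subsetD)
qed

lemma dbounded_weight:
  assumes "\<And>i x. x \<in> D i \<Longrightarrow> w i x \<le> C * v i x" "\<And>i x. x \<in> D i \<Longrightarrow> 0 \<le> w i x"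
  shows "dbounded k D w F \<Longrightarrow> dbounded k D v F"
proof (induction k arbitrary: F)
  case 0
  from dbounded_bound[OF 0 assms(2)] obtain B where "0 \<le> B" "\<And>i x. x \<in> D i \<Longrightarrow> norm (F i x) \<le> B * w i x"
    by blast
  then have "norm (F i x) \<le> (B * C) * v i x" if "x \<in> D i" for i x
    using assms(1)[OF that] that by (smt (verit) mult.assoc mult_left_mono)
  then show ?case unfolding dbounded.simps by blast
next
  case (Suc k)
  from dbounded_bound[OF Suc.prems assms(2)] obtain B where "0 \<le> B" "\<And>i x. x \<in> D i \<Longrightarrow> norm (F i x) \<le> B * w i x"
    by blast
  then have "norm (F i x) \<le> (B * C) * v i x" if "x \<in> D i" for i x
    using assms(1)[OF that] that by (smt (verit) mult.assoc mult_left_mono)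
  then show ?case using Suc by (intro dbounded_SucI) auto
qed

text \<open>A constant that serves all indices serves any selection of them. With a constant
  \<open>g\<close> this extracts one member, and from a family over \<open>unit\<close> it produces
  a constant family.\<close>

lemma dbounded_reindex:
  "dbounded k D w F \<Longrightarrow> dbounded k (\<lambda>i. D (g i)) (\<lambda>i. w (g i)) (\<lambda>i. F (g i))"
proof (induction k arbitrary: F)
  case 0 then show ?case by simp blast
next
  case (Suc k)
  from Suc.prems Suc.IH show ?case by simp blast
qed

lemma dbounded_zero: "dbounded k D w (\<lambda>_ _. 0)"
proof (induction k)
  case 0 show ?case by (auto intro: exI[of _ 0])
next
  case (Suc k)
  have "partial_deriv l (\<lambda>_. 0) = (\<lambda>_. 0::'c)" for l :: 'b
    by (auto simp: partial_deriv_eq[OF has_derivative_const])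
  then show ?case using Suc by (auto intro: exI[of _ 0])
qed

lemma dbounded_const:
  fixes F :: "'i \<Rightarrow> 'b::real_normed_vector" and D :: "'i \<Rightarrow> (real^'d::finite) set"
  assumes "\<And>i x. x \<in> D i \<Longrightarrow> norm (F i) \<le> C * w i x"
  shows "dbounded k D w (\<lambda>i x. F i)"
proof -
  have "partial_deriv l (\<lambda>_::real^'d. F i) = (\<lambda>_. 0)" for l i
    by (auto simp: partial_deriv_eq[OF has_derivative_const])
  then show ?thesis using assms by (cases k) (auto intro!: exI[of _ C] dbounded_zero)
qed

lemma dbounded_linear:
  assumes T: "bounded_linear T" and op: "\<And>i. open (D i)" and w: "\<And>i x. x \<in> D i \<Longrightarrow> 0 \<le> w i x"
  shows "dbounded k D w F \<Longrightarrow> dbounded k D w (\<lambda>i x. T (F i x))"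
proof (induction k arbitrary: F)
  case 0
  from dbounded_bound[OF 0 w] obtain B where B: "0 \<le> B" "\<And>i x. x \<in> D i \<Longrightarrow> norm (F i x) \<le> B * w i x"
    by blast
  from bounded_linear.nonneg_bounded[OF T] obtain K where K: "0 \<le> K" "\<And>x. norm (T x) \<le> norm x * K" by blast
  have "norm (T (F i x)) \<le> B * K * w i x" if "x \<in> D i" for i x
    using K(2)[of "F i x"] mult_right_mono[OF B(2)[OF that] K(1)] by (simp add: mult_ac)
  then show ?case unfolding dbounded.simps by blast
next
  case (Suc k)
  from dbounded_bound[OF Suc.prems w] obtain B where B: "0 \<le> B" "\<And>i x. x \<in> D i \<Longrightarrow> norm (F i x) \<le> B * w i x"
    by blast
  from bounded_linear.nonneg_bounded[OF T] obtain K where K: "0 \<le> K" "\<And>x. norm (T x) \<le> norm x * K" by blast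
  have 1: "norm (T (F i x)) \<le> B * K * w i x" if "x \<in> D i" for i x
    using K(2)[of "F i x"] mult_right_mono[OF B(2)[OF that] K(1)] by (simp add: mult_ac)
  have d: "((\<lambda>x. T (F i x)) has_derivative (\<lambda>h. T (frechet_derivative (F i) (at x) h))) (at x)" if "x \<in> D i" for i x
    by (rule bounded_linear.has_derivative[OF T frechet_derivativeI]) (use Suc.prems that in auto)
  have ds: "dbounded k D w (\<lambda>i. partial_deriv l (\<lambda>x. T (F i x)))" for l
    by (rule dbounded_cong[where D=D and F="\<lambda>i x. T (partial_deriv l (F i) x)", OF op])
      (use Suc.prems partial_deriv_eq[OF d] in \<open>auto intro!: Suc.IH simp: partial_deriv_def[symmetric]\<close>)
  have df: "(\<lambda>x. T (F i x)) differentiable (at x)" if "x \<in> D i" for i x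
    using d[OF that] unfolding differentiable_def by blast
  show ?case by (rule dbounded_SucI) (fact 1 df ds)+
qed

lemma dbounded_add:
  assumes op: "\<And>i. open (D i)"
  shows "dbounded k D w F \<Longrightarrow> dbounded k D w G \<Longrightarrow> dbounded k D w (\<lambda>i x. F i x + G i x)"
proof (induction k arbitrary: F G)
  case 0
  then obtain B C where "\<And>i x. x \<in> D i \<Longrightarrow> norm (F i x) \<le> B * w i x" "\<And>i x. x \<in> D i \<Longrightarrow> norm (G i x) \<le> C * w i x"
    using dbounded_0[OF 0(1)] dbounded_0[OF 0(2)] by blast
  then have "norm (F i x + G i x) \<le> (B + C) * w i x" if "x \<in> D i" for i x
    using that by (smt (verit) norm_triangle_ineq distrib_right)
  then show ?case unfolding dbounded.simps by blast
next
  case (Suc k)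
  then obtain B C where "\<And>i x. x \<in> D i \<Longrightarrow> norm (F i x) \<le> B * w i x" "\<And>i x. x \<in> D i \<Longrightarrow> norm (G i x) \<le> C * w i x"
    using dbounded_0[OF Suc.prems(1)] dbounded_0[OF Suc.prems(2)] by blast
  then have 1: "norm (F i x + G i x) \<le> (B + C) * w i x" if "x \<in> D i" for i x
    using that by (smt (verit) norm_triangle_ineq distrib_right)
  have d: "((\<lambda>x. F i x + G i x) has_derivative (\<lambda>h. frechet_derivative (F i) (at x) h + frechet_derivative (G i) (at x) h)) (at x)" if "x \<in> D i" for i x
    by (intro has_derivative_add) (use Suc.prems that in \<open>auto intro!: frechet_derivativeI\<close>)
  have ds: "dbounded k D w (\<lambda>i. partial_deriv l (\<lambda>x. F i x + G i x))" for l
    by (rule dbounded_cong[where D=D and F="\<lambda>i x. partial_deriv l (F i) x + partial_deriv l (G i) x", OF op])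
      (use Suc.prems partial_deriv_eq[OF d] in \<open>auto intro!: Suc.IH simp: partial_deriv_def[symmetric]\<close>)
  have df: "(\<lambda>x. F i x + G i x) differentiable (at x)" if "x \<in> D i" for i x
    using d[OF that] unfolding differentiable_def by blast
  show ?case by (rule dbounded_SucI) (fact 1 df ds)+
qed

text \<open>Leibniz rule with bookkeeping of the weights: a derivative of the product is a sum of
  two products in which only one factor has been differentiated, and the induction hypothesis, being
  stated for arbitrary families, covers both.\<close>

lemma dbounded_bilinear:
  assumes prd: "bounded_bilinear prd" and op: "\<And>i. open (D i)"
    and w: "\<And>i x. x \<in> D i \<Longrightarrow> 0 \<le> w i x" and v: "\<And>i x. x \<in> D i \<Longrightarrow> 0 \<le> v i x"
  shows "dbounded k D w F \<Longrightarrow> dbounded k D v G \<Longrightarrow> dbounded k D (\<lambda>i x. w i x * v i x) (\<lambda>i x. prd (F i x) (G i x))"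
proof (induction k arbitrary: F G)
  case (0 F G)
  from dbounded_bound[OF 0(1) w] obtain B where B: "0 \<le> B" "\<And>i x. x \<in> D i \<Longrightarrow> norm (F i x) \<le> B * w i x"
    by blast
  from dbounded_bound[OF 0(2) v] obtain C where C: "0 \<le> C" "\<And>i x. x \<in> D i \<Longrightarrow> norm (G i x) \<le> C * v i x"
    by blast
  from bounded_bilinear.nonneg_bounded[OF prd] obtain K where K: "0 \<le> K" "\<And>x y. norm (prd x y) \<le> norm x * norm y * K" by blast
  have "norm (prd (F i x) (G i x)) \<le> (B * C * K) * (w i x * v i x)" if "x \<in> D i" for i x
  proof -
    have "norm (F i x) * norm (G i x) \<le> (B * w i x) * (C * v i x)"
      using B C w v that by (intro mult_mono) auto
    from mult_right_mono[OF this K(1)] show ?thesis using K(2)[of "F i x" "G i x"] by (simp add: mult_ac)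
  qed
  then show ?case unfolding dbounded.simps by blast
next
  case (Suc k F G)
  have "dbounded 0 D w F" "dbounded 0 D v G" using Suc.prems by auto
  have 0: "\<exists>C. \<forall>i. \<forall>x\<in>D i. norm (prd (F i x) (G i x)) \<le> C * (w i x * v i x)"
  proof -
    from dbounded_bound[OF Suc.prems(1) w] obtain B where B: "0 \<le> B" "\<And>i x. x \<in> D i \<Longrightarrow> norm (F i x) \<le> B * w i x"
      by blast
    from dbounded_bound[OF Suc.prems(2) v] obtain C where C: "0 \<le> C" "\<And>i x. x \<in> D i \<Longrightarrow> norm (G i x) \<le> C * v i x"
      by blast
    from bounded_bilinear.nonneg_bounded[OF prd] obtain K where K: "0 \<le> K" "\<And>x y. norm (prd x y) \<le> norm x * norm y * K" by blast
    have "norm (prd (F i x) (G i x)) \<le> (B * C * K) * (w i x * v i x)" if "x \<in> D i" for i x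
    proof -
      have "norm (F i x) * norm (G i x) \<le> (B * w i x) * (C * v i x)"
        using B C w v that by (intro mult_mono) auto
      from mult_right_mono[OF this K(1)] show ?thesis using K(2)[of "F i x" "G i x"] by (simp add: mult_ac)
    qed
    then show ?thesis by blast
  qed
  have d: "((\<lambda>x. prd (F i x) (G i x)) has_derivative
     (\<lambda>h. prd (F i x) (frechet_derivative (G i) (at x) h) + prd (frechet_derivative (F i) (at x) h) (G i x))) (at x)" if "x \<in> D i" for i x
    by (intro bounded_bilinear.FDERIV[OF prd]) (use Suc.prems that in \<open>auto intro!: frechet_derivativeI\<close>)
  have ds: "dbounded k D (\<lambda>i x. w i x * v i x) (\<lambda>i. partial_deriv l (\<lambda>x. prd (F i x) (G i x)))" for l
  proof (rule dbounded_cong[where D=D and F="\<lambda>i x. prd (F i x) (partial_deriv l (G i) x) + prd (partial_deriv l (F i) x) (G i x)", OF op])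
    show "dbounded k D (\<lambda>i x. w i x * v i x) (\<lambda>i x. prd (F i x) (partial_deriv l (G i) x) + prd (partial_deriv l (F i) x) (G i x))"
      \<comment> \<open>The undifferentiated factor is known to order \<open>Suc k\<close> and is
        weakened to order \<open>k\<close> to fit the induction hypothesis.\<close>
      using Suc.prems dbounded_Suc_imp[OF Suc.prems(1)] dbounded_Suc_imp[OF Suc.prems(2)]
      by (intro dbounded_add op Suc.IH) (simp_all del: dbounded.simps(1))
  qed (use partial_deriv_eq[OF d] in \<open>auto simp: partial_deriv_def[symmetric]\<close>)
  have df: "(\<lambda>x. prd (F i x) (G i x)) differentiable (at x)" if "x \<in> D i" for i x
    using d[OF that] unfolding differentiable_def by blast
  obtain B where B: "\<And>i x. x \<in> D i \<Longrightarrow> norm (prd (F i x) (G i x)) \<le> B * (w i x * v i x)" using 0 by blast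
  show ?case by (rule dbounded_SucI) (fact B df ds)+
qed

lemma dbounded_scale:
  assumes "\<And>i. D i \<noteq> {} \<Longrightarrow> \<bar>c i\<bar> \<le> \<kappa> i" "\<And>i. open (D i)" "\<And>i x. x \<in> D i \<Longrightarrow> 0 \<le> w i x"
    "dbounded k D w F"
  shows "dbounded k D (\<lambda>i x. \<kappa> i * w i x) (\<lambda>i x. c i *\<^sub>R F i x)"
proof -
  have "0 \<le> \<kappa> i" if "x \<in> D i" for i x
    using assms(1)[of i] that by force
  moreover have "dbounded k D (\<lambda>i x. \<kappa> i) (\<lambda>i x. c i)"
    by (rule dbounded_const[where C=1]) (use assms(1) in fastforce)
  ultimately show ?thesis
    using dbounded_bilinear[where D=D and w="\<lambda>i x. \<kappa> i" and v=w and F="\<lambda>i x. c i" and G=F,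
      OF bounded_bilinear_scaleR assms(2) _ assms(3) _ assms(4)] by blast
qed

section \<open>Diagonal substitutions\<close>

definition dil :: "real^'d::finite \<Rightarrow> real^'d \<Rightarrow> real^'d" where
  "dil s x = (\<chi> i. s $ i * x $ i)"

lemma linear_dil: "linear (dil s)"
  by (rule linearI) (auto simp: dil_def vec_eq_iff algebra_simps)

lemma bounded_linear_dil: "bounded_linear (dil s)"
  using linear_dil linear_conv_bounded_linear by blast

lemma continuous_on_dil [continuous_intros]: "continuous_on S f \<Longrightarrow> continuous_on S (\<lambda>x. dil s (f x))"
  using bounded_linear.continuous_on[OF bounded_linear_dil] .

lemma dil_axis: "dil s (axis l 1) = s $ l *\<^sub>R axis l 1"
  by (auto simp: dil_def axis_def vec_eq_iff)

lemma has_derivative_diag: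
  assumes "(f has_derivative f') (at (dil s x + b))"
  shows "((\<lambda>x. f (dil s x + b)) has_derivative (\<lambda>h. f' (dil s h))) (at x)"
proof -
  have "((\<lambda>x. dil s x + b) has_derivative (\<lambda>h. dil s h)) (at x)"
    using bounded_linear_imp_has_derivative[OF bounded_linear_dil] has_derivative_add_const by blast
  from diff_chain_at[OF this assms] show ?thesis by (simp add: o_def)
qed

lemma partial_deriv_diag:
  assumes "f differentiable (at (dil s x + b))"
  shows "partial_deriv l (\<lambda>x. f (dil s x + b)) x = s $ l *\<^sub>R partial_deriv l f (dil s x + b)"
proof -
  let ?f' = "frechet_derivative f (at (dil s x + b))"
  have f': "(f has_derivative ?f') (at (dil s x + b))" using assms frechet_derivative_works by auto
  have "partial_deriv l (\<lambda>x. f (dil s x + b)) x = ?f' (dil s (axis l 1))"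
    by (rule partial_deriv_eq[OF has_derivative_diag[OF f']])
  also have "\<dots> = s $ l *\<^sub>R ?f' (axis l 1)"
    unfolding dil_axis using has_derivative_linear[OF f'] linear_scale by blast
  finally show ?thesis by (simp add: partial_deriv_def)
qed

text \<open>Each differentiation of the composite brings out one entry of \<open>s i\<close>, at
  most \<open>K i\<close> in absolute value; since \<open>1 \<le> K i\<close>, the power
  \<open>K i ^ k\<close> also covers derivatives of lower order. It stays explicit in the weight
  because \<open>K i\<close> need not be bounded over the family.\<close>

lemma dbounded_diag:
  fixes s :: "'i \<Rightarrow> real^'d::finite"
  assumes op: "\<And>i. open (D i)" and w: "\<And>i x. x \<in> D i \<Longrightarrow> 0 \<le> w i x"
    and K: "\<And>i l. D i \<noteq> {} \<Longrightarrow> \<bar>s i $ l\<bar> \<le> K i" "\<And>i. D i \<noteq> {} \<Longrightarrow> 1 \<le> K i"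
  shows "dbounded k D w F \<Longrightarrow> dbounded k (\<lambda>i. {x. dil (s i) x + b i \<in> D i})
     (\<lambda>i x. K i ^ k * w i (dil (s i) x + b i)) (\<lambda>i x. F i (dil (s i) x + b i))"
proof (induction k arbitrary: F)
  case 0 then show ?case by auto
next
  case (Suc k)
  let ?D = "\<lambda>i. {x. dil (s i) x + b i \<in> D i}"
  have op': "open (?D i)" for i
  proof -
    have "continuous_on UNIV (\<lambda>x. dil (s i) x + b i)" by (intro continuous_intros)
    from open_vimage[OF op this] show ?thesis by (simp add: vimage_def)
  qed
  from dbounded_bound[OF Suc.prems w] obtain B where B: "0 \<le> B" "\<And>i x. x \<in> D i \<Longrightarrow> norm (F i x) \<le> B * w i x"
    by blast
  have 1: "norm (F i (dil (s i) x + b i)) \<le> B * (K i ^ Suc k * w i (dil (s i) x + b i))" if "x \<in> ?D i" for i x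
  proof -
    have "1 * w i (dil (s i) x + b i) \<le> K i ^ Suc k * w i (dil (s i) x + b i)"
      using K(2)[of i] that w by (intro mult_right_mono one_le_power) auto
    then show ?thesis using B that by (smt (verit) mem_Collect_eq mult_left_mono)
  qed
  have d: "F i differentiable at (dil (s i) x + b i)" if "x \<in> ?D i" for i x
    using Suc.prems that by auto
  have ds: "dbounded k ?D (\<lambda>i x. K i ^ Suc k * w i (dil (s i) x + b i)) (\<lambda>i. partial_deriv l (\<lambda>x. F i (dil (s i) x + b i)))" for l
  proof (rule dbounded_cong[where D="?D" and F="\<lambda>i x. s i $ l *\<^sub>R partial_deriv l (F i) (dil (s i) x + b i)", OF op'])
    have "dbounded k ?D (\<lambda>i x. K i * (K i ^ k * w i (dil (s i) x + b i))) (\<lambda>i x. s i $ l *\<^sub>R partial_deriv l (F i) (dil (s i) x + b i))"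
    proof (rule dbounded_scale[OF _ op' _ Suc.IH])
      fix i assume "?D i \<noteq> {}" then show "\<bar>s i $ l\<bar> \<le> K i" using K(1)[of i] by auto
    next
      fix i x assume "x \<in> ?D i" then show "0 \<le> K i ^ k * w i (dil (s i) x + b i)" using K(2)[of i] w by fastforce
    qed (use Suc.prems in auto)
    then show "dbounded k ?D (\<lambda>i x. K i ^ Suc k * w i (dil (s i) x + b i)) (\<lambda>i x. s i $ l *\<^sub>R partial_deriv l (F i) (dil (s i) x + b i))"
      by (simp add: mult_ac)
  qed (use partial_deriv_diag[OF d] in auto)
  have df: "(\<lambda>x. F i (dil (s i) x + b i)) differentiable (at x)" if "x \<in> ?D i" for i x
    using d[OF that] has_derivative_diag unfolding differentiable_def by blast
  show ?case by (rule dbounded_SucI) (fact 1 df ds)+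
qed

text \<open>Off the closed set \<open>S i\<close> a member vanishes on a neighbourhood, so it is
  differentiable there with zero derivative. The vanishing thus passes to all partial derivatives
  and the estimate on \<open>D i\<close> becomes global.\<close>

lemma dbounded_extend:
  assumes "\<And>i. open (D i)" "\<And>i. closed (S i)" "\<And>i. S i \<subseteq> D i" and w: "\<And>i x. 0 \<le> w i x"
  shows "dbounded k D w F \<Longrightarrow> (\<And>i x. x \<notin> S i \<Longrightarrow> F i x = 0) \<Longrightarrow> dbounded k (\<lambda>i. UNIV) w F"
proof (induction k arbitrary: F)
  case 0
  obtain C where C: "0 \<le> C" "\<And>i x. x \<in> D i \<Longrightarrow> norm (F i x) \<le> C * w i x"
    by (rule dbounded_bound[OF 0(1)]) (use w in blast)+
  have "norm (F i x) \<le> C * w i x" for i x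
  proof (cases "x \<in> S i")
    case True then show ?thesis using C assms(3)[of i] by auto
  next
    case False then show ?thesis using C(1) 0(2) w by simp
  qed
  then show ?case unfolding dbounded.simps by blast
next
  case (Suc k)
  obtain C where C: "0 \<le> C" "\<And>i x. x \<in> D i \<Longrightarrow> norm (F i x) \<le> C * w i x"
    by (rule dbounded_bound[OF Suc.prems(1)]) (use w in blast)+
  have 1: "norm (F i x) \<le> C * w i x" for i x
  proof (cases "x \<in> S i")
    case True then show ?thesis using C assms(3)[of i] by auto
  next
    case False then show ?thesis using C(1) Suc.prems(2) w by simp
  qed
  have z: "((F i) has_derivative (\<lambda>_. 0)) (at x)" if "x \<notin> S i" for i x
    using has_derivative_cong_open[of "- S i" x "F i" "\<lambda>_. 0"] that assms(2)[of i] Suc.prems(2)[of _ i]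
    by (simp add: open_Compl)
  have df: "F i differentiable (at x)" for i x
  proof (cases "x \<in> S i")
    case True then show ?thesis using Suc.prems(1) assms(3)[of i] by auto
  next
    case False then show ?thesis using z differentiable_def by blast
  qed
  have ds: "dbounded k (\<lambda>i. UNIV) w (\<lambda>i. partial_deriv l (F i))" for l
    by (rule Suc.IH) (use Suc.prems(1) in simp, rule partial_deriv_eq[OF z])
  show ?case by (rule dbounded_SucI, rule 1, rule df, rule ds)
qed

text \<open>The summands are treated as one family indexed by pairs \<open>(m,i)\<close>, which
  forces a common constant for all of them; at most \<open>N\<close> terms then cost a factor
  \<open>N\<close>. Pairs with \<open>m\<close> outside \<open>I i\<close> receive the empty
  domain.\<close>

lemma dbounded_sum:
  assumes op: "\<And>i. open (D i)" and w: "\<And>i x. x \<in> D i \<Longrightarrow> 0 \<le> w i x"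
    and fin: "\<And>i. finite (I i)" "\<And>i. card (I i) \<le> N"
  shows "dbounded k (\<lambda>(m,i). if m \<in> I i then D i else {}) (\<lambda>(m,i). w i) (\<lambda>(m,i). G m i) \<Longrightarrow>
    dbounded k D w (\<lambda>i x. \<Sum>m\<in>I i. G m i x)"
proof (induction k arbitrary: G)
  case 0
  have "\<And>mi x. x \<in> (case mi of (m, i) \<Rightarrow> if m \<in> I i then D i else {}) \<Longrightarrow> 0 \<le> (case mi of (m, i) \<Rightarrow> w i) x"
    using w by (auto split: if_splits)
  from dbounded_bound[OF 0 this] obtain C where C: "0 \<le> C" "\<And>m i x. m \<in> I i \<Longrightarrow> x \<in> D i \<Longrightarrow> norm (G m i x) \<le> C * w i x"
    by (simp add: split_paired_all) metis
  have "norm (\<Sum>m\<in>I i. G m i x) \<le> real N * C * w i x" if "x \<in> D i" for i x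
  proof -
    have "norm (\<Sum>m\<in>I i. G m i x) \<le> (\<Sum>m\<in>I i. C * w i x)" using C that by (intro sum_norm_le) auto
    also have "\<dots> \<le> real N * (C * w i x)" using fin(2)[of i] C(1) w that by (simp add: mult_right_mono)
    finally show ?thesis by (simp add: mult_ac)
  qed
  then show ?case unfolding dbounded.simps by blast
next
  case (Suc k)
  have "\<And>mi x. x \<in> (case mi of (m, i) \<Rightarrow> if m \<in> I i then D i else {}) \<Longrightarrow> 0 \<le> (case mi of (m, i) \<Rightarrow> w i) x"
    using w by (auto split: if_splits)
  from dbounded_bound[OF Suc.prems this] obtain C where C: "0 \<le> C" "\<And>m i x. m \<in> I i \<Longrightarrow> x \<in> D i \<Longrightarrow> norm (G m i x) \<le> C * w i x"
    by (simp add: split_paired_all) metis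
  have 1: "norm (\<Sum>m\<in>I i. G m i x) \<le> real N * C * w i x" if "x \<in> D i" for i x
  proof -
    have "norm (\<Sum>m\<in>I i. G m i x) \<le> (\<Sum>m\<in>I i. C * w i x)" using C that by (intro sum_norm_le) auto
    also have "\<dots> \<le> real N * (C * w i x)" using fin(2)[of i] C(1) w that by (simp add: mult_right_mono)
    finally show ?thesis by (simp add: mult_ac)
  qed
  have dG: "G m i differentiable (at x)" if "m \<in> I i" "x \<in> D i" for m i x
    using Suc.prems that by (auto split: prod.splits)
  have d: "((\<lambda>x. \<Sum>m\<in>I i. G m i x) has_derivative (\<lambda>h. \<Sum>m\<in>I i. frechet_derivative (G m i) (at x) h)) (at x)"
    if "x \<in> D i" for i x
    by (intro has_derivative_sum) (use dG that in \<open>auto intro!: frechet_derivativeI\<close>)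
  have ds: "dbounded k D w (\<lambda>i. partial_deriv l (\<lambda>x. \<Sum>m\<in>I i. G m i x))" for l
  proof (rule dbounded_cong[where D=D and F="\<lambda>i x. \<Sum>m\<in>I i. partial_deriv l (G m i) x", OF op])
    have "(\<lambda>i. partial_deriv l (case i of (m, i) \<Rightarrow> G m i)) = (\<lambda>(m,i). partial_deriv l (G m i))" by auto
    then show "dbounded k D w (\<lambda>i x. \<Sum>m\<in>I i. partial_deriv l (G m i) x)"
      using Suc.prems by (intro Suc.IH) (auto simp: split_def)
  qed (use partial_deriv_eq[OF d] in \<open>auto simp: partial_deriv_def[symmetric]\<close>)
  have df: "(\<lambda>x. \<Sum>m\<in>I i. G m i x) differentiable (at x)" if "x \<in> D i" for i x
    using d[OF that] unfolding differentiable_def by blast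
  show ?case by (rule dbounded_SucI) (fact 1 df ds)+
qed

text \<open>The function y = s^(-1/2) satisfies y' = - y^3 s' / 2, so a partial derivative of y is a
  product of powers of y and a partial derivative of s. The induction therefore needs only the
  product rule, and \<open>1 \<le> s i x\<close> starts it.\<close>

lemma dbounded_recip_sqrt:
  fixes s :: "'i \<Rightarrow> real^'d::finite \<Rightarrow> real"
  assumes op: "\<And>i. open (D i)" and s1: "\<And>i x. x \<in> D i \<Longrightarrow> 1 \<le> s i x"
  shows "dbounded k D (\<lambda>_ _. 1) s \<Longrightarrow> dbounded k D (\<lambda>_ _. 1) (\<lambda>i x. 1 / sqrt (s i x))"
proof (induction k)
  case 0
  have "norm (1 / sqrt (s i x)) \<le> 1 * 1" if "x \<in> D i" for i x
    using real_sqrt_le_mono[OF s1[OF that]] by simp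
  then show ?case unfolding dbounded.simps by blast
next
  case (Suc k)
  let ?y = "\<lambda>i x. 1 / sqrt (s i x)"
  have IH: "dbounded k D (\<lambda>_ _. 1) ?y" using Suc.IH[OF dbounded_Suc_imp[OF Suc.prems]] .
  have mul: "dbounded k D (\<lambda>_ _. 1) (\<lambda>i x. F i x * G i x)"
    if "dbounded k D (\<lambda>_ _. 1) F" "dbounded k D (\<lambda>_ _. 1) G" for F G :: "'i \<Rightarrow> real^'d \<Rightarrow> real"
    using dbounded_bilinear[OF bounded_bilinear_mult op _ _ that] by simp
  have d: "(?y i has_derivative (\<lambda>h. - (1/2) * (?y i x * (?y i x * ?y i x)) * frechet_derivative (s i) (at x) h)) (at x)"
    if "x \<in> D i" for i x
  proof -
    have p: "0 < s i x" using s1[OF that] by simp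
    have "((\<lambda>t. 1 / sqrt t) has_real_derivative - (1/2) * (?y i x * (?y i x * ?y i x))) (at (s i x))"
      using p by (auto intro!: derivative_eq_intros simp: field_simps power2_eq_square)
    from has_field_derivative_imp_has_derivative[OF this]
    have 1: "((\<lambda>t. 1 / sqrt t) has_derivative (\<lambda>h. - (1/2) * (?y i x * (?y i x * ?y i x)) * h)) (at (s i x))" .
    have "(s i has_derivative frechet_derivative (s i) (at x)) (at x)"
      by (rule frechet_derivativeI) (use Suc.prems that in auto)
    from diff_chain_at[OF this 1] show ?thesis by (simp add: o_def)
  qed
  have ds: "dbounded k D (\<lambda>_ _. 1) (\<lambda>i. partial_deriv l (?y i))" for l
  proof (rule dbounded_cong[where D=D and F="\<lambda>i x. - (1/2) * (?y i x * (?y i x * ?y i x)) * partial_deriv l (s i) x", OF op])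
    show "dbounded k D (\<lambda>_ _. 1) (\<lambda>i x. - (1/2) * (?y i x * (?y i x * ?y i x)) * partial_deriv l (s i) x)"
      by (intro mul IH dbounded_const[where C="1/2"]) (use Suc.prems in auto)
  qed (use partial_deriv_eq[OF d] in \<open>auto simp: partial_deriv_def[symmetric]\<close>)
  have df: "?y i differentiable (at x)" if "x \<in> D i" for i x
    using d[OF that] unfolding differentiable_def by blast
  have 1: "norm (?y i x) \<le> 1 * 1" if "x \<in> D i" for i x using real_sqrt_le_mono[OF s1[OF that]] by simp
  show ?case by (rule dbounded_SucI) (fact 1 df ds)+
qed

lemma dbounded_partials:
  "dbounded k D w F \<Longrightarrow> length is \<le> k \<Longrightarrow> \<exists>C. \<forall>i. \<forall>x\<in>D i. norm (partials is (F i) x) \<le> C * w i x"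
proof (induction k arbitrary: F "is")
  case 0 then show ?case by auto
next
  case (Suc k)
  show ?case
  proof (cases "is" rule: rev_cases)
    case Nil then show ?thesis using Suc.prems by auto
  next
    case (snoc js l)
    then show ?thesis using Suc.IH[of "\<lambda>i. partial_deriv l (F i)" js] Suc.prems by (auto simp: partials_snoc)
  qed
qed

text \<open>There are finitely many lists of directions of length at most \<open>k\<close>, so their
  constants add up to a single one.\<close>

lemma dbounded_partials_unif:
  fixes F :: "'i \<Rightarrow> real^'d::finite \<Rightarrow> 'b::real_normed_vector"
  assumes "dbounded k D w F" "\<And>i x. x \<in> D i \<Longrightarrow> 0 \<le> w i x"
  obtains C where "0 \<le> C" "\<And>is i x. length is \<le> k \<Longrightarrow> x \<in> D i \<Longrightarrow> norm (partials is (F i) x) \<le> C * w i x"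
proof -
  have "\<forall>is. \<exists>C. length is \<le> k \<longrightarrow> (\<forall>i. \<forall>x\<in>D i. norm (partials is (F i) x) \<le> C * w i x)"
    using dbounded_partials[OF assms(1)] by blast
  then obtain c where c: "\<And>is i x. length is \<le> k \<Longrightarrow> x \<in> D i \<Longrightarrow> norm (partials is (F i) x) \<le> c is * w i x"
    by metis
  let ?L = "{is::'d list. length is \<le> k}"
  have fin: "finite ?L" using finite_lists_length_le[OF finite[of UNIV], of k] by simp
  have "norm (partials is (F i) x) \<le> (\<Sum>is\<in>?L. \<bar>c is\<bar>) * w i x" if "length is \<le> k" "x \<in> D i" for "is" i x
  proof -
    have "c is \<le> (\<Sum>is\<in>?L. \<bar>c is\<bar>)" using member_le_sum[of "is" ?L "\<lambda>is. \<bar>c is\<bar>"] fin that by auto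
    then show ?thesis using c[OF that] assms(2)[OF that(2)] by (meson mult_right_mono order_trans)
  qed
  then show ?thesis using that[of "\<Sum>is\<in>?L. \<bar>c is\<bar>"] by (auto simp: sum_nonneg)
qed

lemma dboundedI:
  assumes "\<And>is. length is \<le> k \<Longrightarrow> \<exists>C. \<forall>i. \<forall>x\<in>D i. norm (partials is (F i) x) \<le> C * w i x"
    "\<And>is i x. length is < k \<Longrightarrow> x \<in> D i \<Longrightarrow> partials is (F i) differentiable (at x)"
  shows "dbounded k D w F"
  using assms
proof (induction k arbitrary: F)
  case 0 from "0.prems"(1)[of "[]"] show ?case by simp
next
  case (Suc k)
  have ds: "dbounded k D w (\<lambda>i. partial_deriv l (F i))" for l
    by (rule Suc.IH) (use Suc.prems(1)[of "_ @ [l]"] Suc.prems(2)[of "_ @ [l]"] in \<open>auto simp: partials_snoc\<close>)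
  then show ?case using Suc.prems(1)[of "[]"] Suc.prems(2)[of "[]"] by auto
qed

section \<open>Smoothness expressed through the family calculus\<close>

lemma smooth_partials: "smooth f \<longleftrightarrow> (\<forall>is x. partials is f differentiable (at x))"
proof
  assume s: "smooth f"
  have *: "smooth f \<Longrightarrow> smooth (partial_deriv i f)" for i and f :: "real^'a \<Rightarrow> 'b"
    unfolding smooth_def
  proof
    fix k assume "\<forall>k. Ck_on k UNIV f"
    from spec[OF this, of "Suc k"] show "Ck_on k UNIV (partial_deriv i f)" by simp
  qed
  have "smooth f \<Longrightarrow> partials is f differentiable (at x)" for "is" x
  proof (induction "is" arbitrary: f rule: rev_induct)
    case Nil
    then have "Ck_on (Suc 0) UNIV f" unfolding smooth_def by blast
    then show ?case by simp
  next
    case (snoc i "is") then show ?case using * by (simp add: partials_snoc)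
  qed
  then show "\<forall>is x. partials is f differentiable (at x)" using s by blast
next
  assume "\<forall>is x. partials is f differentiable (at x)"
  then have "Ck_on k UNIV f" for k
  proof (induction k arbitrary: f)
    case 0
    then have "f differentiable (at x)" for x using partials_simps(1)[of f] by metis
    then show ?case by (auto simp: continuous_on_eq_continuous_at intro!: differentiable_imp_continuous_within)
  next
    case (Suc k)
    have "f differentiable (at x)" for x using Suc.prems partials_simps(1)[of f] by metis
    moreover have "Ck_on k UNIV (partial_deriv i f)" for i
      by (rule Suc.IH) (use Suc.prems in \<open>simp add: partials_snoc[symmetric]\<close>)
    ultimately show ?case by simp
  qed
  then show "smooth f" by (simp add: smooth_def)
qed

lemma smooth_partial_deriv: "smooth f \<Longrightarrow> smooth (partial_deriv i f)"
  by (simp add: smooth_partials partials_snoc[symmetric])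

lemma smooth_differentiable: "smooth f \<Longrightarrow> f differentiable (at x)"
  using smooth_partials[of f] by (metis partials_simps(1))

lemma smooth_continuous: "smooth f \<Longrightarrow> continuous_on S f"
  using smooth_differentiable differentiable_imp_continuous_within
  by (metis continuous_at_imp_continuous_on)

text \<open>The weight is the sum of all derivative norms up to order \<open>k\<close>, so the bound
  is a tautology. As \<open>smoothI\<close> accepts any weight, closure properties of
  \<open>smooth\<close> can be read off from those of \<open>dbounded\<close>.\<close>

lemma smooth_dbounded:
  assumes "smooth f"
  obtains w where "\<And>x. 0 \<le> w x" "dbounded k (\<lambda>_. UNIV) (\<lambda>_. w) (\<lambda>_::'i. f)"
proof
  let ?L = "{is::'a list. length is \<le> k}"
  let ?w = "\<lambda>x. \<Sum>is\<in>?L. norm (partials is f x)"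
  have fin: "finite ?L" using finite_lists_length_le[OF finite[of UNIV], of k] by simp
  show "dbounded k (\<lambda>_. UNIV) (\<lambda>_. ?w) (\<lambda>_::'i. f)"
  proof (rule dboundedI)
    fix "is" :: "'a list" assume "length is \<le> k"
    then show "\<exists>C. \<forall>i::'i. \<forall>x\<in>UNIV. norm (partials is f x) \<le> C * ?w x"
      using member_le_sum[of "is" ?L "\<lambda>is. norm (partials is f _)"] fin by (auto intro!: exI[of _ 1])
  qed (use assms smooth_partials in blast)
qed (auto intro: sum_nonneg)

lemma smoothI:
  fixes f :: "real^'a::finite \<Rightarrow> 'b::real_normed_vector"
  assumes "\<And>k. \<exists>w. dbounded k (\<lambda>_. UNIV) w (\<lambda>_::unit. f)"
  shows "smooth f"
  unfolding smooth_partials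
proof (intro allI)
  have *: "dbounded (Suc (length is)) D w F \<Longrightarrow> x \<in> D i \<Longrightarrow> partials is (F i) differentiable (at x)"
    for "is" x D w and F :: "unit \<Rightarrow> real^'a \<Rightarrow> 'b" and i
  proof (induction "is" arbitrary: F rule: rev_induct)
    case Nil then show ?case by simp
  next
    case (snoc l js)
    have "dbounded (Suc (Suc (length js))) D w F" using snoc.prems(1) by (simp only: length_append_singleton)
    then have "dbounded (Suc (length js)) D w (\<lambda>i. partial_deriv l (F i))"
      by (subst (asm) dbounded.simps(2)) blast
    from snoc.IH[OF this snoc.prems(2)] show ?case by (simp add: partials_snoc)
  qed
  fix "is" :: "'a list" and x
  from assms[of "Suc (length is)"] obtain w where "dbounded (Suc (length is)) (\<lambda>_. UNIV) w (\<lambda>_::unit. f)" by blast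
  from *[OF this] show "partials is f differentiable (at x)" by simp
qed

lemma smooth_bilinear:
  fixes f :: "real^'d::finite \<Rightarrow> 'b::real_normed_vector" and g :: "real^'d \<Rightarrow> 'c::real_normed_vector"
  assumes "bounded_bilinear prd" "smooth f" "smooth g"
  shows "smooth (\<lambda>x. prd (f x) (g x))"
proof (rule smoothI)
  fix k
  obtain w v where "\<And>x. 0 \<le> w x" "dbounded k (\<lambda>_. UNIV) (\<lambda>_. w) (\<lambda>_::unit. f)"
     "\<And>x. 0 \<le> v x" "dbounded k (\<lambda>_. UNIV) (\<lambda>_. v) (\<lambda>_::unit. g)"
    using smooth_dbounded[OF assms(2)] smooth_dbounded[OF assms(3)] by metis
  then have "dbounded k (\<lambda>_. UNIV) (\<lambda>_ x. w x * v x) (\<lambda>_::unit. \<lambda>x. prd (f x) (g x))"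
    by (intro dbounded_bilinear[OF assms(1)]) auto
  then show "\<exists>w. dbounded k (\<lambda>_. UNIV) w (\<lambda>_::unit. \<lambda>x. prd (f x) (g x))" by (intro exI)
qed

lemma smooth_add:
  assumes "smooth f" "smooth g"
  shows "smooth (\<lambda>x. f x + g x)"
proof (rule smoothI)
  fix k
  obtain w v where wv: "\<And>x. 0 \<le> w x" "dbounded k (\<lambda>_. UNIV) (\<lambda>_. w) (\<lambda>_::unit. f)"
     "\<And>x. 0 \<le> v x" "dbounded k (\<lambda>_. UNIV) (\<lambda>_. v) (\<lambda>_::unit. g)"
    using smooth_dbounded[OF assms(1)] smooth_dbounded[OF assms(2)] by metis
  have "dbounded k (\<lambda>_. UNIV) (\<lambda>_ x. w x + v x) (\<lambda>_::unit. f)" "dbounded k (\<lambda>_. UNIV) (\<lambda>_ x. w x + v x) (\<lambda>_::unit. g)"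
    by (rule dbounded_weight[OF _ _ wv(2), where C=1]; use wv in simp)
       (rule dbounded_weight[OF _ _ wv(4), where C=1]; use wv in simp)
  then show "\<exists>w. dbounded k (\<lambda>_. UNIV) w (\<lambda>_::unit. \<lambda>x. f x + g x)"
    by (intro exI dbounded_add) auto
qed

lemma smooth_linear:
  assumes "bounded_linear T" "smooth f"
  shows "smooth (\<lambda>x. T (f x))"
proof (rule smoothI)
  fix k
  obtain w where "\<And>x. 0 \<le> w x" "dbounded k (\<lambda>_. UNIV) (\<lambda>_. w) (\<lambda>_::unit. f)"
    using smooth_dbounded[OF assms(2)] by metis
  then show "\<exists>w. dbounded k (\<lambda>_. UNIV) w (\<lambda>_::unit. \<lambda>x. T (f x))"
    by (intro exI dbounded_linear[OF assms(1)]) auto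
qed

lemma smooth_diag:
  assumes "smooth f"
  shows "smooth (\<lambda>x. f (dil s x + b))"
proof (rule smoothI)
  fix k
  obtain w where w: "\<And>x. 0 \<le> w x" "dbounded k (\<lambda>_. UNIV) (\<lambda>_. w) (\<lambda>_::unit. f)"
    using smooth_dbounded[OF assms] by metis
  have "\<bar>s $ l\<bar> \<le> 1 + norm s" for l using component_le_norm_cart[of s l] by simp
  then show "\<exists>w. dbounded k (\<lambda>_. UNIV) w (\<lambda>_::unit. \<lambda>x. f (dil s x + b))"
    using dbounded_diag[of "\<lambda>_::unit. UNIV" "\<lambda>_. w" "\<lambda>_. s" "\<lambda>_. 1 + norm s" k "\<lambda>_. f" "\<lambda>_. b"] w by auto
qed

section \<open>Decay weights and the Schwartz class\<close>

definition decay :: "nat \<Rightarrow> 'a::real_normed_vector \<Rightarrow> real" where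
  "decay N x = inverse ((1 + norm x) ^ N)"

lemma decay_pos [simp]: "0 < decay N x" "0 \<le> decay N x" "decay N x \<noteq> 0"
  by (auto simp: decay_def add_pos_nonneg less_imp_neq[symmetric] less_imp_le zero_less_power)

text \<open>From here on membership is proved and used in the weighted form, so that products and
  substitutions of Schwartz functions come from the general calculus.\<close>

lemma schwartz_iff:
  "f \<in> schwartz \<longleftrightarrow> (\<forall>k N. dbounded k (\<lambda>_::unit. UNIV) (\<lambda>_. decay N) (\<lambda>_. f))"
proof
  assume f: "f \<in> schwartz"
  show "\<forall>k N. dbounded k (\<lambda>_::unit. UNIV) (\<lambda>_. decay N) (\<lambda>_. f)"
  proof (intro allI, rule dboundedI)
    fix k N and "is" :: "'a list"
    from f obtain C where C: "\<And>x. (1 + norm x) ^ N * norm (partials is f x) \<le> C"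
      unfolding schwartz_def by blast
    have "norm (partials is f x) \<le> C * decay N x" for x
    proof -
      have p: "0 < (1 + norm x) ^ N" by (simp add: add_pos_nonneg)
      show ?thesis using C[of x] p by (simp add: decay_def field_simps)
    qed
    then show "\<exists>C. \<forall>i::unit. \<forall>x\<in>UNIV. norm (partials is f x) \<le> C * decay N x" by blast
  next
    fix "is" x
    show "partials is f differentiable (at x)" using f smooth_partials unfolding schwartz_def by blast
  qed
next
  assume d: "\<forall>k N. dbounded k (\<lambda>_::unit. UNIV) (\<lambda>_. decay N) (\<lambda>_. f)"
  then have "smooth f" by (intro smoothI) blast
  moreover have "\<exists>C. \<forall>x. (1 + norm x) ^ k * norm (partials is f x) \<le> C" for k "is"
  proof -
    obtain C where C: "\<And>x. norm (partials is f x) \<le> C * decay k x"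
      using dbounded_partials[OF d[rule_format, of "length is" k], of "is"] by auto
    have "(1 + norm x) ^ k * norm (partials is f x) \<le> C" for x
    proof -
      have p: "0 < (1 + norm x) ^ k" by (simp add: add_pos_nonneg)
      show ?thesis using C[of x] p by (simp add: decay_def field_simps)
    qed
    then show ?thesis by blast
  qed
  ultimately show "f \<in> schwartz" unfolding schwartz_def mem_Collect_eq by (intro conjI allI)
qed

section \<open>Linear substitutions and Schwartz functions\<close>

lemma prod_Basis_cart: "(\<Prod>b\<in>(Basis::(real^'d::finite) set). g b) = (\<Prod>i\<in>UNIV. g (axis i 1))"
proof -
  have "Basis = (\<lambda>i. axis i 1 :: real^'d) ` UNIV" by (auto simp: Basis_vec_def)
  moreover have "inj (\<lambda>i. axis i 1 :: real^'d)" by (auto simp: inj_on_def axis_eq_axis)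
  ultimately show ?thesis using prod.reindex[of "\<lambda>i. axis i 1 :: real^'d" UNIV g] by (simp add: o_def)
qed

lemma one_norm_pos [simp]: "0 < 1 + norm x" "1 + norm x \<noteq> 0"
  using add_pos_nonneg[OF zero_less_one norm_ge_zero[of x]] by auto

lemma measurable_dil [measurable]: "(\<lambda>x. dil s x + b) \<in> borel_measurable borel"
  by (intro borel_measurable_continuous_onI continuous_intros)

lemma lborel_dil:
  fixes s :: "real^'d::finite"
  assumes "\<And>i. s $ i \<noteq> 0"
  shows "lborel = density (distr lborel borel (\<lambda>x. dil s x + b)) (\<lambda>_. ennreal (\<Prod>i\<in>UNIV. \<bar>s $ i\<bar>))"
proof -
  have T: "(\<lambda>x. b + (\<Sum>j\<in>Basis. ((s \<bullet> j) * (x \<bullet> j)) *\<^sub>R j)) = (\<lambda>x. dil s x + b)"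
  proof
    fix x
    have "(s \<bullet> j) * (x \<bullet> j) = dil s x \<bullet> j" if "j \<in> Basis" for j
      using that by (auto simp: Basis_vec_def inner_axis dil_def)
    then have "(\<Sum>j\<in>Basis. ((s \<bullet> j) * (x \<bullet> j)) *\<^sub>R j) = (\<Sum>j\<in>Basis. (dil s x \<bullet> j) *\<^sub>R j)"
      by (intro sum.cong) auto
    then show "b + (\<Sum>j\<in>Basis. ((s \<bullet> j) * (x \<bullet> j)) *\<^sub>R j) = dil s x + b"
      by (simp add: euclidean_representation add.commute)
  qed
  have "s \<bullet> j \<noteq> 0" if "j \<in> Basis" for j
    using that assms by (auto simp: Basis_vec_def inner_axis)
  from lborel_affine_euclidean[where c="\<lambda>j. s \<bullet> j" and t=b, OF this]
  have "lborel = density (distr lborel borel (\<lambda>x. dil s x + b)) (\<lambda>_. ennreal (\<Prod>j\<in>Basis. \<bar>s \<bullet> j\<bar>))"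
    unfolding T by simp
  then show ?thesis by (simp add: prod_Basis_cart inner_axis)
qed

lemma integrable_scaleR_right_iff:
  fixes f :: "'a \<Rightarrow> 'b::{banach,second_countable_topology}"
  assumes "c \<noteq> 0"
  shows "integrable M (\<lambda>x. c *\<^sub>R f x) \<longleftrightarrow> integrable M f"
  using integrable_scaleR_right[of "1 / c" M "\<lambda>x. c *\<^sub>R f x"] integrable_scaleR_right[of c M f] assms by auto

lemma integral_dil:
  fixes s :: "real^'d::finite" and f :: "real^'d \<Rightarrow> 'b::{banach,second_countable_topology}"
  assumes "\<And>i. s $ i \<noteq> 0" and [measurable]: "f \<in> borel_measurable borel"
  shows "(\<integral>x. f x \<partial>lborel) = (\<Prod>i\<in>UNIV. \<bar>s $ i\<bar>) *\<^sub>R (\<integral>x. f (dil s x + b) \<partial>lborel)"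
    "integrable lborel f \<longleftrightarrow> integrable lborel (\<lambda>x. f (dil s x + b))"
proof -
  have p: "0 < (\<Prod>i\<in>UNIV. \<bar>s $ i\<bar>)" using assms(1) by (intro prod_pos) simp
  show "(\<integral>x. f x \<partial>lborel) = (\<Prod>i\<in>UNIV. \<bar>s $ i\<bar>) *\<^sub>R (\<integral>x. f (dil s x + b) \<partial>lborel)"
    apply (subst lborel_dil[of s b, OF assms(1)])
    using p by (simp add: integral_density integral_distr less_imp_le)
  have "integrable lborel f \<longleftrightarrow> integrable lborel (\<lambda>x. (\<Prod>i\<in>UNIV. \<bar>s $ i\<bar>) *\<^sub>R f (dil s x + b))"
    apply (subst lborel_dil[of s b, OF assms(1)])
    using p by (simp add: integrable_density integrable_distr_eq less_imp_le)
  then show "integrable lborel f \<longleftrightarrow> integrable lborel (\<lambda>x. f (dil s x + b))"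
    using p by (subst (asm) integrable_scaleR_right_iff) (auto simp del: prod_zero_iff)
qed

lemma nn_integral_dil:
  fixes s :: "real^'d::finite"
  assumes "\<And>i. s $ i \<noteq> 0" and [measurable]: "f \<in> borel_measurable borel"
  shows "(\<integral>\<^sup>+x. f x \<partial>lborel) = ennreal (\<Prod>i\<in>UNIV. \<bar>s $ i\<bar>) * (\<integral>\<^sup>+x. f (dil s x + b) \<partial>lborel)"
  apply (subst lborel_dil[of s b, OF assms(1)])
  by (simp add: nn_integral_density nn_integral_distr nn_integral_cmult)

lemma dil_one [simp]: "dil (\<chi> i. c) x = c *\<^sub>R x"
  by (simp add: dil_def vec_eq_iff)

lemma integral_shift:
  fixes f :: "real^'d::finite \<Rightarrow> 'b::{banach,second_countable_topology}"
  assumes "f \<in> borel_measurable borel"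
  shows "(\<integral>x. f (x + b) \<partial>lborel) = (\<integral>x. f x \<partial>lborel)"
    "integrable lborel (\<lambda>x. f (x + b)) \<longleftrightarrow> integrable lborel f"
  using integral_dil[of "\<chi> i. 1" f b] assms by auto

lemma integral_reflect:
  fixes f :: "real^'d::finite \<Rightarrow> 'b::{banach,second_countable_topology}"
  assumes "f \<in> borel_measurable borel"
  shows "(\<integral>x. f (- x) \<partial>lborel) = (\<integral>x. f x \<partial>lborel)"
    "integrable lborel (\<lambda>x. f (- x)) \<longleftrightarrow> integrable lborel f"
  using integral_dil[of "\<chi> i. -1" f 0] assms by auto

section \<open>Algebra and integrability of the decay weights\<close>

lemma continuous_on_decay [continuous_intros]: "continuous_on S (decay N)"
  unfolding decay_def[abs_def]
  by (intro continuous_intros) simp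

lemma measurable_decay [measurable]: "decay N \<in> borel_measurable borel"
  by (intro borel_measurable_continuous_onI continuous_intros)

lemma decay_mono: "N \<le> M \<Longrightarrow> decay M x \<le> decay N x"
  unfolding decay_def by (intro le_imp_inverse_le power_increasing zero_less_power) (auto simp: add_pos_nonneg)

lemma decay_add: "decay (N + M) x = decay N x * decay M x"
  by (simp add: decay_def power_add)

lemma decay_le_1: "decay N x \<le> 1"
  using decay_mono[of 0 N x] by (simp add: decay_def)

lemma decay_minus [simp]: "decay N (- x) = decay N x"
  by (simp add: decay_def)

lemma decay_0 [simp]: "decay N 0 = 1" "decay 0 x = 1"
  by (simp_all add: decay_def)

text \<open>This rests on 1 + |x + y| \<le> (1 + |x|) (1 + |y|). The shift estimates, Peetre's
  inequality and the convolution bounds below are rearrangements of it.\<close>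

lemma decay_mult_le: "decay N x * decay N y \<le> decay N (x + y)"
proof -
  have "1 + norm (x + y) \<le> (1 + norm x) * (1 + norm y)"
    using norm_triangle_ineq[of x y] by (simp add: algebra_simps) (smt (verit) mult_nonneg_nonneg norm_ge_zero)
  then have "(1 + norm (x + y)) ^ N \<le> ((1 + norm x) * (1 + norm y)) ^ N"
    by (intro power_mono) auto
  then show ?thesis
    by (simp add: decay_def power_mult_distrib inverse_mult_distrib[symmetric] del: inverse_mult_distrib)
qed

text \<open>Splitting the exponent evenly gives each coordinate a factor (1 + |x|)^(-2) \<le> 1 / (1
  + x_i^2), and these one-dimensional functions are integrable. This is the origin of the exponent
  \<open>2 * CARD('d)\<close> used throughout.\<close>

lemma nn_integral_decay_finite: "(\<integral>\<^sup>+x. ennreal (decay (2 * CARD('d)) (x::real^'d::finite)) \<partial>lborel) < \<infinity>"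
proof -
  let ?q = "\<lambda>t::real. inverse (1 + t\<^sup>2)"
  have q0: "0 \<le> ?q t" for t by (simp add: add_nonneg_nonneg)
  have "integrable lborel ?q"
    using integrable_inverse_1_plus_square by (simp add: set_integrable_def einterval_def)
  then have "(\<integral>\<^sup>+t. ennreal (?q t) \<partial>lborel) = ennreal (\<integral>t. ?q t \<partial>lborel)"
    by (intro nn_integral_eq_integral) (use q0 in auto)
  then have f1: "(\<integral>\<^sup>+t. ennreal (?q t) \<partial>lborel) < \<infinity>" by simp
  have "decay (2 * CARD('d)) x \<le> (\<Prod>b\<in>Basis. ?q (x \<bullet> b))" for x :: "real^'d"
  proof -
    have "decay (2 * CARD('d)) x = (\<Prod>i\<in>(UNIV::'d set). inverse ((1 + norm x)\<^sup>2))"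
      by (simp add: decay_def power_mult power_inverse)
    also have "\<dots> \<le> (\<Prod>i\<in>UNIV. ?q (x $ i))"
    proof (intro prod_mono conjI le_imp_inverse_le)
      fix i
      have "(x $ i)\<^sup>2 \<le> (norm x)\<^sup>2" using component_le_norm_cart[of x i] by (metis abs_norm_cancel abs_le_square_iff)
      then show "1 + (x $ i)\<^sup>2 \<le> (1 + norm x)\<^sup>2" by (simp add: power2_sum) (smt (verit) norm_ge_zero)
    qed (auto simp: add_pos_nonneg)
    finally show ?thesis by (simp add: prod_Basis_cart inner_axis)
  qed
  then have e: "ennreal (decay (2 * CARD('d)) x) \<le> (\<Prod>b\<in>Basis. ennreal (?q (x \<bullet> b)))" for x :: "real^'d"
    by (subst prod_ennreal) (use q0 in \<open>auto intro: ennreal_leI\<close>)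
  have "(\<integral>\<^sup>+x. ennreal (decay (2 * CARD('d)) (x::real^'d)) \<partial>lborel) \<le> (\<integral>\<^sup>+x. (\<Prod>b\<in>Basis. ennreal (?q (x \<bullet> b))) \<partial>(lborel::(real^'d) measure))"
    by (rule nn_integral_mono) (rule e)
  also have "\<dots> = (\<Prod>b\<in>(Basis::(real^'d) set). (\<integral>\<^sup>+t. ennreal (?q t) \<partial>lborel))"
    by (intro nn_integral_lborel_prod) auto
  also have "\<dots> < \<infinity>" using f1 by (simp add: power_less_top_ennreal)
  finally show ?thesis .
qed

lemma integrable_decay: "2 * CARD('d) \<le> N \<Longrightarrow> integrable lborel (decay N :: real^'d::finite \<Rightarrow> real)"
  apply (rule Bochner_Integration.integrable_bound[of _ "decay (2 * CARD('d))"])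
  using nn_integral_decay_finite[where 'd='d] by (auto simp: integrable_iff_bounded decay_mono)

lemma integrable_decay_bound:
  fixes f :: "real^'d::finite \<Rightarrow> 'b::{banach,second_countable_topology}"
  assumes "f \<in> borel_measurable borel" "\<And>x. norm (f x) \<le> C * decay (2 * CARD('d)) x"
  shows "integrable lborel f"
  by (rule Bochner_Integration.integrable_bound[of _ "\<lambda>x. C * decay (2 * CARD('d)) x"])
    (use assms integrable_decay[where 'd='d, OF order_refl] in \<open>auto intro: order_trans[OF _ abs_ge_self]\<close>)

section \<open>Closure properties of the Schwartz class\<close>

lemma schwartzD: "f \<in> schwartz \<Longrightarrow> dbounded k (\<lambda>_::unit. UNIV) (\<lambda>_. decay N) (\<lambda>_. f)"
  using schwartz_iff by blast

lemma schwartzI: "(\<And>k N. dbounded k (\<lambda>_::unit. UNIV) (\<lambda>_. decay N) (\<lambda>_. f)) \<Longrightarrow> f \<in> schwartz"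
  using schwartz_iff by blast

lemma schwartz_bound:
  assumes "f \<in> schwartz"
  obtains C where "0 \<le> C" "\<And>x. norm (f x) \<le> C * decay N x"
  by (rule dbounded_bound[OF schwartzD[OF assms, of 0 N]]) auto

lemma schwartz_differentiable: "f \<in> schwartz \<Longrightarrow> f differentiable (at x)"
  by (simp add: schwartz_def smooth_differentiable)

lemma schwartz_continuous: "f \<in> schwartz \<Longrightarrow> continuous_on S f"
  by (simp add: schwartz_def smooth_continuous)

lemma schwartz_measurable: "f \<in> schwartz \<Longrightarrow> f \<in> borel_measurable borel"
  by (intro borel_measurable_continuous_onI schwartz_continuous)

lemma schwartz_integrable_mult:
  assumes "f \<in> schwartz" and [measurable]: "g \<in> borel_measurable borel" and "\<And>x. norm (g x) \<le> C * (1 + norm x) ^ M"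
  shows "integrable lborel (\<lambda>x. f x * g x)"
proof -
  from schwartz_bound[OF assms(1), of "2 * CARD('a) + M"] obtain B
    where B: "0 \<le> B" "\<And>x. norm (f x) \<le> B * decay (2 * CARD('a) + M) x" by blast
  note [measurable] = schwartz_measurable[OF assms(1)]
  show ?thesis
  proof (rule integrable_decay_bound[where C="B * C"])
    fix x :: "real^'a"
    have "norm (f x * g x) \<le> (B * decay (2 * CARD('a) + M) x) * (C * (1 + norm x) ^ M)"
      unfolding norm_mult using B assms(3) by (intro mult_mono) auto
    also have "decay M x * (1 + norm x) ^ M = 1"
      by (simp add: decay_def)
    then have "(B * decay (2 * CARD('a) + M) x) * (C * (1 + norm x) ^ M) = B * C * decay (2 * CARD('a)) x"
      unfolding decay_add by (simp add: mult_ac)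
    finally show "norm (f x * g x) \<le> B * C * decay (2 * CARD('a)) x" .
  qed measurable
qed

lemma schwartz_integrable: "f \<in> schwartz \<Longrightarrow> integrable lborel f"
  using schwartz_integrable_mult[of f "\<lambda>_. 1" 1 0] by simp

lemma schwartz_zero: "(\<lambda>_. 0) \<in> schwartz"
  by (rule schwartzI, rule dbounded_zero)

lemma schwartz_add: "f \<in> schwartz \<Longrightarrow> g \<in> schwartz \<Longrightarrow> (\<lambda>x. f x + g x) \<in> schwartz"
  by (rule schwartzI, rule dbounded_add) (auto intro: schwartzD)

text \<open>The multiplier may grow polynomially together with its derivatives, with an exponent
  depending on the order; asking the Schwartz factor for \<open>M\<close> more powers of decay
  compensates.\<close>

lemma schwartz_mult:
  assumes "f \<in> schwartz" "\<And>k. \<exists>M. dbounded k (\<lambda>_::unit. UNIV) (\<lambda>_ x. (1 + norm x) ^ M) (\<lambda>_. g)"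
  shows "(\<lambda>x. g x * f x) \<in> schwartz"
proof (rule schwartzI)
  fix k N
  obtain M where M: "dbounded k (\<lambda>_::unit. UNIV) (\<lambda>_ x. (1 + norm x) ^ M) (\<lambda>_. g)"
    using assms(2) by blast
  have "dbounded k (\<lambda>_::unit. UNIV) (\<lambda>_ x. (1 + norm x) ^ M * decay (M + N) x) (\<lambda>_ x. g x * f x)"
    by (rule dbounded_bilinear[OF bounded_bilinear_mult _ _ _ M schwartzD[OF assms(1)]]) auto
  moreover have "(1 + norm x) ^ M * decay (M + N) x = decay N x" for x :: "real^'a"
    by (simp add: decay_def power_add)
  ultimately show "dbounded k (\<lambda>_::unit. UNIV) (\<lambda>_. decay N) (\<lambda>_ x. g x * f x)" by simp
qed

lemma schwartz_cmult: "f \<in> schwartz \<Longrightarrow> (\<lambda>x. c * f x) \<in> schwartz"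
  by (rule schwartz_mult[where g="\<lambda>_. c"], assumption, rule exI[of _ 0], rule dbounded_const[where C="norm c"]) simp

lemma schwartz_diff: "f \<in> schwartz \<Longrightarrow> g \<in> schwartz \<Longrightarrow> (\<lambda>x. f x - g x) \<in> schwartz"
  using schwartz_add[of f "\<lambda>x. -1 * g x"] schwartz_cmult[of g "-1"] by simp

lemma schwartz_partial_deriv: "f \<in> schwartz \<Longrightarrow> partial_deriv i f \<in> schwartz"
proof (rule schwartzI)
  fix k N assume "f \<in> schwartz"
  from schwartzD[OF this, of "Suc k" N] show "dbounded k (\<lambda>_::unit. UNIV) (\<lambda>_. decay N) (\<lambda>_. partial_deriv i f)"
    by (subst (asm) dbounded.simps(2)) blast
qed

lemma schwartz_partials: "f \<in> schwartz \<Longrightarrow> partials is f \<in> schwartz"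
  by (induction "is") (auto intro: schwartz_partial_deriv)

lemma schwartz_reflect:
  assumes "f \<in> schwartz"
  shows "(\<lambda>x. f (- x)) \<in> schwartz"
proof (rule schwartzI)
  fix k N
  have "dbounded k (\<lambda>i. {x. dil (\<chi> i. -1) x + 0 \<in> UNIV}) (\<lambda>i x. 1 ^ k * decay N (dil (\<chi> i. -1) x + 0)) (\<lambda>_::unit. \<lambda>x. f (dil (\<chi> i. -1) x + 0))"
    by (rule dbounded_diag[OF _ _ _ _ schwartzD[OF assms]]) auto
  then show "dbounded k (\<lambda>_::unit. UNIV) (\<lambda>_. decay N) (\<lambda>_ x. f (- x))" by simp
qed

lemma dbounded_component:
  fixes l :: "'d::finite"
  shows "dbounded k (\<lambda>_::'i. UNIV) (\<lambda>_ x. 1 + norm x) (\<lambda>_ (x::real^'d). complex_of_real (x $ l))"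
proof (cases k)
  case 0
  have "norm (complex_of_real (x $ l)) \<le> 1 * (1 + norm x)" for x :: "real^'d"
    using component_le_norm_cart[of x l] by simp
  then show ?thesis unfolding 0 dbounded.simps by blast
next
  case (Suc k)
  have d: "((\<lambda>x. complex_of_real (x $ l)) has_derivative (\<lambda>h. complex_of_real (h $ l))) (at x)" for x :: "real^'d"
    by (intro has_derivative_of_real bounded_linear_imp_has_derivative bounded_linear_vec_nth)
  have eq: "partial_deriv m (\<lambda>x. complex_of_real ((x::real^'d) $ l)) = (\<lambda>_. complex_of_real (axis m 1 $ l))" for m
    by (rule ext) (rule partial_deriv_eq[OF d])
  show ?thesis unfolding Suc
  proof (rule dbounded_SucI[where C=1])
    show "norm (complex_of_real (x $ l)) \<le> 1 * (1 + norm x)" for x :: "real^'d"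
      using component_le_norm_cart[of x l] by simp
    show "(\<lambda>x. complex_of_real (x $ l)) differentiable at x" for x :: "real^'d"
      using d differentiable_def by blast
    show "dbounded k (\<lambda>_. UNIV) (\<lambda>_ x. 1 + norm x) (\<lambda>_. partial_deriv m (\<lambda>x. complex_of_real ((x::real^'d) $ l)))" for m
      unfolding eq by (rule dbounded_const[where C=1]) (auto simp: axis_def)
  qed
qed

lemma schwartz_component_mult: "f \<in> schwartz \<Longrightarrow> (\<lambda>x. complex_of_real (x $ l) * f x) \<in> schwartz"
  by (rule schwartz_mult[where g="\<lambda>x. complex_of_real (x $ l)"], assumption, rule exI[of _ 1]) (use dbounded_component[where 'i=unit] in simp)

section \<open>Characters\<close>

lemma has_derivative_cis: "((\<lambda>x. cis (x \<bullet> \<xi>)) has_derivative (\<lambda>h. of_real (h \<bullet> \<xi>) * (\<i> * cis (x \<bullet> \<xi>)))) (at x)"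
proof -
  have "((\<lambda>x. \<i> * complex_of_real (x \<bullet> \<xi>)) has_derivative (\<lambda>h. \<i> * complex_of_real (h \<bullet> \<xi>))) (at x)"
    by (intro has_derivative_mult_right has_derivative_of_real bounded_linear_imp_has_derivative bounded_linear_inner_left)
  from has_derivative_compose[OF this DERIV_exp[unfolded has_field_derivative_def]]
  show ?thesis unfolding cis_conv_exp by (simp add: mult_ac)
qed

lemma partial_deriv_cis: "partial_deriv l (\<lambda>x. cis (x \<bullet> \<xi>)) x = (\<i> * of_real (\<xi> $ l)) * cis (x \<bullet> \<xi>)"
  by (subst partial_deriv_eq[OF has_derivative_cis]) (simp add: inner_axis' mult_ac)

text \<open>Each derivative multiplies the character by a component of i \<xi>. The frequency is the
  index of the family, so the growth in \<xi> remains visible; it later yields the polynomial growth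
  of the frame coefficients.\<close>

lemma dbounded_cis: "dbounded k (\<lambda>_. UNIV) (\<lambda>\<xi> _. (1 + norm \<xi>) ^ k) (\<lambda>\<xi> x. cis (x \<bullet> \<xi>))"
proof (induction k)
  case 0
  have "norm (cis (x \<bullet> \<xi>)) \<le> 1 * (1 + norm \<xi>) ^ 0" for x \<xi> :: "real^'a" by simp
  then show ?case unfolding dbounded.simps by blast
next
  case (Suc k)
  show ?case
  proof (rule dbounded_SucI[where C=1])
    show "norm (cis (x \<bullet> \<xi>)) \<le> 1 * (1 + norm \<xi>) ^ Suc k" for \<xi> x :: "real^'a"
      using one_le_power[of "1 + norm \<xi>" "Suc k"] by simp
    show "(\<lambda>x. cis (x \<bullet> \<xi>)) differentiable at x" for \<xi> x :: "real^'a"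
      using has_derivative_cis differentiable_def by blast
    show "dbounded k (\<lambda>_. UNIV) (\<lambda>\<xi> _. (1 + norm \<xi>) ^ Suc k) (\<lambda>\<xi>::real^'a. partial_deriv l (\<lambda>x. cis (x \<bullet> \<xi>)))" for l
    proof -
      have "dbounded k (\<lambda>_. UNIV) (\<lambda>\<xi> _. (1 + norm \<xi>) * (1 + norm \<xi>) ^ k) (\<lambda>(\<xi>::real^'a) x. (\<i> * of_real (\<xi> $ l)) * cis (x \<bullet> \<xi>))"
      proof (rule dbounded_bilinear[OF bounded_bilinear_mult _ _ _ _ Suc])
        show "dbounded k (\<lambda>_. UNIV) (\<lambda>\<xi> _. 1 + norm \<xi>) (\<lambda>(\<xi>::real^'a) x. \<i> * of_real (\<xi> $ l))"
        proof (rule dbounded_const[where C=1])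
          show "norm (\<i> * complex_of_real (\<xi> $ l)) \<le> 1 * (1 + norm \<xi>)" for \<xi> :: "real^'a"
            using component_le_norm_cart[of \<xi> l] by (simp add: norm_mult)
        qed
      qed auto
      then show ?thesis by (simp add: partial_deriv_cis[abs_def])
    qed
  qed
qed

lemma dbounded_cis1: "dbounded k (\<lambda>_::unit. UNIV) (\<lambda>_ _. 1) (\<lambda>_ x. cis (x \<bullet> \<xi>))"
  by (rule dbounded_weight[OF _ _ dbounded_reindex[OF dbounded_cis, where g="\<lambda>_. \<xi>"], where C="(1 + norm \<xi>) ^ k"]) auto

lemma schwartz_cis_mult: "f \<in> schwartz \<Longrightarrow> (\<lambda>x. cis (x \<bullet> \<xi>) * f x) \<in> schwartz"
  by (rule schwartz_mult[where g="\<lambda>x. cis (x \<bullet> \<xi>)"], assumption, rule exI[of _ 0]) (use dbounded_cis1 in simp)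

lemma decay_shift_le:
  assumes "norm y \<le> 1"
  shows "decay N (x + y) \<le> 2 ^ N * decay N x"
proof -
  have "decay N (x + y) * decay N (- y) \<le> decay N x" using decay_mult_le[of N "x + y" "- y"] by simp
  moreover have "inverse (2 ^ N) \<le> decay N (- y)"
    unfolding decay_def using assms by (intro le_imp_inverse_le power_mono zero_less_power) (auto simp: add_pos_nonneg)
  ultimately have "decay N (x + y) * inverse (2 ^ N) \<le> decay N x"
    by (smt (verit) decay_pos(2) mult_left_mono)
  then show ?thesis by (simp add: field_simps)
qed

text \<open>Difference quotients have integral zero by translation invariance, and they converge
  pointwise to the derivative. The mean value inequality dominates them by a decay weight, so the
  limit may be taken under the integral.\<close>

lemma integral_partial_deriv:
  fixes f :: "real^'d::finite \<Rightarrow> complex"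
  assumes f: "f \<in> schwartz"
  shows "(\<integral>x. partial_deriv i f x \<partial>lborel) = 0"
proof -
  let ?e = "axis i 1 :: real^'d"
  let ?N = "2 * CARD('d)"
  \<comment> \<open>Steps of length at most 1 keep the shifted decay weight comparable with the
    unshifted one.\<close>
  define t where "t n = inverse (real (Suc n))" for n
  have t: "0 < t n" "t n \<le> 1" for n by (auto simp: t_def inverse_le_1_iff)
  have t0: "t \<longlonglongrightarrow> 0" unfolding t_def by (rule LIMSEQ_inverse_real_of_nat)
  note [measurable] = schwartz_measurable[OF f] schwartz_measurable[OF schwartz_partial_deriv[OF f]]
  define D where "D n x = (1 / t n) *\<^sub>R (f (x + t n *\<^sub>R ?e) - f x)" for n x
  have [measurable]: "D n \<in> borel_measurable borel" for n unfolding D_def by measurable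
  have D0: "(\<integral>x. D n x \<partial>lborel) = 0" for n
  proof -
    have "integrable lborel (\<lambda>x. f (x + t n *\<^sub>R ?e))" "integrable lborel f"
      using integral_shift(2)[of f] schwartz_integrable[OF f] by auto
    then show ?thesis unfolding D_def by (simp add: integral_shift(1))
  qed
  have dl: "((\<lambda>s. f (x + s *\<^sub>R ?e)) has_derivative (\<lambda>h. h *\<^sub>R partial_deriv i f (x + s *\<^sub>R ?e))) (at s)" for x s
  proof -
    let ?f' = "frechet_derivative f (at (x + s *\<^sub>R ?e))"
    have f': "(f has_derivative ?f') (at (x + s *\<^sub>R ?e))"
      by (intro frechet_derivativeI schwartz_differentiable f)
    have "((\<lambda>s. x + s *\<^sub>R ?e) has_derivative (\<lambda>h. h *\<^sub>R ?e)) (at s)"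
      by (auto intro!: derivative_eq_intros)
    from diff_chain_at[OF this f'] have "((\<lambda>s. f (x + s *\<^sub>R ?e)) has_derivative (\<lambda>h. ?f' (h *\<^sub>R ?e))) (at s)"
      by (simp add: o_def)
    then show ?thesis unfolding partial_deriv_def using linear_scale[OF has_derivative_linear[OF f']] by simp
  qed
  obtain C where C: "0 \<le> C" "\<And>x. norm (partial_deriv i f x) \<le> C * decay ?N x"
    using schwartz_bound[OF schwartz_partial_deriv[OF f]] by blast
  have "(\<lambda>n. \<integral>x. D n x \<partial>lborel) \<longlonglongrightarrow> (\<integral>x. partial_deriv i f x \<partial>lborel)"
  proof (rule integral_dominated_convergence[where w="\<lambda>x. C * 2 ^ ?N * decay ?N x"])
    show "integrable lborel (\<lambda>x::real^'d. C * 2 ^ ?N * decay ?N x)" by (intro integrable_mult_right integrable_decay) simp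
    show "AE x in lborel. (\<lambda>n. D n x) \<longlonglongrightarrow> partial_deriv i f x"
    proof (rule AE_I2)
      fix x
      let ?v = "partial_deriv i f x" and ?\<Delta> = "\<lambda>s. f (x + s *\<^sub>R ?e) - f x"
      have "(\<lambda>s. (?\<Delta> s - s *\<^sub>R ?v) /\<^sub>R \<bar>s\<bar>) \<midarrow>0\<rightarrow> 0"
        using dl[of x 0] by (simp add: has_derivative_at_within)
      then have "(\<lambda>s. norm ((?\<Delta> s - s *\<^sub>R ?v) /\<^sub>R \<bar>s\<bar>)) \<midarrow>0\<rightarrow> 0" by (rule tendsto_norm_zero)
      moreover have "\<forall>\<^sub>F s in at 0. norm ((?\<Delta> s - s *\<^sub>R ?v) /\<^sub>R \<bar>s\<bar>) = norm ((1 / s) *\<^sub>R ?\<Delta> s - ?v)"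
      proof (rule eventually_at_filter[THEN iffD2], rule always_eventually, intro allI impI)
        fix s :: real assume "s \<noteq> 0"
        then have "(1 / s) *\<^sub>R ?\<Delta> s - ?v = (1 / s) *\<^sub>R (?\<Delta> s - s *\<^sub>R ?v)" by (simp add: scaleR_diff_right)
        then show "norm ((?\<Delta> s - s *\<^sub>R ?v) /\<^sub>R \<bar>s\<bar>) = norm ((1 / s) *\<^sub>R ?\<Delta> s - ?v)"
          by (simp add: divide_inverse)
      qed
      ultimately have "(\<lambda>s. norm ((1 / s) *\<^sub>R ?\<Delta> s - ?v)) \<midarrow>0\<rightarrow> 0" by (rule Lim_transform_eventually)
      then have "(\<lambda>s. (1 / s) *\<^sub>R ?\<Delta> s) \<midarrow>0\<rightarrow> ?v" using LIM_zero_iff tendsto_norm_zero_iff by blast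
      then show "(\<lambda>n. D n x) \<longlonglongrightarrow> partial_deriv i f x" unfolding D_def
        by (rule filterlim_compose) (use t t0 in \<open>auto simp: filterlim_at intro!: always_eventually, metis less_irrefl\<close>)
    qed
    show "AE x in lborel. norm (D n x) \<le> C * 2 ^ ?N * decay ?N x" for n
    proof (rule AE_I2)
      fix x
      have "norm (f (x + t n *\<^sub>R ?e) - f (x + 0 *\<^sub>R ?e)) \<le> C * 2 ^ ?N * decay ?N x * norm (t n - 0)"
      proof (rule differentiable_bound[of "{0..t n}"])
        fix s assume s: "s \<in> {0..t n}"
        show "((\<lambda>s. f (x + s *\<^sub>R ?e)) has_derivative (\<lambda>h. h *\<^sub>R partial_deriv i f (x + s *\<^sub>R ?e))) (at s within {0..t n})"
          using dl has_derivative_at_withinI by blast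
        have "norm (partial_deriv i f (x + s *\<^sub>R ?e)) \<le> C * decay ?N (x + s *\<^sub>R ?e)" by (rule C)
        also have "\<dots> \<le> C * (2 ^ ?N * decay ?N x)"
          by (intro mult_left_mono C decay_shift_le) (use s t(2)[of n] in auto)
        finally show "onorm (\<lambda>h. h *\<^sub>R partial_deriv i f (x + s *\<^sub>R ?e)) \<le> C * 2 ^ ?N * decay ?N x"
          using onorm_scaleR_left[of "\<lambda>h::real. h" "partial_deriv i f (x + s *\<^sub>R ?e)"] onorm_id[where 'a=real]
          by (simp add: id_def mult.assoc)
      qed (use t(1)[of n] in auto)
      then show "norm (D n x) \<le> C * 2 ^ ?N * decay ?N x"
        using t(1)[of n] by (simp add: D_def norm_scaleR pos_divide_le_eq mult_ac del: scaleR_right_diff_distrib real_scaleR_def)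
    qed
  qed measurable
  then show ?thesis unfolding D0 using LIMSEQ_unique tendsto_const by metis
qed

section \<open>The Fourier transform on Schwartz functions\<close>

lemma measurable_cis [measurable]: "cis \<in> borel_measurable borel"
  by (intro borel_measurable_continuous_onI continuous_intros)

lemma inv_fourier_eq: "inv_fourier f x = fourier f (- x)"
  by (simp add: inv_fourier_def fourier_def inner_commute)

lemma fourier_eq: "fourier f x = inv_fourier f (- x)"
  by (simp add: inv_fourier_eq)

lemma inv_fourier_reflect:
  assumes [measurable]: "f \<in> borel_measurable borel"
  shows "inv_fourier f x = fourier (\<lambda>y. f (- y)) x"
  unfolding inv_fourier_def fourier_def
  using integral_reflect(1)[of "\<lambda>y. f y * cis (x \<bullet> y)"] by (simp add: inner_commute)

lemma cnj_fourier: "cnj (fourier f x) = inv_fourier (\<lambda>y. cnj (f y)) x"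
proof -
  have "cnj (\<integral>y. f y * cis (- (y \<bullet> x)) \<partial>lborel) = (\<integral>y. cnj (f y * cis (- (y \<bullet> x))) \<partial>lborel)"
    by (rule Bochner_Integration.integral_cnj[symmetric])
  then show ?thesis unfolding inv_fourier_def fourier_def by (simp add: cis_cnj inner_commute)
qed

lemma cnj_inv_fourier: "cnj (inv_fourier f x) = fourier (\<lambda>y. cnj (f y)) x"
  by (simp add: inv_fourier_eq cnj_fourier)

lemma integrable_mult_cis:
  assumes "integrable lborel f" "\<theta> \<in> borel_measurable borel"
  shows "integrable lborel (\<lambda>x. f x * cis (\<theta> (x::real^'d::finite)))"
proof (rule Bochner_Integration.integrable_bound[OF assms(1)])
  have [measurable]: "f \<in> borel_measurable lborel" "\<theta> \<in> borel_measurable borel" using assms by auto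
  show "(\<lambda>x. f x * cis (\<theta> x)) \<in> borel_measurable lborel" by measurable
qed (simp add: norm_mult)

lemma fourier_add: "integrable lborel f \<Longrightarrow> integrable lborel g \<Longrightarrow> fourier (\<lambda>x. f x + g x) \<xi> = fourier f \<xi> + fourier g \<xi>"
  unfolding fourier_def distrib_right by (subst Bochner_Integration.integral_add) (auto intro!: integrable_mult_cis simp: distrib_left)

lemma fourier_cmult: "fourier (\<lambda>x. c * f x) \<xi> = c * fourier f \<xi>"
  unfolding fourier_def by (simp add: mult.assoc mult.left_commute)

lemma fourier_norm_le:
  "norm (fourier f (\<xi>::real^'d::finite)) \<le> (2 * pi) powr (- real CARD('d) / 2) * (\<integral>x. norm (f x) \<partial>lborel)"
proof -
  have "norm (\<integral>x. f x * cis (- (x \<bullet> \<xi>)) \<partial>lborel) \<le> (\<integral>x. norm (f x * cis (- (x \<bullet> \<xi>))) \<partial>lborel)"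
    by (rule integral_norm_bound)
  then show ?thesis unfolding fourier_def norm_mult by (simp add: mult_left_mono)
qed

text \<open>Integration by parts: the derivative of the product with the character has integral
  zero, and the product rule splits it into the two transforms.\<close>

lemma fourier_partial_deriv:
  fixes f :: "real^'d::finite \<Rightarrow> complex"
  assumes f: "f \<in> schwartz"
  shows "fourier (partial_deriv l f) \<xi> = \<i> * of_real (\<xi> $ l) * fourier f \<xi>"
proof -
  let ?e = "\<lambda>x. cis (x \<bullet> (- \<xi>))"
  have d: "partial_deriv l (\<lambda>x. ?e x * f x) x = ?e x * partial_deriv l f x + (\<i> * of_real ((- \<xi>) $ l) * ?e x) * f x" for x
  proof -
    have "((\<lambda>x. ?e x * f x) has_derivative (\<lambda>h. ?e x * frechet_derivative f (at x) h + of_real (h \<bullet> (- \<xi>)) * (\<i> * ?e x) * f x)) (at x)"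
      by (rule has_derivative_mult[OF has_derivative_cis frechet_derivativeI[OF schwartz_differentiable[OF f]]])
    from partial_deriv_eq[OF this] show ?thesis by (simp add: partial_deriv_def inner_axis' mult_ac)
  qed
  have i: "integrable lborel (\<lambda>x. ?e x * partial_deriv l f x)" "integrable lborel (\<lambda>x. ?e x * f x)"
    using schwartz_integrable schwartz_cis_mult schwartz_partial_deriv f by blast+
  have "0 = (\<integral>x. partial_deriv l (\<lambda>x. ?e x * f x) x \<partial>lborel)"
    using integral_partial_deriv[OF schwartz_cis_mult[OF f]] by metis
  also have "\<dots> = (\<integral>x. ?e x * partial_deriv l f x + (\<i> * of_real ((- \<xi>) $ l)) * (?e x * f x) \<partial>lborel)"
    unfolding d by (simp add: mult_ac)
  also have "\<dots> = (\<integral>x. ?e x * partial_deriv l f x \<partial>lborel) + (\<i> * of_real ((- \<xi>) $ l)) * (\<integral>x. ?e x * f x \<partial>lborel)"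
    using i by (subst Bochner_Integration.integral_add) auto
  finally have "(\<integral>x. ?e x * partial_deriv l f x \<partial>lborel) = (\<i> * of_real (\<xi> $ l)) * (\<integral>x. ?e x * f x \<partial>lborel)"
    by (simp add: eq_neg_iff_add_eq_0)
  moreover have "(\<lambda>x. partial_deriv l f x * ?e x) = (\<lambda>x. ?e x * partial_deriv l f x)" "(\<lambda>x. f x * ?e x) = (\<lambda>x. ?e x * f x)"
    by (auto simp: mult.commute)
  ultimately have "(\<integral>x. partial_deriv l f x * ?e x \<partial>lborel) = (\<i> * of_real (\<xi> $ l)) * (\<integral>x. f x * ?e x \<partial>lborel)"
    by simp
  then show ?thesis unfolding fourier_def by (simp add: mult_ac)
qed

lemma fourier_partials_replicate:
  assumes f: "f \<in> schwartz"
  shows "fourier (partials (replicate n l) f) \<xi> = (\<i> * of_real (\<xi> $ l)) ^ n * fourier f \<xi>"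
  by (induction n) (simp_all add: fourier_partial_deriv schwartz_partials[OF f])

text \<open>Decay of a Fourier transform is extracted from repeated derivatives in a single
  direction, so the full power must be controlled by powers of single coordinates. The maximum of 1
  and the coordinates does this, with a factor depending on the dimension.\<close>

lemma one_norm_power_le:
  fixes \<xi> :: "real^'d::finite"
  shows "(1 + norm \<xi>) ^ N \<le> (real CARD('d) + 1) ^ N * (1 + (\<Sum>l\<in>UNIV. \<bar>\<xi> $ l\<bar> ^ N))"
proof -
  let ?A = "insert 1 (range (\<lambda>l. \<bar>\<xi> $ l\<bar>))"
  define m where "m = Max ?A"
  have m: "m \<in> ?A" unfolding m_def by (rule Max_in) auto
  have m1: "1 \<le> m" "\<And>l. \<bar>\<xi> $ l\<bar> \<le> m" unfolding m_def by (rule Max_ge; simp)+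
  have "norm \<xi> \<le> (\<Sum>l\<in>UNIV. \<bar>\<xi> $ l\<bar>)" by (rule norm_le_l1_cart)
  also have "\<dots> \<le> (\<Sum>l\<in>(UNIV::'d set). m)" by (intro sum_mono m1)
  finally have "1 + norm \<xi> \<le> (real CARD('d) + 1) * m" using m1 by (simp add: algebra_simps)
  then have "(1 + norm \<xi>) ^ N \<le> ((real CARD('d) + 1) * m) ^ N" by (intro power_mono) auto
  also have "\<dots> = (real CARD('d) + 1) ^ N * m ^ N" by (rule power_mult_distrib)
  also have "m ^ N \<le> 1 + (\<Sum>l\<in>UNIV. \<bar>\<xi> $ l\<bar> ^ N)"
  proof (cases "m = 1")
    case True then show ?thesis by (simp add: sum_nonneg)
  next
    case False
    with m obtain l where l: "m = \<bar>\<xi> $ l\<bar>" by auto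
    have "\<bar>\<xi> $ l\<bar> ^ N \<le> (\<Sum>l\<in>UNIV. \<bar>\<xi> $ l\<bar> ^ N)" by (rule member_le_sum) auto
    with l show ?thesis by simp
  qed
  then have "(real CARD('d) + 1) ^ N * m ^ N \<le> (real CARD('d) + 1) ^ N * (1 + (\<Sum>l\<in>UNIV. \<bar>\<xi> $ l\<bar> ^ N))"
    by (rule mult_left_mono) simp
  finally show ?thesis .
qed

text \<open>The family version is the point: \<open>N\<close> derivatives with integrable decay
  yield decay of order \<open>N\<close> with one constant for all members, as is needed for the
  profiles attached to the covering.\<close>

lemma fourier_decay:
  fixes F :: "'i \<Rightarrow> real^'d::finite \<Rightarrow> complex"
  assumes F: "dbounded N (\<lambda>_. UNIV) (\<lambda>_. decay (2 * CARD('d))) F" and S: "\<And>i. F i \<in> schwartz"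
  obtains C where "0 \<le> C" "\<And>i \<xi>. norm (fourier (F i) \<xi>) \<le> C * decay N \<xi>"
proof -
  let ?d = "2 * CARD('d)" and ?c = "(2 * pi) powr (- real CARD('d) / 2)"
  obtain C where C: "0 \<le> C" "\<And>is i x. length is \<le> N \<Longrightarrow> norm (partials is (F i) x) \<le> C * decay ?d x"
    by (rule dbounded_partials_unif[OF F]) auto
  define B where "B = ?c * (\<integral>x. C * decay ?d (x::real^'d) \<partial>lborel)"
  have B: "norm (fourier (partials is (F i)) \<xi>) \<le> B" if "length is \<le> N" for "is" i \<xi>
  proof -
    have "(\<integral>x. norm (partials is (F i) x) \<partial>lborel) \<le> (\<integral>x. C * decay ?d (x::real^'d) \<partial>lborel)"
      by (intro integral_mono integrable_norm schwartz_integrable schwartz_partials S integrable_mult_right integrable_decay C that order_refl)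
    from mult_left_mono[OF this, of ?c] show ?thesis unfolding B_def
      using order_trans[OF fourier_norm_le[of "partials is (F i)" \<xi>]] by simp
  qed
  have B0: "0 \<le> B" using order_trans[OF norm_ge_zero B[of "[]" undefined undefined]] by simp
  \<comment> \<open>The power comes from \<open>one_norm_power_le\<close>; the second factor counts
    the undifferentiated term and one term per coordinate.\<close>
  define K where "K = (real CARD('d) + 1) ^ N * (1 + real CARD('d)) * B"
  have "norm (fourier (F i) \<xi>) \<le> K * decay N \<xi>" for i \<xi>
  proof -
    let ?f = "norm (fourier (F i) \<xi>)"
    have f: "?f \<le> B" using B[of "[]" i \<xi>] by simp
    have fl: "\<bar>\<xi> $ l\<bar> ^ N * ?f \<le> B" for l
      using B[of "replicate N l" i \<xi>] by (simp add: fourier_partials_replicate[OF S] norm_mult norm_power)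
    have "(1 + norm \<xi>) ^ N * ?f \<le> (real CARD('d) + 1) ^ N * (1 + (\<Sum>l\<in>UNIV. \<bar>\<xi> $ l\<bar> ^ N)) * ?f"
      by (intro mult_right_mono one_norm_power_le) auto
    also have "\<dots> = (real CARD('d) + 1) ^ N * (?f + (\<Sum>l\<in>UNIV. \<bar>\<xi> $ l\<bar> ^ N * ?f))"
      by (simp add: distrib_right sum_distrib_right mult.assoc)
    also have "\<dots> \<le> (real CARD('d) + 1) ^ N * (B + (\<Sum>l\<in>(UNIV::'d set). B))"
      by (intro mult_left_mono add_mono sum_mono f fl) auto
    also have "\<dots> = K" by (simp add: K_def algebra_simps)
    finally show ?thesis by (simp add: decay_def field_simps)
  qed
  moreover have "0 \<le> K" using B0 by (simp add: K_def)
  ultimately show ?thesis using that by blast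
qed

lemma fourier_decay_schwartz:
  assumes "f \<in> schwartz"
  obtains C where "0 \<le> C" "\<And>\<xi>. norm (fourier f \<xi>) \<le> C * decay N \<xi>"
proof (rule fourier_decay[where F="\<lambda>_::unit. f" and N=N])
  show "dbounded N (\<lambda>_::unit. UNIV) (\<lambda>_. decay (2 * CARD('a))) (\<lambda>_. f)" by (rule schwartzD[OF assms])
  show "f \<in> schwartz" by (rule assms)
  show thesis if "0 \<le> C" "\<And>(i::unit) \<xi>. norm (fourier f \<xi>) \<le> C * decay N \<xi>" for C
    by (rule \<open>\<And>C. 0 \<le> C \<Longrightarrow> (\<And>\<xi>. norm (fourier f \<xi>) \<le> C * decay N \<xi>) \<Longrightarrow> thesis\<close>[OF that])
qed

lemma cis_approx: "norm (cis t - 1 - \<i> * of_real t) \<le> t\<^sup>2 / 2"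
  using iexp_approx1[of t 1] by (simp add: cis_conv_exp numeral_2_eq_2 atMost_Suc algebra_simps power2_eq_square)

text \<open>The first-order Taylor remainder of the character is at most |x \<bullet> h|^2 / 2, so
  the remainder of the transform is bounded by |h|^2 times a multiple of the second absolute moment
  of \<open>f\<close>.\<close>

lemma fourier_has_derivative:
  fixes f :: "real^'d::finite \<Rightarrow> complex"
  assumes f: "f \<in> schwartz"
  shows "(fourier f has_derivative (\<lambda>h. \<Sum>l\<in>UNIV. of_real (h $ l) * fourier (\<lambda>x. - \<i> * (of_real (x $ l) * f x)) \<xi>)) (at \<xi>)"
    (is "(_ has_derivative ?L) _")
proof -
  let ?c = "(2 * pi) powr (- real CARD('d) / 2)"
  note [measurable] = schwartz_measurable[OF f]
  have int: "integrable lborel (\<lambda>x. f x * g x)" if "g \<in> borel_measurable borel" "\<And>x. norm (g x) \<le> C * (1 + norm x) ^ 2" for g C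
    by (rule schwartz_integrable_mult[OF f that])
  define K where "K = ?c * (\<integral>x. norm (f x) * (norm x)\<^sup>2 / 2 \<partial>lborel)"
  have intK: "integrable lborel (\<lambda>x. norm (f x) * (norm x)\<^sup>2 / 2)"
  proof -
    have "integrable lborel (\<lambda>x. f x * complex_of_real ((norm x)\<^sup>2 / 2))"
    proof (rule int[where C=1])
      fix x :: "real^'d"
      have "(norm x)\<^sup>2 \<le> (1 + norm x)\<^sup>2" by (intro power_mono) auto
      moreover have "0 \<le> (norm x)\<^sup>2 / 2" by simp
      then have "norm (complex_of_real ((norm x)\<^sup>2 / 2)) = (norm x)\<^sup>2 / 2"
        by (simp only: norm_of_real real_norm_def abs_of_nonneg)
      ultimately show "norm (complex_of_real ((norm x)\<^sup>2 / 2)) \<le> 1 * (1 + norm x)\<^sup>2"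
        using \<open>0 \<le> (norm x)\<^sup>2 / 2\<close> by linarith
    qed measurable
    from integrable_norm[OF this] show ?thesis by (simp add: norm_mult norm_power norm_divide)
  qed
  have main: "norm (fourier f (\<xi> + h) - fourier f \<xi> - ?L h) \<le> K * (norm h)\<^sup>2" for h
  proof -
    let ?r = "\<lambda>x. cis (- (x \<bullet> (\<xi> + h))) - cis (- (x \<bullet> \<xi>)) + \<i> * of_real (x \<bullet> h) * cis (- (x \<bullet> \<xi>))"
    have xl: "\<bar>x $ l\<bar> \<le> (1 + norm x)\<^sup>2" for x :: "real^'d" and l
      using component_le_norm_cart[of x l] power_increasing[of 1 2 "1 + norm x"] by simp
    have i1: "integrable lborel (\<lambda>x. f x * cis (- (x \<bullet> \<zeta>)))" for \<zeta>
      by (rule int[where C=1]) (use one_le_power[of "1 + norm _" 2] in auto)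
    have i2: "integrable lborel (\<lambda>x. f x * (- \<i> * of_real (x $ l) * cis (- (x \<bullet> \<xi>))))" for l
      by (rule int[where C=1]) (use xl in \<open>auto simp: norm_mult\<close>)
    have "?L h = of_real ?c * (\<Sum>l\<in>UNIV. of_real (h $ l) * (\<integral>x. f x * (- \<i> * of_real (x $ l) * cis (- (x \<bullet> \<xi>))) \<partial>lborel))"
      unfolding fourier_def sum_distrib_left by (intro sum.cong refl) (simp add: mult_ac)
    also have "(\<Sum>l\<in>UNIV. of_real (h $ l) * (\<integral>x. f x * (- \<i> * of_real (x $ l) * cis (- (x \<bullet> \<xi>))) \<partial>lborel))
        = (\<integral>x. (\<Sum>l\<in>UNIV. of_real (h $ l) * (f x * (- \<i> * of_real (x $ l) * cis (- (x \<bullet> \<xi>))))) \<partial>lborel)"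
      using i2 by (subst Bochner_Integration.integral_sum) (auto intro!: integrable_mult_right)
    also have "(\<lambda>x. (\<Sum>l\<in>UNIV. of_real (h $ l) * (f x * (- \<i> * of_real (x $ l) * cis (- (x \<bullet> \<xi>))))))
        = (\<lambda>x. f x * (- \<i> * of_real (x \<bullet> h) * cis (- (x \<bullet> \<xi>))))"
      by (auto simp: inner_vec_def sum_distrib_left sum_distrib_right sum_negf mult_ac)
    finally have L: "?L h = of_real ?c * (\<integral>x. f x * (- \<i> * of_real (x \<bullet> h) * cis (- (x \<bullet> \<xi>))) \<partial>lborel)" .
    have i3: "integrable lborel (\<lambda>x. f x * (- \<i> * of_real (x \<bullet> h) * cis (- (x \<bullet> \<xi>))))"
    proof (rule int[where C="norm h"])
      fix x :: "real^'d"
      have "norm x * norm h \<le> (1 + norm x)\<^sup>2 * norm h"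
        using power_increasing[of 1 2 "1 + norm x"] by (intro mult_right_mono) auto
      then show "norm (- \<i> * of_real (x \<bullet> h) * cis (- (x \<bullet> \<xi>))) \<le> norm h * (1 + norm x)\<^sup>2"
        using Cauchy_Schwarz_ineq2[of x h] by (simp add: norm_mult mult.commute)
    qed measurable
    have "fourier f (\<xi> + h) - fourier f \<xi> - ?L h = of_real ?c * (\<integral>x. f x * ?r x \<partial>lborel)"
    proof -
      have "(\<integral>x. f x * ?r x \<partial>lborel) = (\<integral>x. f x * cis (- (x \<bullet> (\<xi> + h))) - f x * cis (- (x \<bullet> \<xi>)) - f x * (- \<i> * of_real (x \<bullet> h) * cis (- (x \<bullet> \<xi>))) \<partial>lborel)"
        by (simp add: algebra_simps)
      also have "\<dots> = (\<integral>x. f x * cis (- (x \<bullet> (\<xi> + h))) \<partial>lborel) - (\<integral>x. f x * cis (- (x \<bullet> \<xi>)) \<partial>lborel)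
         - (\<integral>x. f x * (- \<i> * of_real (x \<bullet> h) * cis (- (x \<bullet> \<xi>))) \<partial>lborel)"
        using i1[of "\<xi> + h"] i1[of \<xi>] i3 by (simp del: mult_minus_left)
      finally have e: "(\<integral>x. f x * ?r x \<partial>lborel) = \<dots>" .
      show ?thesis by (subst L) (simp only: e fourier_def right_diff_distrib)
    qed
    then have s1: "norm (fourier f (\<xi> + h) - fourier f \<xi> - ?L h) \<le> ?c * (\<integral>x. norm (f x * ?r x) \<partial>lborel)"
      using integral_norm_bound[of lborel "\<lambda>x. f x * ?r x"] by (simp add: norm_mult mult_left_mono)
    have s2: "(\<integral>x. norm (f x * ?r x) \<partial>lborel) \<le> (\<integral>x. (norm (f x) * (norm x)\<^sup>2 / 2) * (norm h)\<^sup>2 \<partial>lborel)"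
    proof (rule integral_mono_AE'[OF integrable_mult_left[OF intK]])
      show "AE x in lborel. norm (f x * ?r x) \<le> norm (f x) * (norm x)\<^sup>2 / 2 * (norm h)\<^sup>2"
      proof (rule AE_I2)
        fix x
        have "?r x = cis (- (x \<bullet> \<xi>)) * (cis (- (x \<bullet> h)) - 1 - \<i> * of_real (- (x \<bullet> h)))"
          by (simp add: inner_add_right cis_mult algebra_simps)
        then have "norm (?r x) \<le> (x \<bullet> h)\<^sup>2 / 2" using cis_approx[of "- (x \<bullet> h)"] by (simp add: norm_mult)
        also have "(x \<bullet> h)\<^sup>2 \<le> (norm x * norm h)\<^sup>2"
          using Cauchy_Schwarz_ineq2[of x h] by (metis abs_ge_zero power2_abs power_mono)
        finally have "norm (?r x) \<le> (norm x)\<^sup>2 * (norm h)\<^sup>2 / 2" by (simp add: power_mult_distrib)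
        then have "norm (f x) * norm (?r x) \<le> norm (f x) * ((norm x)\<^sup>2 * (norm h)\<^sup>2 / 2)" by (intro mult_left_mono) auto
        then show "norm (f x * ?r x) \<le> norm (f x) * (norm x)\<^sup>2 / 2 * (norm h)\<^sup>2" by (simp add: norm_mult mult_ac)
      qed
    qed simp
    have s3: "?c * (\<integral>x. (norm (f x) * (norm x)\<^sup>2 / 2) * (norm h)\<^sup>2 \<partial>lborel) = K * (norm h)\<^sup>2"
      unfolding K_def by (simp only: integral_mult_left_zero mult.assoc)
    show ?thesis using order_trans[OF s1 mult_left_mono[OF s2]] unfolding s3 by simp
  qed
  show ?thesis
  proof (rule has_derivativeI_sandwich[where e=1 and H="\<lambda>y. K * norm (y - \<xi>)"])
    show "bounded_linear ?L"
      by (intro bounded_linear_sum bounded_linear_compose[OF bounded_linear_mult_left]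
         bounded_linear_compose[OF bounded_linear_of_real] bounded_linear_vec_nth)
    show "norm (fourier f y - fourier f \<xi> - ?L (y - \<xi>)) / norm (y - \<xi>) \<le> K * norm (y - \<xi>)" if "y \<noteq> \<xi>" for y
      using main[of "y - \<xi>"] that by (simp add: divide_le_eq power2_eq_square mult_ac)
    show "((\<lambda>y. K * norm (y - \<xi>)) \<longlongrightarrow> 0) (at \<xi>)"
      by (auto intro!: tendsto_eq_intros)
  qed simp
qed

lemma partial_deriv_fourier:
  assumes "f \<in> schwartz"
  shows "partial_deriv l (fourier f) = fourier (\<lambda>x. - \<i> * (of_real (x $ l) * f x))"
proof
  fix \<xi>
  show "partial_deriv l (fourier f) \<xi> = fourier (\<lambda>x. - \<i> * (of_real (x $ l) * f x)) \<xi>"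
  proof -
    let ?X = "\<lambda>m. fourier (\<lambda>x. - \<i> * (of_real (x $ m) * f x)) \<xi>"
    have "(\<Sum>m\<in>UNIV. of_real (axis l 1 $ m) * ?X m) = (\<Sum>m\<in>UNIV. if m = l then ?X m else 0)"
      by (intro sum.cong) (auto simp: axis_def)
    then show ?thesis by (subst partial_deriv_eq[OF fourier_has_derivative[OF assms]]) simp
  qed
qed

text \<open>A partial derivative of a transform is again the transform of a Schwartz function, so by
  induction only the decay of the transform itself has to be known.\<close>

lemma fourier_schwartz:
  assumes "f \<in> schwartz"
  shows "fourier f \<in> schwartz"
proof (rule schwartzI)
  fix k N
  show "dbounded k (\<lambda>_::unit. UNIV) (\<lambda>_. decay N) (\<lambda>_. fourier f)"
    using assms
  proof (induction k arbitrary: f)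
    case (0 f)
    obtain C where "\<And>\<xi>. norm (fourier f \<xi>) \<le> C * decay N \<xi>" using fourier_decay_schwartz[OF 0] by metis
    then show ?case unfolding dbounded.simps by blast
  next
    case (Suc k f)
    obtain C where C: "\<And>\<xi>. norm (fourier f \<xi>) \<le> C * decay N \<xi>" using fourier_decay_schwartz[OF Suc.prems] by metis
    show ?case
    proof (rule dbounded_SucI)
      show "norm (fourier f \<xi>) \<le> C * decay N \<xi>" for \<xi> by (rule C)
      show "fourier f differentiable (at \<xi>)" for \<xi>
        using fourier_has_derivative[OF Suc.prems] differentiable_def by blast
      show "dbounded k (\<lambda>_::unit. UNIV) (\<lambda>_. decay N) (\<lambda>_. partial_deriv l (fourier f))" for l
        unfolding partial_deriv_fourier[OF Suc.prems]
        by (intro Suc.IH schwartz_cmult schwartz_component_mult Suc.prems)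
    qed
  qed
qed

lemma inv_fourier_schwartz: "f \<in> schwartz \<Longrightarrow> inv_fourier f \<in> schwartz"
  unfolding inv_fourier_eq[abs_def] by (rule schwartz_reflect[OF fourier_schwartz])

section \<open>Moving the transform across an integral\<close>

lemma integrable_pair_mult:
  fixes f g :: "real^'d::finite \<Rightarrow> complex"
  assumes f: "integrable lborel f" and g: "integrable lborel g"
    and [measurable]: "(\<lambda>(x,y). k x y) \<in> borel_measurable (lborel \<Otimes>\<^sub>M lborel)" and k: "\<And>x y. norm (k x y) \<le> (1::real)"
  shows "integrable (lborel \<Otimes>\<^sub>M lborel) (\<lambda>(x,y). f x * (k x y :: complex) * g y)"
proof -
  have [measurable]: "f \<in> borel_measurable lborel" "g \<in> borel_measurable lborel" using f g by auto
  have "integrable (lborel \<Otimes>\<^sub>M lborel) (\<lambda>(x,y). norm (f x) * norm (g y))"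
  proof (rule lborel_pair.Fubini_integrable)
    show "integrable lborel (\<lambda>x. \<integral>y. norm (case (x, y) of (x, y) \<Rightarrow> norm (f x) * norm (g y)) \<partial>lborel)"
      using f by simp
    show "AE x in lborel. integrable lborel (\<lambda>y. case (x, y) of (x, y) \<Rightarrow> norm (f x) * norm (g y))"
      using g by simp
  qed measurable
  then show ?thesis
  proof (rule Bochner_Integration.integrable_bound)
    show "AE p in lborel \<Otimes>\<^sub>M lborel. norm (case p of (x, y) \<Rightarrow> f x * k x y * g y) \<le> norm (case p of (x, y) \<Rightarrow> norm (f x) * norm (g y))"
    proof (rule AE_I2, clarsimp simp: norm_mult)
      fix x y
      have "norm (f x) * norm (k x y) \<le> norm (f x) * 1" by (intro mult_left_mono k) auto
      then show "norm (f x) * norm (k x y) * norm (g y) \<le> norm (f x) * norm (g y)" by (intro mult_right_mono) auto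
    qed
  qed measurable
qed

lemma fourier_mult_swap:
  fixes f g :: "real^'d::finite \<Rightarrow> complex"
  assumes f: "integrable lborel f" and g: "integrable lborel g"
  shows "(\<integral>\<xi>. fourier f \<xi> * g \<xi> \<partial>lborel) = (\<integral>x. f x * fourier g x \<partial>lborel)"
proof -
  have i: "integrable (lborel \<Otimes>\<^sub>M lborel) (\<lambda>(x,y). f x * cis (- (x \<bullet> y)) * g y)"
    by (rule integrable_pair_mult[OF f g]) (auto, measurable)
  have e: "fourier f y * g y = of_real ((2 * pi) powr (- real CARD('d) / 2)) * (\<integral>x. f x * cis (- (x \<bullet> y)) * g y \<partial>lborel)" for y
    unfolding fourier_def by simp
  have "(\<integral>\<xi>. fourier f \<xi> * g \<xi> \<partial>lborel) = of_real ((2 * pi) powr (- real CARD('d) / 2)) * (\<integral>y. (\<integral>x. f x * cis (- (x \<bullet> y)) * g y \<partial>lborel) \<partial>lborel)"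
    by (simp only: e integral_mult_right_zero)
  also have "(\<integral>y. (\<integral>x. f x * cis (- (x \<bullet> y)) * g y \<partial>lborel) \<partial>lborel) = (\<integral>x. (\<integral>y. f x * cis (- (x \<bullet> y)) * g y \<partial>lborel) \<partial>lborel)"
    by (rule lborel_pair.Fubini_integral[OF i])
  also have "\<dots> = (\<integral>x. f x * (\<integral>y. g y * cis (- (y \<bullet> x)) \<partial>lborel) \<partial>lborel)"
  proof -
    have e2: "f x * cis (- (x \<bullet> y)) * g y = f x * (g y * cis (- (y \<bullet> x)))" for x y
      by (simp add: inner_commute mult_ac)
    show ?thesis by (simp only: e2 integral_mult_right_zero)
  qed
  finally have e3: "(\<integral>\<xi>. fourier f \<xi> * g \<xi> \<partial>lborel) = of_real ((2 * pi) powr (- real CARD('d) / 2)) * (\<integral>x. f x * (\<integral>y. g y * cis (- (y \<bullet> x)) \<partial>lborel) \<partial>lborel)" .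
  have e4: "f x * fourier g x = of_real ((2 * pi) powr (- real CARD('d) / 2)) * (f x * (\<integral>y. g y * cis (- (y \<bullet> x)) \<partial>lborel))" for x
    unfolding fourier_def by (simp add: mult.left_commute)
  show ?thesis unfolding e3 by (simp only: e4 integral_mult_right_zero)
qed

lemma inv_fourier_mult_swap:
  fixes f g :: "real^'d::finite \<Rightarrow> complex"
  assumes f: "f \<in> schwartz" and g: "g \<in> schwartz"
  shows "(\<integral>\<xi>. inv_fourier f \<xi> * g \<xi> \<partial>lborel) = (\<integral>x. f x * inv_fourier g x \<partial>lborel)"
proof -
  have "(\<integral>\<xi>. inv_fourier f \<xi> * g \<xi> \<partial>lborel) = (\<integral>\<xi>. fourier f \<xi> * g (- \<xi>) \<partial>lborel)"
    using integral_reflect(1)[of "\<lambda>\<xi>. fourier f \<xi> * g (- \<xi>)"] schwartz_measurable[OF fourier_schwartz[OF f]]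
      schwartz_measurable[OF schwartz_reflect[OF g]] by (simp add: inv_fourier_eq)
  also have "\<dots> = (\<integral>x. f x * fourier (\<lambda>\<xi>. g (- \<xi>)) x \<partial>lborel)"
    by (intro fourier_mult_swap schwartz_integrable f schwartz_reflect g)
  finally show ?thesis by (simp add: inv_fourier_reflect schwartz_measurable[OF g])
qed

section \<open>Fourier inversion\<close>

definition gauss :: "real^'d::finite \<Rightarrow> complex" where
  "gauss x = of_real (exp (- (x \<bullet> x) / 2))"

lemma norm_gauss_le_1: "norm (gauss x) \<le> 1"
  by (simp add: gauss_def)

lemma gauss_0 [simp]: "gauss 0 = 1"
  by (simp add: gauss_def)

lemma continuous_on_gauss [continuous_intros]: "continuous_on S f \<Longrightarrow> continuous_on S (\<lambda>x. gauss (f x))"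
  unfolding gauss_def by (intro continuous_intros) auto

lemma measurable_gauss [measurable]: "gauss \<in> borel_measurable borel"
  by (intro borel_measurable_continuous_onI continuous_intros)

text \<open>From (1 + r / n)^n \<le> exp r with n = \<open>Suc N\<close> one gets (1 + r)^N \<le>
  n^N exp r, and r - r^2 / 2 \<le> 1/2 turns exp r into a constant against the Gaussian.\<close>

lemma gauss_decay: "norm (gauss x) \<le> (real (Suc N) ^ N * exp (1/2)) * decay N x"
proof -
  let ?r = "norm x" and ?N = "Suc N"
  have "1 + ?r \<le> real ?N * (1 + ?r / real ?N)" by (simp add: field_simps)
  then have "(1 + ?r) ^ N \<le> (real ?N * (1 + ?r / real ?N)) ^ N" by (intro power_mono) auto
  also have "\<dots> = real ?N ^ N * (1 + ?r / real ?N) ^ N" by (rule power_mult_distrib)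
  also have "(1 + ?r / real ?N) ^ N \<le> (1 + ?r / real ?N) ^ ?N" by (intro power_increasing) auto
  also have "(1 + ?r / real ?N) ^ ?N \<le> exp ?r" by (rule exp_ge_one_plus_x_over_n_power_n) (auto intro: order_trans[OF _ norm_ge_zero])
  finally have 1: "(1 + ?r) ^ N \<le> real ?N ^ N * exp ?r" by (simp add: mult_left_mono)
  have "0 \<le> (?r - 1)\<^sup>2" by simp
  then have "?r - (x \<bullet> x) / 2 \<le> 1/2" by (simp add: power2_eq_square dot_square_norm algebra_simps)
  then have "exp ?r * exp (- (x \<bullet> x) / 2) \<le> exp (1/2)" by (simp add: exp_add[symmetric])
  then have A: "real ?N ^ N * (exp ?r * exp (- (x \<bullet> x) / 2)) \<le> real ?N ^ N * exp (1/2)" by (intro mult_left_mono) auto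
  have B: "(1 + ?r) ^ N * exp (- (x \<bullet> x) / 2) \<le> real ?N ^ N * exp ?r * exp (- (x \<bullet> x) / 2)"
    using 1 by (intro mult_right_mono) auto
  have "(1 + ?r) ^ N * exp (- (x \<bullet> x) / 2) \<le> real ?N ^ N * exp (1/2)" by (rule order_trans[OF B[unfolded mult.assoc] A])
  then have "exp (- (x \<bullet> x) / 2) \<le> real ?N ^ N * exp (1/2) * decay N x" by (simp add: decay_def field_simps)
  then show ?thesis unfolding gauss_def norm_of_real by simp
qed

lemma gauss_has_derivative: "(gauss has_derivative (\<lambda>h. - of_real (x \<bullet> h) * gauss x)) (at x)"
proof -
  have "((\<lambda>x. complex_of_real (exp (- (x \<bullet> x) / 2))) has_derivative (\<lambda>h. complex_of_real (exp (- (x \<bullet> x) / 2) * (- (x \<bullet> h + h \<bullet> x) / 2)))) (at x)"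
    by (auto intro!: derivative_eq_intros simp: inner_commute fun_eq_iff field_simps)
  then show ?thesis unfolding gauss_def[abs_def] by (simp add: inner_commute mult.commute)
qed

lemma partial_deriv_gauss: "partial_deriv l gauss = (\<lambda>x. - 1 * (of_real (x $ l) * gauss x))"
  by (rule ext, subst partial_deriv_eq[OF gauss_has_derivative]) (simp add: inner_axis)

lemma gauss_schwartz: "gauss \<in> schwartz"
proof (rule schwartzI)
  fix k N
  show "dbounded k (\<lambda>_::unit. UNIV) (\<lambda>_. decay N) (\<lambda>_. gauss :: real^'a \<Rightarrow> complex)"
  proof (induction k arbitrary: N)
    case 0
    show ?case unfolding dbounded.simps using gauss_decay[of _ N] by blast
  next
    case (Suc k)
    show ?case
    proof (rule dbounded_SucI)
      show "norm (gauss x) \<le> (real (Suc N) ^ N * exp (1/2)) * decay N x" for x :: "real^'a" by (rule gauss_decay)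
      show "gauss differentiable (at x)" for x :: "real^'a" using gauss_has_derivative differentiable_def by blast
      fix l :: 'a
      have "dbounded k (\<lambda>_::unit. UNIV) (\<lambda>_ x. 1 * ((1 + norm x) * decay (Suc N) x)) (\<lambda>_ x. - 1 * (complex_of_real (x $ l) * gauss x))"
        by (rule dbounded_bilinear[OF bounded_bilinear_mult _ _ _ dbounded_const[where C=1]
           dbounded_bilinear[OF bounded_bilinear_mult _ _ _ dbounded_component Suc]]) auto
      moreover have "(\<lambda>x::real^'a. 1 * ((1 + norm x) * decay (Suc N) x)) = decay N"
        by (auto simp: decay_def)
      ultimately show "dbounded k (\<lambda>_::unit. UNIV) (\<lambda>_. decay N) (\<lambda>_. partial_deriv l gauss)"
        unfolding partial_deriv_gauss by simp
    qed
  qed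
qed

lemma integral_gauss: "(\<integral>x. gauss (x::real^'d::finite) \<partial>lborel) = of_real ((2 * pi) powr (real CARD('d) / 2))"
proof -
  have e: "exp (- (x \<bullet> x) / 2) = (\<Prod>b\<in>Basis. exp (- (x \<bullet> b)\<^sup>2 / 2))" for x :: "real^'d"
    by (simp add: exp_sum[symmetric] euclidean_inner[of x x] power2_eq_square sum_negf sum_divide_distrib)
  have "(\<integral>\<^sup>+x. ennreal (exp (- (x \<bullet> x) / 2)) \<partial>(lborel :: (real^'d) measure)) = (\<integral>\<^sup>+x. (\<Prod>b\<in>Basis. ennreal (exp (- (x \<bullet> b)\<^sup>2 / 2))) \<partial>(lborel :: (real^'d) measure))"
    by (simp only: e, subst prod_ennreal) auto
  also have "\<dots> = (\<Prod>b\<in>(Basis::(real^'d) set). (\<integral>\<^sup>+t. ennreal (exp (- t\<^sup>2 / 2)) \<partial>lborel))"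
    by (intro nn_integral_lborel_prod) auto
  also have "(\<integral>\<^sup>+t. ennreal (exp (- t\<^sup>2 / 2)) \<partial>lborel) = ennreal (sqrt (2 * pi))"
  proof -
    have f: "(\<lambda>t. exp (- t\<^sup>2 / 2)) = (\<lambda>t. sqrt (2 * pi) * std_normal_density t)"
      by (simp add: std_normal_density_def)
    have "integrable lborel (\<lambda>t::real. exp (- t\<^sup>2 / 2))" unfolding f by simp
    then have "(\<integral>\<^sup>+t. ennreal (exp (- t\<^sup>2 / 2)) \<partial>lborel) = ennreal (\<integral>t. exp (- t\<^sup>2 / 2) \<partial>lborel)"
      by (intro nn_integral_eq_integral) auto
    also have "(\<integral>t. exp (- t\<^sup>2 / 2) \<partial>(lborel :: real measure)) = sqrt (2 * pi)" unfolding f by simp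
    finally show ?thesis .
  qed
  also have "(\<Prod>b\<in>(Basis::(real^'d) set). ennreal (sqrt (2 * pi))) = ennreal (sqrt (2 * pi) ^ CARD('d))"
    by (simp add: ennreal_power)
  finally have n: "(\<integral>\<^sup>+x. ennreal (exp (- (x \<bullet> x) / 2)) \<partial>(lborel :: (real^'d) measure)) = ennreal (sqrt (2 * pi) ^ CARD('d))" .
  have "(\<integral>x. exp (- (x \<bullet> x) / 2) \<partial>(lborel :: (real^'d) measure)) = sqrt (2 * pi) ^ CARD('d)"
  proof -
    have "(\<integral>x. exp (- (x \<bullet> x) / 2) \<partial>(lborel :: (real^'d) measure)) = enn2real (\<integral>\<^sup>+x. ennreal (exp (- (x \<bullet> x) / 2)) \<partial>(lborel :: (real^'d) measure))"
      by (rule integral_eq_nn_integral) auto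
    then show ?thesis unfolding n by simp
  qed
  also have "sqrt (2 * pi) ^ CARD('d) = (2 * pi) powr (real CARD('d) / 2)"
    by (simp add: powr_half_sqrt[symmetric] powr_powr powr_realpow[symmetric])
  finally show ?thesis unfolding gauss_def by (simp only: integral_complex_of_real)
qed

text \<open>Differentiation and multiplication by coordinates change places under the transform, so
  the transform of the Gaussian obeys the same first-order system as the Gaussian. Their quotient is
  therefore constant, and its value at 0 is the normalised Gaussian integral.\<close>

lemma fourier_gauss: "fourier gauss = (gauss :: real^'d::finite \<Rightarrow> complex)"
proof -
  have fs: "fourier gauss \<in> (schwartz :: (real^'d \<Rightarrow> complex) set)" by (intro fourier_schwartz gauss_schwartz)
  have pd: "partial_deriv l (fourier gauss) \<xi> = - of_real (\<xi> $ l) * fourier gauss \<xi>" for l and \<xi> :: "real^'d"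
  proof -
    have "partial_deriv l (fourier gauss) \<xi> = \<i> * fourier (partial_deriv l gauss) \<xi>"
      by (simp only: partial_deriv_fourier[OF gauss_schwartz] partial_deriv_gauss fourier_cmult) simp
    also have "\<dots> = - of_real (\<xi> $ l) * fourier gauss \<xi>"
      by (simp add: fourier_partial_deriv[OF gauss_schwartz] complex_i_mult_minus mult.assoc)
    finally show ?thesis .
  qed
  define H where "H \<xi> = fourier gauss \<xi> * of_real (exp ((\<xi> \<bullet> \<xi>) / 2))" for \<xi> :: "real^'d"
  have "(H has_derivative (\<lambda>h. 0)) (at \<xi>)" for \<xi>
  proof -
    let ?f' = "frechet_derivative (fourier gauss) (at \<xi>)"
    have f': "(fourier gauss has_derivative ?f') (at \<xi>)" by (intro frechet_derivativeI schwartz_differentiable fs)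
    have "?f' h = (\<Sum>l\<in>UNIV. of_real (h $ l) * partial_deriv l (fourier gauss) \<xi>)" for h
      unfolding partial_deriv_fourier[OF gauss_schwartz]
      by (rule fun_cong[OF has_derivative_unique[OF f' fourier_has_derivative[OF gauss_schwartz]]])
    then have f'eq: "?f' h = - of_real (\<xi> \<bullet> h) * fourier gauss \<xi>" for h
      by (simp add: pd inner_vec_def sum_distrib_left sum_distrib_right sum_negf mult_ac)
    have e': "((\<lambda>\<xi>. complex_of_real (exp ((\<xi> \<bullet> \<xi>) / 2))) has_derivative (\<lambda>h. complex_of_real (exp ((\<xi> \<bullet> \<xi>) / 2) * ((\<xi> \<bullet> h + h \<bullet> \<xi>) / 2)))) (at \<xi>)"
      by (auto intro!: derivative_eq_intros)
    have "(\<lambda>h. fourier gauss \<xi> * complex_of_real (exp ((\<xi> \<bullet> \<xi>) / 2) * ((\<xi> \<bullet> h + h \<bullet> \<xi>) / 2)) + ?f' h * complex_of_real (exp ((\<xi> \<bullet> \<xi>) / 2))) = (\<lambda>h. 0)"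
      by (rule ext) (simp add: f'eq inner_commute)
    with has_derivative_mult[OF f' e'] show ?thesis unfolding H_def by simp
  qed
  then have Hc: "H \<xi> = H 0" for \<xi> using has_derivative_zero_unique[of UNIV H \<xi> 0] by simp
  have "H 0 = 1"
    by (simp add: H_def fourier_def integral_gauss) (simp add: of_real_mult[symmetric] powr_add[symmetric] del: of_real_mult)
  show ?thesis
  proof
    fix \<xi> :: "real^'d"
    have "fourier gauss \<xi> * of_real (exp ((\<xi> \<bullet> \<xi>) / 2)) = 1" using Hc[of \<xi>] \<open>H 0 = 1\<close> unfolding H_def by simp
    then show "fourier gauss \<xi> = gauss \<xi>" by (simp add: gauss_def exp_minus field_simps)
  qed
qed

lemma integrable_gauss_scaled:
  assumes "0 < \<epsilon>"
  shows "integrable lborel (\<lambda>x::real^'d::finite. gauss (\<epsilon> *\<^sub>R x + b))"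
  using integral_dil(2)[of "\<chi> i. \<epsilon>" gauss b] schwartz_integrable[OF gauss_schwartz[where 'a='d]] assms by simp

lemma integral_gauss_cis:
  assumes "0 < \<epsilon>"
  shows "(\<integral>\<xi>. gauss (\<epsilon> *\<^sub>R \<xi>) * cis (- (\<xi> \<bullet> v)) \<partial>lborel) =
    of_real ((2 * pi) powr (real CARD('d) / 2) * (1 / \<epsilon>) ^ CARD('d)) * gauss ((1 / \<epsilon>) *\<^sub>R (v :: real^'d::finite))"
proof -
  have "(\<integral>\<xi>. gauss (\<epsilon> *\<^sub>R \<xi>) * cis (- (\<xi> \<bullet> v)) \<partial>lborel) = (1 / \<epsilon>) ^ CARD('d) *\<^sub>R (\<integral>w. gauss w * cis (- (w \<bullet> ((1 / \<epsilon>) *\<^sub>R v))) \<partial>lborel)"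
    using integral_dil(1)[of "\<chi> i. 1 / \<epsilon>" "\<lambda>\<xi>. gauss (\<epsilon> *\<^sub>R \<xi>) * cis (- (\<xi> \<bullet> v))" 0] assms by simp
  also have "(\<integral>w. gauss w * cis (- (w \<bullet> ((1 / \<epsilon>) *\<^sub>R v))) \<partial>lborel) = of_real ((2 * pi) powr (real CARD('d) / 2)) * fourier gauss ((1 / \<epsilon>) *\<^sub>R v)"
    unfolding fourier_def mult.assoc[symmetric] by (simp add: of_real_mult[symmetric] powr_add[symmetric] del: of_real_mult)
  finally show ?thesis by (simp add: fourier_gauss scaleR_conv_of_real mult_ac)
qed

text \<open>A Gaussian factor makes the double integral absolutely convergent; moving the transform
  across then shows that the regularised inversion integral is a Gaussian average of
  \<open>f\<close> around \<open>x\<close>. The claim is the limit of this identity as the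
  regularisation disappears.\<close>

theorem fourier_inversion:
  fixes f :: "real^'d::finite \<Rightarrow> complex"
  assumes f: "f \<in> schwartz"
  shows "inv_fourier (fourier f) x = f x"
proof -
  let ?c = "(2 * pi) powr (real CARD('d) / 2)"
  define \<epsilon> where "\<epsilon> n = inverse (real (Suc n))" for n
  have \<epsilon>: "0 < \<epsilon> n" for n by (simp add: \<epsilon>_def)
  have \<epsilon>0: "\<epsilon> \<longlonglongrightarrow> 0" unfolding \<epsilon>_def by (rule LIMSEQ_inverse_real_of_nat)
  note [measurable] = schwartz_measurable[OF f] schwartz_measurable[OF fourier_schwartz[OF f]]
  have g\<epsilon>: "(\<lambda>n. gauss (\<epsilon> n *\<^sub>R \<xi>)) \<longlonglongrightarrow> 1" for \<xi> :: "real^'d"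
  proof -
    have lim: "(\<lambda>n. \<epsilon> n *\<^sub>R \<xi>) \<longlonglongrightarrow> 0" using tendsto_scaleR[OF \<epsilon>0 tendsto_const] by simp
    have "continuous_on UNIV (gauss :: real^'d \<Rightarrow> complex)" by (rule continuous_on_gauss[OF continuous_on_id])
    then have "isCont gauss (0::real^'d)" by (simp add: continuous_on_eq_continuous_at)
    from isCont_tendsto_compose[OF this lim] have "(\<lambda>n. gauss (\<epsilon> n *\<^sub>R \<xi>)) \<longlonglongrightarrow> gauss (0::real^'d)" .
    then show ?thesis by simp
  qed
  have key: "(\<integral>\<xi>. fourier f \<xi> * (gauss (\<epsilon> n *\<^sub>R \<xi>) * cis (\<xi> \<bullet> x)) \<partial>lborel) = (\<integral>w. f (x + \<epsilon> n *\<^sub>R w) * gauss w \<partial>lborel)" for n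
  proof -
    let ?g = "\<lambda>\<xi>. gauss (\<epsilon> n *\<^sub>R \<xi>) * cis (\<xi> \<bullet> x)"
    have ig: "integrable lborel ?g"
      using integrable_gauss_scaled[OF \<epsilon>, of n 0] by (intro integrable_mult_cis) auto
    have fg: "fourier ?g y = of_real ((1 / \<epsilon> n) ^ CARD('d)) * gauss ((1 / \<epsilon> n) *\<^sub>R (y - x))" for y
    proof -
      have "?g \<xi> * cis (- (\<xi> \<bullet> y)) = gauss (\<epsilon> n *\<^sub>R \<xi>) * cis (- (\<xi> \<bullet> (y - x)))" for \<xi>
        by (simp add: mult.assoc cis_mult inner_diff_right)
      then have "fourier ?g y = of_real ((2 * pi) powr (- real CARD('d) / 2)) * (of_real (?c * (1 / \<epsilon> n) ^ CARD('d)) * gauss ((1 / \<epsilon> n) *\<^sub>R (y - x)))"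
        unfolding fourier_def by (simp only: integral_gauss_cis[OF \<epsilon>])
      also have "\<dots> = of_real ((2 * pi) powr (- real CARD('d) / 2) * ?c) * (of_real ((1 / \<epsilon> n) ^ CARD('d)) * gauss ((1 / \<epsilon> n) *\<^sub>R (y - x)))"
        by (simp only: of_real_mult mult_ac)
      also have "(2 * pi) powr (- real CARD('d) / 2) * ?c = 1" by (simp add: powr_add[symmetric])
      finally show ?thesis by simp
    qed
    have "(\<integral>\<xi>. fourier f \<xi> * ?g \<xi> \<partial>lborel) = (\<integral>y. f y * fourier ?g y \<partial>lborel)"
      by (intro fourier_mult_swap schwartz_integrable f ig)
    also have "\<dots> = (\<integral>y. f y * (of_real ((1 / \<epsilon> n) ^ CARD('d)) * gauss ((1 / \<epsilon> n) *\<^sub>R (y - x))) \<partial>lborel)"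
      by (simp only: fg)
    also have "\<dots> = (\<epsilon> n) ^ CARD('d) *\<^sub>R (\<integral>w. f (\<epsilon> n *\<^sub>R w + x) * (of_real ((1 / \<epsilon> n) ^ CARD('d)) * gauss w) \<partial>lborel)"
      using integral_dil(1)[of "\<chi> i. \<epsilon> n" "\<lambda>y. f y * (of_real ((1 / \<epsilon> n) ^ CARD('d)) * gauss ((1 / \<epsilon> n) *\<^sub>R (y - x)))" x] \<epsilon>[of n] by simp
    also have "\<dots> = (\<integral>w. f (x + \<epsilon> n *\<^sub>R w) * gauss w \<partial>lborel)"
    proof -
      have e: "f (\<epsilon> n *\<^sub>R w + x) * (of_real ((1 / \<epsilon> n) ^ CARD('d)) * gauss w) = of_real ((1 / \<epsilon> n) ^ CARD('d)) * (f (x + \<epsilon> n *\<^sub>R w) * gauss w)" for w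
        by (simp add: add.commute mult_ac)
      have "\<epsilon> n ^ CARD('d) * (1 / \<epsilon> n) ^ CARD('d) = 1" using \<epsilon>[of n] by (simp add: power_mult_distrib[symmetric])
      moreover have "\<epsilon> n ^ CARD('d) *\<^sub>R (of_real ((1 / \<epsilon> n) ^ CARD('d)) * I) = of_real (\<epsilon> n ^ CARD('d) * (1 / \<epsilon> n) ^ CARD('d)) * I" for I :: complex
        by (simp only: scaleR_conv_of_real of_real_mult mult.assoc)
      ultimately show ?thesis by (simp only: e integral_mult_right_zero of_real_1 mult_1)
    qed
    finally show ?thesis .
  qed
  have L1: "(\<lambda>n. \<integral>\<xi>. fourier f \<xi> * (gauss (\<epsilon> n *\<^sub>R \<xi>) * cis (\<xi> \<bullet> x)) \<partial>lborel) \<longlonglongrightarrow> (\<integral>\<xi>. fourier f \<xi> * (1 * cis (\<xi> \<bullet> x)) \<partial>lborel)"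
  proof (rule integral_dominated_convergence[where w="\<lambda>\<xi>. norm (fourier f \<xi>)"])
    show "integrable lborel (\<lambda>\<xi>. norm (fourier f \<xi>))" by (intro integrable_norm schwartz_integrable fourier_schwartz f)
    show "AE \<xi> in lborel. (\<lambda>n. fourier f \<xi> * (gauss (\<epsilon> n *\<^sub>R \<xi>) * cis (\<xi> \<bullet> x))) \<longlonglongrightarrow> fourier f \<xi> * (1 * cis (\<xi> \<bullet> x))"
      by (intro AE_I2 tendsto_intros g\<epsilon>)
    show "AE \<xi> in lborel. norm (fourier f \<xi> * (gauss (\<epsilon> n *\<^sub>R \<xi>) * cis (\<xi> \<bullet> x))) \<le> norm (fourier f \<xi>)" for n
      by (intro AE_I2) (simp add: norm_mult mult_left_le norm_gauss_le_1)
  qed measurable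
  have L2: "(\<lambda>n. \<integral>w. f (x + \<epsilon> n *\<^sub>R w) * gauss w \<partial>lborel) \<longlonglongrightarrow> (\<integral>w. f x * gauss (w::real^'d) \<partial>lborel)"
  proof -
    obtain C where C: "0 \<le> C" "\<And>x. norm (f x) \<le> C * decay 0 x" using schwartz_bound[OF f] by metis
    show ?thesis
    proof (rule integral_dominated_convergence[where w="\<lambda>w::real^'d. C * norm (gauss w)"])
      show "integrable lborel (\<lambda>w::real^'d. C * norm (gauss w))" by (intro integrable_mult_right integrable_norm schwartz_integrable gauss_schwartz)
      show "AE w in lborel. (\<lambda>n. f (x + \<epsilon> n *\<^sub>R w) * gauss w) \<longlonglongrightarrow> f x * gauss w"
      proof (intro AE_I2 tendsto_mult tendsto_const)
        fix w
        have "(\<lambda>n. x + \<epsilon> n *\<^sub>R w) \<longlonglongrightarrow> x" using tendsto_add[OF tendsto_const tendsto_scaleR[OF \<epsilon>0 tendsto_const]] by simp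
        then show "(\<lambda>n. f (x + \<epsilon> n *\<^sub>R w)) \<longlonglongrightarrow> f x"
          by (rule continuous_on_tendsto_compose[OF schwartz_continuous[OF f, of UNIV]]) auto
      qed
      show "AE w in lborel. norm (f (x + \<epsilon> n *\<^sub>R w) * gauss w) \<le> C * norm (gauss w)" for n
        using C(2) by (auto simp: norm_mult intro!: mult_right_mono)
    qed measurable
  qed
  have "(\<integral>\<xi>. fourier f \<xi> * (1 * cis (\<xi> \<bullet> x)) \<partial>lborel) = f x * of_real ?c"
    using LIMSEQ_unique[OF L1[unfolded key] L2] by (simp add: integral_gauss)
  then have "inv_fourier (fourier f) x = of_real ((2 * pi) powr (- real CARD('d) / 2)) * (f x * of_real ?c)"
    unfolding inv_fourier_def by (simp add: inner_commute)
  also have "\<dots> = of_real ((2 * pi) powr (- real CARD('d) / 2) * ?c) * f x" by (simp only: of_real_mult mult_ac)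
  also have "(2 * pi) powr (- real CARD('d) / 2) * ?c = 1" by (simp add: powr_add[symmetric])
  finally show ?thesis by simp
qed

lemma fourier_inversion':
  assumes "f \<in> schwartz"
  shows "fourier (inv_fourier f) x = f x"
proof -
  have "fourier (inv_fourier f) x = inv_fourier (\<lambda>y. inv_fourier f (- y)) x"
    using inv_fourier_reflect[of "\<lambda>y. inv_fourier f (- y)"] schwartz_measurable[OF schwartz_reflect[OF inv_fourier_schwartz[OF assms]]]
    by simp
  then show ?thesis using fourier_inversion[OF assms] by (simp add: fourier_eq[symmetric])
qed

section \<open>Functions determined by their Schwartz pairings\<close>

lemma schwartz_mult_bounded:
  assumes "f \<in> schwartz" "\<And>k. dbounded k (\<lambda>_::unit. UNIV) (\<lambda>_ _. 1) (\<lambda>_. g)"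
  shows "(\<lambda>x. g x * f x) \<in> schwartz"
  by (rule schwartz_mult[OF assms(1)], rule exI[of _ 0]) (use assms(2) in simp)

lemma dbounded_schwartz_diag:
  fixes s :: "real^'d::finite"
  assumes "f \<in> schwartz"
  shows "dbounded k (\<lambda>_::unit. UNIV) (\<lambda>_ _. 1) (\<lambda>_ x. f (dil s x + b))"
proof -
  have d: "dbounded k (\<lambda>_::unit. UNIV) (\<lambda>_ _. 1) (\<lambda>_. f)" using schwartzD[OF assms, of k 0] by (simp add: decay_def[abs_def])
  have "\<bar>s $ l\<bar> \<le> 1 + norm s" for l using component_le_norm_cart[of s l] by simp
  then have "dbounded k (\<lambda>i. {x. dil s x + b \<in> UNIV}) (\<lambda>i x. (1 + norm s) ^ k * 1) (\<lambda>_::unit. \<lambda>x. f (dil s x + b))"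
    by (intro dbounded_diag[OF _ _ _ _ d]) auto
  then have d2: "dbounded k (\<lambda>_::unit. UNIV) (\<lambda>_ _. (1 + norm s) ^ k) (\<lambda>_ x. f (dil s x + b))" by simp
  show ?thesis by (rule dbounded_weight[where C="(1 + norm s) ^ k", OF _ _ d2]) auto
qed

text \<open>Boxes generate the Borel sets and are stable under intersection, so vanishing integrals
  extend to all Borel sets. Complements require the total integral to vanish, which follows by
  exhausting the space with boxes.\<close>

lemma AE_zero_of_boxes:
  fixes W :: "real^'d::finite \<Rightarrow> real"
  assumes W: "integrable lborel W" and box: "\<And>a b. (\<integral>x. indicator (box a b) x *\<^sub>R W x \<partial>lborel) = 0"
  shows "AE x in lborel. W x = 0"
proof -
  have [measurable]: "W \<in> borel_measurable borel" using W by auto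
  let ?P = "\<lambda>A. (\<integral>x. indicator A x *\<^sub>R W x \<partial>lborel) = 0"
  have W0: "(\<integral>x. W x \<partial>lborel) = 0"
  proof -
    let ?A = "\<lambda>n::nat. box (- (real n *\<^sub>R One)) (real n *\<^sub>R One) :: (real^'d) set"
    have "(\<lambda>n. \<integral>x. indicator (?A n) x *\<^sub>R W x \<partial>lborel) \<longlonglongrightarrow> (\<integral>x. W x \<partial>lborel)"
    proof (rule integral_dominated_convergence[where w="\<lambda>x. norm (W x)"])
      show "AE x in lborel. (\<lambda>n. indicator (?A n) x *\<^sub>R W x) \<longlonglongrightarrow> W x"
      proof (rule AE_I2)
        fix x :: "real^'d"
        have "x \<in> (\<Union>n. ?A n)" using UN_box_eq_UNIV by blast
        then obtain n0 where n0: "x \<in> ?A n0" by blast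
        have "\<forall>\<^sub>F n in sequentially. indicator (?A n) x *\<^sub>R W x = W x"
          using eventually_ge_at_top[of n0]
        proof eventually_elim
          case (elim n)
          then have "real n0 \<le> real n" by simp
          then have "x \<in> ?A n" using n0 by (auto simp: mem_box intro: le_less_trans less_le_trans)
          then show ?case by simp
        qed
        then show "(\<lambda>n. indicator (?A n) x *\<^sub>R W x) \<longlonglongrightarrow> W x" by (rule tendsto_eventually)
      qed
    qed (use W in \<open>auto simp: indicator_def\<close>)
    then show ?thesis unfolding box using LIMSEQ_unique tendsto_const by metis
  qed
  have P: "?P A" if "A \<in> sets borel" for A
  proof -
    let ?E = "range (\<lambda>(a, b). box a b::(real^'d) set)"
    have "Int_stable ?E" "?E \<subseteq> Pow UNIV" "A \<in> sigma_sets UNIV ?E"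
      using that by (auto simp: Int_stable_def box_Int_box borel_eq_box)
    then show ?thesis
    proof (induction rule: sigma_sets_induct_disjoint)
      case (basic A) then show ?case using box by auto
    next
      case empty then show ?case by simp
    next
      case (compl A)
      then have [measurable]: "A \<in> sets borel" by (simp add: borel_eq_box)
      have "integrable lborel (\<lambda>x. indicator A x *\<^sub>R W x)" by (rule integrable_mult_indicator[OF _ W]) simp
      moreover have "indicator (UNIV - A) x *\<^sub>R W x = W x - indicator A x *\<^sub>R W x" for x
        by (auto simp: indicator_def)
      ultimately show ?case using W W0 compl by simp
    next
      case (union A)
      then have [measurable]: "A i \<in> sets borel" for i by (auto simp: borel_eq_box)
      have "set_integrable lborel (\<Union>i. A i) W" unfolding set_integrable_def by (rule integrable_mult_indicator[OF _ W]) simp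
      then have "(LINT x:(\<Union>i. A i)|lborel. W x) = (\<Sum>i. LINT x:A i|lborel. W x)"
        by (intro lebesgue_integral_countable_add) (use union in \<open>auto simp: disjoint_family_on_def\<close>)
      then show ?case using union unfolding set_lebesgue_integral_def by simp
    qed
  qed
  show ?thesis
    by (rule density_unique_real[of lborel W "\<lambda>_. 0"]) (use W P in \<open>auto simp: set_lebesgue_integral_def\<close>)
qed

text \<open>The function \<open>w\<close> is only integrable against Schwartz functions, so it is
  first multiplied by a Gaussian, which vanishes nowhere. Pairings of the product with translated
  narrow Gaussians are zero; integrating the centre over a box and shrinking the width leaves the
  integral of the product over the box.\<close>

lemma schwartz_separating:
  fixes w :: "real^'d::finite \<Rightarrow> complex"
  assumes [measurable]: "w \<in> borel_measurable borel"
    and int: "\<And>\<psi>. \<psi> \<in> schwartz \<Longrightarrow> integrable lborel (\<lambda>x. w x * \<psi> x)"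
    and zero: "\<And>\<psi>. \<psi> \<in> schwartz \<Longrightarrow> (\<integral>x. w x * \<psi> x \<partial>lborel) = 0"
  shows "AE x in lborel. w x = 0"
proof -
  let ?c = "(2 * pi) powr (real CARD('d) / 2)"
  define W where "W x = w x * gauss x" for x
  have W: "integrable lborel W" unfolding W_def by (rule int[OF gauss_schwartz])
  have [measurable]: "W \<in> borel_measurable borel" unfolding W_def by measurable
  define \<epsilon> where "\<epsilon> n = inverse (real (Suc n))" for n
  have \<epsilon>: "0 < \<epsilon> n" for n by (simp add: \<epsilon>_def)
  have \<epsilon>0: "\<epsilon> \<longlonglongrightarrow> 0" unfolding \<epsilon>_def by (rule LIMSEQ_inverse_real_of_nat)
  have conv0: "(\<integral>y. W y * gauss ((1 / \<epsilon> n) *\<^sub>R (x - y)) \<partial>lborel) = 0" for n x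
  proof -
    have "(\<lambda>y. gauss (dil (\<chi> i. - (1 / \<epsilon> n)) y + (1 / \<epsilon> n) *\<^sub>R x) * gauss y) \<in> schwartz"
      by (intro schwartz_mult_bounded gauss_schwartz dbounded_schwartz_diag)
    from zero[OF this] show ?thesis by (simp add: W_def algebra_simps scaleR_diff_right)
  qed
  have box: "(\<integral>y. indicator (box a b) y *\<^sub>R W y \<partial>lborel) = 0" for a b
  proof -
    let ?B = "box a b"
    let ?i = "\<lambda>x. indicator ?B x :: complex"
    have iB: "integrable lborel ?i"
    proof -
      have "integrable lborel (\<lambda>x. complex_of_real (indicator ?B x))"
        by (intro integrable_of_real integrable_real_indicator) (use emeasure_lborel_box_finite[of a b] in \<open>auto simp: less_top\<close>)
      moreover have "(\<lambda>x. complex_of_real (indicator ?B x)) = ?i" by (auto simp: indicator_def)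
      ultimately show ?thesis by simp
    qed
    define I where "I n y = (\<integral>v. ?i (y + \<epsilon> n *\<^sub>R v) * gauss v \<partial>lborel)" for n y
    \<comment> \<open>Fubini: integrating first over \<open>y\<close> gives the vanishing pairing
      with the kernel, integrating first over the box gives the smoothed indicator
      \<open>I n\<close>.\<close>
    have I0: "(\<integral>y. W y * I n y \<partial>lborel) = 0" for n
    proof -
      let ?F = "\<lambda>x y. ?i x * gauss ((1 / \<epsilon> n) *\<^sub>R (x - y)) * W y"
      have pr: "integrable (lborel \<Otimes>\<^sub>M lborel) (\<lambda>(x,y). ?F x y)"
        by (rule integrable_pair_mult[OF iB W _ norm_gauss_le_1]) measurable
      have e1: "(\<integral>y. ?F x y \<partial>lborel) = 0" for x
      proof -
        have "?F x y = ?i x * (W y * gauss ((1 / \<epsilon> n) *\<^sub>R (x - y)))" for y by simp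
        then show ?thesis by (simp only: integral_mult_right_zero conv0) simp
      qed
      have e2: "(\<integral>x. ?F x y \<partial>lborel) = of_real (\<epsilon> n ^ CARD('d)) * (W y * I n y)" for y
      proof -
        have "(\<integral>x. ?F x y \<partial>lborel) = W y * (\<integral>x. ?i x * gauss ((1 / \<epsilon> n) *\<^sub>R (x - y)) \<partial>lborel)" by simp
        also have "(\<integral>x. ?i x * gauss ((1 / \<epsilon> n) *\<^sub>R (x - y)) \<partial>lborel) = \<epsilon> n ^ CARD('d) *\<^sub>R (\<integral>v. ?i (\<epsilon> n *\<^sub>R v + y) * gauss v \<partial>lborel)"
          using integral_dil(1)[of "\<chi> i. \<epsilon> n" "\<lambda>x. ?i x * gauss ((1 / \<epsilon> n) *\<^sub>R (x - y))" y] \<epsilon>[of n] by simp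
        finally show ?thesis unfolding I_def by (simp add: scaleR_conv_of_real add.commute mult_ac)
      qed
      have "(\<integral>y. (\<integral>x. ?F x y \<partial>lborel) \<partial>lborel) = (\<integral>x. (\<integral>y. ?F x y \<partial>lborel) \<partial>lborel)"
        by (rule lborel_pair.Fubini_integral[OF pr])
      then have "of_real (\<epsilon> n ^ CARD('d)) * (\<integral>y. W y * I n y \<partial>lborel) = 0" by (simp only: e1 e2 integral_mult_right_zero) simp
      then show ?thesis using \<epsilon>[of n] by simp
    qed
    have I_bd: "norm (I n y) \<le> (\<integral>v. norm (gauss (v::real^'d)) \<partial>lborel)" for n y
    proof -
      have "norm (I n y) \<le> (\<integral>v. norm (?i (y + \<epsilon> n *\<^sub>R v) * gauss v) \<partial>lborel)" unfolding I_def by (rule integral_norm_bound)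
      also have "\<dots> \<le> (\<integral>v. norm (gauss (v::real^'d)) \<partial>lborel)"
        by (rule integral_mono_AE'[OF integrable_norm[OF schwartz_integrable[OF gauss_schwartz]]]) (auto simp: indicator_def)
      finally show ?thesis .
    qed
    have [measurable]: "I n \<in> borel_measurable borel" for n unfolding I_def by measurable
    \<comment> \<open>Convergence of the smoothed indicator may fail only on the boundary of the
      box, which is a null set.\<close>
    have I_lim: "(\<lambda>n. I n y) \<longlonglongrightarrow> ?i y * of_real ?c" if "y \<notin> cbox a b - box a b" for y
    proof -
      have "(\<lambda>n. I n y) \<longlonglongrightarrow> (\<integral>v. ?i y * gauss (v::real^'d) \<partial>lborel)" unfolding I_def
      proof (rule integral_dominated_convergence[where w="\<lambda>v::real^'d. norm (gauss v)"])
        show "AE v in lborel. (\<lambda>n. ?i (y + \<epsilon> n *\<^sub>R v) * gauss v) \<longlonglongrightarrow> ?i y * gauss v"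
        proof (rule AE_I2)
          fix v
          have lim: "(\<lambda>n. y + \<epsilon> n *\<^sub>R v) \<longlonglongrightarrow> y" using tendsto_add[OF tendsto_const tendsto_scaleR[OF \<epsilon>0 tendsto_const]] by simp
          have "\<forall>\<^sub>F n in sequentially. ?i (y + \<epsilon> n *\<^sub>R v) = ?i y"
          proof (cases "y \<in> box a b")
            case True
            then have "\<forall>\<^sub>F n in sequentially. y + \<epsilon> n *\<^sub>R v \<in> box a b" by (rule topological_tendstoD[OF lim open_box])
            then show ?thesis by eventually_elim (use True in simp)
          next
            case False
            with that have "y \<in> - cbox a b" by auto
            then have "\<forall>\<^sub>F n in sequentially. y + \<epsilon> n *\<^sub>R v \<in> - cbox a b"
              by (rule topological_tendstoD[OF lim open_Compl[OF closed_cbox]])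
            then show ?thesis
            proof eventually_elim
              case (elim n)
              then have "y + \<epsilon> n *\<^sub>R v \<notin> box a b" using box_subset_cbox by blast
              then show ?case using False by simp
            qed
          qed
          then show "(\<lambda>n. ?i (y + \<epsilon> n *\<^sub>R v) * gauss v) \<longlonglongrightarrow> ?i y * gauss v"
            by (intro tendsto_eventually) (auto elim: eventually_mono)
        qed
        show "integrable lborel (\<lambda>v::real^'d. norm (gauss v))" by (intro integrable_norm schwartz_integrable gauss_schwartz)
      qed (auto simp: indicator_def)
      then show ?thesis by (simp add: integral_gauss)
    qed
    have "(\<lambda>n. \<integral>y. W y * I n y \<partial>lborel) \<longlonglongrightarrow> (\<integral>y. W y * (?i y * of_real ?c) \<partial>lborel)"
    proof (rule integral_dominated_convergence[where w="\<lambda>y. norm (W y) * (\<integral>v. norm (gauss (v::real^'d)) \<partial>lborel)"])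
      have "cbox a b - box a b \<in> null_sets lborel"
        using negligible_frontier_interval[of a b] by (simp add: negligible_iff_null_sets null_sets_completion_iff)
      then have "AE y in lborel. y \<notin> cbox a b - box a b" by (rule AE_not_in)
      then show "AE y in lborel. (\<lambda>n. W y * I n y) \<longlonglongrightarrow> W y * (?i y * of_real ?c)"
        by eventually_elim (intro tendsto_mult tendsto_const I_lim)
      show "AE y in lborel. norm (W y * I n y) \<le> norm (W y) * (\<integral>v. norm (gauss (v::real^'d)) \<partial>lborel)" for n
        using I_bd by (auto simp: norm_mult intro!: AE_I2 mult_left_mono)
    qed (use W in auto)
    from LIMSEQ_unique[OF this[unfolded I0] tendsto_const]
    have "(\<integral>y. W y * (?i y * of_real ?c) \<partial>lborel) = 0" .
    moreover have e: "W y * (?i y * of_real ?c) = (indicator (box a b) y *\<^sub>R W y) * of_real ?c" for y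
      by (simp add: indicator_def)
    ultimately have "(\<integral>y. indicator (box a b) y *\<^sub>R W y \<partial>lborel) * of_real ?c = 0"
      by (simp only: e integral_mult_left_zero)
    then show ?thesis by simp
  qed
  have iW: "integrable lborel (\<lambda>y. indicator (box a b) y *\<^sub>R W y)" for a b :: "real^'d"
    by (rule integrable_mult_indicator[OF _ W]) simp
  have "(\<integral>y. indicator (box a b) y *\<^sub>R Re (W y) \<partial>lborel) = 0" "(\<integral>y. indicator (box a b) y *\<^sub>R Im (W y) \<partial>lborel) = 0" for a b
    using integral_Re[OF iW[of a b]] integral_Im[OF iW[of a b]] box[of a b] by auto
  then have "AE x in lborel. Re (W x) = 0" "AE x in lborel. Im (W x) = 0"
    using W by (auto intro!: AE_zero_of_boxes)
  then show ?thesis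
  proof eventually_elim
    case (elim x)
    then have "W x = 0" by (simp add: complex_eq_iff)
    then show ?case by (simp add: W_def gauss_def)
  qed
qed

section \<open>Fourier series of functions supported in a cube\<close>

lemma integral_lborel_prod:
  fixes g :: "'a::euclidean_space \<Rightarrow> real \<Rightarrow> complex"
  assumes "\<And>b. b \<in> Basis \<Longrightarrow> integrable lborel (g b)"
  shows "(\<integral>x. (\<Prod>b\<in>Basis. g b (x \<bullet> b)) \<partial>lborel) = (\<Prod>b\<in>Basis. \<integral>t. g b t \<partial>lborel)"
proof -
  interpret product_sigma_finite "\<lambda>_::'a. lborel :: real measure" by unfold_locales
  have [measurable]: "g b \<in> borel_measurable borel" if "b \<in> Basis" for b using assms[OF that] by auto
  have "(\<integral>x. (\<Prod>b\<in>Basis. g b (x \<bullet> b)) \<partial>lborel) = (\<integral>f. (\<Prod>b\<in>Basis. g b ((\<Sum>b\<in>Basis. f b *\<^sub>R b) \<bullet> b)) \<partial>(\<Pi>\<^sub>M b\<in>(Basis::'a set). lborel))"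
    by (subst lborel_eq, subst integral_distr) auto
  also have "\<dots> = (\<integral>f. (\<Prod>b\<in>Basis. g b (f b)) \<partial>(\<Pi>\<^sub>M b\<in>(Basis::'a set). lborel))"
    by (intro Bochner_Integration.integral_cong prod.cong refl) simp
  also have "\<dots> = (\<Prod>b\<in>Basis. \<integral>t. g b t \<partial>lborel)"
    by (rule product_integral_prod) (use assms in auto)
  finally show ?thesis .
qed

lemma cis_sum: "cis (\<Sum>i\<in>A. f i) = (\<Prod>i\<in>A. cis (f i))"
  by (induction A rule: infinite_finite_induct) (auto simp: cis_mult[symmetric])

text \<open>The frequencies of the exponentials that are periodic with period 2 l in each
  coordinate.\<close>

definition freq :: "real \<Rightarrow> int^'d::finite \<Rightarrow> real^'d" where
  "freq l n = (\<chi> i. pi / l * real_of_int (n $ i))"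

lemma freq_simps [simp]: "freq l 0 = 0" "freq l (n + m) = freq l n + freq l m" "freq l (- n) = - freq l n"
  by (auto simp: freq_def vec_eq_iff distrib_left add_divide_distrib)

lemma mem_cube: "\<omega> \<in> cube z l \<longleftrightarrow> (\<forall>i. z $ i - l \<le> \<omega> $ i \<and> \<omega> $ i \<le> z $ i + l)"
  by (auto simp: cube_def mem_box_cart)

lemma compact_cube: "compact (cube z l)"
  by (simp add: cube_def)

lemma measurable_cube [measurable]: "cube z l \<in> sets borel"
  by (simp add: cube_def)

lemma integral_interval_cis:
  assumes l: "0 < l"
  shows "(\<integral>t. indicator {a - l..a + l} t *\<^sub>R cis (t * (pi / l * real_of_int k)) \<partial>lborel) = (if k = 0 then of_real (2 * l) else 0)"
proof (cases "k = 0")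
  case True
  have "(\<integral>t. indicator {a - l..a + l} t *\<^sub>R (1::complex) \<partial>lborel) = of_real (measure lborel {a - l..a + l})"
    by (simp add: scaleR_conv_of_real)
  then show ?thesis using True l by (simp add: cis_zero)
next
  case False
  define w where "w = pi / l * real_of_int k"
  have w: "w \<noteq> 0" using False l by (simp add: w_def)
  have "(\<integral>t. indicator {a - l..a + l} t *\<^sub>R cis (t * w) \<partial>lborel) = cis ((a + l) * w) / (\<i> * of_real w) - cis ((a - l) * w) / (\<i> * of_real w)"
  proof (rule integral_FTC_atLeastAtMost)
    fix t
    have "((\<lambda>t::real. \<i> * complex_of_real (t * w)) has_derivative (\<lambda>h. \<i> * complex_of_real (h * w))) (at t)"
      by (intro has_derivative_mult_right has_derivative_of_real bounded_linear_imp_has_derivative bounded_linear_mult_left)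
    from has_derivative_compose[OF this DERIV_exp[unfolded has_field_derivative_def]]
    have "((\<lambda>t. cis (t * w)) has_derivative (\<lambda>h. cis (t * w) * (\<i> * complex_of_real (h * w)))) (at t)"
      unfolding cis_conv_exp by simp
    from has_derivative_mult_left[OF this, of "1 / (\<i> * of_real w)"]
    have "((\<lambda>t. cis (t * w) / (\<i> * of_real w)) has_vector_derivative cis (t * w)) (at t)"
      using w by (simp add: has_vector_derivative_def scaleR_conv_of_real field_simps)
    then show "((\<lambda>t. cis (t * w) / (\<i> * of_real w)) has_vector_derivative cis (t * w)) (at t within {a - l..a + l})"
      by (rule has_vector_derivative_at_within)
  qed (use l in \<open>auto intro!: continuous_intros\<close>)
  moreover have "cis ((a + l) * w) = cis ((a - l) * w)"
  proof -
    have "(a + l) * w = (a - l) * w + 2 * pi * real_of_int k" using l by (simp add: w_def field_simps)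
    then show ?thesis by (simp add: cis_mult[symmetric])
  qed
  ultimately show ?thesis using False by (simp add: w_def)
qed

lemma integral_cube_cis:
  fixes n :: "int^'d::finite"
  assumes l: "0 < l"
  shows "(\<integral>\<omega>. indicator (cube z l) \<omega> *\<^sub>R cis (\<omega> \<bullet> freq l n) \<partial>lborel) = (if n = 0 then of_real ((2 * l) ^ CARD('d)) else 0)"
proof -
  let ?g = "\<lambda>(b::real^'d) t. indicator {z \<bullet> b - l..z \<bullet> b + l} t *\<^sub>R cis (t * (b \<bullet> freq l n))"
  have e: "indicator (cube z l) \<omega> *\<^sub>R cis (\<omega> \<bullet> freq l n) = (\<Prod>b\<in>Basis. ?g b (\<omega> \<bullet> b))" for \<omega>
  proof -
    have "cis (\<omega> \<bullet> freq l n) = (\<Prod>b\<in>Basis. cis ((\<omega> \<bullet> b) * (b \<bullet> freq l n)))"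
      by (subst euclidean_inner) (simp add: cis_sum inner_commute)
    moreover have "(indicator (cube z l) \<omega> :: real) = (\<Prod>b\<in>Basis. indicator {z \<bullet> b - l..z \<bullet> b + l} (\<omega> \<bullet> b))"
    proof (cases "\<omega> \<in> cube z l")
      case True then show ?thesis by (simp add: mem_cube prod_Basis_cart inner_axis)
    next
      case False
      then obtain i where "\<omega> $ i \<notin> {z $ i - l..z $ i + l}" by (auto simp: mem_cube)
      then have "(\<Prod>i\<in>UNIV. indicator {z $ i - l..z $ i + l} (\<omega> $ i)) = (0::real)"
        by (intro prod_zero bexI[of _ i]) auto
      then show ?thesis using False by (simp add: prod_Basis_cart inner_axis)
    qed
    ultimately show ?thesis by (simp add: scaleR_conv_of_real prod.distrib)
  qed
  have "(\<integral>\<omega>. indicator (cube z l) \<omega> *\<^sub>R cis (\<omega> \<bullet> freq l n) \<partial>lborel) = (\<integral>\<omega>. (\<Prod>b\<in>Basis. ?g b (\<omega> \<bullet> b)) \<partial>lborel)" by (simp only: e)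
  also have "\<dots> = (\<Prod>b\<in>Basis. \<integral>t. ?g b t \<partial>lborel)"
    by (rule integral_lborel_prod, rule borel_integrable_compact) (auto intro!: continuous_intros)
  also have "\<dots> = (\<Prod>i\<in>UNIV. \<integral>t. indicator {z $ i - l..z $ i + l} t *\<^sub>R cis (t * (pi / l * real_of_int (n $ i))) \<partial>lborel)"
    by (simp add: prod_Basis_cart inner_axis inner_axis' freq_def)
  also have "\<dots> = (\<Prod>i\<in>UNIV. if n $ i = 0 then of_real (2 * l) else 0)"
    by (simp only: integral_interval_cis[OF l])
  also have "\<dots> = (if n = 0 then of_real ((2 * l) ^ CARD('d)) else 0)"
    by (auto simp: vec_eq_iff prod_zero_iff)
  finally show ?thesis .
qed

section \<open>Completeness of the exponentials on the cube\<close>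

inductive trigpoly :: "real \<Rightarrow> (real^'d::finite \<Rightarrow> complex) \<Rightarrow> bool" for l where
  mono: "trigpoly l (\<lambda>\<omega>. c * cis (\<omega> \<bullet> freq l n))"
| add: "trigpoly l f \<Longrightarrow> trigpoly l g \<Longrightarrow> trigpoly l (\<lambda>\<omega>. f \<omega> + g \<omega>)"

lemma trigpoly_mult:
  assumes f: "trigpoly l f" and g: "trigpoly l g"
  shows "trigpoly l (\<lambda>\<omega>. f \<omega> * g \<omega>)"
  using f
proof induction
  case (mono c n)
  show ?case using g
  proof induction
    case (mono c' n')
    have "(\<lambda>\<omega>. c * cis (\<omega> \<bullet> freq l n) * (c' * cis (\<omega> \<bullet> freq l n'))) = (\<lambda>\<omega>. (c * c') * cis (\<omega> \<bullet> freq l (n + n')))"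
      by (auto simp: inner_add_right cis_mult[symmetric] mult_ac)
    then show ?case using trigpoly.mono[of l "c * c'" "n + n'"] by simp
  next
    case (add f g) then show ?case using trigpoly.add by (simp add: distrib_left)
  qed
next
  case (add f g) then show ?case using trigpoly.add by (simp add: distrib_right)
qed

lemma trigpoly_integral:
  assumes u: "continuous_on (cube z l) u" and 0: "\<And>n. (\<integral>\<omega>. indicator (cube z l) \<omega> *\<^sub>R (u \<omega> * cis (\<omega> \<bullet> freq l n)) \<partial>lborel) = (0::complex)"
    and t: "trigpoly l t"
  shows "continuous_on UNIV t \<and> (\<integral>\<omega>. indicator (cube z l) \<omega> *\<^sub>R (u \<omega> * t \<omega>) \<partial>lborel) = 0"
  using t
proof induction
  case (mono c n)
  have e: "indicator (cube z l) \<omega> *\<^sub>R (u \<omega> * (c * cis (\<omega> \<bullet> freq l n))) = c * (indicator (cube z l) \<omega> *\<^sub>R (u \<omega> * cis (\<omega> \<bullet> freq l n)))" for \<omega>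
    by (simp add: mult.left_commute)
  have "(\<integral>\<omega>. indicator (cube z l) \<omega> *\<^sub>R (u \<omega> * (c * cis (\<omega> \<bullet> freq l n))) \<partial>lborel) = 0" by (simp only: e integral_mult_right_zero 0) simp
  moreover have "continuous_on UNIV (\<lambda>\<omega>. c * cis (\<omega> \<bullet> freq l n))" by (intro continuous_intros)
  ultimately show ?case by blast
next
  case (add f g)
  have i: "integrable lborel (\<lambda>\<omega>. indicator (cube z l) \<omega> *\<^sub>R (u \<omega> * h \<omega>))" if "continuous_on UNIV h" for h
    by (rule borel_integrable_compact[OF compact_cube continuous_on_mult[OF u continuous_on_subset[OF that]]]) simp
  show ?case using add i[of f] i[of g] by (auto intro!: continuous_intros simp: distrib_left scaleR_add_right)
qed

text \<open>The hypothesis \<open>per\<close> makes \<open>u\<close> a function on the torus,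
  realised as the compact image of the cube under \<tau>. Stone-Weierstrass makes trigonometric
  polynomials dense there, and \<open>u\<close> is orthogonal to all of them, so the integral of its
  square is zero.\<close>

lemma cube_eqI:
  fixes u :: "real^'d::finite \<Rightarrow> real"
  assumes l: "0 < l" and u: "continuous_on (cube z l) u"
    and per: "\<And>\<omega> \<omega>'. \<omega> \<in> cube z l \<Longrightarrow> \<omega>' \<in> cube z l \<Longrightarrow> (\<And>i. cis (pi / l * \<omega> $ i) = cis (pi / l * \<omega>' $ i)) \<Longrightarrow> u \<omega> = u \<omega>'"
    and 0: "\<And>n. (\<integral>\<omega>. indicator (cube z l) \<omega> *\<^sub>R (complex_of_real (u \<omega>) * cis (\<omega> \<bullet> freq l n)) \<partial>lborel) = 0"
    and \<omega>: "\<omega> \<in> cube z l"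
  shows "u \<omega> = 0"
proof -
  let ?Q = "cube z l"
  define \<tau> :: "real^'d \<Rightarrow> complex^'d" where "\<tau> \<omega> = (\<chi> i. cis (pi / l * \<omega> $ i))" for \<omega>
  have \<tau>: "continuous_on S \<tau>" for S unfolding \<tau>_def by (intro continuous_intros)
  let ?T = "\<tau> ` ?Q"
  define E where "E y = u (SOME \<omega>. \<omega> \<in> ?Q \<and> \<tau> \<omega> = y)" for y
  have E: "E (\<tau> \<omega>) = u \<omega>" if "\<omega> \<in> ?Q" for \<omega>
  proof -
    let ?s = "SOME \<omega>'. \<omega>' \<in> ?Q \<and> \<tau> \<omega>' = \<tau> \<omega>"
    have "?s \<in> ?Q \<and> \<tau> ?s = \<tau> \<omega>" by (rule someI[of _ \<omega>]) (use that in auto)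
    then show ?thesis unfolding E_def by (intro per that) (auto simp: \<tau>_def vec_eq_iff)
  qed
  \<comment> \<open>The map from the compact cube onto its image is a quotient map, so a function
    that factors through it is continuous on the image.\<close>
  have cE: "continuous_on ?T E"
    unfolding continuous_openin_preimage_eq
  proof (intro allI impI)
    fix U :: "real set" assume "open U"
    have "openin (top_of_set ?Q) (?Q \<inter> u -` U)" using u \<open>open U\<close> continuous_openin_preimage_eq by blast
    moreover have "\<tau> x \<in> ?T \<inter> E -` U \<longleftrightarrow> u x \<in> U" if "x \<in> ?Q" for x using E[OF that] that by simp
    then have "?Q \<inter> \<tau> -` (?T \<inter> E -` U) = ?Q \<inter> u -` U" by blast
    ultimately show "openin (top_of_set ?T) (?T \<inter> E -` U)"
      using Abstract_Topology_2.continuous_imp_quotient_map[OF \<tau> refl compact_cube[of z l], of "?T \<inter> E -` U"] by auto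
  qed
  have cT: "compact ?T" by (intro compact_continuous_image \<tau> compact_cube)
  define P where "P g \<longleftrightarrow> continuous_on ?T g \<and> trigpoly l (\<lambda>\<omega>. complex_of_real (g (\<tau> \<omega>)))" for g :: "complex^'d \<Rightarrow> real"
  have tc: "trigpoly l (\<lambda>\<omega>::real^'d. c)" for c using trigpoly.mono[of l c 0] by simp
  have approx: "\<exists>g. P g \<and> (\<forall>x\<in>?T. \<bar>E x - g x\<bar> < e)" if "0 < e" for e
  proof (rule Stone_Weierstrass_HOL[OF cT _ _ _ _ _ cE that])
    show "P (\<lambda>x. c)" for c by (simp add: P_def tc)
    show "continuous_on ?T g" if "P g" for g using that by (simp add: P_def)
    show "P (\<lambda>x. f x + g x)" if "P f \<and> P g" for f g
      using that trigpoly.add[of l "\<lambda>\<omega>. complex_of_real (f (\<tau> \<omega>))" "\<lambda>\<omega>. complex_of_real (g (\<tau> \<omega>))"]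
      by (auto simp: P_def intro!: continuous_intros)
    show "P (\<lambda>x. f x * g x)" if "P f \<and> P g" for f g
      using that trigpoly_mult[of l "\<lambda>\<omega>. complex_of_real (f (\<tau> \<omega>))" "\<lambda>\<omega>. complex_of_real (g (\<tau> \<omega>))"]
      by (auto simp: P_def intro!: continuous_intros)
    fix x y assume "x \<in> ?T \<and> y \<in> ?T \<and> x \<noteq> y"
    then obtain i where i: "x $ i \<noteq> y $ i" by (auto simp: vec_eq_iff)
    have e: "\<omega> \<bullet> freq l (axis i 1) = pi / l * \<omega> $ i" for \<omega> :: "real^'d"
    proof -
      have "freq l (axis i 1) = axis i (pi / l)" by (auto simp: freq_def axis_def vec_eq_iff)
      then show ?thesis by (simp add: inner_axis)
    qed
    have "trigpoly l (\<lambda>\<omega>. (1/2) * cis (\<omega> \<bullet> freq l (axis i 1)) + (1/2) * cis (\<omega> \<bullet> freq l (- axis i 1)))"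
      by (rule trigpoly.add[OF trigpoly.mono trigpoly.mono])
    moreover have "(1/2) * cis (\<omega> \<bullet> freq l (axis i 1)) + (1/2) * cis (\<omega> \<bullet> freq l (- axis i 1)) = complex_of_real (Re (\<tau> \<omega> $ i))" for \<omega>
      by (simp add: e \<tau>_def complex_eq_iff)
    ultimately have "trigpoly l (\<lambda>\<omega>. complex_of_real (Re (\<tau> \<omega> $ i)))" by simp
    then have PR: "P (\<lambda>x. Re (x $ i))" by (simp add: P_def) (intro continuous_intros)
    have "trigpoly l (\<lambda>\<omega>. (- \<i>/2) * cis (\<omega> \<bullet> freq l (axis i 1)) + (\<i>/2) * cis (\<omega> \<bullet> freq l (- axis i 1)))"
      by (rule trigpoly.add[OF trigpoly.mono trigpoly.mono])
    moreover have "(- \<i>/2) * cis (\<omega> \<bullet> freq l (axis i 1)) + (\<i>/2) * cis (\<omega> \<bullet> freq l (- axis i 1)) = complex_of_real (Im (\<tau> \<omega> $ i))" for \<omega>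
      by (simp add: e \<tau>_def complex_eq_iff)
    ultimately have "trigpoly l (\<lambda>\<omega>. complex_of_real (Im (\<tau> \<omega> $ i)))" by simp
    then have PI: "P (\<lambda>x. Im (x $ i))" by (simp add: P_def) (intro continuous_intros)
    show "\<exists>f. P f \<and> f x \<noteq> f y" using PR PI i complex_eqI by blast
  qed
  have int: "integrable lborel (\<lambda>\<omega>. indicator ?Q \<omega> *\<^sub>R h \<omega>)" if "continuous_on ?Q h" for h :: "real^'d \<Rightarrow> real"
    by (rule borel_integrable_compact[OF compact_cube that])
  let ?I = "\<integral>\<omega>. indicator ?Q \<omega> *\<^sub>R (u \<omega> * u \<omega>) \<partial>lborel" and ?M = "\<integral>\<omega>. indicator ?Q \<omega> *\<^sub>R \<bar>u \<omega>\<bar> \<partial>lborel"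
  have M: "0 \<le> ?M" by (intro integral_nonneg_AE AE_I2) simp
  have Ie: "?I \<le> e * ?M" if e0: "0 < e" for e
  proof -
    obtain g where g: "P g" "\<And>x. x \<in> ?T \<Longrightarrow> \<bar>E x - g x\<bar> < e" using approx[OF e0] by blast
    have t: "trigpoly l (\<lambda>\<omega>. complex_of_real (g (\<tau> \<omega>)))" using g by (simp add: P_def)
    have cg: "continuous_on ?Q (\<lambda>\<omega>. g (\<tau> \<omega>))" using g(1) continuous_on_compose[OF \<tau>, of ?Q g] by (simp add: P_def o_def)
    have "continuous_on ?Q (\<lambda>\<omega>. complex_of_real (u \<omega>))" by (intro continuous_intros u)
    from trigpoly_integral[OF this 0 t]
    have "(\<integral>\<omega>. indicator ?Q \<omega> *\<^sub>R (complex_of_real (u \<omega>) * complex_of_real (g (\<tau> \<omega>))) \<partial>lborel) = 0" by blast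
    moreover have e: "indicator ?Q \<omega> *\<^sub>R (complex_of_real (u \<omega>) * complex_of_real (g (\<tau> \<omega>))) = complex_of_real (indicator ?Q \<omega> *\<^sub>R (u \<omega> * g (\<tau> \<omega>)))" for \<omega>
      by (simp add: scaleR_conv_of_real)
    ultimately have z0: "(\<integral>\<omega>. indicator ?Q \<omega> *\<^sub>R (u \<omega> * g (\<tau> \<omega>)) \<partial>lborel) = 0"
      by (simp only: e integral_complex_of_real of_real_eq_0_iff)
    have i1: "integrable lborel (\<lambda>\<omega>. indicator ?Q \<omega> *\<^sub>R (u \<omega> * u \<omega>))" "integrable lborel (\<lambda>\<omega>. indicator ?Q \<omega> *\<^sub>R (u \<omega> * g (\<tau> \<omega>)))"
      "integrable lborel (\<lambda>\<omega>. indicator ?Q \<omega> *\<^sub>R \<bar>u \<omega>\<bar>)"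
      by (intro int continuous_intros u cg)+
    \<comment> \<open>Orthogonality allows the approximating polynomial to be subtracted from one
      factor at no cost, so the integrand is at most \<open>e\<close> times the absolute value of
      \<open>u\<close>.\<close>
    have "?I = (\<integral>\<omega>. indicator ?Q \<omega> *\<^sub>R (u \<omega> * u \<omega>) - indicator ?Q \<omega> *\<^sub>R (u \<omega> * g (\<tau> \<omega>)) \<partial>lborel)"
      using z0 by (subst Bochner_Integration.integral_diff[OF i1(1,2)]) simp
    also have "\<dots> \<le> (\<integral>\<omega>. e * (indicator ?Q \<omega> *\<^sub>R \<bar>u \<omega>\<bar>) \<partial>lborel)"
    proof (rule integral_mono)
      show "indicator ?Q \<omega> *\<^sub>R (u \<omega> * u \<omega>) - indicator ?Q \<omega> *\<^sub>R (u \<omega> * g (\<tau> \<omega>)) \<le> e * (indicator ?Q \<omega> *\<^sub>R \<bar>u \<omega>\<bar>)" for \<omega>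
      proof (cases "\<omega> \<in> ?Q")
        case True
        then have "\<bar>u \<omega> - g (\<tau> \<omega>)\<bar> \<le> e" using g(2)[of "\<tau> \<omega>"] E[OF True] by force
        then have "\<bar>u \<omega>\<bar> * \<bar>u \<omega> - g (\<tau> \<omega>)\<bar> \<le> \<bar>u \<omega>\<bar> * e" by (intro mult_left_mono) auto
        moreover have "u \<omega> * (u \<omega> - g (\<tau> \<omega>)) \<le> \<bar>u \<omega>\<bar> * \<bar>u \<omega> - g (\<tau> \<omega>)\<bar>" by (metis abs_ge_self abs_mult)
        ultimately show ?thesis using True by (simp add: algebra_simps)
      qed simp
    qed (use i1 in auto)
    finally show ?thesis by simp
  qed
  have small: "x \<le> 0" if x: "\<And>e. 0 < e \<Longrightarrow> x \<le> e * y" and y: "0 \<le> y" for x y :: real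
  proof (rule field_le_epsilon)
    fix e :: real assume e: "0 < e"
    have "x \<le> e / (y + 1) * y" using e y by (intro x divide_pos_pos) auto
    also have "\<dots> \<le> e" using e y by (simp add: field_simps)
    finally show "x \<le> 0 + e" by simp
  qed
  have "?I \<le> 0" by (rule small[OF Ie M])
  moreover have "0 \<le> ?I" by (intro integral_nonneg_AE AE_I2) simp
  ultimately have "?I = 0" by (rule antisym)
  moreover have "set_integrable lborel ?Q (\<lambda>\<omega>. u \<omega> * u \<omega>)"
    unfolding set_integrable_def by (intro int continuous_intros u)
  ultimately have "integral ?Q (\<lambda>\<omega>. u \<omega> * u \<omega>) = 0"
    using set_borel_integral_eq_integral(2)[of ?Q "\<lambda>\<omega>. u \<omega> * u \<omega>"] by (simp add: set_lebesgue_integral_def)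
  moreover have "continuous_on ?Q (\<lambda>\<omega>. u \<omega> * u \<omega>)" by (intro continuous_intros u)
  moreover have "box (z - (\<chi> i. l)) (z + (\<chi> i. l)) \<noteq> {}" using l by (simp add: box_ne_empty inner_diff_left inner_add_left Basis_vec_def inner_axis)
  ultimately have "u \<omega> * u \<omega> = 0"
    using integral_cbox_eq_0_iff[of "z - (\<chi> i. l)" "z + (\<chi> i. l)" "\<lambda>\<omega>. u \<omega> * u \<omega>"] \<omega>
    by (simp add: cube_def)
  then show ?thesis by simp
qed

text \<open>Two points with the same exponentials differ in each coordinate by a multiple of 2 l; in
  a cube of side 2 l a nonzero multiple forces opposite faces.\<close>

lemma cube_boundary:
  assumes l: "0 < l" and \<omega>: "\<omega> \<in> cube z l" "\<omega>' \<in> cube z l" and eq: "\<And>i. cis (pi / l * \<omega> $ i) = cis (pi / l * \<omega>' $ i)"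
    and ne: "\<omega> \<noteq> \<omega>'"
  shows "\<exists>i. \<bar>\<omega> $ i - z $ i\<bar> = l"
proof -
  obtain i where i: "\<omega> $ i \<noteq> \<omega>' $ i" using ne by (auto simp: vec_eq_iff)
  have "sin (pi / l * \<omega> $ i) = sin (pi / l * \<omega>' $ i) \<and> cos (pi / l * \<omega> $ i) = cos (pi / l * \<omega>' $ i)"
    using eq[of i] by (simp add: complex_eq_iff)
  then obtain k :: int where k: "pi / l * \<omega> $ i = pi / l * \<omega>' $ i + 2 * pi * k"
    using sin_cos_eq_iff by blast
  then have "pi * \<omega> $ i = pi * (\<omega>' $ i + 2 * l * k)" using l by (simp add: field_simps)
  then have d: "\<omega> $ i - \<omega>' $ i = 2 * l * k" by (simp add: mult_cancel_left)
  have b: "z $ i - l \<le> \<omega> $ i" "\<omega> $ i \<le> z $ i + l" "z $ i - l \<le> \<omega>' $ i" "\<omega>' $ i \<le> z $ i + l"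
    using \<omega> by (auto simp: mem_cube)
  have "k \<noteq> 0" using d i by auto
  then consider "1 \<le> real_of_int k" | "real_of_int k \<le> -1" by linarith
  then show ?thesis
  proof cases
    case 1
    then have "2 * l * 1 \<le> 2 * l * k" using l by (intro mult_left_mono) auto
    then have "\<omega> $ i - z $ i = l" using b d by linarith
    then show ?thesis using l by (intro exI[of _ i]) simp
  next
    case 2
    then have "2 * l * k \<le> 2 * l * (-1)" using l by (intro mult_left_mono) auto
    then have "\<omega> $ i - z $ i = - l" using b d by linarith
    then show ?thesis using l by (intro exI[of _ i]) simp
  qed
qed

lemma cis_inner_freq: "cis (\<omega> \<bullet> freq l n) = (\<Prod>i\<in>UNIV. cis (pi / l * \<omega> $ i) powi (n $ i))"
  by (simp add: inner_vec_def freq_def cis_sum cis_power_int mult_ac)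

text \<open>The series converges uniformly by its summable majorant, and its sum has the same
  Fourier coefficients as \<open>q\<close>. The difference is a function on the torus with vanishing
  coefficients, hence zero; the identification of opposite faces is harmless because
  \<open>q\<close> vanishes there.\<close>

theorem fourier_series:
  fixes q :: "real^'d::finite \<Rightarrow> complex"
  assumes l: "0 < l" and q: "continuous_on UNIV q" "\<And>\<omega>. (\<exists>i. l \<le> \<bar>\<omega> $ i - z $ i\<bar>) \<Longrightarrow> q \<omega> = 0"
    and c: "\<And>n. c n = (\<integral>\<omega>. q \<omega> * cis (\<omega> \<bullet> freq l n) \<partial>lborel)" and M: "\<And>n. norm (c n) \<le> M n" "M summable_on UNIV"
    and \<omega>: "\<omega> \<in> cube z l"
  shows "((\<lambda>n. c n / of_real ((2 * l) ^ CARD('d)) * cis (- (\<omega> \<bullet> freq l n))) has_sum q \<omega>) UNIV"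
proof -
  let ?Q = "cube z l" and ?V = "(2 * l) ^ CARD('d)"
  define f where "f n \<omega> = c n / of_real ?V * cis (- (\<omega> \<bullet> freq l n))" for n \<omega>
  define s where "s \<omega> = (\<Sum>\<^sub>\<infinity>n. f n \<omega>)" for \<omega>
  have V: "0 < ?V" using l by simp
  have fM: "norm (f n \<omega>) \<le> M n / ?V" for n \<omega>
    using M(1)[of n] V l by (simp add: f_def norm_mult norm_divide norm_power divide_right_mono)
  have sumM: "(\<lambda>n. M n / ?V) summable_on UNIV" using summable_on_cmult_left[OF M(2), of "1 / ?V"] by simp
  have ul: "uniform_limit UNIV (\<lambda>F \<omega>. \<Sum>n\<in>F. f n \<omega>) s (finite_subsets_at_top UNIV)"
    unfolding s_def by (rule Weierstrass_m_test_general[OF fM sumM])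
  have s: "continuous_on UNIV s"
    by (rule uniform_limit_theorem[OF always_eventually ul]) (use l in \<open>auto simp: f_def intro!: continuous_intros\<close>)
  have summ: "(\<lambda>n. f n \<omega>) summable_on UNIV" for \<omega>
    by (rule abs_summable_summable, rule summable_on_comparison_test[OF sumM]) (use fM in auto)
  have int: "integrable lborel (\<lambda>\<omega>. indicator ?Q \<omega> *\<^sub>R h \<omega>)" if "continuous_on UNIV h" for h :: "real^'d \<Rightarrow> complex"
    by (rule borel_integrable_compact[OF compact_cube continuous_on_subset[OF that]]) simp
  have cm: "(\<integral>\<omega>. indicator ?Q \<omega> *\<^sub>R (s \<omega> * cis (\<omega> \<bullet> freq l m)) \<partial>lborel) = c m" for m
  proof -
    let ?A = "\<integral>\<omega>. indicator ?Q \<omega> *\<^sub>R (s \<omega> * cis (\<omega> \<bullet> freq l m)) \<partial>lborel"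
    \<comment> \<open>A finite partial sum containing \<open>m\<close> already has the exact
      coefficient \<open>c m\<close>; uniform closeness to \<open>s\<close> costs at most
      \<open>e\<close> times the volume of the cube.\<close>
    have bd: "norm (?A - c m) \<le> e * ?V" if "0 < e" for e
    proof -
      have ev: "\<forall>\<^sub>F F in finite_subsets_at_top UNIV. (\<forall>\<omega>\<in>UNIV. dist (\<Sum>n\<in>F. f n \<omega>) (s \<omega>) < e) \<and> (finite F \<and> {m} \<subseteq> F \<and> F \<subseteq> UNIV)"
        using uniform_limitD[OF ul that]
        by (rule eventually_conj) (auto simp: eventually_finite_subsets_at_top intro!: exI[of _ "{m}"])
      obtain F where F: "\<And>\<omega>. dist (\<Sum>n\<in>F. f n \<omega>) (s \<omega>) < e" "finite F" "m \<in> F"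
        using eventually_happens'[OF finite_subsets_at_top_neq_bot ev] by auto
      let ?sF = "\<lambda>\<omega>. \<Sum>n\<in>F. f n \<omega>"
      have csF: "continuous_on UNIV ?sF" unfolding f_def by (intro continuous_intros) (use l in auto)
      have fe: "indicator ?Q \<omega> *\<^sub>R (f n \<omega> * cis (\<omega> \<bullet> freq l m)) = c n / of_real ?V * (indicator ?Q \<omega> *\<^sub>R cis (\<omega> \<bullet> freq l (m + - n)))" for n \<omega>
      proof -
        have "cis (\<omega> \<bullet> freq l (m + - n)) = cis (- (\<omega> \<bullet> freq l n)) * cis (\<omega> \<bullet> freq l m)"
          by (simp only: freq_simps inner_add_right inner_minus_right cis_mult) (simp add: add.commute)
        then show ?thesis unfolding f_def by (simp only: scaleR_conv_of_real mult_ac)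
      qed
      have "(\<integral>\<omega>. indicator ?Q \<omega> *\<^sub>R (?sF \<omega> * cis (\<omega> \<bullet> freq l m)) \<partial>lborel) = (\<integral>\<omega>. (\<Sum>n\<in>F. indicator ?Q \<omega> *\<^sub>R (f n \<omega> * cis (\<omega> \<bullet> freq l m))) \<partial>lborel)"
        by (simp add: sum_distrib_right scaleR_sum_right)
      also have "\<dots> = (\<Sum>n\<in>F. \<integral>\<omega>. indicator ?Q \<omega> *\<^sub>R (f n \<omega> * cis (\<omega> \<bullet> freq l m)) \<partial>lborel)"
        by (intro Bochner_Integration.integral_sum int) (use l in \<open>auto simp: f_def intro!: continuous_intros\<close>)
      also have "\<dots> = (\<Sum>n\<in>F. if n = m then c n else 0)"
      proof (intro sum.cong refl)
        fix n
        have "(\<integral>\<omega>. indicator ?Q \<omega> *\<^sub>R (f n \<omega> * cis (\<omega> \<bullet> freq l m)) \<partial>lborel) = c n / of_real ?V * (if m + - n = 0 then of_real ?V else 0)"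
          by (simp only: fe integral_mult_right_zero integral_cube_cis[OF l])
        then show "(\<integral>\<omega>. indicator ?Q \<omega> *\<^sub>R (f n \<omega> * cis (\<omega> \<bullet> freq l m)) \<partial>lborel) = (if n = m then c n else 0)"
          using V l by (auto simp del: of_real_power)
      qed
      also have "\<dots> = c m" using F by simp
      finally have "?A - c m = (\<integral>\<omega>. indicator ?Q \<omega> *\<^sub>R (s \<omega> * cis (\<omega> \<bullet> freq l m)) - indicator ?Q \<omega> *\<^sub>R (?sF \<omega> * cis (\<omega> \<bullet> freq l m)) \<partial>lborel)"
        by (subst Bochner_Integration.integral_diff) (auto intro!: int continuous_intros s csF)
      then have "norm (?A - c m) \<le> (\<integral>\<omega>. norm (indicator ?Q \<omega> *\<^sub>R (s \<omega> * cis (\<omega> \<bullet> freq l m)) - indicator ?Q \<omega> *\<^sub>R (?sF \<omega> * cis (\<omega> \<bullet> freq l m))) \<partial>lborel)"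
        by (simp only: integral_norm_bound)
      also have "\<dots> \<le> (\<integral>\<omega>. e * indicator ?Q \<omega> \<partial>lborel)"
      proof (rule integral_mono_AE')
        show "integrable lborel (\<lambda>\<omega>. e * indicator ?Q \<omega> :: real)"
          using borel_integrable_compact[OF compact_cube[of z l], of "\<lambda>_. e"] by (simp add: mult.commute)
        show "AE \<omega> in lborel. norm (indicator ?Q \<omega> *\<^sub>R (s \<omega> * cis (\<omega> \<bullet> freq l m)) - indicator ?Q \<omega> *\<^sub>R (?sF \<omega> * cis (\<omega> \<bullet> freq l m))) \<le> e * indicator ?Q \<omega>"
        proof (rule AE_I2)
          fix \<omega>
          have "indicator ?Q \<omega> *\<^sub>R (s \<omega> * cis (\<omega> \<bullet> freq l m)) - indicator ?Q \<omega> *\<^sub>R (?sF \<omega> * cis (\<omega> \<bullet> freq l m)) = indicator ?Q \<omega> *\<^sub>R ((s \<omega> - ?sF \<omega>) * cis (\<omega> \<bullet> freq l m))"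
            by (simp add: scaleR_diff_right left_diff_distrib)
          then show "norm (indicator ?Q \<omega> *\<^sub>R (s \<omega> * cis (\<omega> \<bullet> freq l m)) - indicator ?Q \<omega> *\<^sub>R (?sF \<omega> * cis (\<omega> \<bullet> freq l m))) \<le> e * indicator ?Q \<omega>"
            using F(1)[of \<omega>] by (simp add: norm_mult dist_norm norm_minus_commute indicator_def)
        qed
      qed (use \<open>0 < e\<close> in auto)
      also have "(\<integral>\<omega>. e * indicator ?Q \<omega> \<partial>(lborel :: (real^'d) measure)) = e * ?V"
      proof -
        have "complex_of_real (\<integral>\<omega>. indicator ?Q \<omega> \<partial>(lborel :: (real^'d) measure)) = of_real ?V"
          using integral_cube_cis[OF l, of z 0] by (subst integral_complex_of_real[symmetric]) (simp add: cis_zero scaleR_conv_of_real)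
        then show ?thesis by (simp only: of_real_eq_iff integral_mult_right_zero)
      qed
      finally show ?thesis .
    qed
    have "norm (?A - c m) \<le> 0 + e" if e: "0 < e" for e
    proof -
      have "norm (?A - c m) \<le> e / ?V * ?V" by (rule bd[OF divide_pos_pos[OF e V]])
      also have "e / ?V * ?V = e" using V by (intro nonzero_eq_divide_eq[THEN iffD1, OF _ refl]) linarith
      finally show ?thesis by simp
    qed
    then have "norm (?A - c m) \<le> 0" by (rule field_le_epsilon)
    then show ?thesis by simp
  qed
  define D where "D \<omega> = q \<omega> - s \<omega>" for \<omega>
  have D: "continuous_on UNIV D" unfolding D_def by (intro continuous_intros q s)
  have D0: "(\<integral>\<omega>. indicator ?Q \<omega> *\<^sub>R (D \<omega> * cis (\<omega> \<bullet> freq l m)) \<partial>lborel) = 0" for m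
  proof -
    have "indicator ?Q \<omega> *\<^sub>R (q \<omega> * cis (\<omega> \<bullet> freq l m)) = q \<omega> * cis (\<omega> \<bullet> freq l m)" for \<omega>
    proof (cases "\<omega> \<in> ?Q")
      case False
      then obtain i where "\<not> (z $ i - l \<le> \<omega> $ i \<and> \<omega> $ i \<le> z $ i + l)" by (auto simp: mem_cube)
      then have "l \<le> \<bar>\<omega> $ i - z $ i\<bar>" by linarith
      then have "q \<omega> = 0" using q(2) by blast
      then show ?thesis by simp
    qed simp
    then have "(\<integral>\<omega>. indicator ?Q \<omega> *\<^sub>R (q \<omega> * cis (\<omega> \<bullet> freq l m)) \<partial>lborel) = c m" unfolding c by simp
    moreover have "indicator ?Q \<omega> *\<^sub>R (D \<omega> * cis (\<omega> \<bullet> freq l m)) = indicator ?Q \<omega> *\<^sub>R (q \<omega> * cis (\<omega> \<bullet> freq l m)) - indicator ?Q \<omega> *\<^sub>R (s \<omega> * cis (\<omega> \<bullet> freq l m))" for \<omega>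
      by (simp add: D_def left_diff_distrib scaleR_diff_right)
    moreover have "integrable lborel (\<lambda>\<omega>. indicator ?Q \<omega> *\<^sub>R (q \<omega> * cis (\<omega> \<bullet> freq l m)))" "integrable lborel (\<lambda>\<omega>. indicator ?Q \<omega> *\<^sub>R (s \<omega> * cis (\<omega> \<bullet> freq l m)))"
      by (intro int continuous_intros q s)+
    ultimately show ?thesis using cm by simp
  qed
  \<comment> \<open>\<open>cube_eqI\<close> is about real functions. The set of frequencies is
    symmetric, so the conjugate has vanishing coefficients as well, and real and imaginary parts are
    combinations of the two.\<close>
  have D0': "(\<integral>\<omega>. indicator ?Q \<omega> *\<^sub>R (cnj (D \<omega>) * cis (\<omega> \<bullet> freq l m)) \<partial>lborel) = 0" for m
  proof -
    have e: "indicator ?Q \<omega> *\<^sub>R (cnj (D \<omega>) * cis (\<omega> \<bullet> freq l m)) = cnj (indicator ?Q \<omega> *\<^sub>R (D \<omega> * cis (\<omega> \<bullet> freq l (- m))))" for \<omega>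
      by (simp add: cis_cnj)
    show ?thesis unfolding e by (subst Bochner_Integration.integral_cnj) (simp only: D0 complex_cnj_zero)
  qed
  have iD: "integrable lborel (\<lambda>\<omega>. indicator ?Q \<omega> *\<^sub>R (D \<omega> * cis (\<omega> \<bullet> freq l m)))" "integrable lborel (\<lambda>\<omega>. indicator ?Q \<omega> *\<^sub>R (cnj (D \<omega>) * cis (\<omega> \<bullet> freq l m)))" for m
    by (intro int continuous_intros D)+
  have per: "D \<omega> = D \<omega>'" if *: "\<omega> \<in> ?Q" "\<omega>' \<in> ?Q" "\<And>i. cis (pi / l * \<omega> $ i) = cis (pi / l * \<omega>' $ i)" for \<omega> \<omega>'
  proof (cases "\<omega> = \<omega>'")
    case False
    obtain i where "\<bar>\<omega> $ i - z $ i\<bar> = l" using cube_boundary[OF l * False] by blast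
    then have "q \<omega> = 0" using q(2)[of \<omega>] by force
    moreover obtain j where "\<bar>\<omega>' $ j - z $ j\<bar> = l" using cube_boundary[OF l *(2,1) *(3)[symmetric]] False by metis
    then have "q \<omega>' = 0" using q(2)[of \<omega>'] by force
    moreover have "f n \<omega> = f n \<omega>'" for n
    proof -
      have "cis (\<omega> \<bullet> freq l (- n)) = cis (\<omega>' \<bullet> freq l (- n))" unfolding cis_inner_freq *(3) ..
      then show ?thesis by (simp add: f_def)
    qed
    then have "s \<omega> = s \<omega>'" by (simp add: s_def)
    ultimately show ?thesis by (simp add: D_def)
  qed simp
  have "Re (D \<omega>) = 0"
  proof (rule cube_eqI[OF l _ _ _ \<omega>])
    show "continuous_on ?Q (\<lambda>\<omega>. Re (D \<omega>))" by (intro continuous_intros continuous_on_subset[OF D]) simp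
    show "Re (D \<omega>) = Re (D \<omega>')" if *: "\<omega> \<in> ?Q" "\<omega>' \<in> ?Q" "\<And>i. cis (pi / l * \<omega> $ i) = cis (pi / l * \<omega>' $ i)" for \<omega> \<omega>'
      using per[OF *] by simp
    have e: "indicator ?Q \<omega> *\<^sub>R (complex_of_real (Re (D \<omega>)) * cis (\<omega> \<bullet> freq l m)) =
       (1/2) * (indicator ?Q \<omega> *\<^sub>R (D \<omega> * cis (\<omega> \<bullet> freq l m)) + indicator ?Q \<omega> *\<^sub>R (cnj (D \<omega>) * cis (\<omega> \<bullet> freq l m)))" for \<omega> m
      by (simp add: scaleR_add_right[symmetric] distrib_right[symmetric] complex_add_cnj del: scaleR_add_right)
    show "(\<integral>\<omega>. indicator ?Q \<omega> *\<^sub>R (complex_of_real (Re (D \<omega>)) * cis (\<omega> \<bullet> freq l m)) \<partial>lborel) = 0" for m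
      by (simp only: e integral_mult_right_zero Bochner_Integration.integral_add[OF iD] D0 D0') simp
  qed
  moreover have "Im (D \<omega>) = 0"
  proof (rule cube_eqI[OF l _ _ _ \<omega>])
    show "continuous_on ?Q (\<lambda>\<omega>. Im (D \<omega>))" by (intro continuous_intros continuous_on_subset[OF D]) simp
    show "Im (D \<omega>) = Im (D \<omega>')" if *: "\<omega> \<in> ?Q" "\<omega>' \<in> ?Q" "\<And>i. cis (pi / l * \<omega> $ i) = cis (pi / l * \<omega>' $ i)" for \<omega> \<omega>'
      using per[OF *] by simp
    have e: "indicator ?Q \<omega> *\<^sub>R (complex_of_real (Im (D \<omega>)) * cis (\<omega> \<bullet> freq l m)) =
       (- \<i>/2) * (indicator ?Q \<omega> *\<^sub>R (D \<omega> * cis (\<omega> \<bullet> freq l m)) - indicator ?Q \<omega> *\<^sub>R (cnj (D \<omega>) * cis (\<omega> \<bullet> freq l m)))" for \<omega> m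
    proof -
      have "complex_of_real (Im (D \<omega>)) = (- \<i>/2) * (D \<omega> - cnj (D \<omega>))" by (simp add: complex_eq_iff)
      then show ?thesis by (simp only: scaleR_conv_of_real right_diff_distrib left_diff_distrib mult_ac)
    qed
    show "(\<integral>\<omega>. indicator ?Q \<omega> *\<^sub>R (complex_of_real (Im (D \<omega>)) * cis (\<omega> \<bullet> freq l m)) \<partial>lborel) = 0" for m
      by (simp only: e integral_mult_right_zero Bochner_Integration.integral_diff[OF iD] D0 D0') simp
  qed
  ultimately have "q \<omega> = s \<omega>" by (simp add: D_def complex_eq_iff)
  then show ?thesis using has_sum_infsum[OF summ[of \<omega>]] unfolding s_def f_def by simp
qed

section \<open>Distributions modulo polynomials on the Fourier side\<close>

lemma smooth_partials_continuous: "smooth f \<Longrightarrow> continuous_on S (partials is f)"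
  using smooth_partials differentiable_imp_continuous_within continuous_at_imp_continuous_on by metis

lemma smooth_partials_smooth: "smooth f \<Longrightarrow> smooth (partials is f)"
  by (induction "is") (auto intro: smooth_partial_deriv)

lemma smooth_mult:
  fixes f g :: "real^'d::finite \<Rightarrow> 'b::real_normed_algebra"
  shows "smooth f \<Longrightarrow> smooth g \<Longrightarrow> smooth (\<lambda>x. f x * g x)"
  by (rule smooth_bilinear[OF bounded_bilinear_mult])

lemma partials_outside:
  assumes "closed S" "\<And>x. x \<notin> S \<Longrightarrow> m x = 0"
  shows "x \<notin> S \<Longrightarrow> partials is m x = 0"
proof (induction "is" arbitrary: x)
  case Nil then show ?case using assms by simp
next
  case (Cons i "is")
  have "partial_deriv i (partials is m) x = partial_deriv i (\<lambda>_. 0) x"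
    by (rule partial_deriv_cong[of "- S"]) (use assms Cons in auto)
  also have "\<dots> = 0" by (simp add: partial_deriv_eq[OF has_derivative_const])
  finally show ?case by simp
qed

lemma compact_supp_bounded:
  fixes g :: "'a::topological_space \<Rightarrow> real"
  assumes "compact S" "continuous_on S g" "\<And>x. x \<notin> S \<Longrightarrow> g x = 0"
  shows "\<exists>C\<ge>0. \<forall>x. g x \<le> C"
proof -
  have "bounded (g ` S)" using assms compact_continuous_image compact_imp_bounded by blast
  then obtain C where C: "\<And>x. x \<in> S \<Longrightarrow> \<bar>g x\<bar> \<le> C" unfolding bounded_real by blast
  have "g x \<le> \<bar>C\<bar>" for x using C[of x] assms(3)[of x] by (cases "x \<in> S") (auto intro: order_trans[OF abs_ge_self])
  then show ?thesis by (intro exI[of _ "\<bar>C\<bar>"]) auto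
qed

lemma compact_supp_schwartz:
  fixes m :: "real^'d::finite \<Rightarrow> complex"
  assumes "smooth m" "compact S" "\<And>x. x \<notin> S \<Longrightarrow> m x = 0"
  shows "m \<in> schwartz"
  unfolding schwartz_def mem_Collect_eq
proof (intro conjI allI assms(1))
  fix k "is"
  have "continuous_on S (\<lambda>x. (1 + norm x) ^ k * norm (partials is m x))"
    by (intro continuous_intros smooth_partials_continuous assms)
  moreover have "(1 + norm x) ^ k * norm (partials is m x) = 0" if "x \<notin> S" for x
    using partials_outside[OF compact_imp_closed[OF assms(2)] assms(3) that] by simp
  ultimately show "\<exists>C. \<forall>x. (1 + norm x) ^ k * norm (partials is m x) \<le> C"
    using compact_supp_bounded[OF assms(2), of "\<lambda>x. (1 + norm x) ^ k * norm (partials is m x)"] by blast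
qed

lemma smooth_reflect: "smooth f \<Longrightarrow> smooth (\<lambda>x. f (- x))"
  using smooth_diag[of f "\<chi> i. -1" 0] by simp

lemma partials_reflect: "smooth m \<Longrightarrow> partials is (\<lambda>x. m (- x)) x = (-1) ^ length is *\<^sub>R partials is m (- x)"
proof (induction "is" arbitrary: m rule: rev_induct)
  case Nil then show ?case by simp
next
  case (snoc i "is")
  have "partial_deriv i (\<lambda>x. m (- x)) = (\<lambda>x. - partial_deriv i m (- x))"
  proof
    fix x
    show "partial_deriv i (\<lambda>x. m (- x)) x = - partial_deriv i m (- x)"
      using partial_deriv_diag[of m "\<chi> i. -1" x 0 i] smooth_differentiable[OF snoc.prems] by simp
  qed
  moreover have "partials is (\<lambda>x. - g x) x = - partials is g x" if "smooth g" for g :: "real^'a \<Rightarrow> 'b" and x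
    using that
  proof (induction "is" arbitrary: g rule: rev_induct)
    case (snoc j "is")
    have "partial_deriv j (\<lambda>x. - g x) = (\<lambda>x. - partial_deriv j g x)"
      using has_derivative_minus[OF frechet_derivativeI[OF smooth_differentiable[OF snoc.prems]]]
      by (intro ext) (subst partial_deriv_eq, assumption, simp add: partial_deriv_def)
    then show ?case using snoc by (simp add: partials_snoc smooth_partial_deriv)
  qed simp
  ultimately show ?case
    using snoc.IH[OF smooth_partial_deriv[OF snoc.prems, of i]] smooth_reflect[OF smooth_partial_deriv[OF snoc.prems, of i]]
    by (simp add: partials_snoc)
qed

lemma partials_add:
  "smooth f \<Longrightarrow> smooth g \<Longrightarrow> partials is (\<lambda>x. f x + g x) x = partials is f x + partials is g x"
proof (induction "is" arbitrary: f g rule: rev_induct)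
  case (snoc i "is")
  have "partial_deriv i (\<lambda>x. f x + g x) = (\<lambda>x. partial_deriv i f x + partial_deriv i g x)"
    using has_derivative_add[OF frechet_derivativeI[OF smooth_differentiable[OF snoc.prems(1)]] frechet_derivativeI[OF smooth_differentiable[OF snoc.prems(2)]]]
    by (intro ext) (subst partial_deriv_eq, assumption, simp add: partial_deriv_def)
  then show ?case using snoc by (simp add: partials_snoc smooth_partial_deriv)
qed simp

lemma partials_cmult:
  fixes f :: "real^'d::finite \<Rightarrow> complex"
  shows "smooth f \<Longrightarrow> partials is (\<lambda>x. c * f x) x = c * partials is f x"
proof (induction "is" arbitrary: f rule: rev_induct)
  case (snoc i "is")
  have "partial_deriv i (\<lambda>x. c * f x) = (\<lambda>x. c * partial_deriv i f x)"
    using has_derivative_mult_right[OF frechet_derivativeI[OF smooth_differentiable[OF snoc.prems(1)]]]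
    by (intro ext) (subst partial_deriv_eq, assumption, simp add: partial_deriv_def)
  then show ?case using snoc by (simp add: partials_snoc smooth_partial_deriv)
qed simp

section \<open>Bounds by the weights of the test space\<close>

definition zw :: "nat \<Rightarrow> real^'d::finite \<Rightarrow> real" where
  "zw M \<xi> = norm \<xi> ^ M + inverse (norm \<xi>) ^ M"

lemma zw_pos: "\<xi> \<noteq> 0 \<Longrightarrow> 0 < zw M \<xi>"
  by (simp add: zw_def add_pos_pos)

lemma zw_minus [simp]: "zw M (- \<xi>) = zw M \<xi>"
  by (simp add: zw_def)

text \<open>A real bound for the \<open>M\<close>-th defining norm, read on the Fourier side; an
  explicit real number is easier to scale and to add than an extended-valued supremum.\<close>

definition zbound :: "nat \<Rightarrow> (real^'d::finite \<Rightarrow> complex) \<Rightarrow> real \<Rightarrow> bool" where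
  "zbound M m B \<longleftrightarrow> (\<forall>is \<xi>. length is \<le> M \<longrightarrow> \<xi> \<noteq> 0 \<longrightarrow> norm (partials is m \<xi>) * zw M \<xi> \<le> B)"

definition Z0 :: "(real^'d::finite \<Rightarrow> complex) set" where
  "Z0 = {m \<in> schwartz. \<forall>M. \<exists>B. zbound M m B}"

text \<open>On the Fourier side \<^const>\<open>S0\<close> becomes the space \<open>Z0\<close> of Schwartz functions that vanish to
  infinite order at the origin.\<close>

lemma S0_norm_le_iff:
  assumes "\<theta> \<in> schwartz" "0 \<le> B"
  shows "S0_norm M \<theta> \<le> ennreal B \<longleftrightarrow> zbound M (inv_fourier \<theta>) B"
proof -
  have s: "smooth (inv_fourier \<theta>)" using inv_fourier_schwartz[OF assms(1)] by (simp add: schwartz_def)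
  have "fourier \<theta> = (\<lambda>\<xi>. inv_fourier \<theta> (- \<xi>))" by (auto simp: fourier_eq)
  then have p: "norm (partials is (fourier \<theta>) \<xi>) = norm (partials is (inv_fourier \<theta>) (- \<xi>))" for "is" \<xi>
    using partials_reflect[OF s] by simp
  have "S0_norm M \<theta> \<le> ennreal B \<longleftrightarrow> (\<forall>is. length is \<le> M \<longrightarrow> (\<forall>\<xi>. \<xi> \<noteq> 0 \<longrightarrow> norm (partials is (inv_fourier \<theta>) (- \<xi>)) * zw M \<xi> \<le> B))"
    unfolding S0_norm_def p zw_def[symmetric] SUP_le_iff using assms(2) by (auto simp: ennreal_le_iff)
  also have "\<dots> \<longleftrightarrow> zbound M (inv_fourier \<theta>) B"
    unfolding zbound_def by (metis add.inverse_inverse neg_equal_0_iff_equal zw_minus)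
  finally show ?thesis .
qed

lemma S0_norm_fourier_le_iff:
  "m \<in> schwartz \<Longrightarrow> 0 \<le> B \<Longrightarrow> S0_norm M (fourier m) \<le> ennreal B \<longleftrightarrow> zbound M m B"
  using S0_norm_le_iff[OF fourier_schwartz, of m B M] fourier_inversion[of m] by (simp add: ext[of "inv_fourier (fourier m)" m])

lemma zbound_mono: "zbound M m B \<Longrightarrow> B \<le> B' \<Longrightarrow> zbound M m B'"
  unfolding zbound_def by (meson order_trans)

lemma zbound_nonneg: "zbound M (m :: real^'d::finite \<Rightarrow> complex) B \<Longrightarrow> 0 \<le> B"
proof -
  assume z: "zbound M m B"
  define x :: "real^'d" where "x = axis undefined 1"
  have "x \<noteq> 0" by (simp add: x_def axis_eq_0_iff)
  then have "norm (partials [] m x) * zw M x \<le> B"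
    using z[unfolded zbound_def, rule_format, of "[]" x] by simp
  moreover have "0 \<le> norm (partials [] m x) * zw M x" by (simp add: zw_def)
  ultimately show ?thesis by linarith
qed

lemma fourier_Z0:
  assumes "m \<in> Z0"
  shows "fourier m \<in> S0"
proof -
  have m: "m \<in> schwartz" using assms by (simp add: Z0_def)
  have "S0_norm M (fourier m) < \<infinity>" for M
  proof -
    obtain B where "zbound M m B" using assms by (auto simp: Z0_def)
    then have "S0_norm M (fourier m) \<le> ennreal B" using S0_norm_fourier_le_iff[OF m zbound_nonneg] by blast
    then show ?thesis using ennreal_less_top le_less_trans infinity_ennreal_def by metis
  qed
  then show ?thesis using fourier_schwartz[OF m] by (simp add: S0_def)
qed

lemma inv_fourier_S0:
  assumes "\<theta> \<in> S0"
  shows "inv_fourier \<theta> \<in> Z0"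
proof -
  have t: "\<theta> \<in> schwartz" using assms by (simp add: S0_def)
  have "\<exists>B. zbound M (inv_fourier \<theta>) B" for M
  proof -
    have "S0_norm M \<theta> < \<infinity>" using assms by (simp add: S0_def)
    then have "S0_norm M \<theta> \<le> ennreal (enn2real (S0_norm M \<theta>))" by simp
    then show ?thesis using S0_norm_le_iff[OF t enn2real_nonneg] by blast
  qed
  then show ?thesis using inv_fourier_schwartz[OF t] by (simp add: Z0_def)
qed

lemma zbound_add:
  fixes f g :: "real^'a::finite \<Rightarrow> complex"
  shows "smooth f \<Longrightarrow> smooth g \<Longrightarrow> zbound M f B \<Longrightarrow> zbound M g C \<Longrightarrow> zbound M (\<lambda>x. f x + g x) (B + C)"
  unfolding zbound_def
proof (intro allI impI)
  fix "is" :: "'a list" and \<xi> :: "real^'a" assume s: "smooth f" "smooth g" and b: "\<forall>is \<xi>. length is \<le> M \<longrightarrow> \<xi> \<noteq> 0 \<longrightarrow> norm (partials is f \<xi>) * zw M \<xi> \<le> B"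
    "\<forall>is \<xi>. length is \<le> M \<longrightarrow> \<xi> \<noteq> 0 \<longrightarrow> norm (partials is g \<xi>) * zw M \<xi> \<le> C" and h: "length is \<le> M" "\<xi> \<noteq> 0"
  have "norm (partials is (\<lambda>x. f x + g x) \<xi>) * zw M \<xi> \<le> (norm (partials is f \<xi>) + norm (partials is g \<xi>)) * zw M \<xi>"
    unfolding partials_add[OF s] by (intro mult_right_mono norm_triangle_ineq less_imp_le zw_pos h)
  also have "\<dots> \<le> B + C" unfolding distrib_right by (intro add_mono) (use b h in auto)
  finally show "norm (partials is (\<lambda>x. f x + g x) \<xi>) * zw M \<xi> \<le> B + C" .
qed

lemma zbound_cmult:
  fixes f :: "real^'a::finite \<Rightarrow> complex"
  shows "smooth f \<Longrightarrow> zbound M f B \<Longrightarrow> zbound M (\<lambda>x. c * f x) (norm c * B)"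
  unfolding zbound_def
proof (intro allI impI)
  fix "is" :: "'a list" and \<xi> :: "real^'a" assume s: "smooth f" and b: "\<forall>is \<xi>. length is \<le> M \<longrightarrow> \<xi> \<noteq> 0 \<longrightarrow> norm (partials is f \<xi>) * zw M \<xi> \<le> B"
    and h: "length is \<le> M" "\<xi> \<noteq> 0"
  have "norm c * (norm (partials is f \<xi>) * zw M \<xi>) \<le> norm c * B" by (intro mult_left_mono) (use b h in auto)
  then show "norm (partials is (\<lambda>x. c * f x) \<xi>) * zw M \<xi> \<le> norm c * B"
    unfolding partials_cmult[OF s] by (simp add: norm_mult mult.assoc)
qed

lemma Z0_schwartz: "m \<in> Z0 \<Longrightarrow> m \<in> schwartz" and Z0_smooth: "m \<in> Z0 \<Longrightarrow> smooth m"
  by (auto simp: Z0_def schwartz_def)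

lemma Z0_add: "f \<in> Z0 \<Longrightarrow> g \<in> Z0 \<Longrightarrow> (\<lambda>x. f x + g x) \<in> Z0"
  using zbound_add[OF Z0_smooth[of f] Z0_smooth[of g]] schwartz_add[OF Z0_schwartz[of f] Z0_schwartz[of g]] by (simp add: Z0_def) meson

lemma Z0_cmult: "f \<in> Z0 \<Longrightarrow> (\<lambda>x. c * f x) \<in> Z0"
  using zbound_cmult[OF Z0_smooth[of f]] schwartz_cmult[OF Z0_schwartz[of f]] by (simp add: Z0_def) meson

lemma Z0_zero: "(\<lambda>_. 0) \<in> Z0"
proof -
  have "zbound M (\<lambda>_. 0) 0" for M
    by (simp add: zbound_def partials_outside[of "{}"])
  then show ?thesis using schwartz_zero by (auto simp: Z0_def)
qed

lemma Z0_sum: "(\<And>i. i \<in> I \<Longrightarrow> m i \<in> Z0) \<Longrightarrow> (\<lambda>x. \<Sum>i\<in>I. m i x) \<in> Z0"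
  by (induction I rule: infinite_finite_induct) (auto intro: Z0_add Z0_zero)

section \<open>Functionals evaluated on Fourier transforms\<close>

lemma dist_fourier_add:
  assumes "f \<in> dist_mod_poly" "m \<in> Z0" "m' \<in> Z0"
  shows "f (fourier (\<lambda>x. m x + m' x)) = f (fourier m) + f (fourier m')"
proof -
  have "fourier (\<lambda>x. m x + m' x) = (\<lambda>\<xi>. fourier m \<xi> + fourier m' \<xi>)"
    using fourier_add[OF schwartz_integrable schwartz_integrable] assms Z0_schwartz by blast
  moreover have "fourier m \<in> S0" "fourier m' \<in> S0" using assms fourier_Z0 by blast+
  ultimately show ?thesis using assms(1) by (auto simp: dist_mod_poly_def)
qed

lemma dist_fourier_cmult:
  assumes "f \<in> dist_mod_poly" "m \<in> Z0"
  shows "f (fourier (\<lambda>x. c * m x)) = c * f (fourier m)"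
proof -
  have "fourier (\<lambda>x. c * m x) = (\<lambda>\<xi>. c * fourier m \<xi>)" using fourier_cmult by blast
  moreover have "fourier m \<in> S0" using assms fourier_Z0 by blast
  ultimately show ?thesis using assms(1) by (auto simp: dist_mod_poly_def)
qed

lemma dist_fourier_zero: "f \<in> dist_mod_poly \<Longrightarrow> f (fourier (\<lambda>x. 0)) = 0"
  using dist_fourier_cmult[OF _ Z0_zero, of f 0] by simp

lemma dist_fourier_sum:
  assumes "f \<in> dist_mod_poly" "\<And>i. i \<in> I \<Longrightarrow> m i \<in> Z0"
  shows "f (fourier (\<lambda>x. \<Sum>i\<in>I. m i x)) = (\<Sum>i\<in>I. f (fourier (m i)))"
  using assms(2)
proof (induction I rule: infinite_finite_induct)
  case (insert i I)
  then show ?case by (simp add: dist_fourier_add[OF assms(1)] Z0_sum)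
qed (simp_all add: dist_fourier_zero[OF assms(1)])

text \<open>Continuity at 0 gives a bound on a small ball of one norm, and homogeneity extends it to
  a linear bound. This converts later convergence claims for \<open>f\<close> into
  \<open>zbound\<close> estimates.\<close>

lemma dist_fourier_bound:
  fixes f :: "'d::finite functional"
  assumes f: "f \<in> dist_mod_poly"
  obtains M C where "0 \<le> C" "\<And>m B. m \<in> Z0 \<Longrightarrow> zbound M m B \<Longrightarrow> norm (f (fourier m)) \<le> C * B"
proof -
  have f0: "f (fourier (\<lambda>_. 0)) = 0" by (rule dist_fourier_zero[OF f])
  have S: "fourier (\<lambda>_. 0) \<in> (S0 :: (real^'d \<Rightarrow> complex) set)" by (rule fourier_Z0[OF Z0_zero])
  have z: "fourier (\<lambda>_. 0) = (\<lambda>_::real^'d. 0)" by (auto simp: fourier_def)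
  have "\<forall>\<theta>\<in>S0. \<forall>\<epsilon>>0. \<exists>M. \<exists>r>0. \<forall>\<psi>\<in>S0. S0_norm M (\<lambda>x. \<psi> x - \<theta> x) < r \<longrightarrow> norm (f \<psi> - f \<theta>) < \<epsilon>"
    using f by (simp add: dist_mod_poly_def)
  from this[rule_format, OF S zero_less_one]
  obtain M r where r: "0 < r" "\<And>\<psi>. \<psi> \<in> S0 \<Longrightarrow> S0_norm M \<psi> < r \<Longrightarrow> norm (f \<psi>) < 1"
    unfolding f0 unfolding z by auto
  obtain r0 :: real where r0: "0 < r0" "ennreal r0 < r"
  proof -
    obtain x where "0 < x" "x < r" using dense[OF r(1)] by blast
    then show ?thesis using that[of "enn2real x"] by (cases x) (auto simp: ennreal_less_iff less_top[symmetric] enn2real_positive_iff)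
  qed
  \<comment> \<open>Scaling \<open>m\<close> down to norm \<open>r0\<close> requires a positive
    \<open>B\<close>; the case of an arbitrary bound is reached afterwards by adding a small number
    to \<open>B\<close>.\<close>
  have pos: "norm (f (fourier m)) \<le> 1 / r0 * B" if m: "m \<in> Z0" and B: "zbound M m B" "0 < B" for m B
  proof -
    let ?c = "complex_of_real (r0 / B)"
    have "zbound M (\<lambda>x. ?c * m x) (norm ?c * B)" by (intro zbound_cmult Z0_smooth m B)
    moreover have cB: "norm ?c * B = r0" using B r0 by (simp add: norm_divide)
    ultimately have "S0_norm M (fourier (\<lambda>x. ?c * m x)) \<le> ennreal r0"
      using S0_norm_fourier_le_iff[OF Z0_schwartz[OF Z0_cmult[OF m]] less_imp_le[OF r0(1)], of M ?c] unfolding cB by blast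
    then have "norm (f (fourier (\<lambda>x. ?c * m x))) < 1"
      by (intro r(2) fourier_Z0 Z0_cmult m le_less_trans[OF _ r0(2)])
    then have "r0 / B * norm (f (fourier m)) < 1"
      using r0 B unfolding dist_fourier_cmult[OF f m] norm_mult by (simp add: norm_divide)
    then show ?thesis using r0 B by (simp add: field_simps)
  qed
  have "norm (f (fourier m)) \<le> 1 / r0 * B" if m: "m \<in> Z0" and B: "zbound M m B" for m B
  proof (rule field_le_epsilon)
    fix e :: real assume e: "0 < e"
    have "norm (f (fourier m)) \<le> 1 / r0 * (B + e * r0)"
      using e r0 zbound_nonneg[OF B] by (intro pos m zbound_mono[OF B]) (auto intro: add_nonneg_pos)
    also have "\<dots> = 1 / r0 * B + e" using r0 by (simp add: field_simps)
    finally show "norm (f (fourier m)) \<le> 1 / r0 * B + e" .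
  qed
  then show ?thesis using that[of "1 / r0" M] r0 by auto
qed

lemma multiplier_eq: "multiplier m f \<psi> = f (fourier (\<lambda>\<xi>. m \<xi> * inv_fourier \<psi> \<xi>))"
  by (simp add: multiplier_def dist_inv_fourier_def dist_mult_def dist_fourier_def)

section \<open>Multipliers supported away from the origin\<close>

definition ccinf0 :: "(real^'d::finite \<Rightarrow> complex) set" where
  "ccinf0 = {m. smooth m \<and> (\<exists>S. compact S \<and> 0 \<notin> S \<and> (\<forall>\<xi>. \<xi> \<notin> S \<longrightarrow> m \<xi> = 0))}"

lemma ccinf0_Z0:
  assumes "m \<in> ccinf0"
  shows "m \<in> Z0"
proof -
  obtain S where S: "smooth m" "compact S" "0 \<notin> S" "\<And>\<xi>. \<xi> \<notin> S \<Longrightarrow> m \<xi> = 0" using assms by (auto simp: ccinf0_def)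
  have "\<exists>B. zbound M m B" for M
  proof -
    have "\<exists>B. 0 \<le> B \<and> (\<forall>\<xi>. norm (partials is m \<xi>) * zw M \<xi> \<le> B)" for "is"
    proof -
      have "continuous_on S (\<lambda>\<xi>. norm (partials is m \<xi>) * zw M \<xi>)"
        unfolding zw_def using S(3) by (intro continuous_intros smooth_partials_continuous S(1)) auto
      moreover have "norm (partials is m x) * zw M x = 0" if "x \<notin> S" for x
        using partials_outside[OF compact_imp_closed[OF S(2)] S(4) that] by simp
      ultimately show ?thesis using compact_supp_bounded[OF S(2), of "\<lambda>x. norm (partials is m x) * zw M x"] by blast
    qed
    then obtain b where b: "\<And>is. 0 \<le> b is" "\<And>is \<xi>. norm (partials is m \<xi>) * zw M \<xi> \<le> b is" by metis
    let ?L = "{is::'a list. length is \<le> M}"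
    have fin: "finite ?L" using finite_lists_length_le[OF finite[of UNIV], of M] by simp
    have "zbound M m (\<Sum>is\<in>?L. b is)"
      unfolding zbound_def
    proof (intro allI impI)
      fix "is" :: "'a list" and \<xi> assume "length is \<le> M"
      then have "b is \<le> (\<Sum>is\<in>?L. b is)" by (intro member_le_sum) (auto simp: b fin)
      then show "norm (partials is m \<xi>) * zw M \<xi> \<le> (\<Sum>is\<in>?L. b is)" using b(2) order_trans by blast
    qed
    then show ?thesis by blast
  qed
  then show ?thesis using compact_supp_schwartz[OF S(1,2,4)] by (simp add: Z0_def)
qed

lemma ccinf0_mult:
  assumes "smooth g" "m \<in> ccinf0"
  shows "(\<lambda>\<xi>. m \<xi> * g \<xi>) \<in> ccinf0" "(\<lambda>\<xi>. g \<xi> * m \<xi>) \<in> ccinf0"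
proof -
  obtain S where S: "smooth m" "compact S" "0 \<notin> S" "\<And>\<xi>. \<xi> \<notin> S \<Longrightarrow> m \<xi> = 0" using assms by (auto simp: ccinf0_def)
  show "(\<lambda>\<xi>. m \<xi> * g \<xi>) \<in> ccinf0" "(\<lambda>\<xi>. g \<xi> * m \<xi>) \<in> ccinf0"
    using smooth_mult[OF S(1) assms(1)] smooth_mult[OF assms(1) S(1)] S by (auto simp: ccinf0_def intro!: exI[of _ S])
qed

lemma schwartz_smooth: "f \<in> schwartz \<Longrightarrow> smooth f"
  by (simp add: schwartz_def)

lemma ccinf0_dbounded:
  assumes "m \<in> ccinf0"
  shows "dbounded k (\<lambda>_::unit. UNIV) (\<lambda>_ _. 1) (\<lambda>_. m)"
  using schwartzD[OF Z0_schwartz[OF ccinf0_Z0[OF assms]], of k 0] by (simp add: decay_def[abs_def])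

text \<open>All pairs of a smooth function and a bound for it form one family, so whatever the
  family calculus yields has a constant that does not depend on the function.\<close>

lemma zbound_dbounded:
  "dbounded M (\<lambda>(g,B). if smooth g \<and> zbound M g B then - {0} else {}) (\<lambda>(g,B) \<xi>. B / zw M \<xi>) (\<lambda>(g,B). g)"
proof (rule dboundedI)
  fix "is" :: "'a list" assume l: "length is \<le> M"
  show "\<exists>C. \<forall>i. \<forall>x\<in>case i of (g, B) \<Rightarrow> if smooth g \<and> zbound M g B then - {0} else {}.
     norm (partials is (case i of (g, B) \<Rightarrow> g) x) \<le> C * (case i of (g, B) \<Rightarrow> \<lambda>\<xi>. B / zw M \<xi>) x"
    using l by (intro exI[of _ 1]) (auto simp: zbound_def pos_le_divide_eq zw_pos split: if_splits)
qed (auto split: if_splits simp: smooth_partials)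

lemma zbound_mult:
  assumes m: "dbounded M (\<lambda>_::unit. - {0}) (\<lambda>_ _. 1) (\<lambda>_. m)"
  obtains K where "0 \<le> K" "\<And>g B. smooth g \<Longrightarrow> zbound M g B \<Longrightarrow> zbound M (\<lambda>\<xi>. m \<xi> * g \<xi>) (K * B)"
proof -
  let ?D = "\<lambda>(g,B). if smooth g \<and> zbound M g B then - {0 :: real^'a} else {}"
  have m': "dbounded M ?D (\<lambda>_ _. 1) (\<lambda>_. m)"
    by (rule dbounded_subset[OF dbounded_reindex[OF m]]) (auto split: if_splits)
  have op: "open (?D i)" for i by (cases i) (auto intro!: open_Compl closed_singleton)
  have nn: "0 \<le> (case i of (g, B) \<Rightarrow> \<lambda>\<xi>. B / zw M \<xi>) x" if "x \<in> ?D i" for i x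
    using that zbound_nonneg zw_pos by (cases i) (auto split: if_splits intro!: divide_nonneg_pos)
  have d: "dbounded M ?D (\<lambda>i x. 1 * (case i of (g,B) \<Rightarrow> \<lambda>\<xi>. B / zw M \<xi>) x) (\<lambda>i x. m x * (case i of (g,B) \<Rightarrow> g) x)"
    by (rule dbounded_bilinear[where D="?D", OF bounded_bilinear_mult op _ nn m' zbound_dbounded]) auto
  obtain K where K: "0 \<le> K" "\<And>is i x. length is \<le> M \<Longrightarrow> x \<in> ?D i \<Longrightarrow>
      norm (partials is (\<lambda>x. m x * (case i of (g,B) \<Rightarrow> g) x) x) \<le> K * (1 * (case i of (g,B) \<Rightarrow> \<lambda>\<xi>. B / zw M \<xi>) x)"
  proof (rule dbounded_partials_unif[OF d])
    fix i x assume "x \<in> ?D i"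
    then show "0 \<le> 1 * (case i of (g,B) \<Rightarrow> \<lambda>\<xi>. B / zw M \<xi>) x" using nn by simp
  next
    fix C assume c: "0 \<le> C" "\<And>is i x. length is \<le> M \<Longrightarrow> x \<in> ?D i \<Longrightarrow>
      norm (partials is (\<lambda>x. m x * (case i of (g,B) \<Rightarrow> g) x) x) \<le> C * (1 * (case i of (g,B) \<Rightarrow> \<lambda>\<xi>. B / zw M \<xi>) x)"
    show thesis by (rule that[OF c])
  qed
  have "zbound M (\<lambda>\<xi>. m \<xi> * g \<xi>) (K * B)" if "smooth g" "zbound M g B" for g B
    unfolding zbound_def
  proof (intro allI impI)
    fix "is" :: "'a list" and \<xi> :: "real^'a" assume "length is \<le> M" "\<xi> \<noteq> 0"
    with K(2)[of "is" \<xi> "(g,B)"] that show "norm (partials is (\<lambda>\<xi>. m \<xi> * g \<xi>) \<xi>) * zw M \<xi> \<le> K * B"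
      using zw_pos[of \<xi> M] by (simp add: field_simps)
  qed
  then show ?thesis using K(1) that by blast
qed

lemma multiplier_dist:
  assumes m: "m \<in> ccinf0" and f: "f \<in> dist_mod_poly"
  shows "multiplier m f \<in> dist_mod_poly"
proof -
  have z: "(\<lambda>\<xi>. m \<xi> * inv_fourier \<theta> \<xi>) \<in> Z0" if "\<theta> \<in> schwartz" for \<theta>
    by (intro ccinf0_Z0 ccinf0_mult m schwartz_smooth inv_fourier_schwartz that)
  have inv_add: "inv_fourier (\<lambda>x. \<theta> x + \<psi> x) = (\<lambda>\<xi>. inv_fourier \<theta> \<xi> + inv_fourier \<psi> \<xi>)" if "\<theta> \<in> schwartz" "\<psi> \<in> schwartz" for \<theta> \<psi>
    using fourier_add[OF schwartz_integrable schwartz_integrable, OF that] by (auto simp: inv_fourier_eq)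
  have inv_cmult: "inv_fourier (\<lambda>x. c * \<theta> x) = (\<lambda>\<xi>. c * inv_fourier \<theta> \<xi>)" for \<theta> c
    by (auto simp: inv_fourier_eq fourier_cmult)
  have add: "multiplier m f (\<lambda>x. \<theta> x + \<psi> x) = multiplier m f \<theta> + multiplier m f \<psi>" if "\<theta> \<in> schwartz" "\<psi> \<in> schwartz" for \<theta> \<psi>
    unfolding multiplier_eq inv_add[OF that] distrib_left by (rule dist_fourier_add[OF f z z]) (use that in auto)
  have cmult: "multiplier m f (\<lambda>x. c * \<theta> x) = c * multiplier m f \<theta>" if "\<theta> \<in> schwartz" for \<theta> c
    unfolding multiplier_eq inv_cmult using dist_fourier_cmult[OF f z[OF that], of c] by (simp add: mult.left_commute)
  obtain M C where C: "0 \<le> C" "\<And>m B. m \<in> Z0 \<Longrightarrow> zbound M m B \<Longrightarrow> norm (f (fourier m)) \<le> C * B"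
    using dist_fourier_bound[OF f] by metis
  obtain K where K: "0 \<le> K" "\<And>g B. smooth g \<Longrightarrow> zbound M g B \<Longrightarrow> zbound M (\<lambda>\<xi>. m \<xi> * g \<xi>) (K * B)"
    using zbound_mult[OF dbounded_subset[OF ccinf0_dbounded[OF m]]] by (metis subset_UNIV)
  have cont: "\<exists>M. \<exists>r>0. \<forall>\<psi>\<in>S0. S0_norm M (\<lambda>x. \<psi> x - \<theta> x) < r \<longrightarrow> norm (multiplier m f \<psi> - multiplier m f \<theta>) < \<epsilon>"
    if t: "\<theta> \<in> S0" and e: "0 < \<epsilon>" for \<theta> \<epsilon>
  proof -
    \<comment> \<open>The radius makes \<open>C * (K * r)\<close> smaller than
      \<open>\<epsilon>\<close>; the summand 1 avoids a division by zero.\<close>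
    define r where "r = \<epsilon> / (C * K + 1) / 2"
    have CK: "0 \<le> C * K" using C K by simp
    have r: "0 < r" using e CK by (simp add: r_def)
    have "norm (multiplier m f \<psi> - multiplier m f \<theta>) < \<epsilon>" if p: "\<psi> \<in> S0" and lt: "S0_norm M (\<lambda>x. \<psi> x - \<theta> x) < ennreal r" for \<psi>
    proof -
      have st: "\<theta> \<in> schwartz" "\<psi> \<in> schwartz" using t p by (auto simp: S0_def)
      have sd: "(\<lambda>x. \<psi> x - \<theta> x) \<in> schwartz" by (intro schwartz_diff st)
      have "multiplier m f \<psi> - multiplier m f \<theta> = multiplier m f (\<lambda>x. \<psi> x - \<theta> x)"
        using add[OF sd st(1)] by simp
      moreover have "zbound M (inv_fourier (\<lambda>x. \<psi> x - \<theta> x)) r" using S0_norm_le_iff[OF sd less_imp_le[OF r], of M] less_imp_le[OF lt] by blast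
      then have "zbound M (\<lambda>\<xi>. m \<xi> * inv_fourier (\<lambda>x. \<psi> x - \<theta> x) \<xi>) (K * r)"
        by (intro K schwartz_smooth inv_fourier_schwartz sd)
      then have "norm (multiplier m f (\<lambda>x. \<psi> x - \<theta> x)) \<le> C * (K * r)" unfolding multiplier_eq by (intro C z sd)
      moreover have "C * (K * r) < \<epsilon>"
      proof -
        have "C * (K * r) = (C * K / (C * K + 1)) * (\<epsilon> / 2)" by (simp add: r_def)
        also have "\<dots> \<le> 1 * (\<epsilon> / 2)" using CK e by (intro mult_right_mono) (auto simp: divide_le_eq)
        finally show ?thesis using e by simp
      qed
      ultimately show ?thesis by simp
    qed
    then show ?thesis using r by (intro exI[of _ M] exI[of _ "ennreal r"]) auto
  qed
  show ?thesis unfolding dist_mod_poly_def mem_Collect_eq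
    using add cmult cont by (auto simp: S0_def)
qed

section \<open>The covering and the square-root system\<close>

lemma aniso_dil_mult: "(aniso_dil a t *v x) $ i = t powr (a $ i) * x $ i"
  by (simp add: aniso_dil_def matrix_vector_mult_def if_distrib[where f="\<lambda>y. y * _"] cong: if_cong)

lemma aniso_dil_norm_strict_mono:
  fixes x :: "real^'d::finite"
  assumes a: "\<And>i. 0 < a $ i" and st: "0 < s" "s < t" and x: "x \<noteq> 0"
  shows "norm (aniso_dil a s *v x) < norm (aniso_dil a t *v x)"
proof -
  obtain k where k: "x $ k \<noteq> 0" using x by (auto simp: vec_eq_iff)
  have le: "\<bar>(aniso_dil a s *v x) $ i\<bar> \<le> \<bar>(aniso_dil a t *v x) $ i\<bar>" for i
  proof -
    have "s powr (a $ i) \<le> t powr (a $ i)" by (rule powr_mono2) (use st a[of i] in auto)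
    then show ?thesis by (simp add: aniso_dil_mult abs_mult mult_right_mono)
  qed
  have lt: "\<bar>(aniso_dil a s *v x) $ k\<bar> < \<bar>(aniso_dil a t *v x) $ k\<bar>"
  proof -
    have "s powr (a $ k) < t powr (a $ k)" by (rule powr_less_mono2) (use st a[of k] in auto)
    then show ?thesis using k by (simp add: aniso_dil_mult abs_mult)
  qed
  have "(\<Sum>i\<in>UNIV. \<bar>(aniso_dil a s *v x) $ i\<bar>\<^sup>2) < (\<Sum>i\<in>UNIV. \<bar>(aniso_dil a t *v x) $ i\<bar>\<^sup>2)"
  proof (rule sum_strict_mono_ex1)
    show "\<forall>i\<in>UNIV. \<bar>(aniso_dil a s *v x) $ i\<bar>\<^sup>2 \<le> \<bar>(aniso_dil a t *v x) $ i\<bar>\<^sup>2" by (intro ballI power_mono le abs_ge_zero)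
    have "\<bar>(aniso_dil a s *v x) $ k\<bar>\<^sup>2 < \<bar>(aniso_dil a t *v x) $ k\<bar>\<^sup>2" by (rule power_strict_mono[OF lt]) auto
    then show "\<exists>i\<in>UNIV. \<bar>(aniso_dil a s *v x) $ i\<bar>\<^sup>2 < \<bar>(aniso_dil a t *v x) $ i\<bar>\<^sup>2" by blast
  qed simp
  then show ?thesis by (simp add: norm_vec_def L2_set_def)
qed

text \<open>In the variable s = 1 / t the norm of the dilated vector is strictly increasing, tends
  to 0 at 0, and is at least 1 at the value \<open>s1\<close> where one nonzero coordinate has been
  scaled to modulus 1.\<close>

lemma aniso_norm_ex1:
  fixes a :: "real^'d::finite"
  assumes an: "anisotropy a" and x: "x \<noteq> 0"
  shows "\<exists>!t. 0 < t \<and> norm (aniso_dil a (1 / t) *v x) = 1"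
proof -
  have a: "0 < a $ i" for i using an by (simp add: anisotropy_def)
  let ?N = "\<lambda>s. norm (aniso_dil a s *v x)"
  obtain k where k: "x $ k \<noteq> 0" using x by (auto simp: vec_eq_iff)
  define s1 where "s1 = (1 / \<bar>x $ k\<bar>) powr (1 / a $ k)"
  have s1: "0 < s1" "1 \<le> ?N s1"
  proof -
    show "0 < s1" using k by (simp add: s1_def)
    have "s1 powr (a $ k) = 1 / \<bar>x $ k\<bar>" using a[of k] k by (simp add: s1_def powr_powr)
    then have "\<bar>(aniso_dil a s1 *v x) $ k\<bar> = 1" using k by (simp add: aniso_dil_mult abs_mult)
    then show "1 \<le> ?N s1" using component_le_norm_cart[of "aniso_dil a s1 *v x" k] by simp
  qed
  have cont: "continuous_on {0<..} ?N"
    unfolding norm_vec_def L2_set_def aniso_dil_mult by (intro continuous_intros) auto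
  have "(?N \<longlongrightarrow> 0) (at_right 0)"
  proof -
    have "((\<lambda>s. s powr (a $ i) * x $ i) \<longlongrightarrow> 0) (at_right 0)" for i
    proof -
      have "((\<lambda>s. s powr (a $ i)) \<longlongrightarrow> 0 powr (a $ i)) (at_right 0)"
        by (rule tendsto_powr2) (use a[of i] in \<open>auto intro!: tendsto_eq_intros eventually_at_right_less[THEN eventually_mono] less_imp_le simp: eventually_at_right_less\<close>)
      then show ?thesis using tendsto_mult_left_zero a[of i] by fastforce
    qed
    then have "((\<lambda>s. aniso_dil a s *v x) \<longlongrightarrow> 0) (at_right 0)"
      by (intro vec_tendstoI) (simp add: aniso_dil_mult)
    then show ?thesis by (rule tendsto_norm_zero)
  qed
  then have "\<forall>\<^sub>F s in at_right 0. ?N s < 1" by (rule order_tendstoD) simp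
  then obtain e where e: "0 < e" "\<And>s. 0 < s \<Longrightarrow> s < e \<Longrightarrow> ?N s < 1" by (auto simp: eventually_at_right_field)
  define s0 where "s0 = min (e / 2) s1"
  have s0: "0 < s0" "s0 \<le> s1" "?N s0 \<le> 1" using e s1 by (auto simp: s0_def intro!: less_imp_le)
  obtain s where s: "s0 \<le> s" "?N s = 1"
    using IVT'[of ?N s0 1 s1] s0 s1 continuous_on_subset[OF cont, of "{s0..s1}"] by force
  have "0 < s" using s s0 by simp
  show ?thesis
  proof (rule ex1I[of _ "1 / s"])
    show "0 < 1 / s \<and> ?N (1 / (1 / s)) = 1" using s \<open>0 < s\<close> by simp
    fix t assume t: "0 < t \<and> ?N (1 / t) = 1"
    show "t = 1 / s"
    proof (rule ccontr)
      assume "t \<noteq> 1 / s"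
      then have "1 / t \<noteq> s" by auto
      then consider "1 / t < s" | "s < 1 / t" by linarith
      then show False
        using aniso_dil_norm_strict_mono[OF a, of "1 / t" s x] aniso_dil_norm_strict_mono[OF a, of s "1 / t" x] t s \<open>0 < s\<close> x
        by cases auto
    qed
  qed
qed

lemma aniso_norm_pos:
  assumes "anisotropy a" "x \<noteq> 0"
  shows "0 < aniso_norm a x" "norm (aniso_dil a (1 / aniso_norm a x) *v x) = 1"
  using theI'[OF aniso_norm_ex1[OF assms]] assms(2) by (simp_all add: aniso_norm_def)

text \<open>For quasi-norm at most 1 the dilation parameter is at least 1, so a lower bound \<alpha>
  of the exponents underestimates the stretching. Inverse powers of the quasi-norm become inverse
  powers of the Euclidean norm.\<close>

lemma aniso_norm_lower:
  fixes x :: "real^'d::finite"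
  assumes an: "anisotropy a" and x: "x \<noteq> 0" and al: "\<And>i. \<alpha> \<le> a $ i" and t: "aniso_norm a x \<le> 1"
  shows "(1 / aniso_norm a x) powr \<alpha> \<le> 1 / norm x"
proof -
  let ?s = "1 / aniso_norm a x"
  have s: "1 \<le> ?s" using t aniso_norm_pos(1)[OF an x] by simp
  have "norm (?s powr \<alpha> *\<^sub>R x) \<le> norm (aniso_dil a ?s *v x)"
  proof (rule norm_le_componentwise_cart)
    fix i
    have "?s powr \<alpha> \<le> ?s powr (a $ i)" using s al by (intro powr_mono) auto
    then show "norm ((?s powr \<alpha> *\<^sub>R x) $ i) \<le> norm ((aniso_dil a ?s *v x) $ i)"
      by (simp add: aniso_dil_mult abs_mult mult_right_mono)
  qed
  then have "?s powr \<alpha> * norm x \<le> 1" using aniso_norm_pos(2)[OF an x] by simp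
  then show ?thesis using x by (simp add: field_simps)
qed

text \<open>The weights \<open>\<rho>\<close> and \<open>1 - \<rho>\<close> are nonzero only where
  the lower bound of the corresponding function is available, so the convex combination inherits the
  common minorant.\<close>

lemma hybrid_lower_bound:
  assumes an: "anisotropy a" and hy: "hybrid_regulation a h"
  obtains c r where "0 < c" "0 \<le> r" "\<And>x. x \<noteq> 0 \<Longrightarrow> c * min 1 (aniso_norm a x powr r) \<le> h x"
proof -
  from hy obtain s \<rho> h1 h2 c0 c1 c2 c3 r where H: "ramp_function a s \<rho>" "0 < c0" "0 < c2" "1 \<le> r"
    "\<And>x. 0 < aniso_norm a x \<and> aniso_norm a x \<le> 4/3 \<Longrightarrow> c0 * aniso_norm a x powr r \<le> h1 x"
    "\<And>x. aniso_norm a x \<ge> 2/3 \<Longrightarrow> c2 \<le> h2 x"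
    "\<And>x. x \<noteq> 0 \<Longrightarrow> h x = \<rho> x * h1 x + (1 - \<rho> x) * h2 x"
    unfolding hybrid_regulation_def by blast
  define c where "c = min c0 c2"
  have c: "0 < c" "c \<le> c0" "c \<le> c2" using H by (auto simp: c_def)
  have "c * min 1 (aniso_norm a x powr r) \<le> h x" if x: "x \<noteq> 0" for x
  proof -
    let ?t = "aniso_norm a x"
    have t: "0 < ?t" by (rule aniso_norm_pos(1)[OF an x])
    have rho: "0 \<le> \<rho> x" "\<rho> x \<le> 1" using H(1) x by (auto simp: ramp_function_def)
    let ?m = "c * min 1 (?t powr r)"
    have m1: "?m \<le> h1 x" if "?t \<le> 4/3"
    proof -
      have "?m \<le> c0 * ?t powr r" using c by (intro mult_mono) auto
      then show ?thesis using H(5)[of x] t that by linarith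
    qed
    have m2: "?m \<le> h2 x" if "2/3 \<le> ?t"
    proof -
      have "?m \<le> c2 * 1" using c by (intro mult_mono) auto
      then show ?thesis using H(6)[of x] that by linarith
    qed
    consider "?t \<le> 2/3" | "2/3 \<le> ?t" "?t \<le> 4/3" | "4/3 \<le> ?t" by linarith
    then show ?thesis
    proof cases
      case 1
      then have "\<rho> x = 1" using H(1) t by (auto simp: ramp_function_def)
      then show ?thesis using H(7)[OF x] m1 1 by simp
    next
      case 2
      have "\<rho> x * ?m + (1 - \<rho> x) * ?m \<le> \<rho> x * h1 x + (1 - \<rho> x) * h2 x"
        using rho m1 m2 2 by (intro add_mono mult_left_mono) auto
      then show ?thesis using H(7)[OF x] by (simp add: algebra_simps)
    next
      case 3
      then have "\<rho> x = 0" using H(1) by (auto simp: ramp_function_def)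
      then show ?thesis using H(7)[OF x] m2 3 by simp
    qed
  qed
  then show ?thesis using that[of c r] c H by auto
qed

text \<open>Large near the origin and near infinity, and at least 1 at every nonzero point; powers
  of it are the price of derivatives of the square-root system.\<close>

definition zweight :: "real^'d::finite \<Rightarrow> real" where
  "zweight x = norm x + inverse (norm x)"

lemma zweight_ge1: "x \<noteq> 0 \<Longrightarrow> 1 \<le> zweight x"
proof -
  assume "x \<noteq> 0"
  then have n: "0 < norm x" by simp
  show ?thesis
  proof (cases "1 \<le> norm x")
    case True then show ?thesis using n by (simp add: zweight_def add_increasing2)
  next
    case False
    then have "1 \<le> inverse (norm x)" using n by (simp add: one_le_inverse_iff)
    then show ?thesis using n by (simp add: zweight_def add_increasing)
  qed
qed

lemma zweight_nonneg [simp]: "0 \<le> zweight x"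
  by (simp add: zweight_def)

lemma inverse_norm_le_zweight: "inverse (norm x) \<le> zweight x"
  by (simp add: zweight_def)

lemma compact_supp_dbounded:
  fixes m :: "real^'d::finite \<Rightarrow> 'b::real_normed_vector"
  assumes "smooth m" "compact S" "\<And>x. x \<notin> S \<Longrightarrow> m x = 0"
  shows "dbounded k (\<lambda>_::unit. UNIV) (\<lambda>_ _. 1) (\<lambda>_. m)"
proof (rule dboundedI)
  fix "is" :: "'d list"
  have "continuous_on S (\<lambda>x. norm (partials is m x))"
    by (intro continuous_intros smooth_partials_continuous assms)
  moreover have "norm (partials is m x) = 0" if "x \<notin> S" for x
    using partials_outside[OF compact_imp_closed[OF assms(2)] assms(3) that] by simp
  ultimately show "\<exists>C. \<forall>i::unit. \<forall>x\<in>UNIV. norm (partials is m x) \<le> C * 1"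
    using compact_supp_bounded[OF assms(2), of "\<lambda>x. norm (partials is m x)"] by simp blast
qed (use assms(1) smooth_partials in blast)

lemma dil_minus: "dil s (- x) = - dil s x"
  by (simp add: dil_def vec_eq_iff)

locale frame_setup =
  fixes a :: "real^'d::finite" and h :: "real^'d \<Rightarrow> real" and R \<delta>\<^sub>0 \<delta> :: real
    and J :: "'j set" and \<xi> :: "'j \<Rightarrow> real^'d"
    and A :: "'j \<Rightarrow> real^'d^'d" and b :: "'j \<Rightarrow> real^'d"
    and P Q :: "(real^'d) set" and \<Phi> :: "real^'d \<Rightarrow> real"
    and z :: "real^'d" and l :: real
  assumes an: "anisotropy a"
    and hy: "hybrid_regulation a h"
    and mo: "moderate_with a R \<delta>\<^sub>0 h"
    and \<delta>: "0 < \<delta>" "\<delta> < \<delta>\<^sub>0"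
    and cov: "ball_covering a h \<delta> J \<xi> A b P Q"
    and bu: "bump P Q \<Phi>"
    and l: "0 < l" and Ql: "Q \<subseteq> cube z l"
begin

lemma a_pos: "0 < a $ i"
  using an by (simp add: anisotropy_def)

lemma a_le: "a $ i \<le> real CARD('d)"
proof -
  have "a $ i \<le> (\<Sum>i\<in>UNIV. a $ i)" by (rule member_le_sum) (auto simp: a_pos less_imp_le)
  then show ?thesis using an by (simp add: anisotropy_def)
qed

lemma h_pos: "x \<noteq> 0 \<Longrightarrow> 0 < h x"
  using mo by (simp add: moderate_with_def)

lemma \<xi>_nz: "j \<in> J \<Longrightarrow> \<xi> j \<noteq> 0"
  using cov by (simp add: ball_covering_def)

section \<open>Coordinates attached to the covering\<close>

definition \<tau> :: "'j \<Rightarrow> real^'d" where "\<tau> j = (\<chi> i. (\<delta> * h (\<xi> j)) powr (a $ i))"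
definition \<iota> :: "'j \<Rightarrow> real^'d" where "\<iota> j = (\<chi> i. 1 / \<tau> j $ i)"
definition T :: "'j \<Rightarrow> real^'d \<Rightarrow> real^'d" where "T j x = dil (\<tau> j) x + b j"
text \<open>The inverse of \<open>T j\<close>, written as a dilation plus a vector so that the
  substitution lemmas for \<open>dil s x + b\<close> apply literally.\<close>

definition Ti :: "'j \<Rightarrow> real^'d \<Rightarrow> real^'d" where "Ti j x = dil (\<iota> j) x + - dil (\<iota> j) (b j)"
definition Qs :: "'j \<Rightarrow> (real^'d) set" where "Qs j = {x. Ti j x \<in> Q}"
definition S where "S = closure {x. \<Phi> x \<noteq> 0}"
definition nb :: "'j \<Rightarrow> 'j set" where "nb j = {k \<in> J. Qs k \<inter> Qs j \<noteq> {}}"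

lemma \<tau>_pos: "j \<in> J \<Longrightarrow> 0 < \<tau> j $ i"
  using h_pos[OF \<xi>_nz, of j] \<delta> by (simp add: \<tau>_def)

lemma affine_T: "j \<in> J \<Longrightarrow> affine_map (A j) (b j) = T j"
proof -
  assume "j \<in> J"
  then have "A j = aniso_dil a (\<delta> * h (\<xi> j))" using cov unfolding ball_covering_def by blast
  then have "A j *v x = dil (\<tau> j) x" for x
    by (simp only:) (simp add: \<tau>_def vec_eq_iff aniso_dil_mult dil_def)
  then show ?thesis by (intro ext) (simp add: affine_map_def T_def)
qed

lemma T_Ti: "j \<in> J \<Longrightarrow> T j (Ti j x) = x"
  using \<tau>_pos[of j] by (simp add: T_def Ti_def dil_def \<iota>_def vec_eq_iff field_simps less_imp_neq[symmetric])

lemma Ti_T: "j \<in> J \<Longrightarrow> Ti j (T j x) = x"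
  using \<tau>_pos[of j] by (simp add: T_def Ti_def dil_def \<iota>_def vec_eq_iff field_simps less_imp_neq[symmetric])

lemma inv_T: "j \<in> J \<Longrightarrow> inv (affine_map (A j) (b j)) = Ti j"
  unfolding affine_T by (rule inv_unique_comp) (auto simp: T_Ti Ti_T)

lemma T_image: "j \<in> J \<Longrightarrow> affine_map (A j) (b j) ` U = {x. Ti j x \<in> U}"
  unfolding affine_T using T_Ti Ti_T by (auto simp: image_iff) metis

lemma sc: "structured_covering J A b P Q"
  using cov by (simp add: ball_covering_def)

lemma openQ: "open Q" and openP: "open P" and Q0: "0 \<notin> Q" and PQ: "P \<subseteq> Q" and boundedQ: "bounded Q"
  using sc closure_subset[of P] by (auto simp: structured_covering_def)

lemma Qs_ball: "j \<in> J \<Longrightarrow> Qs j = aniso_ball a (\<xi> j) (\<delta> * h (\<xi> j))"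
proof -
  assume j: "j \<in> J"
  then have "affine_map (A j) (b j) ` Q = aniso_ball a (\<xi> j) (\<delta> * h (\<xi> j))" using cov unfolding ball_covering_def by blast
  then show ?thesis unfolding T_image[OF j] Qs_def .
qed

lemma Qs_nz: "j \<in> J \<Longrightarrow> x \<in> Qs j \<Longrightarrow> x \<noteq> 0"
  using sc T_image[of _ Q] unfolding structured_covering_def admissible_covering_def Qs_def by auto

lemma P_covers: "x \<noteq> 0 \<Longrightarrow> \<exists>j\<in>J. Ti j x \<in> P"
proof -
  assume x: "x \<noteq> 0"
  have u: "(\<Union>j\<in>J. affine_map (A j) (b j) ` P) = - {0}"
    using sc by (simp add: structured_covering_def admissible_covering_def)
  have "x \<in> (\<Union>j\<in>J. affine_map (A j) (b j) ` P)" unfolding u using x by simp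
  then obtain j where "j \<in> J" "x \<in> affine_map (A j) (b j) ` P" by blast
  then show ?thesis using T_image[of j P] by auto
qed

lemma nb_bound: "\<exists>N. \<forall>j\<in>J. finite (nb j) \<and> card (nb j) \<le> N"
proof -
  obtain N where N: "\<And>j. j \<in> J \<Longrightarrow> finite {i\<in>J. affine_map (A i) (b i) ` Q \<inter> affine_map (A j) (b j) ` Q \<noteq> {}} \<and>
     card {i\<in>J. affine_map (A i) (b i) ` Q \<inter> affine_map (A j) (b j) ` Q \<noteq> {}} \<le> N"
  proof -
    have "admissible_covering J (\<lambda>j. affine_map (A j) (b j) ` Q)" using sc by (simp add: structured_covering_def)
    then show thesis using that unfolding admissible_covering_def by blast
  qed
  have e: "{i\<in>J. affine_map (A i) (b i) ` Q \<inter> affine_map (A j) (b j) ` Q \<noteq> {}} = nb j" if "j \<in> J" for j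
    unfolding nb_def Qs_def using T_image that by auto
  show ?thesis
  proof (intro exI[of _ N] ballI)
    fix j assume j: "j \<in> J"
    show "finite (nb j) \<and> card (nb j) \<le> N" using N[OF j] unfolding e[OF j] .
  qed
qed

lemma fin_nb: "j \<in> J \<Longrightarrow> finite (nb j)"
  using nb_bound by blast

lemma nb_sym: "j \<in> J \<Longrightarrow> k \<in> nb j \<Longrightarrow> j \<in> nb k" and nb_J: "k \<in> nb j \<Longrightarrow> k \<in> J"
  by (auto simp: nb_def)

lemma R_ge1: "1 \<le> R"
proof -
  define x :: "real^'d" where "x = axis undefined 1"
  have "x \<noteq> 0" by (simp add: x_def axis_eq_0_iff)
  moreover have "aniso_dist a x x \<le> \<delta>\<^sub>0 * h x" using mo h_pos[OF \<open>x \<noteq> 0\<close>] by (simp add: aniso_dist_def aniso_norm_def moderate_with_def)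
  ultimately have "h x / h x \<le> R" using mo unfolding moderate_with_def by blast
  then show ?thesis using h_pos[OF \<open>x \<noteq> 0\<close>] by simp
qed

lemma h_ratio_pt:
  assumes "j \<in> J" "x \<in> Qs j"
  shows "h (\<xi> j) \<le> R * h x" "h x \<le> R * h (\<xi> j)"
proof -
  have x: "x \<noteq> 0" using Qs_nz assms by blast
  have "aniso_dist a (\<xi> j) x < \<delta> * h (\<xi> j)" using assms Qs_ball by (auto simp: aniso_ball_def)
  also have "\<dots> \<le> \<delta>\<^sub>0 * h (\<xi> j)" using \<delta> h_pos[OF \<xi>_nz[OF assms(1)]] by (intro mult_right_mono) auto
  finally have "1 / R \<le> h (\<xi> j) / h x \<and> h (\<xi> j) / h x \<le> R" using mo x \<xi>_nz[OF assms(1)] by (auto simp: moderate_with_def)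
  then show "h (\<xi> j) \<le> R * h x" "h x \<le> R * h (\<xi> j)" using h_pos[OF x] R_ge1 by (auto simp: field_simps)
qed

text \<open>The two centres need not be within the range of moderateness of each other, but both are
  within range of a common point; this costs \<open>R\<close> twice.\<close>

lemma h_ratio:
  assumes "j \<in> J" "k \<in> nb j"
  shows "h (\<xi> k) \<le> R\<^sup>2 * h (\<xi> j)"
proof -
  obtain x where x: "x \<in> Qs k" "x \<in> Qs j" using assms by (auto simp: nb_def)
  have "h (\<xi> k) \<le> R * h x" using h_ratio_pt(1)[OF nb_J[OF assms(2)] x(1)] .
  also have "\<dots> \<le> R * (R * h (\<xi> j))" using h_ratio_pt(2)[OF assms(1) x(2)] R_ge1 by (intro mult_left_mono) auto
  finally show ?thesis by (simp add: power2_eq_square)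
qed

text \<open>The ratio of \<open>h\<close> at neighbouring centres is at most
  \<open>R\<^sup>2\<close>, and no exponent \<open>a $ i\<close> exceeds the dimension; this number
  therefore bounds the ratios of all corresponding scales.\<close>

definition Kr where "Kr = (R\<^sup>2) powr real CARD('d)"

lemma Kr_ge1: "1 \<le> Kr"
  unfolding Kr_def using R_ge1 by (intro ge_one_powr_ge_zero) auto

lemma \<tau>_ratio:
  assumes "j \<in> J" "k \<in> nb j"
  shows "\<tau> k $ i \<le> Kr * \<tau> j $ i"
proof -
  have hj: "0 < h (\<xi> j)" "0 < h (\<xi> k)" using h_pos \<xi>_nz assms nb_J by blast+
  have "\<delta> * h (\<xi> k) \<le> R\<^sup>2 * (\<delta> * h (\<xi> j))" using h_ratio[OF assms] \<delta> by (simp add: mult.left_commute)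
  then have "(\<delta> * h (\<xi> k)) powr (a $ i) \<le> (R\<^sup>2 * (\<delta> * h (\<xi> j))) powr (a $ i)"
    using \<delta> hj a_pos[of i] by (intro powr_mono2) (auto intro: less_imp_le)
  also have "\<dots> = (R\<^sup>2) powr (a $ i) * (\<delta> * h (\<xi> j)) powr (a $ i)" using \<delta> hj by (simp add: powr_mult)
  also have "\<dots> \<le> Kr * (\<delta> * h (\<xi> j)) powr (a $ i)"
    unfolding Kr_def using R_ge1 a_le by (intro mult_right_mono powr_mono) auto
  finally show ?thesis by (simp add: \<tau>_def)
qed

lemma Ti_T_comp: "Ti k (T j x) = dil (\<chi> i. \<tau> j $ i / \<tau> k $ i) x + dil (\<iota> k) (b j - b k)"
  by (simp add: Ti_def T_def dil_def \<iota>_def vec_eq_iff add_divide_distrib diff_divide_distrib)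

lemma \<Phi>_smooth: "smooth \<Phi>" and \<Phi>_nonneg: "0 \<le> \<Phi> x" and \<Phi>_P: "x \<in> P \<Longrightarrow> \<Phi> x = 1" and S_Q: "S \<subseteq> Q"
  using bu by (auto simp: bump_def S_def)

lemma \<Phi>_S: "x \<notin> S \<Longrightarrow> \<Phi> x = 0"
  unfolding S_def using closure_subset[of "{x. \<Phi> x \<noteq> 0}"] by auto

lemma compact_S: "compact S"
  unfolding S_def using S_Q boundedQ by (simp add: compact_eq_bounded_closed S_def bounded_subset)

lemma \<Phi>_Q: "x \<notin> Q \<Longrightarrow> \<Phi> x = 0"
  using \<Phi>_S S_Q by blast

section \<open>The square-root system\<close>

definition sq :: "'j \<Rightarrow> real^'d \<Rightarrow> real" where "sq j x = (\<Sum>k\<in>nb j. \<Phi> (Ti k x) * \<Phi> (Ti k x))"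

abbreviation \<phi> where "\<phi> \<equiv> sqrt_system J A b \<Phi>"

text \<open>The smaller sets built from \<open>P\<close> also cover, so at every point of
  \<open>Qs j\<close> some neighbour contributes the value 1.\<close>

lemma sq_ge1:
  assumes j: "j \<in> J" and x: "x \<in> Qs j"
  shows "1 \<le> sq j x"
proof -
  obtain k where k: "k \<in> J" "Ti k x \<in> P" using P_covers Qs_nz[OF j x] by blast
  then have "k \<in> nb j" using x PQ by (auto simp: nb_def Qs_def)
  moreover have "finite (nb j)" by (rule fin_nb[OF j])
  ultimately have "\<Phi> (Ti k x) * \<Phi> (Ti k x) \<le> sq j x"
    unfolding sq_def by (intro member_le_sum) auto
  then show ?thesis using \<Phi>_P[OF k(2)] by simp
qed

text \<open>On \<open>Qs j\<close> the infinite sum under the root has only the terms of neighbours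
  of \<open>j\<close>, so it reduces to the finite sum \<open>sq j\<close>.\<close>

lemma \<phi>_eq:
  assumes j: "j \<in> J" and x: "x \<in> Qs j" and k: "k \<in> J"
  shows "\<phi> k x = \<Phi> (Ti k x) / sqrt (sq j x)"
proof -
  have fin: "finite (nb j)" by (rule fin_nb[OF j])
  have "(\<Sum>\<^sub>\<infinity>k\<in>J. (\<Phi> (inv (affine_map (A k) (b k)) x))\<^sup>2) = (\<Sum>\<^sub>\<infinity>k\<in>nb j. (\<Phi> (Ti k x))\<^sup>2)"
  proof (rule infsum_cong_neutral)
    fix i assume "i \<in> J - nb j"
    then have "Ti i x \<notin> Q" using x by (auto simp: nb_def Qs_def)
    then show "(\<Phi> (inv (affine_map (A i) (b i)) x))\<^sup>2 = 0" using \<Phi>_Q inv_T \<open>i \<in> J - nb j\<close> by simp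
  qed (use nb_J inv_T in auto)
  also have "\<dots> = sq j x" using fin by (simp add: sq_def power2_eq_square)
  finally show ?thesis using k inv_T by (simp add: sqrt_system_def Let_def)
qed

lemma \<phi>_zero: "k \<in> J \<Longrightarrow> Ti k x \<notin> S \<Longrightarrow> \<phi> k x = 0"
  using \<Phi>_S inv_T by (simp add: sqrt_system_def Let_def)

lemma \<phi>_Qs: "k \<in> J \<Longrightarrow> x \<notin> Qs k \<Longrightarrow> \<phi> k x = 0"
  using \<phi>_zero S_Q by (auto simp: Qs_def)

lemma \<phi>_sum1:
  assumes j: "j \<in> J" and x: "x \<in> Qs j" and F: "finite F" "F \<subseteq> J" "nb j \<subseteq> F"
  shows "(\<Sum>k\<in>F. (\<phi> k x)\<^sup>2) = 1"
proof -
  have "(\<Sum>k\<in>F. (\<phi> k x)\<^sup>2) = (\<Sum>k\<in>nb j. (\<phi> k x)\<^sup>2)"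
  proof (rule sum.mono_neutral_right[OF F(1,3)])
    show "\<forall>k\<in>F - nb j. (\<phi> k x)\<^sup>2 = 0"
      using \<phi>_Qs x F(2) by (force simp: nb_def)
  qed
  also have "\<dots> = (\<Sum>k\<in>nb j. \<Phi> (Ti k x) * \<Phi> (Ti k x) / sq j x)"
    using \<phi>_eq[OF j x] sq_ge1[OF j x] nb_J by (intro sum.cong) (auto simp: power_divide power2_eq_square)
  also have "\<dots> = 1" using sq_ge1[OF j x] by (simp add: sum_divide_distrib[symmetric] sq_def[symmetric])
  finally show ?thesis .
qed

text \<open>\<open>mm j\<close> is \<open>\<phi> j\<close> in the coordinates in which the set \<open>Qs j\<close> becomes \<open>Q\<close>; in these coordinates
  all \<open>\<phi> j\<close> live on the same compact set with uniformly bounded derivatives.\<close>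

definition mm :: "'j \<Rightarrow> real^'d \<Rightarrow> real" where
  "mm j x = (if j \<in> J then \<phi> j (T j x) else 0)"

lemma mm_zero: "x \<notin> S \<Longrightarrow> mm j x = 0"
  using \<phi>_zero Ti_T by (simp add: mm_def)

text \<open>In the coordinates of \<open>j\<close> every neighbouring bump is the fixed function
  \<Phi> composed with a diagonal affine map with entries at most \<open>Kr\<close>, so all of them
  share derivative bounds. The denominator is the root of a sum of boundedly many squares that is at
  least 1, and the numerator is \<Phi> itself.\<close>

lemma mm_dbounded: "dbounded k (\<lambda>j. UNIV) (\<lambda>_ _. 1) mm"
proof -
  let ?D = "\<lambda>j. if j \<in> J then Q else {}"
  have op: "open (?D j)" for j using openQ by auto
  have \<Phi>d: "dbounded k (\<lambda>_::unit. UNIV) (\<lambda>_ _. 1) (\<lambda>_. \<Phi>)"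
    by (rule compact_supp_dbounded[OF \<Phi>_smooth compact_S \<Phi>_S])
  \<comment> \<open>Pairs that are not adjacent get the empty domain, because the scale ratios are
    controlled for neighbours only.\<close>
  let ?E = "\<lambda>(m,j). if j \<in> J \<and> m \<in> nb j then UNIV :: (real^'d) set else {}"
  let ?G = "\<lambda>(m,j) x. \<Phi> (dil (\<chi> i. \<tau> j $ i / \<tau> m $ i) x + dil (\<iota> m) (b j - b m))"
  have "dbounded k (\<lambda>i. {x. dil (case i of (m,j) \<Rightarrow> \<chi> i. \<tau> j $ i / \<tau> m $ i) x + (case i of (m,j) \<Rightarrow> dil (\<iota> m) (b j - b m)) \<in> ?E i})
     (\<lambda>i x. Kr ^ k * 1) (\<lambda>i x. \<Phi> (dil (case i of (m,j) \<Rightarrow> \<chi> i. \<tau> j $ i / \<tau> m $ i) x + (case i of (m,j) \<Rightarrow> dil (\<iota> m) (b j - b m))))"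
  proof (rule dbounded_diag)
    show "dbounded k ?E (\<lambda>_ _. 1) (\<lambda>_. \<Phi>)"
      by (rule dbounded_subset[OF dbounded_reindex[OF \<Phi>d]]) auto
    fix i i' assume "?E i \<noteq> {}"
    then obtain m j where i: "i = (m,j)" "j \<in> J" "m \<in> nb j" by (cases i) (auto split: if_splits)
    have "\<tau> j $ i' \<le> Kr * \<tau> m $ i'" by (rule \<tau>_ratio[OF nb_J[OF i(3)] nb_sym[OF i(2,3)]])
    then show "\<bar>(case i of (m,j) \<Rightarrow> \<chi> i. \<tau> j $ i / \<tau> m $ i) $ i'\<bar> \<le> Kr"
      using \<tau>_pos[OF i(2), of i'] \<tau>_pos[OF nb_J[OF i(3)], of i'] i by (simp add: field_simps)
  qed (auto simp: Kr_ge1)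
  moreover have "{x. dil (case i of (m,j) \<Rightarrow> \<chi> i. \<tau> j $ i / \<tau> m $ i) x + (case i of (m,j) \<Rightarrow> dil (\<iota> m) (b j - b m)) \<in> ?E i} = ?E i" for i
    by (cases i) auto
  ultimately have "dbounded k ?E (\<lambda>_ _. Kr ^ k) ?G" by (simp add: split_def)
  then have G1: "dbounded k ?E (\<lambda>_ _. 1) ?G"
    by (rule dbounded_weight[rotated 2, where C="Kr ^ k"]) (use Kr_ge1 in auto)
  have opE: "open (?E i)" for i by (cases i) auto
  have "dbounded k ?E (\<lambda>_ _. 1 * 1) (\<lambda>i x. ?G i x * ?G i x)"
    by (rule dbounded_bilinear[where D="?E", OF bounded_bilinear_mult opE _ _ G1 G1]) auto
  then have G2: "dbounded k (\<lambda>(m,j). if m \<in> (if j \<in> J then nb j else {}) then ?D j else {}) (\<lambda>(m,j) _. 1) (\<lambda>(m,j) x. ?G (m,j) x * ?G (m,j) x)"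
    by (simp add: split_def) (erule dbounded_subset, auto)
  obtain N where N: "\<And>j. j \<in> J \<Longrightarrow> finite (nb j) \<and> card (nb j) \<le> N" using nb_bound by blast
  have s: "dbounded k ?D (\<lambda>_ _. 1) (\<lambda>j x. \<Sum>m\<in>(if j \<in> J then nb j else {}). ?G (m,j) x * ?G (m,j) x)"
    by (rule dbounded_sum[where N=N, OF op _ _ _ G2]) (use N in auto)
  let ?s = "\<lambda>j x. \<Sum>m\<in>(if j \<in> J then nb j else {}). ?G (m,j) x * ?G (m,j) x"
  have se: "?s j x = sq j (T j x)" if "j \<in> J" for j x
    using that by (simp add: sq_def Ti_T_comp)
  have "1 \<le> ?s j x" if "x \<in> ?D j" for j x
  proof -
    have j: "j \<in> J" "x \<in> Q" using that by (auto split: if_splits)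
    then have "T j x \<in> Qs j" by (simp add: Qs_def Ti_T)
    then show ?thesis using sq_ge1[OF j(1)] se[OF j(1), of x] by simp
  qed
  from dbounded_recip_sqrt[where D="?D", OF op this s]
  have y: "dbounded k ?D (\<lambda>_ _. 1) (\<lambda>j x. 1 / sqrt (?s j x))" .
  have \<Phi>d': "dbounded k ?D (\<lambda>_ _. 1) (\<lambda>_. \<Phi>)"
    by (rule dbounded_subset[OF dbounded_reindex[OF \<Phi>d]]) auto
  have y1: "dbounded k ?D (\<lambda>_ _. 1 * 1) (\<lambda>j x. \<Phi> x * (1 / sqrt (?s j x)))"
    by (rule dbounded_bilinear[where D="?D", OF bounded_bilinear_mult op _ _ \<Phi>d' y]) auto
  have "dbounded k ?D (\<lambda>_ _. 1) mm"
  proof (rule dbounded_cong[where D="?D", OF op _ y1[unfolded mult_1_left]])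
    fix j x assume "x \<in> ?D j"
    then have j: "j \<in> J" "x \<in> Q" by (auto split: if_splits)
    then have "T j x \<in> Qs j" by (simp add: Qs_def Ti_T)
    then show "\<Phi> x * (1 / sqrt (?s j x)) = mm j x"
      using \<phi>_eq[OF j(1) _ j(1)] se[OF j(1), of x] j by (simp add: mm_def Ti_T)
  qed
  \<comment> \<open>The estimates hold on \<open>Q\<close> only, but the function vanishes off the
    compact set \<open>S\<close> inside it, so they extend to the whole space.\<close>
  then show ?thesis
    by (rule dbounded_extend[where D="?D" and S="\<lambda>j. if j \<in> J then S else {}", rotated 4])
      (use openQ S_Q compact_imp_closed[OF compact_S] in \<open>auto simp: mm_def \<phi>_zero Ti_T\<close>)
qed

end

text \<open>Of the larger weight, \<open>N\<close> powers pay for the growth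
  \<open>zweight x ^ N\<close>, \<open>M\<close> powers restore the target weight, and the one extra
  power leaves a factor that is small near the origin and near infinity.\<close>

lemma zw_zweight:
  fixes x :: "real^'d::finite"
  assumes "x \<noteq> 0"
  shows "zweight x ^ N * zw M x / zw (N + M + 1) x \<le> 2 ^ (N + 2) / zweight x"
proof -
  define r where "r = max (norm x) (inverse (norm x))"
  have n: "0 < norm x" using assms by simp
  have r1: "0 < r" using n by (auto simp: r_def less_max_iff_disj)
  have zr: "zweight x \<le> 2 * r" by (simp add: zweight_def r_def)
  have pw: "norm x ^ K \<le> r ^ K" "inverse (norm x) ^ K \<le> r ^ K" for K
    by (intro power_mono; simp add: r_def)+
  have a: "zw M x \<le> 2 * r ^ M" using pw[of M] by (simp add: zw_def)
  have b: "r ^ K \<le> zw K x" for K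
    using n by (cases "norm x \<le> inverse (norm x)") (auto simp: zw_def r_def max_def)
  have z0: "0 < zweight x" using zweight_ge1[OF assms] by simp
  have "zweight x ^ Suc N * zw M x \<le> (2 * r) ^ Suc N * (2 * r ^ M)"
    using a zr z0 r1 by (intro mult_mono power_mono) (auto simp: zw_def)
  also have "\<dots> = 2 ^ (N + 2) * r ^ (N + M + 1)" by (simp add: power_mult_distrib power_add)
  also have "\<dots> \<le> 2 ^ (N + 2) * zw (N + M + 1) x" by (intro mult_left_mono b) auto
  finally show ?thesis using z0 zw_pos[OF assms, of "N + M + 1"] by (simp add: field_simps)
qed

lemma norm_bounds_of_zweight:
  fixes x :: "real^'d::finite"
  assumes "x \<noteq> 0" "zweight x < n"
  shows "1 / n < norm x" "norm x < n"
proof -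
  have n: "0 < norm x" using assms by simp
  have i: "0 < inverse (norm x)" using n by simp
  show "norm x < n" using assms(2) i unfolding zweight_def by linarith
  have "inverse (norm x) < n" using assms(2) n unfolding zweight_def by linarith
  moreover have "0 < n" using calculation i by linarith
  ultimately show "1 / n < norm x" using n by (simp add: field_simps)
qed

context frame_setup
begin

section \<open>The multipliers in the original coordinates\<close>

definition ph :: "'j \<Rightarrow> real^'d \<Rightarrow> complex" where "ph j x = of_real (mm j (Ti j x))"

lemma ph_eq: "j \<in> J \<Longrightarrow> ph j x = of_real (\<phi> j x)"
  by (simp add: ph_def mm_def T_Ti)

lemma ph_zero: "Ti j x \<notin> S \<Longrightarrow> ph j x = 0"
  by (simp add: ph_def mm_zero)

lemma ph_Qs: "x \<notin> Qs j \<Longrightarrow> ph j x = 0"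
  using ph_zero S_Q by (auto simp: Qs_def)

lemma smooth_mm: "smooth (mm j)"
  by (rule smoothI) (blast intro: dbounded_reindex[OF mm_dbounded, where g="\<lambda>_. j"])

lemma smooth_ph: "smooth (ph j)"
  unfolding ph_def[abs_def] Ti_def
  by (intro smooth_linear[OF bounded_linear_of_real] smooth_diag smooth_mm)

lemma continuous_on_T: "continuous_on X (T j)" and continuous_on_Ti: "continuous_on X (Ti j)"
  unfolding T_def[abs_def] Ti_def[abs_def] by (intro continuous_intros)+

lemma open_Qs: "open (Qs j)"
proof -
  have "Qs j = Ti j -` Q" by (auto simp: Qs_def)
  then show ?thesis using openQ continuous_on_Ti[of UNIV j] by (simp add: open_vimage)
qed

definition TS :: "'j \<Rightarrow> (real^'d) set" where "TS j = {x. Ti j x \<in> S}"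

lemma TS_props:
  assumes "j \<in> J"
  shows "compact (TS j)" "0 \<notin> TS j" "TS j \<subseteq> Qs j" "\<And>x. x \<notin> TS j \<Longrightarrow> ph j x = 0"
proof -
  have "TS j = T j ` S"
  proof (intro set_eqI iffI)
    fix x assume "x \<in> TS j"
    then show "x \<in> T j ` S" by (intro image_eqI[of _ _ "Ti j x"]) (simp_all add: TS_def T_Ti[OF assms])
  qed (auto simp: TS_def Ti_T[OF assms])
  then show "compact (TS j)" using compact_continuous_image[OF continuous_on_T compact_S] by simp
  show "TS j \<subseteq> Qs j" using S_Q by (auto simp: TS_def Qs_def)
  then show "0 \<notin> TS j" using Qs_nz[OF assms] by blast
  show "\<And>x. x \<notin> TS j \<Longrightarrow> ph j x = 0" using ph_zero by (simp add: TS_def)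
qed

lemma ph_ccinf0: "j \<in> J \<Longrightarrow> ph j \<in> ccinf0"
  unfolding ccinf0_def mem_Collect_eq by (intro conjI smooth_ph exI[of _ "TS j"] allI impI) (use TS_props in auto)

lemma ph2_ccinf0: "j \<in> J \<Longrightarrow> (\<lambda>x. ph j x * ph j x) \<in> ccinf0"
  by (intro ccinf0_mult smooth_ph ph_ccinf0)

lemma phi2_eq: "j \<in> J \<Longrightarrow> (\<lambda>\<zeta>. complex_of_real ((\<phi> j \<zeta>)\<^sup>2)) = (\<lambda>x. ph j x * ph j x)"
  by (simp add: ph_eq power2_eq_square)

text \<open>Moderateness compares \<open>h\<close> at the centre with \<open>h\<close> at a point of
  \<open>Qs j\<close>, the hybrid lower bound makes the latter at least a power of the quasi-norm
  near the origin, and the quasi-norm is compared with the Euclidean norm. The inverse scales are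
  inverse powers of \<open>\<delta> * h (\<xi> j)\<close> with exponents at most the
  dimension.\<close>

lemma inv_scale_bound: "\<exists>C N. 1 \<le> C \<and> (\<forall>j\<in>J. \<forall>x\<in>Qs j. \<forall>i. \<iota> j $ i \<le> C * zweight x ^ N)"
proof -
  obtain c r where cr: "0 < c" "0 \<le> r" "\<And>x. x \<noteq> 0 \<Longrightarrow> c * min 1 (aniso_norm a x powr r) \<le> h x"
    using hybrid_lower_bound[OF an hy] by metis
  define \<alpha> where "\<alpha> = Min (range (($) a))"
  have al: "\<alpha> \<le> a $ i" for i by (simp add: \<alpha>_def)
  have al0: "0 < \<alpha>" using a_pos by (simp add: \<alpha>_def)
  define K where "K = max 1 (R / (\<delta> * c))"
  \<comment> \<open>An inverse \<open>r\<close>-th power of the quasi-norm costs the power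
    \<open>r / \<alpha>\<close> of 1 / |x|, rounded up to a natural number.\<close>
  define N1 where "N1 = nat \<lceil>r / \<alpha>\<rceil>"
  have K1: "1 \<le> K" by (simp add: K_def)
  have N1: "r / \<alpha> \<le> real N1" by (simp add: N1_def) linarith
  have "\<iota> j $ i \<le> K ^ CARD('d) * zweight x ^ (N1 * CARD('d))" if j: "j \<in> J" and x: "x \<in> Qs j" for j x i
  proof -
    have x0: "x \<noteq> 0" by (rule Qs_nz[OF j x])
    define y where "y = \<delta> * h (\<xi> j)"
    define t where "t = aniso_norm a x"
    have t: "0 < t" using aniso_norm_pos[OF an x0] by (simp add: t_def)
    have y: "0 < y" using \<delta> h_pos[OF \<xi>_nz[OF j]] by (simp add: y_def)
    have z1: "1 \<le> zweight x" by (rule zweight_ge1[OF x0])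
    have m: "1 / min 1 (t powr r) \<le> zweight x ^ N1"
    proof (cases "1 \<le> t")
      case True
      then have "1 \<le> t powr r" using cr(2) by (simp add: ge_one_powr_ge_zero)
      then show ?thesis using z1 by (simp add: min_def one_le_power)
    next
      case False
      have "t powr r \<le> 1" using t False cr(2) by (intro powr_le1) auto
      then have "1 / min 1 (t powr r) = (1 / t) powr r" using t by (simp add: min_def powr_divide)
      also have "\<dots> = ((1 / t) powr \<alpha>) powr (r / \<alpha>)" using al0 by (simp add: powr_powr)
      also have "\<dots> \<le> (1 / norm x) powr (r / \<alpha>)"
        using aniso_norm_lower[OF an x0 al] False al0 cr(2) t by (intro powr_mono2) (auto simp: t_def)
      also have "\<dots> \<le> zweight x powr (r / \<alpha>)"
        using al0 cr(2) inverse_norm_le_zweight[of x] by (intro powr_mono2) (auto simp: field_simps)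
      also have "\<dots> \<le> zweight x powr real N1" by (intro powr_mono N1 z1)
      finally show ?thesis using z1 by (simp add: powr_realpow)
    qed
    have mp: "0 < min 1 (t powr r)" using t by simp
    have "c * min 1 (t powr r) \<le> R * h (\<xi> j)"
      using cr(3)[OF x0] h_ratio_pt(2)[OF j x] unfolding t_def by linarith
    then have "\<delta> * (c * min 1 (t powr r)) \<le> R * y" using \<delta> by (simp add: y_def mult.left_commute)
    then have "1 / y \<le> R / (\<delta> * c) * (1 / min 1 (t powr r))"
      using y mp \<delta> cr(1) by (simp add: field_simps)
    also have "\<dots> \<le> K * zweight x ^ N1" using m mp K1 by (intro mult_mono) (auto simp: K_def)
    finally have yb: "1 / y \<le> K * zweight x ^ N1" .
    \<comment> \<open>The base has to be at least 1 before the exponent \<open>a $ i\<close> may be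
      raised to the dimension.\<close>
    have b1: "1 \<le> K * zweight x ^ N1" using mult_mono[OF K1 one_le_power[OF z1, of N1]] K1 by simp
    have "\<iota> j $ i = (1 / y) powr (a $ i)" using y by (simp add: \<iota>_def \<tau>_def y_def powr_divide)
    also have "\<dots> \<le> (K * zweight x ^ N1) powr (a $ i)"
      using y yb a_pos[of i] by (intro powr_mono2) auto
    also have "\<dots> \<le> (K * zweight x ^ N1) powr real CARD('d)" by (intro powr_mono a_le b1)
    also have "\<dots> = K ^ CARD('d) * zweight x ^ (N1 * CARD('d))"
      using b1 K1 z1 by (simp add: powr_realpow power_mult_distrib power_mult)
    finally show ?thesis .
  qed
  moreover have "1 \<le> K ^ CARD('d)" using K1 by (simp add: one_le_power)
  ultimately show ?thesis by blast
qed

text \<open>Undoing the coordinates of \<open>j\<close> costs at most one inverse scale per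
  derivative, and inverse scales grow no faster than a power of \<open>zweight\<close>. The exponent
  depends on \<open>k\<close> but not on \<open>j\<close>.\<close>

lemma ph_dbounded: "\<exists>M. dbounded k (\<lambda>_. UNIV) (\<lambda>_ x. zweight x ^ M) ph"
proof -
  obtain C N where C: "1 \<le> C" "\<forall>j\<in>J. \<forall>x\<in>Qs j. \<forall>i. \<iota> j $ i \<le> C * zweight x ^ N"
    using inv_scale_bound by blast
  define K where "K j = 1 + (\<Sum>i\<in>UNIV. \<bar>\<iota> j $ i\<bar>)" for j
  have K1: "1 \<le> K j" for j by (simp add: K_def sum_nonneg)
  have ik: "\<bar>\<iota> j $ i\<bar> \<le> K j" for i j
    using member_le_sum[of i UNIV "\<lambda>i. \<bar>\<iota> j $ i\<bar>"] by (simp add: K_def)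
  let ?D = "\<lambda>j. if j \<in> J then Q else {}"
  let ?E = "\<lambda>j. if j \<in> J then Qs j else {}"
  define B where "B = (1 + real CARD('d) * C) ^ k"
  have "dbounded k (\<lambda>j. {x. dil (\<iota> j) x + - dil (\<iota> j) (b j) \<in> ?D j})
     (\<lambda>j x. K j ^ k * 1) (\<lambda>j x. mm j (dil (\<iota> j) x + - dil (\<iota> j) (b j)))"
    by (rule dbounded_diag[where D="?D"]) (use openQ ik K1 dbounded_subset[OF mm_dbounded subset_UNIV] in auto)
  then have "dbounded k ?E (\<lambda>j x. K j ^ k * 1) (\<lambda>j x. mm j (Ti j x))"
    unfolding Ti_def[symmetric] by (rule dbounded_subset) (auto simp: Qs_def)
  then have "dbounded k ?E (\<lambda>j x. zweight x ^ (N * k)) (\<lambda>j x. mm j (Ti j x))"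
  proof (rule dbounded_weight[rotated 2])
    fix j x assume x: "x \<in> ?E j"
    show "0 \<le> K j ^ k * 1" using K1[of j] by simp
    have j: "j \<in> J" "x \<in> Qs j" using x by (auto split: if_splits)
    have z1: "1 \<le> zweight x ^ N" by (intro one_le_power zweight_ge1 Qs_nz[OF j])
    have "\<bar>\<iota> j $ i\<bar> \<le> C * zweight x ^ N" for i using C(2) j \<tau>_pos[OF j(1), of i] by (simp add: \<iota>_def)
    then have "(\<Sum>i\<in>UNIV. \<bar>\<iota> j $ i\<bar>) \<le> (\<Sum>i\<in>(UNIV::'d set). C * zweight x ^ N)" by (intro sum_mono)
    then have "K j \<le> zweight x ^ N + real CARD('d) * C * zweight x ^ N" using z1 by (simp add: K_def)
    then have "K j \<le> (1 + real CARD('d) * C) * zweight x ^ N" by (simp add: algebra_simps)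
    then have "K j ^ k \<le> ((1 + real CARD('d) * C) * zweight x ^ N) ^ k" using K1[of j] by (intro power_mono) auto
    then show "K j ^ k * 1 \<le> B * zweight x ^ (N * k)" by (simp add: power_mult_distrib power_mult B_def)
  qed
  then have "dbounded k (\<lambda>_. UNIV) (\<lambda>j x. zweight x ^ (N * k)) (\<lambda>j x. mm j (Ti j x))"
  proof (rule dbounded_extend[where D="?E" and S="\<lambda>j. if j \<in> J then TS j else {}", rotated 4])
    fix j x assume "x \<notin> (if j \<in> J then TS j else {})"
    then show "mm j (Ti j x) = 0" by (cases "j \<in> J") (simp add: TS_def mm_zero, simp add: mm_def)
  qed (use open_Qs TS_props(3) compact_imp_closed[OF TS_props(1)] in auto)
  then have "dbounded k (\<lambda>_. UNIV) (\<lambda>j x. zweight x ^ (N * k)) ph"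
    unfolding ph_def[abs_def] by (intro dbounded_linear[OF bounded_linear_of_real]) auto
  then show ?thesis by blast
qed

text \<open>Compactness selects finitely many of the open sets built from \<open>P\<close>; an index
  whose set meets \<open>K\<close> shares a point with one of them and is therefore among its
  neighbours.\<close>

lemma locally_finite:
  assumes "compact K" "0 \<notin> K"
  shows "finite {j\<in>J. Qs j \<inter> K \<noteq> {}}"
proof -
  have op: "open {x. Ti j x \<in> P}" for j
    using open_vimage[OF openP continuous_on_Ti[of UNIV j]] by (simp add: vimage_def)
  have c: "K \<subseteq> (\<Union>j\<in>J. {x. Ti j x \<in> P})"
  proof
    fix x assume "x \<in> K"
    then have "x \<noteq> 0" using assms(2) by metis
    then show "x \<in> (\<Union>j\<in>J. {x. Ti j x \<in> P})" using P_covers[of x] by simp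
  qed
  obtain J0 where J0: "J0 \<subseteq> J" "finite J0" "K \<subseteq> (\<Union>j\<in>J0. {x. Ti j x \<in> P})"
    by (rule compactE_image[OF assms(1) _ c]) (use op in auto)
  have "{j\<in>J. Qs j \<inter> K \<noteq> {}} \<subseteq> (\<Union>i\<in>J0. nb i)"
  proof
    fix j assume j: "j \<in> {j\<in>J. Qs j \<inter> K \<noteq> {}}"
    then obtain x where x: "x \<in> Qs j" "x \<in> K" by blast
    then obtain i where i: "i \<in> J0" "Ti i x \<in> P" using J0 by blast
    then have "x \<in> Qs i" using PQ by (auto simp: Qs_def)
    then show "j \<in> (\<Union>i\<in>J0. nb i)" using i x j by (auto simp: nb_def)
  qed
  moreover have "finite (\<Union>i\<in>J0. nb i)" using J0 fin_nb by blast
  ultimately show ?thesis by (rule finite_subset)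
qed

text \<open>Indices of \<open>F\<close> whose sets miss \<open>x\<close> contribute zero. Adjoining
  the neighbours of a set containing \<open>x\<close> reduces the claim to the finite partition
  identity.\<close>

lemma ph_sum1:
  assumes x: "x \<noteq> 0" and F: "finite F" "F \<subseteq> J" "\<And>k. k \<in> J \<Longrightarrow> x \<in> Qs k \<Longrightarrow> k \<in> F"
  shows "(\<Sum>k\<in>F. ph k x * ph k x) = 1"
proof -
  obtain j where j: "j \<in> J" "x \<in> Qs j" using P_covers[OF x] PQ by (auto simp: Qs_def)
  have "(\<Sum>k\<in>F. ph k x * ph k x) = (\<Sum>k\<in>F \<union> nb j. ph k x * ph k x)"
  proof (rule sum.mono_neutral_left)
    show "\<forall>i\<in>F \<union> nb j - F. ph i x * ph i x = 0"
    proof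
      fix i assume "i \<in> F \<union> nb j - F"
      then have "i \<in> J" "i \<notin> F" using nb_J by auto
      then have "x \<notin> Qs i" using F(3) by blast
      then show "ph i x * ph i x = 0" by (simp add: ph_Qs)
    qed
  qed (use F fin_nb[OF j(1)] in auto)
  also have "\<dots> = of_real (\<Sum>k\<in>F \<union> nb j. (\<phi> k x)\<^sup>2)"
    unfolding of_real_sum
  proof (rule sum.cong[OF refl])
    fix k assume "k \<in> F \<union> nb j"
    then have "k \<in> J" using F(2) by (auto simp: nb_def)
    then show "ph k x * ph k x = of_real ((\<phi> k x)\<^sup>2)" by (simp add: ph_eq power2_eq_square)
  qed
  also have "\<dots> = 1"
    by (subst \<phi>_sum1[OF j]) (use F(1,2) fin_nb[OF j(1)] in \<open>auto simp: nb_def\<close>)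
  finally show ?thesis .
qed

text \<open>The constant must not depend on \<open>F\<close>. On \<open>Qs j\<close> only the
  indices in \<open>F \<inter> nb j\<close> contribute, and their number is bounded; their
  derivatives cost powers of \<open>zweight\<close>, which the vanishing of \<open>m\<close> at the
  origin and its decay at infinity pay for.\<close>

lemma remainder_bound:
  assumes m: "m \<in> Z0"
  obtains C where "0 \<le> C" "\<And>F is x. finite F \<Longrightarrow> F \<subseteq> J \<Longrightarrow> length is \<le> M \<Longrightarrow> x \<noteq> 0 \<Longrightarrow>
    norm (partials is (\<lambda>x. (1 - (\<Sum>k\<in>F. ph k x * ph k x)) * m x) x) * zw M x \<le> C / zweight x"
proof -
  obtain L where L: "dbounded M (\<lambda>_. UNIV) (\<lambda>_ x. zweight x ^ L) ph" using ph_dbounded by blast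
  \<comment> \<open>Order \<open>L + L\<close> covers the two factors of each square,
    \<open>M\<close> the weight of the conclusion, and 1 the gain of \<open>zweight\<close>.\<close>
  obtain B where B: "zbound (L + L + M + 1) m B" using m by (auto simp: Z0_def)
  obtain N where N: "\<And>j. j \<in> J \<Longrightarrow> finite (nb j) \<and> card (nb j) \<le> N" using nb_bound by blast
  let ?D = "\<lambda>(F,j). if finite F \<and> F \<subseteq> J \<and> j \<in> J then Qs j else {}"
  let ?I = "\<lambda>(F,j). if finite F \<and> F \<subseteq> J \<and> j \<in> J then F \<inter> nb j else {}"
  let ?w = "\<lambda>x. zweight x ^ L * zweight x ^ L :: real"
  have op: "open (?D i)" for i using open_Qs by (cases i) auto
  have Dnz: "x \<noteq> 0" if "x \<in> ?D i" for x i using that Qs_nz by (cases i) (auto split: if_splits)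
  have L2: "dbounded M (\<lambda>_. UNIV) (\<lambda>_. ?w) (\<lambda>k x. ph k x * ph k x)"
    by (rule dbounded_bilinear[OF bounded_bilinear_mult _ _ _ L L]) auto
  have "dbounded M (\<lambda>(k,i). if k \<in> ?I i then ?D i else {}) (\<lambda>(k,i). ?w) (\<lambda>(k,i) x. ph k x * ph k x)"
    using dbounded_subset[OF dbounded_reindex[OF L2, where g=fst] subset_UNIV] by (simp add: split_def)
  then have s1: "dbounded M ?D (\<lambda>_. ?w) (\<lambda>i x. \<Sum>k\<in>?I i. ph k x * ph k x)"
  proof (rule dbounded_sum[where N=N, OF op, rotated 3])
    fix i show "finite (?I i)" using N by (cases i) auto
    show "card (?I i) \<le> N"
    proof (cases i)
      case (Pair F j)
      have "card (F \<inter> nb j) \<le> N" if "j \<in> J" using N[OF that] card_mono[of "nb j" "F \<inter> nb j"] by auto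
      then show ?thesis using Pair by simp
    qed
  qed simp
  have s2: "dbounded M ?D (\<lambda>_. ?w) (\<lambda>i x. - (\<Sum>k\<in>?I i. ph k x * ph k x))"
    by (rule dbounded_linear[OF bounded_linear_minus[OF bounded_linear_ident] op _ s1]) auto
  have c1: "dbounded M ?D (\<lambda>_. ?w) (\<lambda>i x. 1 :: complex)"
  proof (rule dbounded_const[where C=1])
    fix i x assume "x \<in> ?D i"
    then have "1 \<le> zweight x ^ L" by (intro one_le_power zweight_ge1 Dnz)
    then have "1 * 1 \<le> ?w x" by (intro mult_mono) auto
    then show "norm (1::complex) \<le> 1 * ?w x" by simp
  qed
  have g: "dbounded M ?D (\<lambda>_. ?w) (\<lambda>i x. 1 + - (\<Sum>k\<in>?I i. ph k x * ph k x))"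
    by (rule dbounded_add[OF op c1 s2])
  have mD: "dbounded M ?D (\<lambda>_ x. B / zw (L + L + M + 1) x) (\<lambda>_. m)"
  proof (rule dboundedI)
    fix "is" :: "'d list" assume l: "length is \<le> M"
    show "\<exists>C. \<forall>i. \<forall>x\<in>?D i. norm (partials is m x) \<le> C * (B / zw (L + L + M + 1) x)"
    proof (intro exI[of _ 1] allI ballI)
      fix i x assume "x \<in> ?D i"
      then have "x \<noteq> 0" by (rule Dnz)
      then show "norm (partials is m x) \<le> 1 * (B / zw (L + L + M + 1) x)"
        using B[unfolded zbound_def, rule_format, of "is" x] l zw_pos[of x "L + L + M + 1"] by (simp add: pos_le_divide_eq)
    qed
  qed (use Z0_smooth[OF m] smooth_partials in blast)
  have B0: "0 \<le> B" by (rule zbound_nonneg[OF B])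
  have v0: "0 \<le> B / zw (L + L + M + 1) x" if "x \<in> ?D i" for x i
    by (intro divide_nonneg_pos B0 zw_pos Dnz[OF that])
  have gm: "dbounded M ?D (\<lambda>_ x. ?w x * (B / zw (L + L + M + 1) x)) (\<lambda>i x. (1 + - (\<Sum>k\<in>?I i. ph k x * ph k x)) * m x)"
    by (rule dbounded_bilinear[where D="?D", OF bounded_bilinear_mult op _ v0 g mD]) auto
  have rm: "dbounded M ?D (\<lambda>_ x. ?w x * (B / zw (L + L + M + 1) x)) (\<lambda>(F,j) x. (1 - (\<Sum>k\<in>F. ph k x * ph k x)) * m x)"
  \<comment> \<open>On \<open>Qs j\<close> the full sum over \<open>F\<close> agrees with the sum
    over the neighbours in \<open>F\<close>, as all other terms vanish there.\<close>
  proof (rule dbounded_cong[where D="?D", OF op _ gm])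
    fix i x assume x: "x \<in> ?D i"
    obtain F j where i: "i = (F,j)" by (cases i)
    have F: "finite F" "F \<subseteq> J" "j \<in> J" "x \<in> Qs j" using x i by (auto split: if_splits)
    have "(\<Sum>k\<in>F. ph k x * ph k x) = (\<Sum>k\<in>F \<inter> nb j. ph k x * ph k x)"
    proof (rule sum.mono_neutral_right)
      show "\<forall>k\<in>F - F \<inter> nb j. ph k x * ph k x = 0"
        using F ph_Qs by (auto simp: nb_def)
    qed (use F in auto)
    then show "(1 + - (\<Sum>k\<in>?I i. ph k x * ph k x)) * m x = (case i of (F,j) \<Rightarrow> \<lambda>x. (1 - (\<Sum>k\<in>F. ph k x * ph k x)) * m x) x"
      using F i by simp
  qed
  show thesis
  proof (rule dbounded_partials_unif[OF rm])
    fix i x assume "x \<in> ?D i"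
    then show "0 \<le> ?w x * (B / zw (L + L + M + 1) x)" using v0 by (intro mult_nonneg_nonneg) auto
  next
    fix C assume C: "0 \<le> C" "\<And>is i x. length is \<le> M \<Longrightarrow> x \<in> ?D i \<Longrightarrow>
      norm (partials is ((\<lambda>(F,j) x. (1 - (\<Sum>k\<in>F. ph k x * ph k x)) * m x) i) x) \<le> C * (?w x * (B / zw (L + L + M + 1) x))"
    show thesis
    proof (rule that[of "C * B * 2 ^ (L + L + 2)"])
      show "0 \<le> C * B * 2 ^ (L + L + 2)" using C B0 by simp
      fix F :: "'j set" and "is" :: "'d list" and x :: "real^'d" assume F: "finite F" "F \<subseteq> J" and l: "length is \<le> M" and x: "x \<noteq> 0"
      obtain j where j: "j \<in> J" "x \<in> Qs j" using P_covers[OF x] PQ by (auto simp: Qs_def)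
      have "norm (partials is (\<lambda>x. (1 - (\<Sum>k\<in>F. ph k x * ph k x)) * m x) x) \<le> C * (?w x * (B / zw (L + L + M + 1) x))"
        using C(2)[OF l, of x "(F,j)"] F j by simp
      then have "norm (partials is (\<lambda>x. (1 - (\<Sum>k\<in>F. ph k x * ph k x)) * m x) x) * zw M x \<le> C * (?w x * (B / zw (L + L + M + 1) x)) * zw M x"
        by (rule mult_right_mono) (simp add: zw_def)
      also have "\<dots> = C * B * (zweight x ^ (L + L) * zw M x / zw (L + L + M + 1) x)" by (simp add: power_add)
      also have "\<dots> \<le> C * B * (2 ^ (L + L + 2) / zweight x)"
        using C B0 by (intro mult_left_mono zw_zweight x) auto
      finally show "norm (partials is (\<lambda>x. (1 - (\<Sum>k\<in>F. ph k x * ph k x)) * m x) x) * zw M x \<le> C * B * 2 ^ (L + L + 2) / zweight x" by simp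
    qed
  qed
qed

text \<open>Where \<open>zweight\<close> is below \<open>n\<close>, a large enough finite set of
  indices makes the remainder vanish with all derivatives; elsewhere the gain in
  \<open>remainder_bound\<close> makes it at most \<open>C' / n\<close>. Together this bounds the
  remainder in the norm that controls \<open>f\<close>.\<close>

lemma ph2_has_sum:
  assumes f: "f \<in> dist_mod_poly" and t: "\<theta> \<in> S0"
  shows "((\<lambda>j. multiplier (\<lambda>x. ph j x * ph j x) f \<theta>) has_sum f \<theta>) J"
proof -
  define m where "m = inv_fourier \<theta>"
  have m: "m \<in> Z0" unfolding m_def by (rule inv_fourier_S0[OF t])
  have fm: "fourier m = \<theta>" using fourier_inversion' t by (auto simp: m_def S0_def)
  obtain M C where C: "0 \<le> C" "\<And>m B. m \<in> Z0 \<Longrightarrow> zbound M m B \<Longrightarrow> norm (f (fourier m)) \<le> C * B"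
    using dist_fourier_bound[OF f] by metis
  obtain C' where C': "0 \<le> C'" "\<And>F is x. finite F \<Longrightarrow> F \<subseteq> J \<Longrightarrow> length is \<le> M \<Longrightarrow> x \<noteq> 0 \<Longrightarrow>
    norm (partials is (\<lambda>x. (1 - (\<Sum>k\<in>F. ph k x * ph k x)) * m x) x) * zw M x \<le> C' / zweight x"
    using remainder_bound[OF m, of M] by blast
  have zj: "(\<lambda>x. ph j x * ph j x * m x) \<in> Z0" if "j \<in> J" for j
    by (rule ccinf0_Z0[OF ccinf0_mult(1)[OF Z0_smooth[OF m] ph2_ccinf0[OF that]]])
  show ?thesis
    unfolding has_sum_def
  proof (rule tendstoI)
    fix e :: real assume e: "0 < e"
    \<comment> \<open>Chosen so that the final bound \<open>C * C' / n\<close> is below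
      \<open>e\<close>; the summand 1 keeps \<open>n\<close> positive when the constants
      vanish.\<close>
    define n where "n = 1 + C * C' / e"
    have n: "0 < n" "C * C' / n < e"
    proof -
      show n0: "0 < n" unfolding n_def using C C' e by (intro add_pos_nonneg) auto
      have "C * C' = (n - 1) * e" using e by (simp add: n_def)
      also have "\<dots> < n * e" using e by simp
      finally show "C * C' / n < e" using n0 by (simp add: field_simps)
    qed
    \<comment> \<open>The closed annulus contains all nonzero points with \<open>zweight\<close>
      below \<open>n\<close>.\<close>
    define K where "K = cball (0::real^'d) n - ball 0 (1 / n)"
    have K: "compact K" "0 \<notin> K" using n by (auto simp: K_def intro!: compact_diff)
    define F0 where "F0 = {j\<in>J. Qs j \<inter> K \<noteq> {}}"
    have F0: "finite F0" "F0 \<subseteq> J" using locally_finite[OF K] by (auto simp: F0_def)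
    have "dist (\<Sum>j\<in>F. multiplier (\<lambda>x. ph j x * ph j x) f \<theta>) (f \<theta>) < e" if F: "finite F" "F0 \<subseteq> F" "F \<subseteq> J" for F
    proof -
      let ?r = "\<lambda>x. (1 - (\<Sum>k\<in>F. ph k x * ph k x)) * m x"
      let ?g = "\<lambda>x. \<Sum>k\<in>F. ph k x * ph k x * m x"
      have gZ: "?g \<in> Z0" by (rule Z0_sum) (use zj F in auto)
      have re: "?r = (\<lambda>x. m x + - 1 * ?g x)" by (intro ext) (simp add: left_diff_distrib sum_distrib_right)
      have rZ: "?r \<in> Z0" unfolding re by (intro Z0_add m Z0_cmult gZ)
      have r0: "?r x = 0" if "x \<in> {x. 1 / n < norm x \<and> norm x < n}" for x
      proof -
        have "x \<noteq> 0" "x \<in> K" using that n by (auto simp: K_def zero_less_divide_1_iff dest: less_trans)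
        then have "(\<Sum>k\<in>F. ph k x * ph k x) = 1" using F by (intro ph_sum1) (auto simp: F0_def)
        then show ?thesis by simp
      qed
      \<comment> \<open>Vanishing on an open annulus, not merely at single points, makes all
        derivatives vanish there.\<close>
      have cl: "closed (- {x::real^'d. 1 / n < norm x \<and> norm x < n})"
        by (intro closed_Compl open_Collect_conj open_Collect_less continuous_intros)
      have "zbound M ?r (C' / n)"
        unfolding zbound_def
      proof (intro allI impI)
        fix "is" :: "'d list" and x :: "real^'d" assume l: "length is \<le> M" and x: "x \<noteq> 0"
        show "norm (partials is ?r x) * zw M x \<le> C' / n"
        proof (cases "zweight x < n")
          case True
          have "partials is ?r x = 0"
            by (rule partials_outside[OF cl]) (use r0 norm_bounds_of_zweight[OF x True] in auto)
          then show ?thesis using C' n by simp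
        next
          case False
          have "C' / zweight x \<le> C' / n" using False C' n by (intro divide_left_mono) auto
          then show ?thesis using C'(2)[OF F(1,3) l x] by linarith
        qed
      qed
      then have "norm (f (fourier ?r)) \<le> C * (C' / n)" by (rule C(2)[OF rZ])
      then have b: "norm (f (fourier ?r)) < e" using n by simp
      have "f (fourier ?r) = f (fourier m) + - 1 * f (fourier ?g)"
        unfolding re dist_fourier_add[OF f m Z0_cmult[OF gZ]] dist_fourier_cmult[OF f gZ] ..
      also have "f (fourier ?g) = (\<Sum>k\<in>F. f (fourier (\<lambda>x. ph k x * ph k x * m x)))"
        by (rule dist_fourier_sum[OF f]) (use zj F in auto)
      finally show ?thesis using b by (simp add: fm multiplier_eq m_def[symmetric] dist_norm norm_minus_commute)
    qed
    then show "\<forall>\<^sub>F F in finite_subsets_at_top J. dist (\<Sum>j\<in>F. multiplier (\<lambda>x. ph j x * ph j x) f \<theta>) (f \<theta>) < e"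
      unfolding eventually_finite_subsets_at_top by (intro exI[of _ F0] conjI allI impI) (use F0 in auto)
  qed
qed

end

section \<open>Expansion in the frame system\<close>

lemma decay_shift:
  assumes "norm w \<le> \<rho>"
  shows "decay N y \<le> (1 + \<rho>) ^ N * decay N (y + w)"
proof -
  have "decay N y * decay N w \<le> decay N (y + w)" by (rule decay_mult_le)
  then have "decay N y \<le> (1 + norm w) ^ N * decay N (y + w)"
    unfolding decay_def[of N w] by (simp add: divide_inverse[symmetric] pos_divide_le_eq mult.commute)
  also have "\<dots> \<le> (1 + \<rho>) ^ N * decay N (y + w)"
    using assms by (intro mult_right_mono power_mono) auto
  finally show ?thesis .
qed

text \<open>A fixed enumeration of the integer vectors; it gives access to results on series over
  the naturals, such as exchanging a series with an integral.\<close>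

definition latt :: "nat \<Rightarrow> int^'d::finite" where "latt = from_nat_into UNIV"

lemma bij_latt: "bij_betw (latt :: nat \<Rightarrow> int^'d::finite) UNIV UNIV"
  unfolding latt_def
proof (rule bij_betw_from_nat_into)
  have "inj (\<lambda>k::int. (\<chi> i. k) :: int^'d)" by (rule injI) (simp add: vec_eq_iff)
  then show "infinite (UNIV :: (int^'d) set)"
    using infinite_UNIV_int finite_subset[OF subset_UNIV] finite_imageD by blast
qed simp

text \<open>The lattice points are corners of disjoint boxes of equal volume, and the weight at a
  corner is at most a multiple of the weight anywhere in the box. The sum is thus at most a multiple
  of the integral over the whole space, whatever the shift \<open>y\<close>.\<close>

lemma lattice_sum_nn:
  assumes l: "0 < l"
  obtains C where "0 \<le> C"
    "\<And>y::real^'d::finite. (\<Sum>i. ennreal (decay (2 * CARD('d)) (y + freq l (latt i)))) \<le> ennreal C"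
proof -
  let ?N = "2 * CARD('d)"
  define c :: "real^'d" where "c = (\<chi> i. pi / l)"
  define B where "B i = box (freq l (latt i)) (freq l (latt i) + c)" for i
  define v where "v = (pi / l) ^ CARD('d)"
  have v: "0 < v" using l by (simp add: v_def)
  have emB: "emeasure lborel (B i) = ennreal v" for i
  proof -
    have cb: "0 \<le> c \<bullet> b" if "b \<in> Basis" for b
      using that l by (auto simp: Basis_vec_def inner_axis c_def)
    have "emeasure lborel (B i) = ennreal (\<Prod>b\<in>Basis. c \<bullet> b)"
      unfolding B_def by (subst emeasure_lborel_box) (use cb in \<open>auto simp: inner_add_left\<close>)
    also have "(\<Prod>b\<in>Basis. c \<bullet> b) = v" by (simp add: prod_Basis_cart inner_axis c_def v_def)
    finally show ?thesis .
  qed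
  have dis: "disjoint_family B"
    unfolding disjoint_family_on_def
  proof (intro ballI impI)
    fix m n :: nat assume "m \<noteq> n"
    then have "(latt m :: int^'d) \<noteq> latt n" using bij_latt by (metis UNIV_I bij_betw_def inj_on_def)
    then obtain k where k: "(latt m :: int^'d) $ k \<noteq> latt n $ k" by (auto simp: vec_eq_iff)
    have "x \<notin> B n" if "x \<in> B m" for x
    proof
      assume "x \<in> B n"
      with that have h: "pi / l * real_of_int (latt m $ k) < x $ k" "x $ k < pi / l * real_of_int (latt m $ k) + pi / l"
         "pi / l * real_of_int (latt n $ k) < x $ k" "x $ k < pi / l * real_of_int (latt n $ k) + pi / l"
        by (auto simp: B_def mem_box_cart freq_def c_def)
      have "pi / l * real_of_int (latt m $ k) < pi / l * (real_of_int (latt n $ k) + 1)"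
        "pi / l * real_of_int (latt n $ k) < pi / l * (real_of_int (latt m $ k) + 1)"
        using h by (simp_all add: distrib_left)
      then have "real_of_int (latt m $ k) < real_of_int (latt n $ k) + 1" "real_of_int (latt n $ k) < real_of_int (latt m $ k) + 1"
        using l by (simp_all add: divide_less_cancel)
      then show False using k by linarith
    qed
    then show "B m \<inter> B n = {}" by blast
  qed
  define K where "K = (1 + norm c) ^ ?N"
  have K0: "0 \<le> K" by (simp add: K_def)
  have ptw: "decay ?N (y + freq l (latt i)) \<le> K * decay ?N (y + x)" if "x \<in> B i" for x y i
  proof -
    have "norm (x - freq l (latt i)) \<le> norm c"
      by (rule norm_le_componentwise_cart) (use that in \<open>auto simp: B_def mem_box_cart less_imp_le abs_le_iff, smt (verit)\<close>)
    from decay_shift[OF this, of ?N "y + freq l (latt i)"] show ?thesis by (simp add: K_def)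
  qed
  define I where "I = (\<integral>\<^sup>+x. ennreal (decay ?N (x::real^'d)) \<partial>lborel)"
  have "I < \<infinity>" unfolding I_def by (rule nn_integral_decay_finite)
  then obtain r where r: "0 \<le> r" "I = ennreal r" by (cases I) auto
  have fin: "(\<Sum>i. ennreal (decay ?N (y + freq l (latt i)))) \<le> ennreal (K * r / v)" for y :: "real^'d"
  proof -
    let ?s = "\<Sum>i. ennreal (decay ?N (y + freq l (latt i)))"
    have "ennreal v * ?s = (\<Sum>i. ennreal v * ennreal (decay ?N (y + freq l (latt i))))" by simp
    also have "\<dots> = (\<Sum>i. \<integral>\<^sup>+x\<in>B i. ennreal (decay ?N (y + freq l (latt i))) \<partial>lborel)"
      using emB by (subst nn_integral_cmult_indicator) (auto simp: B_def mult.commute)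
    also have "\<dots> \<le> (\<Sum>i. \<integral>\<^sup>+x\<in>B i. ennreal (K * decay ?N (y + x)) \<partial>lborel)"
      by (intro suminf_le summableI nn_integral_mono) (auto simp: indicator_def intro!: ennreal_leI ptw)
    also have "\<dots> = (\<integral>\<^sup>+x\<in>(\<Union>i. B i). ennreal (K * decay ?N (y + x)) \<partial>lborel)"
      by (rule nn_integral_disjoint_family[symmetric]) (auto simp: B_def dis[unfolded B_def])
    also have "\<dots> \<le> (\<integral>\<^sup>+x. ennreal (K * decay ?N (y + x)) \<partial>lborel)"
      by (intro nn_integral_mono) (auto simp: indicator_def)
    also have "\<dots> = ennreal K * (\<integral>\<^sup>+x. ennreal (decay ?N (y + x)) \<partial>lborel)"
      using K0 by (simp add: ennreal_mult nn_integral_cmult)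
    also have "(\<integral>\<^sup>+x. ennreal (decay ?N (y + x)) \<partial>lborel) = I"
      using nn_integral_dil[of "\<chi> i. 1" "\<lambda>x. ennreal (decay ?N (x::real^'d))" y] by (simp add: I_def add.commute)
    finally have "ennreal v * ?s \<le> ennreal (K * r)" using r K0 by (simp add: ennreal_mult)
    then have "ennreal (1 / v) * (ennreal v * ?s) \<le> ennreal (1 / v) * ennreal (K * r)" by (rule mult_left_mono) simp
    moreover have "ennreal (1 / v) * (ennreal v * ?s) = ?s" using v by (simp add: mult.assoc[symmetric] ennreal_mult[symmetric])
    moreover have "ennreal (1 / v) * ennreal (K * r) = ennreal (K * r / v)" using v K0 r by (simp add: ennreal_mult[symmetric])
    ultimately show ?thesis by simp
  qed
  show thesis by (rule that[OF _ fin]) (use K0 r v in simp)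
qed

lemma lattice_sum:
  assumes l: "0 < l"
  obtains C where "0 \<le> C"
    "\<And>y::real^'d::finite. summable (\<lambda>i. decay (2 * CARD('d)) (y + freq l (latt i)))"
    "\<And>y::real^'d::finite. (\<Sum>i. decay (2 * CARD('d)) (y + freq l (latt i))) \<le> C"
proof -
  obtain C where C: "0 \<le> C" "\<And>y::real^'d. (\<Sum>i. ennreal (decay (2 * CARD('d)) (y + freq l (latt i)))) \<le> ennreal C"
    using lattice_sum_nn[OF l] by blast
  have s: "summable (\<lambda>i. decay (2 * CARD('d)) (y + freq l (latt i)))" for y :: "real^'d"
    by (rule summable_suminf_not_top) (use C(2)[of y] in \<open>auto simp: top_unique\<close>)
  have b: "(\<Sum>i. decay (2 * CARD('d)) (y + freq l (latt i))) \<le> C" for y :: "real^'d"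
  proof -
    have "ennreal (\<Sum>i. decay (2 * CARD('d)) (y + freq l (latt i))) \<le> ennreal C"
      using C(2)[of y] by (subst suminf_ennreal2[OF _ s, symmetric]) auto
    then show ?thesis using C(1) by (simp add: ennreal_le_iff)
  qed
  show thesis by (rule that[OF C(1) s b])
qed

lemma summable_on_latt:
  fixes F :: "int^'d::finite \<Rightarrow> real"
  assumes "\<And>n. 0 \<le> F n" "summable (\<lambda>i. F (latt i))"
  shows "F summable_on UNIV"
  using assms summable_on_UNIV_nonneg_real_iff[of "\<lambda>i. F (latt i)"] summable_on_reindex_bij_betw[OF bij_latt, of F] by simp

lemma decay_freq_summable:
  assumes "0 < l"
  shows "(\<lambda>n::int^'d::finite. decay (2 * CARD('d)) (freq l n)) summable_on UNIV"
proof -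
  obtain C where C: "\<And>y::real^'d. summable (\<lambda>i. decay (2 * CARD('d)) (y + freq l (latt i)))"
    using lattice_sum[OF assms] by blast
  show ?thesis by (rule summable_on_latt) (use C[of 0] in auto)
qed

text \<open>The fixed function \<open>m\<close> supplies the vanishing, while the family
  \<open>G\<close> has to be controlled only on the open set \<open>U\<close> around the support of
  \<open>m\<close>. The numbers \<open>w i\<close> pass through linearly, so if they tend to 0 the
  products do so in the \<open>M\<close>-th norm.\<close>

lemma family_zbound:
  fixes m :: "real^'d::finite \<Rightarrow> complex"
  assumes m: "m \<in> Z0" and S: "closed S" "S \<subseteq> U" "open U" "0 \<notin> U" "\<And>x. x \<notin> S \<Longrightarrow> m x = 0"
    and G: "dbounded M (\<lambda>i. if p i then U else {}) (\<lambda>i _. w i) G" and w: "\<And>i. p i \<Longrightarrow> 0 \<le> w i"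
  obtains C where "0 \<le> C" "\<And>i. p i \<Longrightarrow> zbound M (\<lambda>x. m x * G i x) (C * w i)"
proof -
  let ?D = "\<lambda>i. if p i then U else {}"
  obtain B where B: "zbound M m B" using m by (auto simp: Z0_def)
  have B0: "0 \<le> B" by (rule zbound_nonneg[OF B])
  have op: "open (?D i)" for i using S by auto
  have nz: "x \<noteq> 0" if "x \<in> ?D i" for x i using that S by (auto split: if_splits)
  have mD: "dbounded M ?D (\<lambda>_ x. B / zw M x) (\<lambda>_. m)"
  proof (rule dboundedI)
    fix "is" :: "'d list" assume l: "length is \<le> M"
    show "\<exists>C. \<forall>i. \<forall>x\<in>?D i. norm (partials is m x) \<le> C * (B / zw M x)"
    proof (intro exI[of _ 1] allI ballI)
      fix i x assume "x \<in> ?D i"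
      then have "x \<noteq> 0" by (rule nz)
      then show "norm (partials is m x) \<le> 1 * (B / zw M x)"
        using B[unfolded zbound_def, rule_format, of "is" x] l zw_pos[of x M] by (simp add: pos_le_divide_eq)
    qed
  qed (use Z0_smooth[OF m] smooth_partials in blast)
  have v0: "0 \<le> B / zw M x" if "x \<in> ?D i" for x i
    by (intro divide_nonneg_pos B0 zw_pos nz[OF that])
  have w0: "0 \<le> w i" if "x \<in> ?D i" for x i using that w by (auto split: if_splits)
  have d: "dbounded M ?D (\<lambda>i x. B / zw M x * w i) (\<lambda>i x. m x * G i x)"
    by (rule dbounded_bilinear[where D="?D", OF bounded_bilinear_mult op v0 w0 mD G])
  show thesis
  proof (rule dbounded_partials_unif[OF d])
    fix i x assume "x \<in> ?D i"
    then show "0 \<le> B / zw M x * w i" using v0 w0 by (intro mult_nonneg_nonneg) auto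
  next
    fix C assume C: "0 \<le> C" "\<And>is i x. length is \<le> M \<Longrightarrow> x \<in> ?D i \<Longrightarrow>
      norm (partials is (\<lambda>x. m x * G i x) x) \<le> C * (B / zw M x * w i)"
    show thesis
    proof (rule that[of "C * B"])
      show "0 \<le> C * B" using C B0 by simp
      fix i assume i: "p i"
      show "zbound M (\<lambda>x. m x * G i x) (C * B * w i)"
        unfolding zbound_def
      proof (intro allI impI)
        fix "is" :: "'d list" and x :: "real^'d" assume l: "length is \<le> M" and x: "x \<noteq> 0"
        have z: "0 < zw M x" by (rule zw_pos[OF x])
        show "norm (partials is (\<lambda>x. m x * G i x) x) * zw M x \<le> C * B * w i"
        proof (cases "x \<in> U")
          case True
          then have "norm (partials is (\<lambda>x. m x * G i x) x) \<le> C * (B / zw M x * w i)" using C(2)[OF l, of x i] i by simp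
          then show ?thesis using z by (simp add: field_simps)
        next
          case False
          then have "partials is (\<lambda>x. m x * G i x) x = 0"
            by (intro partials_outside[OF S(1)]) (use S in auto)
          then show ?thesis using C B0 w[OF i] by simp
        qed
      qed
    qed
  qed
qed

lemma smooth_cis: "smooth (\<lambda>x::real^'d::finite. cis (x \<bullet> \<zeta>))"
  by (rule smoothI) (blast intro: dbounded_cis1)

section \<open>Remainders of Fourier series\<close>

definition fc :: "real \<Rightarrow> (real^'d::finite \<Rightarrow> complex) \<Rightarrow> int^'d \<Rightarrow> complex" where
  "fc l q n = (\<integral>\<omega>. q \<omega> * cis (\<omega> \<bullet> freq l n) \<partial>lborel)"

text \<open>Differentiation commutes with taking the remainder of the Fourier series, so that bounding the
  remainder itself for all \<open>q\<close> bounds all its derivatives.\<close>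

definition srem :: "real \<Rightarrow> (real^'d::finite \<Rightarrow> complex) \<Rightarrow> (int^'d) set \<Rightarrow> real^'d \<Rightarrow> complex" where
  "srem l q F \<omega> = q \<omega> - (\<Sum>n\<in>F. fc l q n / of_real ((2 * l) ^ CARD('d)) * cis (\<omega> \<bullet> - freq l n))"

text \<open>The part of the convergent lattice series outside \<open>F\<close>, written as a
  difference so that its limit is immediate.\<close>

definition ftail :: "real \<Rightarrow> (int^'d::finite) set \<Rightarrow> real" where
  "ftail l F = (\<Sum>\<^sub>\<infinity>n::int^'d. decay (2 * CARD('d)) (freq l n)) - (\<Sum>n\<in>F. decay (2 * CARD('d)) (freq l n))"

lemma fc_fourier:
  fixes q :: "real^'d::finite \<Rightarrow> complex"
  shows "fc l q n = of_real ((2 * pi) powr (real CARD('d) / 2)) * fourier q (- freq l n)"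
  by (simp add: fc_def fourier_def powr_minus mult.assoc[symmetric] of_real_mult[symmetric] del: of_real_mult)

lemma ftail_nonneg: "0 < l \<Longrightarrow> finite F \<Longrightarrow> 0 \<le> ftail l F"
  unfolding ftail_def using finite_sum_le_infsum[OF decay_freq_summable, of l F] by simp

lemma ftail_tendsto: "0 < l \<Longrightarrow> (ftail l \<longlongrightarrow> 0) (finite_subsets_at_top (UNIV::(int^'d::finite) set))"
proof -
  assume l: "0 < l"
  have "((\<lambda>n::int^'d::finite. decay (2 * CARD('d)) (freq l n)) has_sum (\<Sum>\<^sub>\<infinity>n::int^'d. decay (2 * CARD('d)) (freq l n))) UNIV"
    by (rule has_sum_infsum[OF decay_freq_summable[OF l]])
  from tendsto_diff[OF tendsto_const[of "\<Sum>\<^sub>\<infinity>n::int^'d. decay (2 * CARD('d)) (freq l n)"] this[unfolded has_sum_def]]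
  show ?thesis unfolding ftail_def[abs_def] by simp
qed

context
  fixes l :: real and Q :: "(real^'d::finite) set" and z :: "real^'d" and S :: "(real^'d) set"
  assumes l: "0 < l" and Ql: "Q \<subseteq> cube z l" and opQ: "open Q" and S: "compact S" "S \<subseteq> Q"
begin

text \<open>The coefficients of \<open>q\<close> are dominated by the summable weight because
  \<open>q\<close> is a Schwartz function, so the remainder is at most a multiple of the tail of
  that weight.\<close>

lemma srem_bound:
  assumes q: "smooth q" "\<And>x. x \<notin> S \<Longrightarrow> q x = 0"
  obtains C where "0 \<le> C" "\<And>F \<omega>. finite F \<Longrightarrow> \<omega> \<in> Q \<Longrightarrow> norm (srem l q F \<omega>) \<le> C * ftail l F"
proof -
  let ?V = "(2 * l) ^ CARD('d)" and ?d = "\<lambda>n::int^'d. decay (2 * CARD('d)) (freq l n)"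
  have V: "0 < ?V" using l by simp
  have qs: "q \<in> schwartz" by (rule compact_supp_schwartz[OF q(1) S(1) q(2)])
  obtain C0 where C0: "0 \<le> C0" "\<And>\<xi>. norm (fourier q \<xi>) \<le> C0 * decay (2 * CARD('d)) \<xi>"
    using fourier_decay_schwartz[OF qs] by metis
  define C where "C = (2 * pi) powr (real CARD('d) / 2) * C0"
  have C: "0 \<le> C" "norm (fc l q n) \<le> C * ?d n" for n
    using C0(1) mult_left_mono[OF C0(2)[of "- freq l n"], of "(2 * pi) powr (real CARD('d) / 2)"]
    by (simp_all add: C_def fc_fourier norm_mult mult.assoc)
  \<comment> \<open>\<open>Q\<close> is open, so it lies in the interior of the closed cube; this
    gives the strict inequality by which \<open>q\<close> vanishes on the faces.\<close>
  have int: "\<omega> \<in> Q \<Longrightarrow> \<bar>\<omega> $ i - z $ i\<bar> < l" for \<omega> i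
  proof -
    assume "\<omega> \<in> Q"
    then have "\<omega> \<in> interior (cube z l)" using Ql opQ interior_maximal by blast
    then have "\<omega> \<in> box (z - (\<chi> i. l)) (z + (\<chi> i. l))" by (simp add: cube_def interior_cbox)
    then show ?thesis by (auto simp: mem_box_cart abs_less_iff dest!: spec[of _ i])
  qed
  have ds: "?d summable_on UNIV" by (rule decay_freq_summable[OF l])
  have "norm (srem l q F \<omega>) \<le> C / ?V * ftail l F" if F: "finite F" and \<omega>: "\<omega> \<in> Q" for F \<omega>
  proof -
    let ?t = "\<lambda>n. fc l q n / of_real ?V * cis (- (\<omega> \<bullet> freq l n))"
    have hs: "(?t has_sum q \<omega>) UNIV"
    proof (rule fourier_series[OF l])
      show "continuous_on UNIV q" by (rule smooth_continuous[OF q(1)])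
      show "q \<omega> = 0" if "\<exists>i. l \<le> \<bar>\<omega> $ i - z $ i\<bar>" for \<omega>
        using q(2)[of \<omega>] int[of \<omega>] S(2) that by (meson not_less subsetD)
      show "norm (fc l q n) \<le> C * ?d n" for n by (rule C)
      show "(\<lambda>n. C * ?d n) summable_on UNIV" by (intro summable_on_cmult_right ds)
    qed (use Ql \<omega> fc_def[of l q] in auto)
    have h1: "(?t has_sum (q \<omega> - (\<Sum>n\<in>F. ?t n))) (UNIV - F)"
      by (rule has_sum_Diff[OF hs has_sum_finite[OF F]]) simp
    have h2: "((\<lambda>n. C / ?V * ?d n) has_sum (C / ?V * ftail l F)) (UNIV - F)"
      unfolding ftail_def by (intro has_sum_cmult_right has_sum_Diff has_sum_infsum ds has_sum_finite F) simp
    have "norm (q \<omega> - (\<Sum>n\<in>F. ?t n)) \<le> C / ?V * ftail l F"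
    proof (rule norm_infsum_le[OF h1 h2])
      fix n
      have "norm (?t n) = norm (fc l q n) / ?V" using l by (simp add: norm_mult norm_divide norm_power abs_of_pos)
      also have "\<dots> \<le> C * ?d n / ?V" using C(2)[of n] V by (intro divide_right_mono) auto
      finally show "norm (?t n) \<le> C / ?V * ?d n" by simp
    qed
    then show ?thesis by (simp add: srem_def)
  qed
  note b = this
  show thesis by (rule that[OF _ b]) (use C V in simp)
qed

text \<open>Differentiating an exponential multiplies it by the same factor by which the Fourier
  coefficient of the derivative of \<open>q\<close> differs from that of \<open>q\<close>.\<close>

lemma partial_deriv_srem:
  assumes q: "smooth q" "\<And>x. x \<notin> S \<Longrightarrow> q x = 0"
  shows "partial_deriv k (srem l q F) = srem l (partial_deriv k q) F" "srem l q F differentiable (at x)"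
proof -
  have qs: "q \<in> schwartz" by (rule compact_supp_schwartz[OF q(1) S(1) q(2)])
  have hd: "(srem l q F has_derivative (\<lambda>h. frechet_derivative q (at \<omega>) h -
     (\<Sum>n\<in>F. fc l q n / of_real ((2 * l) ^ CARD('d)) * (of_real (h \<bullet> - freq l n) * (\<i> * cis (\<omega> \<bullet> - freq l n)))))) (at \<omega>)" for \<omega>
    unfolding srem_def[abs_def]
    by (intro has_derivative_diff has_derivative_sum has_derivative_mult_right has_derivative_cis
        frechet_derivativeI smooth_differentiable q)
  then show "srem l q F differentiable (at x)" unfolding differentiable_def by blast
  have fcd: "fc l (partial_deriv k q) n = - \<i> * of_real (freq l n $ k) * fc l q n" for n
    by (simp add: fc_fourier fourier_partial_deriv[OF qs])
  show "partial_deriv k (srem l q F) = srem l (partial_deriv k q) F"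
  proof
    fix \<omega>
    have "partial_deriv k (srem l q F) \<omega> = partial_deriv k q \<omega> -
     (\<Sum>n\<in>F. fc l q n / of_real ((2 * l) ^ CARD('d)) * (of_real (axis k 1 \<bullet> - freq l n) * (\<i> * cis (\<omega> \<bullet> - freq l n))))"
      by (subst partial_deriv_eq[OF hd]) (simp add: partial_deriv_def)
    also have "\<dots> = srem l (partial_deriv k q) F \<omega>"
      unfolding srem_def fcd
      by (intro arg_cong2[of _ _ _ _ "(-)"] refl sum.cong) (simp add: inner_axis' mult.assoc mult.left_commute)
    finally show "partial_deriv k (srem l q F) \<omega> = srem l (partial_deriv k q) F \<omega>" .
  qed
qed

lemma partials_srem:
  assumes q: "smooth q" "\<And>x. x \<notin> S \<Longrightarrow> q x = 0"
  shows "partials is (srem l q F) = srem l (partials is q) F"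
proof (induction "is")
  case (Cons k "is")
  have "partials is q x = 0" if "x \<notin> S" for x by (rule partials_outside[OF compact_imp_closed[OF S(1)] q(2) that])
  then show ?case using partial_deriv_srem(1)[OF smooth_partials_smooth[OF q(1)]] Cons by simp
qed simp

text \<open>The index of the family is the finite set of frequencies that has been subtracted, so
  the tail appears as the weight.\<close>

lemma srem_dbounded:
  assumes q: "smooth q" "\<And>x. x \<notin> S \<Longrightarrow> q x = 0"
  shows "dbounded k (\<lambda>F. if finite F then Q else {}) (\<lambda>F _. ftail l F) (srem l q)"
proof (rule dboundedI)
  have z: "partials is q x = 0" if "x \<notin> S" for x "is" by (rule partials_outside[OF compact_imp_closed[OF S(1)] q(2) that])
  fix "is" :: "'d list"
  obtain C where b: "\<And>F \<omega>. finite F \<Longrightarrow> \<omega> \<in> Q \<Longrightarrow> norm (srem l (partials is q) F \<omega>) \<le> C * ftail l F"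
    using srem_bound[OF smooth_partials_smooth[OF q(1)] z] by metis
  show "\<exists>C. \<forall>F. \<forall>x\<in>if finite F then Q else {}. norm (partials is (srem l q F) x) \<le> C * ftail l F"
  proof (intro exI[of _ C] allI ballI)
    fix F :: "(int^'d) set" and x assume "x \<in> (if finite F then Q else {})"
    then have "finite F" "x \<in> Q" by (auto split: if_splits)
    then show "norm (partials is (srem l q F) x) \<le> C * ftail l F" using b partials_srem[OF q, of "is" F] by simp
  qed
  show "partials is (srem l q F) differentiable (at x)" for F x
    using partial_deriv_srem(2)[OF smooth_partials_smooth[OF q(1), of "is"] z, of F x] partials_srem[OF q, of "is" F] by simp
qed

end

context frame_setup
begin

section \<open>Frame functions and coefficients on the Fourier side\<close>

definition Dt :: "'j \<Rightarrow> real" where "Dt j = (\<Prod>i\<in>UNIV. \<tau> j $ i)"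

definition \<alpha> :: "'j \<Rightarrow> real" where "\<alpha> j = (2 * l) powr (- real CARD('d) / 2) * Dt j powr (- 1/2)"

text \<open>The Fourier transform of the frame function, written without the cutoff to the cube:
  \<open>ph j\<close> already vanishes where the cutoff would.\<close>

definition En :: "int^'d \<Rightarrow> 'j \<Rightarrow> real^'d \<Rightarrow> complex" where
  "En n j x = of_real (\<alpha> j) * (ph j x * cis (Ti j x \<bullet> freq l n))"

lemma Dt_pos: "j \<in> J \<Longrightarrow> 0 < Dt j"
  unfolding Dt_def by (rule prod_pos) (simp add: \<tau>_pos)

lemma det_A: "j \<in> J \<Longrightarrow> det (A j) = Dt j"
proof -
  assume "j \<in> J"
  then have "A j = aniso_dil a (\<delta> * h (\<xi> j))" using cov unfolding ball_covering_def by blast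
  then show ?thesis by (simp only:) (subst det_diagonal, auto simp: aniso_dil_def Dt_def \<tau>_def)
qed

text \<open>Two normalisations, the Jacobian of the substitution and the volume of the cube: the
  factors that meet when a Fourier coefficient is put back into its series.\<close>

lemma \<alpha>_sq: "j \<in> J \<Longrightarrow> \<alpha> j * Dt j * \<alpha> j * (2 * l) ^ CARD('d) = 1"
proof -
  assume j: "j \<in> J"
  have "\<alpha> j * \<alpha> j = ((2 * l) powr (- real CARD('d) / 2) * (2 * l) powr (- real CARD('d) / 2)) * (Dt j powr (- 1/2) * Dt j powr (- 1/2))"
    by (simp add: \<alpha>_def)
  also have "\<dots> = (2 * l) powr (- real CARD('d)) * Dt j powr (- 1)"
    unfolding powr_add[symmetric] by simp
  finally have "\<alpha> j * \<alpha> j * ((2 * l) ^ CARD('d) * Dt j) = 1"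
    using l Dt_pos[OF j] by (simp add: powr_minus powr_realpow divide_inverse[symmetric])
  then show ?thesis by (simp add: mult_ac)
qed

lemma \<alpha>_Dt: "j \<in> J \<Longrightarrow> \<alpha> j * Dt j = (2 * l) powr (- real CARD('d) / 2) * Dt j powr (1/2)"
proof -
  assume j: "j \<in> J"
  have "Dt j powr (- 1/2) * Dt j = Dt j powr (- 1/2) * Dt j powr 1" using Dt_pos[OF j] by simp
  also have "\<dots> = Dt j powr (1/2)" unfolding powr_add[symmetric] by simp
  finally show ?thesis by (simp add: \<alpha>_def)
qed

lemma freq_scale: "freq l n = (pi / l) *\<^sub>R (\<chi> i. real_of_int (n $ i))"
  by (simp add: freq_def vec_eq_iff)

lemma frame_En:
  assumes "j \<in> J"
  shows "frame_system J A b \<Phi> z l n j = inv_fourier (En n j)"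
proof -
  have "of_real (\<phi> j x) * exp_system A b z l n j x = En n j x" for x
  proof (cases "x \<in> Qs j")
    case True
    then have "Ti j x \<in> cube z l" using Ql by (auto simp: Qs_def)
    then show ?thesis
      by (simp add: exp_system_def Let_def inv_T[OF assms] det_A[OF assms] En_def ph_eq[OF assms] \<alpha>_def
        freq_scale inner_commute abs_of_pos[OF Dt_pos[OF assms]])
  next
    case False
    then show ?thesis using ph_Qs[OF False] \<phi>_Qs[OF assms False] by (simp add: En_def)
  qed
  then show ?thesis unfolding frame_system_def by simp
qed

lemma smooth_cis_Ti: "smooth (\<lambda>x. cis (Ti j x \<bullet> \<zeta>))"
  unfolding Ti_def by (rule smooth_diag[OF smooth_cis])

lemma En_ccinf0: "j \<in> J \<Longrightarrow> En n j \<in> ccinf0"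
proof -
  assume j: "j \<in> J"
  have "smooth (\<lambda>x. of_real (\<alpha> j) * cis (Ti j x \<bullet> freq l n))"
    by (intro smooth_linear[OF bounded_linear_mult_right] smooth_cis_Ti)
  from ccinf0_mult(1)[OF this ph_ccinf0[OF j]] show ?thesis
    by (simp add: En_def[abs_def] mult.left_commute)
qed

lemma cnj_En: "cnj (En n j x) = En (- n) j x"
  by (simp add: En_def ph_def cis_cnj)

text \<open>The pairing conjugates \<open>\<eta>\<close>, hence the frequency \<open>- n\<close>.\<close>

definition cc :: "'d functional \<Rightarrow> int^'d \<Rightarrow> 'j \<Rightarrow> complex" where
  "cc f n j = f (fourier (En (- n) j))"

lemma cis_Ti_dbounded:
  "\<exists>K\<ge>0. dbounded k (\<lambda>_. UNIV) (\<lambda>n _. K * (1 + norm (freq l n)) ^ k) (\<lambda>n x. cis (Ti j x \<bullet> freq l (- n)))"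
proof -
  define K where "K = 1 + (\<Sum>i\<in>UNIV. \<bar>\<iota> j $ i\<bar>)"
  have K1: "1 \<le> K" by (simp add: K_def sum_nonneg)
  have ik: "\<bar>\<iota> j $ i\<bar> \<le> K" for i
    using member_le_sum[of i UNIV "\<lambda>i. \<bar>\<iota> j $ i\<bar>"] by (simp add: K_def)
  have "dbounded k (\<lambda>n. {x. dil (\<iota> j) x + - dil (\<iota> j) (b j) \<in> UNIV}) (\<lambda>n x. K ^ k * (1 + norm (freq l (- n))) ^ k)
     (\<lambda>n x. cis ((dil (\<iota> j) x + - dil (\<iota> j) (b j)) \<bullet> freq l (- n)))"
    by (rule dbounded_diag[where D="\<lambda>_. UNIV"]) (use ik K1 dbounded_reindex[OF dbounded_cis, where g="\<lambda>n. freq l (- n)"] in auto)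
  then show ?thesis using K1 by (intro exI[of _ "K ^ k"]) (simp add: Ti_def)
qed

text \<open>The functional \<open>f\<close> may see \<open>M\<close> derivatives of the exponential,
  and each costs a power of the frequency; the cutoff \<open>ph j\<close> keeps the test function
  away from the origin.\<close>

lemma cc_bound:
  assumes f: "f \<in> dist_mod_poly" and j: "j \<in> J"
  obtains M C where "0 \<le> C" "\<And>n. norm (cc f n j) \<le> C * (1 + norm (freq l n)) ^ M"
proof -
  obtain M C where C: "0 \<le> C" "\<And>m B. m \<in> Z0 \<Longrightarrow> zbound M m B \<Longrightarrow> norm (f (fourier m)) \<le> C * B"
    using dist_fourier_bound[OF f] by metis
  obtain K where K: "0 \<le> K" "dbounded M (\<lambda>_. UNIV) (\<lambda>n _. K * (1 + norm (freq l n)) ^ M) (\<lambda>n x. cis (Ti j x \<bullet> freq l (- n)))"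
    using cis_Ti_dbounded by blast
  have mZ: "(\<lambda>x. of_real (\<alpha> j) * ph j x) \<in> Z0" by (intro Z0_cmult ccinf0_Z0 ph_ccinf0 j)
  obtain C' where C': "0 \<le> C'" "\<And>n. True \<Longrightarrow> zbound M (\<lambda>x. of_real (\<alpha> j) * ph j x * cis (Ti j x \<bullet> freq l (- n))) (C' * (K * (1 + norm (freq l n)) ^ M))"
  proof (rule family_zbound[OF mZ compact_imp_closed[OF TS_props(1)[OF j]] TS_props(3)[OF j] open_Qs, where p="\<lambda>_. True"])
    show "dbounded M (\<lambda>i. if True then Qs j else {}) (\<lambda>n _. K * (1 + norm (freq l n)) ^ M) (\<lambda>n x. cis (Ti j x \<bullet> freq l (- n)))"
      by (rule dbounded_subset[OF K(2) subset_UNIV])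
  qed (use Qs_nz[OF j] TS_props(4)[OF j] K in auto)
  have "norm (cc f n j) \<le> C * C' * K * (1 + norm (freq l n)) ^ M" for n
    using C(2)[OF ccinf0_Z0[OF En_ccinf0[OF j]], of "- n" "C' * (K * (1 + norm (freq l n)) ^ M)"] C'(2)[of n]
    by (simp add: cc_def En_def[abs_def] mult.assoc)
  moreover have "0 \<le> C * C' * K" using C C' K by simp
  ultimately show thesis by (rule that[rotated])
qed

definition Mh :: "'j \<Rightarrow> real^'d \<Rightarrow> complex" where
  "Mh j = inv_fourier (\<lambda>\<omega>. of_real (mm j \<omega>))"

lemma T_dil_integral:
  fixes F :: "real^'d \<Rightarrow> complex"
  assumes j: "j \<in> J" and F: "continuous_on UNIV F"
  shows "(\<integral>x. F x \<partial>lborel) = of_real (Dt j) * (\<integral>\<omega>. F (T j \<omega>) \<partial>lborel)"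
  using integral_dil(1)[of "\<tau> j" F "b j"] \<tau>_pos[OF j] borel_measurable_continuous_onI[OF F]
  by (simp add: T_def Dt_def less_imp_neq[symmetric] scaleR_conv_of_real abs_of_pos)

text \<open>Substituting \<open>T j \<omega>\<close> for the frequency in the inverse transform
  turns the exponential on the cube into a lattice translation and the shift \<open>b j\<close> into
  a modulation.\<close>

lemma \<eta>_eq:
  assumes j: "j \<in> J"
  shows "inv_fourier (En n j) x = of_real (\<alpha> j * Dt j) * (cis (x \<bullet> b j) * Mh j (dil (\<tau> j) x + freq l n))"
proof -
  have cont: "continuous_on UNIV (\<lambda>\<zeta>. En n j \<zeta> * cis (x \<bullet> \<zeta>))"
    by (intro continuous_intros smooth_continuous ccinf0_Z0[THEN Z0_smooth] En_ccinf0 j continuous_on_cis)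
  have ip: "x \<bullet> T j \<omega> = dil (\<tau> j) x \<bullet> \<omega> + x \<bullet> b j" for \<omega>
    by (simp add: T_def inner_add_right inner_vec_def dil_def distrib_left sum.distrib mult_ac)
  have "En n j (T j \<omega>) * cis (x \<bullet> T j \<omega>) = of_real (\<alpha> j) * cis (x \<bullet> b j) * (of_real (mm j \<omega>) * cis ((dil (\<tau> j) x + freq l n) \<bullet> \<omega>))" for \<omega>
    by (simp add: En_def ph_def Ti_T[OF j] ip inner_add_left inner_commute[of \<omega>] cis_mult[symmetric])
  then show ?thesis
    unfolding inv_fourier_def T_dil_integral[OF j cont] Mh_def by (simp add: mult_ac)
qed

lemma S_bounded: obtains r where "0 \<le> r" "\<And>x. x \<in> Q \<Longrightarrow> norm x \<le> r"
  using boundedQ unfolding bounded_iff by (metis linear norm_ge_zero order_trans)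

lemma mm_schwartz: "(\<lambda>\<omega>. complex_of_real (mm j \<omega>)) \<in> schwartz"
  by (rule compact_supp_schwartz[OF smooth_linear[OF bounded_linear_of_real smooth_mm] compact_S]) (simp add: mm_zero)

text \<open>Decay of order \<open>N\<close> comes from \<open>N\<close> derivatives of the family
  \<open>mm\<close>. Its members live on one bounded set, where a constant weight is at most a
  multiple of a decay weight; hence one constant serves every \<open>j\<close>.\<close>

lemma Mh_decay: obtains C where "0 \<le> C" "\<And>j y. norm (Mh j y) \<le> C * decay N y"
proof -
  obtain r where r: "0 \<le> r" "\<And>x. x \<in> Q \<Longrightarrow> norm x \<le> r" using S_bounded by blast
  have "dbounded N (\<lambda>_. Q) (\<lambda>_ _. 1) mm" by (rule dbounded_subset[OF mm_dbounded subset_UNIV])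
  then have "dbounded N (\<lambda>_. Q) (\<lambda>_. decay (2 * CARD('d))) mm"
  proof (rule dbounded_weight[rotated 2])
    fix j :: 'j and x assume "x \<in> Q"
    then show "1 \<le> (1 + r) ^ (2 * CARD('d)) * decay (2 * CARD('d)) x"
      using decay_shift[of x r "2 * CARD('d)" 0] r by simp
  qed simp
  then have "dbounded N (\<lambda>_. UNIV) (\<lambda>_. decay (2 * CARD('d))) mm"
    by (rule dbounded_extend[where D="\<lambda>_. Q" and S="\<lambda>_. S", rotated 4])
      (use openQ compact_imp_closed[OF compact_S] S_Q mm_zero in auto)
  then have "dbounded N (\<lambda>_. UNIV) (\<lambda>_. decay (2 * CARD('d))) (\<lambda>j \<omega>. complex_of_real (mm j \<omega>))"
    by (intro dbounded_linear[OF bounded_linear_of_real]) auto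
  from fourier_decay[OF this mm_schwartz] obtain C where C: "0 \<le> C" "\<And>j \<xi>. norm (fourier (\<lambda>\<omega>. complex_of_real (mm j \<omega>)) \<xi>) \<le> C * decay N \<xi>"
    by blast
  have "norm (Mh j y) \<le> C * decay N y" for j y using C(2)[of j "- y"] by (simp add: Mh_def inv_fourier_eq)
  with C(1) show thesis by (rule that)
qed

lemma \<eta>_bound: obtains C where "0 \<le> C"
  "\<And>j n x. j \<in> J \<Longrightarrow> norm (inv_fourier (En n j) x) \<le> C * Dt j powr (1/2) * decay N (dil (\<tau> j) x + freq l n)"
proof -
  obtain C where C: "0 \<le> C" "\<And>j y. norm (Mh j y) \<le> C * decay N y" using Mh_decay by blast
  let ?c = "(2 * l) powr (- real CARD('d) / 2)"
  have "norm (inv_fourier (En n j) x) \<le> ?c * C * Dt j powr (1/2) * decay N (dil (\<tau> j) x + freq l n)" if j: "j \<in> J" for j n x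
  proof -
    have "norm (inv_fourier (En n j) x) = \<alpha> j * Dt j * norm (Mh j (dil (\<tau> j) x + freq l n))"
      unfolding \<eta>_eq[OF j] norm_mult norm_of_real \<alpha>_Dt[OF j] by simp
    also have "\<dots> \<le> \<alpha> j * Dt j * (C * decay N (dil (\<tau> j) x + freq l n))"
      by (intro mult_left_mono C) (simp add: \<alpha>_Dt[OF j])
    finally show ?thesis unfolding \<alpha>_Dt[OF j] by (simp add: mult_ac)
  qed
  moreover have "0 \<le> ?c * C" using C by simp
  ultimately show thesis by (rule that[rotated])
qed

text \<open>One factor \<open>ph j\<close> enters the function that is expanded, so that it is
  smooth with support inside the cube. The other multiplies the series afterwards: it produces the
  exponentials \<open>En (- n) j\<close> and keeps every remainder a test function, and the
  remainders tend to 0 with the tail of the coefficient weight.\<close>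

theorem expand_has_sum:
  assumes f: "f \<in> dist_mod_poly" and j: "j \<in> J" and g: "smooth g"
  shows "((\<lambda>n. cc f n j * (\<integral>x. En n j x * g x \<partial>lborel)) has_sum f (fourier (\<lambda>x. ph j x * ph j x * g x))) UNIV"
proof -
  define q where "q \<omega> = complex_of_real (mm j \<omega>) * g (T j \<omega>)" for \<omega>
  have q: "smooth q" "\<And>x. x \<notin> S \<Longrightarrow> q x = 0"
    unfolding q_def[abs_def] T_def
    by (intro smooth_mult smooth_linear[OF bounded_linear_of_real] smooth_mm smooth_diag g) (simp add: mm_zero)
  let ?e = "\<lambda>n. \<integral>x. En n j x * g x \<partial>lborel" and ?V = "(2 * l) ^ CARD('d)"
  have e: "?e n = of_real (\<alpha> j * Dt j) * fc l q n" for n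
  proof -
    have cont: "continuous_on UNIV (\<lambda>x. En n j x * g x)"
      by (intro continuous_intros smooth_continuous ccinf0_Z0[THEN Z0_smooth] En_ccinf0 j g)
    have t: "En n j (T j \<omega>) * g (T j \<omega>) = of_real (\<alpha> j) * (q \<omega> * cis (\<omega> \<bullet> freq l n))" for \<omega>
      by (simp add: En_def ph_def Ti_T[OF j] q_def mult_ac)
    show ?thesis unfolding T_dil_integral[OF j cont] t integral_mult_right_zero by (simp add: fc_def)
  qed
  have Zp: "ph j \<in> Z0" by (intro ccinf0_Z0 ph_ccinf0 j)
  have Zg: "(\<lambda>x. ph j x * ph j x * g x) \<in> Z0" by (rule ccinf0_Z0[OF ccinf0_mult(1)[OF g ph2_ccinf0[OF j]]])
  have ZE: "En (- n) j \<in> Z0" for n by (rule ccinf0_Z0[OF En_ccinf0[OF j]])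
  have r: "ph j x * srem l q F (Ti j x) = ph j x * ph j x * g x + - 1 * (\<Sum>n\<in>F. ?e n * En (- n) j x)" for F x
  proof -
    \<comment> \<open>The normalisation of the system is used here: by \<open>\<alpha>_sq\<close>
      the constants in front of the exponentials multiply to the factor of the Fourier
      series.\<close>
    have s: "ph j x * (fc l q n / of_real ?V * cis (Ti j x \<bullet> - freq l n)) = ?e n * En (- n) j x" for n
    proof -
      have a: "?e n * En (- n) j x = of_real (\<alpha> j * Dt j * \<alpha> j) * (fc l q n * (ph j x * cis (Ti j x \<bullet> - freq l n)))"
        by (simp only: e) (simp add: En_def)
      have v: "\<alpha> j * Dt j * \<alpha> j = 1 / ?V" using \<alpha>_sq[OF j] l by (simp add: field_simps)
      show ?thesis unfolding a v by simp
    qed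
    have "q (Ti j x) = ph j x * g x" by (simp add: q_def ph_def T_Ti[OF j])
    then have "ph j x * srem l q F (Ti j x) = ph j x * ph j x * g x - (\<Sum>n\<in>F. ph j x * (fc l q n / of_real ?V * cis (Ti j x \<bullet> - freq l n)))"
      by (simp only: srem_def right_diff_distrib sum_distrib_left mult.assoc)
    then show ?thesis unfolding s by simp
  qed
  obtain M C where C: "0 \<le> C" "\<And>m B. m \<in> Z0 \<Longrightarrow> zbound M m B \<Longrightarrow> norm (f (fourier m)) \<le> C * B"
    using dist_fourier_bound[OF f] by metis
  define K where "K = 1 + (\<Sum>i\<in>UNIV. \<bar>\<iota> j $ i\<bar>)"
  have K1: "1 \<le> K" by (simp add: K_def sum_nonneg)
  have ik: "\<bar>\<iota> j $ i\<bar> \<le> K" for i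
    using member_le_sum[of i UNIV "\<lambda>i. \<bar>\<iota> j $ i\<bar>"] by (simp add: K_def)
  let ?D = "\<lambda>F :: (int^'d) set. if finite F then Q else {}"
  \<comment> \<open>The substitution costs powers of the scales of the single index
    \<open>j\<close>, which is fixed here, so a constant depending on \<open>j\<close> is
    acceptable.\<close>
  have "dbounded M (\<lambda>F. {x. dil (\<iota> j) x + - dil (\<iota> j) (b j) \<in> ?D F}) (\<lambda>F x. K ^ M * ftail l F)
     (\<lambda>F x. srem l q F (dil (\<iota> j) x + - dil (\<iota> j) (b j)))"
  proof (rule dbounded_diag[where D="?D"])
    show "dbounded M ?D (\<lambda>F _. ftail l F) (srem l q)"
      by (rule srem_dbounded[OF l Ql openQ compact_S S_Q q])
  qed (use openQ ik K1 ftail_nonneg[OF l] in \<open>auto split: if_splits\<close>)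
  then have d: "dbounded M (\<lambda>F. if finite F then Qs j else {}) (\<lambda>F x. K ^ M * ftail l F) (\<lambda>F x. srem l q F (Ti j x))"
    unfolding Ti_def[symmetric] by (rule dbounded_subset) (auto simp: Qs_def)
  obtain C' where C': "0 \<le> C'" "\<And>F. finite F \<Longrightarrow> zbound M (\<lambda>x. ph j x * srem l q F (Ti j x)) (C' * (K ^ M * ftail l F))"
  proof (rule family_zbound[OF Zp compact_imp_closed[OF TS_props(1)[OF j]] TS_props(3)[OF j] open_Qs _ _ d])
    show "0 \<notin> Qs j" using Qs_nz[OF j] by blast
    show "ph j x = 0" if "x \<notin> TS j" for x using TS_props(4)[OF j that] .
    show "0 \<le> K ^ M * ftail l F" if "finite F" for F using K1 ftail_nonneg[OF l that] by simp
    fix C assume C: "0 \<le> C" "\<And>F. finite F \<Longrightarrow> zbound M (\<lambda>x. ph j x * srem l q F (Ti j x)) (C * (K ^ M * ftail l F))"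
    show thesis by (rule that[OF C])
  qed
  let ?s = "\<lambda>F. \<Sum>n\<in>F. cc f n j * ?e n"
  let ?L = "f (fourier (\<lambda>x. ph j x * ph j x * g x))"
  have bd: "norm (?s F - ?L) \<le> C * C' * K ^ M * ftail l F" if F: "finite F" for F
  proof -
    have Zs: "(\<lambda>x. \<Sum>n\<in>F. ?e n * En (- n) j x) \<in> Z0" by (intro Z0_sum Z0_cmult ZE)
    have eq: "f (fourier (\<lambda>x. ph j x * srem l q F (Ti j x))) = ?L + - 1 * f (fourier (\<lambda>x. \<Sum>n\<in>F. ?e n * En (- n) j x))"
      unfolding r dist_fourier_add[OF f Zg Z0_cmult[OF Zs]] dist_fourier_cmult[OF f Zs] ..
    also have "f (fourier (\<lambda>x. \<Sum>n\<in>F. ?e n * En (- n) j x)) = (\<Sum>n\<in>F. f (fourier (\<lambda>x. ?e n * En (- n) j x)))"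
      by (rule dist_fourier_sum[OF f]) (intro Z0_cmult ZE)
    also have "\<dots> = ?s F" unfolding dist_fourier_cmult[OF f ZE] cc_def by (simp add: mult.commute)
    finally have "norm (?s F - ?L) = norm (f (fourier (\<lambda>x. ph j x * srem l q F (Ti j x))))" by (simp add: norm_minus_commute)
    moreover have "(\<lambda>x. ph j x * srem l q F (Ti j x)) \<in> Z0" unfolding r by (intro Z0_add Zg Z0_cmult Zs)
    ultimately show ?thesis using C(2)[OF _ C'(2)[OF F]] by (simp add: mult.assoc)
  qed
  have "((\<lambda>F. ?s F - ?L) \<longlongrightarrow> 0) (finite_subsets_at_top UNIV)"
  proof (rule Lim_null_comparison)
    show "\<forall>\<^sub>F F in finite_subsets_at_top UNIV. norm (?s F - ?L) \<le> C * C' * K ^ M * ftail l F"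
      by (rule eventually_finite_subsets_at_top_weakI) (rule bd)
    show "((\<lambda>F. C * C' * K ^ M * ftail l F) \<longlongrightarrow> 0) (finite_subsets_at_top UNIV)"
      by (rule tendsto_mult_right_zero[OF ftail_tendsto[OF l]])
  qed
  then show ?thesis unfolding has_sum_def by (rule LIM_zero_cancel)
qed

end

section \<open>The functions representing the pieces of a distribution\<close>

lemma norm_dil_le:
  fixes s :: "real^'d::finite"
  assumes "\<And>i. \<bar>s $ i\<bar> \<le> K"
  shows "norm (dil s x) \<le> K * norm x"
proof -
  have K: "0 \<le> K" using assms[of undefined] by simp
  have "norm (dil s x) \<le> norm (K *\<^sub>R x)"
    by (rule norm_le_componentwise_cart) (use assms K in \<open>simp add: dil_def abs_mult mult_right_mono\<close>)
  then show ?thesis using K by simp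
qed

lemma decay_dil_le:
  fixes s :: "real^'d::finite"
  assumes "\<And>i. \<bar>s $ i\<bar> \<le> K" "1 \<le> K"
  shows "decay N x \<le> K ^ N * decay N (dil s x)"
proof -
  have "1 + norm (dil s x) \<le> K * (1 + norm x)" using norm_dil_le[OF assms(1), of x] assms(2) by (simp add: distrib_left)
  then have "(1 + norm (dil s x)) ^ N \<le> (K * (1 + norm x)) ^ N" by (intro power_mono) auto
  then have "(1 + norm (dil s x)) ^ N \<le> K ^ N * (1 + norm x) ^ N" unfolding power_mult_distrib .
  then show ?thesis by (simp add: decay_def field_simps)
qed

text \<open>A form of Peetre's inequality: growth in \<open>y\<close> is traded for growth in
  \<open>x - y\<close>, at the expense of as many powers of decay in \<open>x\<close>.\<close>

lemma peetre_ineq: "(1 + norm y) ^ M * decay (M + N) x \<le> (1 + norm (x - y)) ^ M * decay N x"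
proof -
  have "decay M x * decay M (y - x) \<le> decay M y" using decay_mult_le[of M x "y - x"] by simp
  then have "(1 + norm y) ^ M * decay M x \<le> (1 + norm (x - y)) ^ M"
    by (simp add: decay_def field_simps norm_minus_commute)
  then have "(1 + norm y) ^ M * decay M x * decay N x \<le> (1 + norm (x - y)) ^ M * decay N x"
    by (rule mult_right_mono) simp
  then show ?thesis by (simp add: decay_add mult.assoc)
qed

lemma decay_mult_le_diff: "decay N x * decay N y \<le> decay N (x - y)"
  using decay_mult_le[of N x "- y"] by simp

lemma Lp_norm_AE_cong:
  assumes [measurable]: "f \<in> borel_measurable lborel" "g \<in> borel_measurable lborel" and "AE x in lborel. f x = g x"
  shows "Lp_norm p f = Lp_norm p g"
proof (cases "p = \<infinity>")
  case True
  then show ?thesis using assms(3) unfolding Lp_norm_def by (auto intro!: esssup_AE_cong elim: AE_mp)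
next
  case False
  have "(\<integral>\<^sup>+x. ennreal (norm (f x) powr enn2real p) \<partial>lborel) = (\<integral>\<^sup>+x. ennreal (norm (g x) powr enn2real p) \<partial>lborel)"
    by (rule nn_integral_cong_AE) (use assms(3) in auto)
  with False show ?thesis by (simp add: Lp_norm_def)
qed

text \<open>Any two representing functions have the same pairings with Schwartz functions and so
  agree almost everywhere; the infimum in the definition runs over a single value.\<close>

lemma dist_Lp_norm_represents:
  fixes G :: "real^'d::finite \<Rightarrow> complex"
  assumes G: "represents G u"
  shows "dist_Lp_norm p u = Lp_norm p G"
proof -
  have eq: "Lp_norm p g = Lp_norm p G" if g: "represents g u" for g
  proof (rule Lp_norm_AE_cong)
    show gm: "g \<in> borel_measurable lborel" "G \<in> borel_measurable lborel" using g G by (auto simp: represents_def)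
    have "AE x in lborel. g x - G x = 0"
    proof (rule schwartz_separating)
      show "(\<lambda>x. g x - G x) \<in> borel_measurable borel" using gm by measurable
      fix \<psi> :: "real^'d \<Rightarrow> complex" assume p: "\<psi> \<in> schwartz"
      have i: "integrable lborel (\<lambda>x. g x * \<psi> x)" "integrable lborel (\<lambda>x. G x * \<psi> x)" and e: "u \<psi> = (\<integral>x. g x * \<psi> x \<partial>lborel)" "u \<psi> = (\<integral>x. G x * \<psi> x \<partial>lborel)"
        using g G p by (auto simp: represents_def dist_of_fun_def)
      show "integrable lborel (\<lambda>x. (g x - G x) * \<psi> x)" "(\<integral>x. (g x - G x) * \<psi> x \<partial>lborel) = 0"
        using Bochner_Integration.integrable_diff[OF i] Bochner_Integration.integral_diff[OF i] e by (simp_all add: left_diff_distrib)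
    qed
    then show "AE x in lborel. g x = G x" by simp
  qed
  show ?thesis
    unfolding dist_Lp_norm_def
  proof (rule antisym)
    show "(INF g\<in>{g. represents g u}. Lp_norm p g) \<le> Lp_norm p G" by (rule INF_lower) (simp add: G)
    show "Lp_norm p G \<le> (INF g\<in>{g. represents g u}. Lp_norm p g)" by (rule INF_greatest) (simp add: eq)
  qed
qed

context frame_setup
begin

section \<open>Pointwise and weak properties of the representing functions\<close>

abbreviation \<eta> :: "int^'d \<Rightarrow> 'j \<Rightarrow> real^'d \<Rightarrow> complex" where "\<eta> n j \<equiv> inv_fourier (En n j)"

definition G :: "'d functional \<Rightarrow> 'j \<Rightarrow> real^'d \<Rightarrow> complex" where
  "G f j x = (\<Sum>i. cc f (latt i) j * \<eta> (latt i) j x)"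

lemma En_schwartz: "j \<in> J \<Longrightarrow> En n j \<in> schwartz"
  by (rule Z0_schwartz[OF ccinf0_Z0[OF En_ccinf0]])

lemma \<eta>_schwartz: "j \<in> J \<Longrightarrow> \<eta> n j \<in> schwartz"
  by (rule inv_fourier_schwartz[OF En_schwartz])

lemma \<eta>_measurable: "j \<in> J \<Longrightarrow> \<eta> n j \<in> borel_measurable borel"
  by (rule schwartz_measurable[OF \<eta>_schwartz])

lemma G_measurable: "j \<in> J \<Longrightarrow> G f j \<in> borel_measurable borel"
  unfolding G_def[abs_def] by (intro borel_measurable_suminf borel_measurable_times \<eta>_measurable) auto

text \<open>Growth of the coefficients in \<open>n\<close> is moved onto the point by Peetre's
  inequality: surplus decay of the frame function around the negative of the frequency makes
  frequency and dilated point interchangeable.\<close>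

lemma term_bound:
  assumes f: "f \<in> dist_mod_poly" and j: "j \<in> J"
  obtains C M where "0 \<le> C" "\<And>n x. norm (cc f n j * \<eta> n j x) \<le> C * (1 + norm (dil (\<tau> j) x)) ^ M * decay (2 * CARD('d)) (dil (\<tau> j) x + freq l n)"
proof -
  obtain M C where C: "0 \<le> C" "\<And>n. norm (cc f n j) \<le> C * (1 + norm (freq l n)) ^ M" by (rule cc_bound[OF f j]) (rule that)
  obtain E where E: "0 \<le> E" "\<And>j n x. j \<in> J \<Longrightarrow> norm (\<eta> n j x) \<le> E * Dt j powr (1/2) * decay (M + 2 * CARD('d)) (dil (\<tau> j) x + freq l n)"
    by (rule \<eta>_bound[where N="M + 2 * CARD('d)"]) (rule that)
  have "norm (cc f n j * \<eta> n j x) \<le> C * E * Dt j powr (1/2) * (1 + norm (dil (\<tau> j) x)) ^ M * decay (2 * CARD('d)) (dil (\<tau> j) x + freq l n)" for n x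
  proof -
    let ?y = "dil (\<tau> j) x"
    have "norm (cc f n j * \<eta> n j x) \<le> (C * (1 + norm (freq l n)) ^ M) * (E * Dt j powr (1/2) * decay (M + 2 * CARD('d)) (?y + freq l n))"
      unfolding norm_mult using C E j by (intro mult_mono) auto
    also have "\<dots> = C * E * Dt j powr (1/2) * ((1 + norm (freq l n)) ^ M * decay (M + 2 * CARD('d)) (?y + freq l n))" by simp
    also have "\<dots> \<le> C * E * Dt j powr (1/2) * ((1 + norm ?y) ^ M * decay (2 * CARD('d)) (?y + freq l n))"
      using peetre_ineq[of "freq l n" M "2 * CARD('d)" "?y + freq l n"] C(1) E(1) by (intro mult_left_mono) auto
    finally show ?thesis by (simp add: mult.assoc)
  qed
  moreover have "0 \<le> C * E * Dt j powr (1/2)" using C E by simp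
  ultimately show thesis by (rule that[rotated])
qed

lemma G_summable:
  assumes f: "f \<in> dist_mod_poly" and j: "j \<in> J"
  shows "summable (\<lambda>i. norm (cc f (latt i) j * \<eta> (latt i) j x))"
proof -
  obtain C M where C: "0 \<le> C" "\<And>n x. norm (cc f n j * \<eta> n j x) \<le> C * (1 + norm (dil (\<tau> j) x)) ^ M * decay (2 * CARD('d)) (dil (\<tau> j) x + freq l n)"
    by (rule term_bound[OF f j]) (rule that)
  obtain L where "0 \<le> L" and L: "\<And>y::real^'d. summable (\<lambda>i. decay (2 * CARD('d)) (y + freq l (latt i)))"
    and "\<And>y::real^'d. (\<Sum>i. decay (2 * CARD('d)) (y + freq l (latt i))) \<le> L" by (rule lattice_sum[OF l]) (rule that)
  show ?thesis
    by (rule summable_comparison_test[OF _ summable_mult[OF L]]) (use C(2) in auto)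
qed

lemma G_bound:
  assumes f: "f \<in> dist_mod_poly" and j: "j \<in> J"
  obtains C M where "0 \<le> C" "\<And>x. norm (G f j x) \<le> C * (1 + norm (dil (\<tau> j) x)) ^ M"
proof -
  obtain C M where C: "0 \<le> C" "\<And>n x. norm (cc f n j * \<eta> n j x) \<le> C * (1 + norm (dil (\<tau> j) x)) ^ M * decay (2 * CARD('d)) (dil (\<tau> j) x + freq l n)"
    by (rule term_bound[OF f j]) (rule that)
  obtain L where L: "0 \<le> L" "\<And>y::real^'d. summable (\<lambda>i. decay (2 * CARD('d)) (y + freq l (latt i)))"
    "\<And>y::real^'d. (\<Sum>i. decay (2 * CARD('d)) (y + freq l (latt i))) \<le> L" by (rule lattice_sum[OF l]) (rule that)
  have "norm (G f j x) \<le> C * L * (1 + norm (dil (\<tau> j) x)) ^ M" for x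
  proof -
    let ?y = "dil (\<tau> j) x"
    have "norm (G f j x) \<le> (\<Sum>i. norm (cc f (latt i) j * \<eta> (latt i) j x))"
      unfolding G_def by (rule summable_norm[OF G_summable[OF f j]])
    also have "\<dots> \<le> (\<Sum>i. C * (1 + norm ?y) ^ M * decay (2 * CARD('d)) (?y + freq l (latt i)))"
      by (intro suminf_le C G_summable[OF f j] summable_mult L)
    also have "\<dots> = C * (1 + norm ?y) ^ M * (\<Sum>i. decay (2 * CARD('d)) (?y + freq l (latt i)))"
      by (rule suminf_mult[OF L(2)])
    also have "\<dots> \<le> C * (1 + norm ?y) ^ M * L" using C(1) by (intro mult_left_mono L) auto
    finally show ?thesis by (simp add: mult_ac)
  qed
  moreover have "0 \<le> C * L" using C L by simp
  ultimately show thesis by (rule that[rotated])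
qed

lemma expand_sums:
  assumes "f \<in> dist_mod_poly" "j \<in> J" "smooth g"
  shows "(\<lambda>i. cc f (latt i) j * (\<integral>x. En (latt i) j x * g x \<partial>lborel)) sums f (fourier (\<lambda>x. ph j x * ph j x * g x))"
  by (rule has_sum_imp_sums)
    (use expand_has_sum[OF assms] has_sum_reindex_bij_betw[OF bij_latt, of "\<lambda>n. cc f n j * (\<integral>x. En n j x * g x \<partial>lborel)"] in simp)

text \<open>Taking a character as the test factor turns the integrals in the expansion into values
  of frame functions. The left side is free of the series, which is the form suited to inserting
  further cutoffs.\<close>

lemma G_eq:
  assumes f: "f \<in> dist_mod_poly" and j: "j \<in> J"
  shows "of_real ((2 * pi) powr (- real CARD('d) / 2)) * f (fourier (\<lambda>\<zeta>. ph j \<zeta> * ph j \<zeta> * cis (\<zeta> \<bullet> x))) = G f j x"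
proof -
  have "(\<lambda>i. of_real ((2 * pi) powr (- real CARD('d) / 2)) * (cc f (latt i) j * (\<integral>\<zeta>. En (latt i) j \<zeta> * cis (\<zeta> \<bullet> x) \<partial>lborel)))
    sums (of_real ((2 * pi) powr (- real CARD('d) / 2)) * f (fourier (\<lambda>\<zeta>. ph j \<zeta> * ph j \<zeta> * cis (\<zeta> \<bullet> x))))"
    by (intro sums_mult expand_sums f j smooth_cis)
  then show ?thesis
    unfolding G_def by (simp add: sums_iff inv_fourier_def mult.left_commute inner_commute[of _ x])
qed

text \<open>The series defining \<open>G f j\<close> is integrated term by term against a Schwartz
  function; the outcome is the expansion tested with the inverse transform of that function.\<close>

theorem G_represents:
  assumes f: "f \<in> dist_mod_poly" and j: "j \<in> J"
  shows "represents (G f j) (multiplier (\<lambda>x. ph j x * ph j x) f)"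
  unfolding represents_def
proof (intro conjI ballI)
  show "G f j \<in> borel_measurable lborel" using G_measurable[OF j] by simp
  fix \<psi> :: "real^'d \<Rightarrow> complex" assume p: "\<psi> \<in> schwartz"
  let ?D = "2 * CARD('d)"
  let ?F = "\<lambda>i x. cc f (latt i) j * \<eta> (latt i) j x * \<psi> x"
  obtain C M where C: "0 \<le> C" "\<And>n x. norm (cc f n j * \<eta> n j x) \<le> C * (1 + norm (dil (\<tau> j) x)) ^ M * decay ?D (dil (\<tau> j) x + freq l n)"
    by (rule term_bound[OF f j]) (rule that)
  obtain C2 where C2: "0 \<le> C2" "\<And>x. norm (\<psi> x) \<le> C2 * decay (M + ?D + ?D) x" by (rule schwartz_bound[OF p]) (rule that)
  define K where "K = 1 + (\<Sum>i\<in>UNIV. \<bar>\<tau> j $ i\<bar>)"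
  have K1: "1 \<le> K" by (simp add: K_def sum_nonneg)
  have ik: "\<bar>\<tau> j $ i\<bar> \<le> K" for i
    using member_le_sum[of i UNIV "\<lambda>i. \<bar>\<tau> j $ i\<bar>"] by (simp add: K_def)
  define C4 where "C4 = C * C2 * K ^ (M + ?D)"
  have C4: "0 \<le> C4" using C C2 K1 by (simp add: C4_def)
  \<comment> \<open>The surplus decay of \<open>\<psi>\<close> is spent in three ways: against the
    growth in the dilated variable, to produce summable decay in the frequency, and to remain
    integrable in \<open>x\<close>.\<close>
  have b: "norm (cc f n j * \<eta> n j x * \<psi> x) \<le> C4 * decay ?D (freq l n) * decay ?D x" for n x
  proof -
    let ?y = "dil (\<tau> j) x"
    have "norm (\<psi> x) \<le> C2 * (decay (M + ?D) x * decay ?D x)" using C2(2)[of x] unfolding decay_add[of "M + ?D" ?D] .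
    also have "\<dots> \<le> C2 * (K ^ (M + ?D) * decay (M + ?D) ?y * decay ?D x)"
      using C2(1) by (intro mult_left_mono mult_right_mono decay_dil_le ik K1) auto
    finally have "norm (cc f n j * \<eta> n j x * \<psi> x) \<le> (C * (1 + norm ?y) ^ M * decay ?D (?y + freq l n)) * (C2 * (K ^ (M + ?D) * decay (M + ?D) ?y * decay ?D x))"
      unfolding norm_mult[of _ "\<psi> x"] using C by (intro mult_mono) auto
    also have "\<dots> = C4 * (((1 + norm ?y) ^ M * decay M ?y) * (decay ?D (?y + freq l n) * decay ?D ?y)) * decay ?D x"
      by (simp add: C4_def decay_add mult_ac)
    also have "(1 + norm ?y) ^ M * decay M ?y = 1" by (simp add: decay_def)
    also have "C4 * (1 * (decay ?D (?y + freq l n) * decay ?D ?y)) * decay ?D x \<le> C4 * decay ?D (freq l n) * decay ?D x"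
      using decay_mult_le_diff[of ?D "?y + freq l n" ?y] C4 by (intro mult_right_mono mult_left_mono) auto
    finally show ?thesis .
  qed
  have meas: "(\<lambda>x. cc f n j * \<eta> n j x * \<psi> x) \<in> borel_measurable borel" for n
    by (intro borel_measurable_times borel_measurable_const \<eta>_measurable[OF j] schwartz_measurable[OF p])
  have int: "integrable lborel (?F i)" for i
    by (rule integrable_decay_bound[OF meas b])
  have sn: "summable (\<lambda>i. norm (?F i x))" for x
    using summable_mult2[OF G_summable[OF f j, of x], of "norm (\<psi> x)"] by (simp add: norm_mult)
  have ds: "summable (\<lambda>i. decay ?D (freq l (latt i :: int^'d)))"
    using decay_freq_summable[OF l, where 'd='d] summable_on_reindex_bij_betw[OF bij_latt, of "\<lambda>n::int^'d. decay ?D (freq l n)"]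
    by (auto intro: summable_on_imp_summable)
  have si: "summable (\<lambda>i. \<integral>x. norm (?F i x) \<partial>lborel)"
  proof (rule summable_comparison_test)
    show "summable (\<lambda>i. C4 * (\<integral>x. decay ?D x \<partial>(lborel :: (real^'d) measure)) * decay ?D (freq l (latt i :: int^'d)))"
      by (intro summable_mult ds)
    have "(\<integral>x. norm (?F i x) \<partial>lborel) \<le> (\<integral>x. C4 * decay ?D (freq l (latt i :: int^'d)) * decay ?D x \<partial>(lborel :: (real^'d) measure))" for i
    proof (rule Bochner_Integration.integral_mono)
      show "integrable lborel (\<lambda>x. norm (?F i x))" by (rule integrable_norm[OF int])
      show "integrable lborel (\<lambda>x::real^'d. C4 * decay ?D (freq l (latt i :: int^'d)) * decay ?D x)"
        by (intro integrable_mult_right integrable_decay order_refl)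
      show "norm (?F i x) \<le> C4 * decay ?D (freq l (latt i :: int^'d)) * decay ?D x" for x by (rule b)
    qed
    then show "\<exists>N. \<forall>i\<ge>N. norm (\<integral>x. norm (?F i x) \<partial>lborel) \<le> C4 * (\<integral>x. decay ?D x \<partial>(lborel :: (real^'d) measure)) * decay ?D (freq l (latt i :: int^'d))"
      by (simp add: mult_ac)
  qed
  have Gp: "G f j x * \<psi> x = (\<Sum>i. ?F i x)" for x
    unfolding G_def by (rule suminf_mult2[OF summable_norm_cancel[OF G_summable[OF f j]]])
  show "integrable lborel (\<lambda>x. G f j x * \<psi> x)"
    unfolding Gp by (rule integrable_suminf[OF int _ si]) (use sn in auto)
  have "(\<integral>x. G f j x * \<psi> x \<partial>lborel) = (\<Sum>i. \<integral>x. ?F i x \<partial>lborel)"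
    unfolding Gp by (rule integral_suminf[OF int _ si]) (use sn in auto)
  also have "\<dots> = (\<Sum>i. cc f (latt i) j * (\<integral>x. En (latt i) j x * inv_fourier \<psi> x \<partial>lborel))"
    by (simp add: mult.assoc inv_fourier_mult_swap[OF En_schwartz[OF j] p])
  also have "\<dots> = multiplier (\<lambda>x. ph j x * ph j x) f \<psi>"
    using expand_sums[OF f j schwartz_smooth[OF inv_fourier_schwartz[OF p]]] by (simp add: sums_iff multiplier_eq)
  finally show "multiplier (\<lambda>x. ph j x * ph j x) f \<psi> = dist_of_fun (G f j) \<psi>" by (simp add: dist_of_fun_def)
qed

lemma G_pair:
  assumes "f \<in> dist_mod_poly" "k \<in> J" "g \<in> schwartz"
  shows "f (fourier (\<lambda>x. ph k x * ph k x * g x)) = (\<integral>y. G f k y * fourier g y \<partial>lborel)"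
proof -
  have "inv_fourier (fourier g) = g" using fourier_inversion[OF assms(3)] by auto
  then have "f (fourier (\<lambda>x. ph k x * ph k x * g x)) = multiplier (\<lambda>x. ph k x * ph k x) f (fourier g)"
    by (simp add: multiplier_eq)
  also have "\<dots> = (\<integral>y. G f k y * fourier g y \<partial>lborel)"
    using G_represents[OF assms(1,2)] fourier_schwartz[OF assms(3)] by (simp add: represents_def dist_of_fun_def)
  finally show ?thesis .
qed

lemma G_pair_bound:
  assumes "f \<in> dist_mod_poly" "k \<in> J" "g \<in> schwartz" "\<And>y. norm (fourier g y) \<le> B y" "B \<in> borel_measurable borel"
  shows "ennreal (norm (f (fourier (\<lambda>x. ph k x * ph k x * g x)))) \<le> (\<integral>\<^sup>+y. ennreal (norm (G f k y) * B y) \<partial>lborel)"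
proof -
  have "ennreal (norm (\<integral>y. G f k y * fourier g y \<partial>lborel)) \<le> (\<integral>\<^sup>+y. ennreal (norm (G f k y * fourier g y)) \<partial>lborel)"
    by (rule integral_norm_bound_ennreal) (use G_represents[OF assms(1,2)] fourier_schwartz[OF assms(3)] in \<open>simp add: represents_def\<close>)
  also have "\<dots> \<le> (\<integral>\<^sup>+y. ennreal (norm (G f k y) * B y) \<partial>lborel)"
    by (intro nn_integral_mono ennreal_leI) (simp add: norm_mult mult_left_mono assms(4))
  finally show ?thesis by (simp only: G_pair[OF assms(1-3)])
qed

text \<open>The local partition of unity, read in the coordinates of one index \<open>j\<close>, is
  smooth and compactly supported, and it equals 1 on \<open>Q\<close> because every set meeting
  \<open>Qs j\<close> is included.\<close>

lemma bump_exists: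
  obtains \<Psi> K where "smooth \<Psi>" "compact K" "\<And>\<omega>. \<omega> \<notin> K \<Longrightarrow> \<Psi> \<omega> = (0::complex)" "\<And>\<omega>. \<omega> \<in> Q \<Longrightarrow> \<Psi> \<omega> = 1"
proof -
  have "axis undefined 1 \<noteq> (0::real^'d)" by (simp add: axis_eq_0_iff)
  then obtain j where j: "j \<in> J" using P_covers by blast
  define \<Psi> where "\<Psi> \<omega> = (\<Sum>i\<in>nb j. ph i (T j \<omega>) * ph i (T j \<omega>))" for \<omega>
  define K where "K = (\<Union>i\<in>nb j. Ti j ` TS i)"
  have sm: "smooth (\<lambda>\<omega>. \<Sum>i\<in>I. ph i (T j \<omega>) * ph i (T j \<omega>))" if "finite I" for I
    using that
  proof (induction I)
    case empty
    show ?case using schwartz_smooth[OF schwartz_zero] by simp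
  next
    case (insert i I)
    have "smooth (\<lambda>\<omega>. ph i (T j \<omega>) * ph i (T j \<omega>))" unfolding T_def by (intro smooth_diag[of "\<lambda>x. ph i x * ph i x"] smooth_mult smooth_ph)
    from smooth_add[OF this insert.IH] show ?case using insert by simp
  qed
  show thesis
  proof (rule that)
    show "smooth \<Psi>" unfolding \<Psi>_def[abs_def] by (rule sm[OF fin_nb[OF j]])
    show "compact K" unfolding K_def
      by (intro compact_UN fin_nb j compact_continuous_image continuous_on_Ti TS_props(1)) (rule nb_J)
    fix \<omega>
    show "\<Psi> \<omega> = 0" if "\<omega> \<notin> K"
      unfolding \<Psi>_def
    proof (rule sum.neutral, rule ballI)
      fix i assume i: "i \<in> nb j"
      have "T j \<omega> \<notin> TS i"
      proof
        assume "T j \<omega> \<in> TS i"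
        then have "Ti j (T j \<omega>) \<in> K" using i unfolding K_def by blast
        then show False using that by (simp add: Ti_T[OF j])
      qed
      then show "ph i (T j \<omega>) * ph i (T j \<omega>) = 0" using TS_props(4)[OF nb_J[OF i]] by simp
    qed
    show "\<Psi> \<omega> = 1" if "\<omega> \<in> Q"
    proof -
      have x: "T j \<omega> \<in> Qs j" using that by (simp add: Qs_def Ti_T[OF j])
      show ?thesis unfolding \<Psi>_def
        by (rule ph_sum1[OF Qs_nz[OF j x] fin_nb[OF j]]) (use x in \<open>auto simp: nb_def\<close>)
    qed
  qed
qed

text \<open>A cutoff equal to 1 on \<open>Qs k\<close> may be inserted next to the multiplier
  without changing \<open>G f k\<close>. Its transform is a rescaled Schwartz function, so the
  constant depends on \<open>k\<close> only through the Jacobian.\<close>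

lemma G_repro:
  obtains C where "0 \<le> C" "\<And>f k x. f \<in> dist_mod_poly \<Longrightarrow> k \<in> J \<Longrightarrow>
    ennreal (norm (G f k x)) \<le> ennreal (C * Dt k) * (\<integral>\<^sup>+y. ennreal (norm (G f k y) * decay N (dil (\<tau> k) (x - y))) \<partial>lborel)"
proof -
  obtain \<Psi> K where \<Psi>: "smooth \<Psi>" "compact K" "\<And>\<omega>. \<omega> \<notin> K \<Longrightarrow> \<Psi> \<omega> = (0::complex)" "\<And>\<omega>. \<omega> \<in> Q \<Longrightarrow> \<Psi> \<omega> = 1"
    by (rule bump_exists) (rule that)
  have \<Psi>s: "\<Psi> \<in> schwartz" by (rule compact_supp_schwartz[OF \<Psi>(1-3)])
  obtain C where C: "0 \<le> C" "\<And>\<zeta>. norm (fourier \<Psi> \<zeta>) \<le> C * decay N \<zeta>" by (rule fourier_decay_schwartz[OF \<Psi>s]) (rule that)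
  let ?c = "(2 * pi) powr (- real CARD('d) / 2)"
  have "ennreal (norm (G f k x)) \<le> ennreal (?c * C * Dt k) * (\<integral>\<^sup>+y. ennreal (norm (G f k y) * decay N (dil (\<tau> k) (x - y))) \<partial>lborel)"
    if f: "f \<in> dist_mod_poly" and k: "k \<in> J" for f k x
  proof -
    \<comment> \<open>The character yields the value of \<open>G f k\<close> at \<open>x\<close>,
      the rescaled bump yields the decay of the kernel.\<close>
    define g where "g \<zeta> = cis (\<zeta> \<bullet> x) * \<Psi> (Ti k \<zeta>)" for \<zeta>
    have Ts: "(\<lambda>\<zeta>. \<Psi> (Ti k \<zeta>)) \<in> schwartz"
    proof (rule compact_supp_schwartz)
      show "smooth (\<lambda>\<zeta>. \<Psi> (Ti k \<zeta>))" unfolding Ti_def by (rule smooth_diag[OF \<Psi>(1)])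
      show "compact (T k ` K)" by (intro compact_continuous_image continuous_on_T \<Psi>)
      show "\<Psi> (Ti k x) = 0" if "x \<notin> T k ` K" for x
        by (rule \<Psi>(3)) (use that image_eqI[of x "T k" "Ti k x" K] T_Ti[OF k] in auto)
    qed
    have gs: "g \<in> schwartz" unfolding g_def[abs_def] by (rule schwartz_cis_mult[OF Ts])
    have e: "ph k \<zeta> * ph k \<zeta> * g \<zeta> = ph k \<zeta> * ph k \<zeta> * cis (\<zeta> \<bullet> x)" for \<zeta>
      by (cases "\<zeta> \<in> Qs k") (simp_all add: ph_Qs g_def \<Psi>(4) Qs_def)
    have nb: "norm (fourier g y) \<le> C * Dt k * decay N (dil (\<tau> k) (x - y))" for y
    proof -
      have cont: "continuous_on UNIV (\<lambda>\<zeta>. g \<zeta> * cis (- (\<zeta> \<bullet> y)))"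
        by (intro continuous_intros schwartz_continuous[OF gs] continuous_on_cis)
      have "\<Psi> \<omega> * cis (- (\<omega> \<bullet> dil (\<tau> k) (y - x))) = cis (b k \<bullet> (y - x)) * (g (T k \<omega>) * cis (- (T k \<omega> \<bullet> y)))" for \<omega>
      proof -
        have ip: "T k \<omega> \<bullet> v = \<omega> \<bullet> dil (\<tau> k) v + b k \<bullet> v" for v
          by (simp add: T_def inner_add_left inner_vec_def dil_def distrib_left sum.distrib mult_ac)
        have "b k \<bullet> (y - x) + (T k \<omega> \<bullet> x + - (T k \<omega> \<bullet> y)) = - (\<omega> \<bullet> dil (\<tau> k) (y - x))"
          using ip[of "y - x"] inner_diff_right[of "T k \<omega>" y x] by linarith
        then have "cis (- (\<omega> \<bullet> dil (\<tau> k) (y - x))) = cis (b k \<bullet> (y - x)) * (cis (T k \<omega> \<bullet> x) * cis (- (T k \<omega> \<bullet> y)))"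
          by (simp only: cis_mult)
        then show ?thesis by (simp only: g_def Ti_T[OF k] mult.assoc mult.left_commute mult.commute)
      qed
      then have "fourier \<Psi> (dil (\<tau> k) (y - x)) = of_real ?c * (cis (b k \<bullet> (y - x)) * (\<integral>\<omega>. g (T k \<omega>) * cis (- (T k \<omega> \<bullet> y)) \<partial>lborel))"
        unfolding fourier_def by simp
      then have "fourier g y * cis (b k \<bullet> (y - x)) = of_real (Dt k) * fourier \<Psi> (dil (\<tau> k) (y - x))"
        unfolding fourier_def[of g] T_dil_integral[OF k cont] by (simp add: mult_ac)
      then have "norm (fourier g y * cis (b k \<bullet> (y - x))) = norm (of_real (Dt k) * fourier \<Psi> (dil (\<tau> k) (y - x)))" by simp
      then have "norm (fourier g y) = Dt k * norm (fourier \<Psi> (dil (\<tau> k) (y - x)))"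
        using Dt_pos[OF k] by (simp add: norm_mult)
      also have "\<dots> \<le> Dt k * (C * decay N (dil (\<tau> k) (y - x)))" using Dt_pos[OF k] by (intro mult_left_mono C) auto
      also have "decay N (dil (\<tau> k) (y - x)) = decay N (dil (\<tau> k) (x - y))"
        using decay_minus[of N "dil (\<tau> k) (x - y)"] by (simp add: dil_minus[symmetric])
      finally show ?thesis by (simp add: mult_ac)
    qed
    have gx: "norm (G f k x) = ?c * norm (f (fourier (\<lambda>\<zeta>. ph k \<zeta> * ph k \<zeta> * g \<zeta>)))"
      unfolding e G_eq[OF f k, symmetric] norm_mult by simp
    have [measurable]: "(\<lambda>y. decay N (dil (\<tau> k) (x - y))) \<in> borel_measurable borel"
      by (intro borel_measurable_continuous_onI continuous_on_compose2[OF continuous_on_decay[of UNIV]] continuous_intros) auto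
    note [measurable] = G_measurable[OF k]
    have "ennreal (norm (f (fourier (\<lambda>\<zeta>. ph k \<zeta> * ph k \<zeta> * g \<zeta>)))) \<le> (\<integral>\<^sup>+y. ennreal (norm (G f k y) * (C * Dt k * decay N (dil (\<tau> k) (x - y)))) \<partial>lborel)"
      by (rule G_pair_bound[OF f k gs nb]) measurable
    also have "\<dots> = (\<integral>\<^sup>+y. ennreal (C * Dt k) * ennreal (norm (G f k y) * decay N (dil (\<tau> k) (x - y))) \<partial>lborel)"
      using C(1) Dt_pos[OF k] by (simp add: ennreal_mult[symmetric] mult_ac)
    also have "\<dots> = ennreal (C * Dt k) * (\<integral>\<^sup>+y. ennreal (norm (G f k y) * decay N (dil (\<tau> k) (x - y))) \<partial>lborel)"
      by (rule nn_integral_cmult) measurable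
    finally have "ennreal ?c * ennreal (norm (f (fourier (\<lambda>\<zeta>. ph k \<zeta> * ph k \<zeta> * g \<zeta>)))) \<le> ennreal ?c * (ennreal (C * Dt k) * (\<integral>\<^sup>+y. ennreal (norm (G f k y) * decay N (dil (\<tau> k) (x - y))) \<partial>lborel))"
      by (rule mult_left_mono) simp
    then show ?thesis using C(1) Dt_pos[OF k] unfolding gx by (simp add: ennreal_mult mult.assoc)
  qed
  note r = this
  show thesis by (rule that[OF _ r]) (use C in auto)
qed

text \<open>The test function of the coefficient has as its transform the conjugate of the frame
  function and hence the same decay. Inserting the local partition of unity leaves integrals of
  \<open>G f k\<close> against a translated decay weight.\<close>

lemma cc_le:
  obtains C where "0 \<le> C" "\<And>f j n. f \<in> dist_mod_poly \<Longrightarrow> j \<in> J \<Longrightarrow>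
    ennreal (norm (cc f n j)) \<le> (\<Sum>k\<in>nb j. ennreal (C * Dt j powr (1/2)) * (\<integral>\<^sup>+y. ennreal (norm (G f k y) * decay N (dil (\<tau> j) y + freq l n)) \<partial>lborel))"
proof -
  obtain C where C: "0 \<le> C" "\<And>j n x. j \<in> J \<Longrightarrow> norm (\<eta> n j x) \<le> C * Dt j powr (1/2) * decay N (dil (\<tau> j) x + freq l n)"
    by (rule \<eta>_bound[where N=N]) (rule that)
  have "ennreal (norm (cc f n j)) \<le> (\<Sum>k\<in>nb j. ennreal (C * Dt j powr (1/2)) * (\<integral>\<^sup>+y. ennreal (norm (G f k y) * decay N (dil (\<tau> j) y + freq l n)) \<partial>lborel))"
    if f: "f \<in> dist_mod_poly" and j: "j \<in> J" for f j n
  proof -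
    let ?g = "En (- n) j"
    have s: "?g = (\<lambda>x. \<Sum>k\<in>nb j. ph k x * ph k x * ?g x)"
    proof
      fix x
      show "?g x = (\<Sum>k\<in>nb j. ph k x * ph k x * ?g x)"
      proof (cases "x \<in> Qs j")
        case True
        have "(\<Sum>k\<in>nb j. ph k x * ph k x) = 1"
          by (rule ph_sum1[OF Qs_nz[OF j True] fin_nb[OF j]]) (use True in \<open>auto simp: nb_def\<close>)
        then show ?thesis by (simp add: sum_distrib_right[symmetric])
      qed (simp add: En_def ph_Qs)
    qed
    have nbd: "norm (fourier ?g y) \<le> C * Dt j powr (1/2) * decay N (dil (\<tau> j) y + freq l n)" for y
    proof -
      have "fourier ?g y = cnj (\<eta> n j y)" by (simp add: cnj_inv_fourier cnj_En)
      then show ?thesis using C(2)[OF j, of n y] by simp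
    qed
    have "cc f n j = f (fourier (\<lambda>x. \<Sum>k\<in>nb j. ph k x * ph k x * ?g x))" unfolding cc_def by (subst s) (rule refl)
    also have "\<dots> = (\<Sum>k\<in>nb j. f (fourier (\<lambda>x. ph k x * ph k x * ?g x)))"
      by (intro dist_fourier_sum f ccinf0_Z0 ccinf0_mult(1) schwartz_smooth En_schwartz j ph2_ccinf0 nb_J)
    finally have e: "cc f n j = (\<Sum>k\<in>nb j. f (fourier (\<lambda>x. ph k x * ph k x * ?g x)))" .
    have "norm (cc f n j) \<le> (\<Sum>k\<in>nb j. norm (f (fourier (\<lambda>x. ph k x * ph k x * ?g x))))"
      unfolding e by (rule norm_sum)
    then have "ennreal (norm (cc f n j)) \<le> (\<Sum>k\<in>nb j. ennreal (norm (f (fourier (\<lambda>x. ph k x * ph k x * ?g x)))))"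
      by (simp add: ennreal_leI)
    also have "\<dots> \<le> (\<Sum>k\<in>nb j. ennreal (C * Dt j powr (1/2)) * (\<integral>\<^sup>+y. ennreal (norm (G f k y) * decay N (dil (\<tau> j) y + freq l n)) \<partial>lborel))"
    proof (rule sum_mono)
      fix k assume "k \<in> nb j"
      then have k: "k \<in> J" by (rule nb_J)
      note [measurable] = G_measurable[OF k]
      have "ennreal (norm (f (fourier (\<lambda>x. ph k x * ph k x * ?g x)))) \<le> (\<integral>\<^sup>+y. ennreal (norm (G f k y) * (C * Dt j powr (1/2) * decay N (dil (\<tau> j) y + freq l n))) \<partial>lborel)"
        by (rule G_pair_bound[OF f k En_schwartz[OF j] nbd]) measurable
      also have "\<dots> = (\<integral>\<^sup>+y. ennreal (C * Dt j powr (1/2)) * ennreal (norm (G f k y) * decay N (dil (\<tau> j) y + freq l n)) \<partial>lborel)"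
        using C(1) by (simp add: ennreal_mult[symmetric] mult_ac)
      also have "\<dots> = ennreal (C * Dt j powr (1/2)) * (\<integral>\<^sup>+y. ennreal (norm (G f k y) * decay N (dil (\<tau> j) y + freq l n)) \<partial>lborel)"
        by (rule nn_integral_cmult) measurable
      finally show "ennreal (norm (f (fourier (\<lambda>x. ph k x * ph k x * ?g x)))) \<le> ennreal (C * Dt j powr (1/2)) * (\<integral>\<^sup>+y. ennreal (norm (G f k y) * decay N (dil (\<tau> j) y + freq l n)) \<partial>lborel)" .
    qed
    finally show ?thesis .
  qed
  note r = this
  show thesis by (rule that[OF C(1) r])
qed

end

section \<open>Discrete and continuous convolution inequalities\<close>

text \<open>A Jensen inequality for a kernel of total mass at most \<open>A\<close>, proved by
  truncation: the values of \<open>a\<close> below \<open>lam\<close> account for at most half of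
  the integral, and above that level a \<le> lam^(1-p) a^p.\<close>

lemma nn_powr_large:
  fixes a k :: "'a \<Rightarrow> real"
  assumes p: "1 \<le> p" and [measurable]: "a \<in> borel_measurable M" "k \<in> borel_measurable M"
    and a0: "\<And>x. 0 \<le> a x" and k0: "\<And>x. 0 \<le> k x"
    and A: "(\<integral>\<^sup>+x. ennreal (k x) \<partial>M) \<le> ennreal A" "0 < A"
    and s: "(\<integral>\<^sup>+x. ennreal (a x * k x) \<partial>M) = ennreal s" "0 \<le> s"
  shows "ennreal (s powr p) \<le> ennreal (2 * (2 * A) powr (p - 1)) * (\<integral>\<^sup>+x. ennreal (a x powr p * k x) \<partial>M)"
proof (cases "s = 0")
  case True
  then show ?thesis by simp
next
  case False
  \<comment> \<open>This level gives \<open>lam * A = s / 2\<close>, which bounds the contribution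
    of the small values.\<close>
  define lam where "lam = s / (2 * A)"
  let ?U = "\<integral>\<^sup>+x. ennreal (a x powr p * k x) \<partial>M"
  have l: "0 < lam" "s = 2 * A * lam" using s False A by (simp_all add: lam_def)
  have pt: "a x \<le> lam + lam powr (1 - p) * a x powr p" for x
  proof (cases "a x \<le> lam")
    case True
    then show ?thesis by (simp add: add_increasing2)
  next
    case f: False
    then have "a x powr (1 - p) \<le> lam powr (1 - p)" using p l by (intro powr_mono2') auto
    then have "a x powr (1 - p) * a x powr p \<le> lam powr (1 - p) * a x powr p" by (rule mult_right_mono) simp
    moreover have "a x powr (1 - p) * a x powr p = a x" using f l by (simp add: powr_add[symmetric])
    ultimately show ?thesis using l by simp
  qed
  have "ennreal (s / 2) + ennreal (s / 2) = (\<integral>\<^sup>+x. ennreal (a x * k x) \<partial>M)"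
    using s by (simp add: ennreal_plus[symmetric] del: ennreal_plus)
  also have "\<dots> \<le> (\<integral>\<^sup>+x. ennreal lam * ennreal (k x) + ennreal (lam powr (1 - p)) * ennreal (a x powr p * k x) \<partial>M)"
  proof (rule nn_integral_mono)
    fix x
    have "a x * k x \<le> (lam + lam powr (1 - p) * a x powr p) * k x" by (rule mult_right_mono[OF pt k0])
    then have "ennreal (a x * k x) \<le> ennreal (lam * k x + lam powr (1 - p) * (a x powr p * k x))"
      by (intro ennreal_leI) (simp add: algebra_simps)
    also have "\<dots> = ennreal lam * ennreal (k x) + ennreal (lam powr (1 - p)) * ennreal (a x powr p * k x)"
      using l k0[of x] by (simp add: ennreal_plus ennreal_mult[symmetric])
    finally show "ennreal (a x * k x) \<le> ennreal lam * ennreal (k x) + ennreal (lam powr (1 - p)) * ennreal (a x powr p * k x)" .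
  qed
  also have "\<dots> = ennreal lam * (\<integral>\<^sup>+x. ennreal (k x) \<partial>M) + ennreal (lam powr (1 - p)) * ?U"
    by (subst nn_integral_add) (simp_all add: nn_integral_cmult)
  also have "\<dots> \<le> ennreal lam * ennreal A + ennreal (lam powr (1 - p)) * ?U"
    by (intro add_mono mult_left_mono A) auto
  also have "ennreal lam * ennreal A = ennreal (s / 2)" using l A by (simp add: ennreal_mult[symmetric] mult.commute)
  finally have "ennreal (s / 2) \<le> ennreal (lam powr (1 - p)) * ?U"
    by (simp add: ennreal_add_left_cancel_le)
  then have "ennreal (2 * (2 * A) powr (p - 1) * lam powr (p - 1)) * ennreal (s / 2)
      \<le> ennreal (2 * (2 * A) powr (p - 1) * lam powr (p - 1)) * (ennreal (lam powr (1 - p)) * ?U)"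
    by (rule mult_left_mono) simp
  moreover have "ennreal (2 * (2 * A) powr (p - 1) * lam powr (p - 1)) * ennreal (s / 2) = ennreal (s powr p)"
  proof -
    have "s powr p = s powr (p - 1) * s powr 1" unfolding powr_add[symmetric] by simp
    also have "\<dots> = (2 * A) powr (p - 1) * lam powr (p - 1) * s" using l A by (simp add: powr_mult)
    finally show ?thesis using s by (simp add: ennreal_mult[symmetric])
  qed
  moreover have "ennreal (2 * (2 * A) powr (p - 1) * lam powr (p - 1)) * (ennreal (lam powr (1 - p)) * ?U) = ennreal (2 * (2 * A) powr (p - 1)) * ?U"
  proof -
    have "lam powr (p - 1) * lam powr (1 - p) = 1" using l by (simp add: powr_add[symmetric])
    then have "2 * (2 * A) powr (p - 1) * lam powr (p - 1) * lam powr (1 - p) = 2 * (2 * A) powr (p - 1)"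
      by (simp only: mult.assoc)
    then show ?thesis by (simp only: mult.assoc[symmetric] ennreal_mult[symmetric] mult_nonneg_nonneg powr_ge_zero zero_le_numeral)
  qed
  ultimately show ?thesis by simp
qed

text \<open>The a priori bound \<open>b x \<le> B * s\<close> replaces convexity: b = b^(1-p) b^p
  \<le> (B s)^(1-p) b^p, and after integration the powers of \<open>s\<close> are divided
  out.\<close>

lemma nn_powr_small:
  fixes b :: "'a \<Rightarrow> real"
  assumes p: "0 < p" "p \<le> 1" and [measurable]: "b \<in> borel_measurable M"
    and b0: "\<And>x. 0 \<le> b x" and s: "(\<integral>\<^sup>+x. ennreal (b x) \<partial>M) = ennreal s" "0 \<le> s"
    and B: "\<And>x. b x \<le> B * s" "1 \<le> B"
  shows "ennreal (s powr p) \<le> ennreal (B powr (1 - p)) * (\<integral>\<^sup>+x. ennreal (b x powr p) \<partial>M)"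
proof (cases "s = 0")
  case True
  then show ?thesis by simp
next
  case False
  then have s0: "0 < s" using s by simp
  let ?U = "\<integral>\<^sup>+x. ennreal (b x powr p) \<partial>M"
  have pt: "b x \<le> (B * s) powr (1 - p) * b x powr p" for x
  proof (cases "b x = 0")
    case f: False
    have "b x powr (1 - p) \<le> (B * s) powr (1 - p)" using p b0[of x] B(1)[of x] by (intro powr_mono2) auto
    then have "b x powr (1 - p) * b x powr p \<le> (B * s) powr (1 - p) * b x powr p" by (rule mult_right_mono) simp
    moreover have "b x powr (1 - p) * b x powr p = b x" using f b0[of x] by (simp add: powr_add[symmetric])
    ultimately show ?thesis by simp
  qed simp
  have "ennreal s \<le> (\<integral>\<^sup>+x. ennreal ((B * s) powr (1 - p)) * ennreal (b x powr p) \<partial>M)"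
    unfolding s(1)[symmetric] by (rule nn_integral_mono) (use pt in \<open>simp add: ennreal_mult[symmetric] ennreal_leI\<close>)
  also have "\<dots> = ennreal ((B * s) powr (1 - p)) * ?U" by (rule nn_integral_cmult) measurable
  finally have "ennreal (s powr (p - 1)) * ennreal s \<le> ennreal (s powr (p - 1)) * (ennreal ((B * s) powr (1 - p)) * ?U)"
    by (rule mult_left_mono) simp
  moreover have "ennreal (s powr (p - 1)) * ennreal s = ennreal (s powr p)"
  proof -
    have "s powr p = s powr (p - 1) * s powr 1" unfolding powr_add[symmetric] by simp
    then show ?thesis using s0 by (simp add: ennreal_mult[symmetric])
  qed
  moreover have "ennreal (s powr (p - 1)) * (ennreal ((B * s) powr (1 - p)) * ?U) = ennreal (B powr (1 - p)) * ?U"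
  proof -
    have "s powr (p - 1) * (B * s) powr (1 - p) = B powr (1 - p) * (s powr (p - 1) * s powr (1 - p))"
      using s0 B(2) by (simp add: powr_mult)
    also have "s powr (p - 1) * s powr (1 - p) = 1" using s0 by (simp add: powr_add[symmetric])
    finally have e: "s powr (p - 1) * (B * s) powr (1 - p) = B powr (1 - p)" by simp
    show ?thesis unfolding mult.assoc[symmetric] ennreal_mult[OF powr_ge_zero powr_ge_zero, symmetric] e ..
  qed
  ultimately show ?thesis by simp
qed

text \<open>The decay exponent for which both \<open>decay N\<close> and \<open>decay N powr p\<close> are integrable.\<close>

definition Np :: "nat \<Rightarrow> real \<Rightarrow> nat" where
  "Np d p = nat \<lceil>2 * real d / min p 1\<rceil>"

lemma Np_ge:
  assumes "0 < p"
  shows "2 * d \<le> Np d p" "p \<le> 1 \<Longrightarrow> 2 * real d \<le> real (Np d p) * p"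
proof -
  have n: "2 * real d / min p 1 \<le> real (Np d p)" unfolding Np_def by linarith
  have "2 * real d \<le> 2 * real d / min p 1" using assms by (simp add: field_simps mult_left_le)
  then show "2 * d \<le> Np d p" using n by linarith
  show "2 * real d \<le> real (Np d p) * p" if "p \<le> 1" using n assms that by (simp add: min_def field_simps split: if_splits)
qed

lemma decay_powr_le:
  assumes "2 * real d \<le> real N * p"
  shows "decay N x powr p \<le> decay (2 * d) x"
proof -
  have "decay K x = (1 + norm x) powr (- real K)" for K
    by (simp add: decay_def powr_minus powr_realpow)
  then have "decay N x powr p = (1 + norm x) powr (- (real N * p))" by (simp add: powr_powr)
  also have "\<dots> \<le> (1 + norm x) powr (- real (2 * d))" using assms by (intro powr_mono) auto
  also have "\<dots> = decay (2 * d) x" by (simp add: decay_def powr_minus powr_realpow[symmetric])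
  finally show ?thesis .
qed

text \<open>Both preceding estimates, on counting measure. For exponents below 1 each nonnegative
  term is at most the whole sum, so the a priori bound holds with constant 1.\<close>

lemma synth_powr:
  assumes l: "0 < l" and p: "0 < p"
  obtains C where "0 \<le> C" "\<And>a (y::real^'d::finite). (\<And>i. 0 \<le> a i) \<Longrightarrow>
    summable (\<lambda>i. a i * decay (Np CARD('d) p) (y + freq l (latt i))) \<Longrightarrow>
    ennreal ((\<Sum>i. a i * decay (Np CARD('d) p) (y + freq l (latt i))) powr p) \<le>
      ennreal C * (\<Sum>i. ennreal (a i powr p * decay (2 * CARD('d)) (y + freq l (latt i))))"
proof -
  obtain L where L: "0 \<le> L" "\<And>y::real^'d. (\<Sum>i. ennreal (decay (2 * CARD('d)) (y + freq l (latt i)))) \<le> ennreal L"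
    by (rule lattice_sum_nn[OF l]) (rule that)
  define C where "C = max 1 (2 * (2 * (L + 1)) powr (p - 1))"
  have C0: "0 \<le> C" by (simp add: C_def)
  have main: "ennreal ((\<Sum>i. a i * decay (Np CARD('d) p) (y + freq l (latt i))) powr p) \<le>
      ennreal C * (\<Sum>i. ennreal (a i powr p * decay (2 * CARD('d)) (y + freq l (latt i))))"
    if a0: "\<And>i. 0 \<le> a i" and sm: "summable (\<lambda>i. a i * decay (Np CARD('d) p) (y + freq l (latt i)))" for a and y :: "real^'d"
  proof -
    let ?k = "\<lambda>i. decay (Np CARD('d) p) (y + freq l (latt i))" and ?d = "\<lambda>i. decay (2 * CARD('d)) (y + freq l (latt i))"
    define s where "s = (\<Sum>i. a i * ?k i)"
    have s0: "0 \<le> s" unfolding s_def by (rule suminf_nonneg[OF sm]) (simp add: a0)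
    have s: "(\<integral>\<^sup>+i. ennreal (a i * ?k i) \<partial>count_space UNIV) = ennreal s"
      unfolding nn_integral_count_space_nat s_def by (rule suminf_ennreal2[OF _ sm]) (simp add: a0)
    have kd: "?k i \<le> ?d i" for i by (rule decay_mono[OF Np_ge(1)[OF p]])
    show ?thesis
    proof (cases "1 \<le> p")
      case True
      have "(\<integral>\<^sup>+i. ennreal (?k i) \<partial>count_space UNIV) \<le> (\<Sum>i. ennreal (?d i))"
        unfolding nn_integral_count_space_nat by (intro suminf_le ennreal_leI kd summableI)
      also have "\<dots> \<le> ennreal (L + 1)" using L(1) by (intro order_trans[OF L(2)] ennreal_leI) simp
      finally have A: "(\<integral>\<^sup>+i. ennreal (?k i) \<partial>count_space UNIV) \<le> ennreal (L + 1)" .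
      have "ennreal (s powr p) \<le> ennreal (2 * (2 * (L + 1)) powr (p - 1)) * (\<integral>\<^sup>+i. ennreal (a i powr p * ?k i) \<partial>count_space UNIV)"
        by (rule nn_powr_large[OF True _ _ a0 _ A _ s s0]) (use L in auto)
      also have "\<dots> \<le> ennreal C * (\<Sum>i. ennreal (a i powr p * ?d i))"
        unfolding nn_integral_count_space_nat
        by (intro mult_mono suminf_le ennreal_leI mult_left_mono kd summableI) (auto simp: C_def)
      finally show ?thesis unfolding s_def .
    next
      case False
      have "a i * ?k i \<le> 1 * s" for i
        using sum_le_suminf[OF sm, of "{i}"] a0 by (simp add: s_def)
      then have "ennreal (s powr p) \<le> ennreal (1 powr (1 - p)) * (\<integral>\<^sup>+i. ennreal ((a i * ?k i) powr p) \<partial>count_space UNIV)"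
        by (intro nn_powr_small[OF p _ _ _ s s0]) (use False a0 in auto)
      also have "\<dots> \<le> ennreal C * (\<Sum>i. ennreal (a i powr p * ?d i))"
        unfolding nn_integral_count_space_nat
      proof (intro mult_mono suminf_le ennreal_leI summableI)
        show "(a i * ?k i) powr p \<le> a i powr p * ?d i" for i
          unfolding powr_mult
          by (intro mult_left_mono decay_powr_le Np_ge(2)[OF p]) (use False in auto)
      qed (auto simp: C_def)
      finally show ?thesis unfolding s_def .
    qed
  qed
  show thesis by (rule that[OF C0 main])
qed

lemma nn_shift:
  fixes f :: "real^'d::finite \<Rightarrow> ennreal"
  assumes "f \<in> borel_measurable borel"
  shows "(\<integral>\<^sup>+x. f (x + b) \<partial>lborel) = (\<integral>\<^sup>+x. f x \<partial>lborel)"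
  using nn_integral_dil[of "\<chi> i. 1" f b] assms by simp

lemma nn_decay: obtains I where "0 < I" "\<And>y::real^'d::finite. (\<integral>\<^sup>+x. ennreal (decay (2 * CARD('d)) (x + y)) \<partial>lborel) \<le> ennreal I"
proof -
  let ?I = "\<integral>\<^sup>+x. ennreal (decay (2 * CARD('d)) (x::real^'d)) \<partial>lborel"
  have f: "?I < \<infinity>" by (rule nn_integral_decay_finite)
  have "?I = ennreal (enn2real ?I)" using f by simp
  also have "\<dots> \<le> ennreal (enn2real ?I + 1)" by (rule ennreal_leI) simp
  finally have "?I \<le> ennreal (enn2real ?I + 1)" .
  then have "(\<integral>\<^sup>+x. ennreal (decay (2 * CARD('d)) (x + y)) \<partial>lborel) \<le> ennreal (enn2real ?I + 1)" for y :: "real^'d"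
    by (subst nn_shift[of "\<lambda>x. ennreal (decay (2 * CARD('d)) x)"]) auto
  note b = this
  show thesis by (rule that[OF _ b]) (simp add: add_nonneg_pos)
qed

section \<open>Convolution estimates for functions dominated by their own averages\<close>

context
  fixes g :: "real^'d::finite \<Rightarrow> real" and p :: real and B :: "nat \<Rightarrow> real"
  assumes p: "0 < p" and g0: "\<And>y. 0 \<le> g y" and gm: "g \<in> borel_measurable borel"
    and B1: "\<And>N. 1 \<le> B N"
    and repro: "\<And>N y. ennreal (g y) \<le> ennreal (B N) * (\<integral>\<^sup>+w. ennreal (g w * decay N (y - w)) \<partial>lborel)"
begin

text \<open>The a priori bound comes from applying \<open>repro\<close> at \<open>w\<close> and
  merging the two decay weights: the weight at \<open>w + y\<close> times the weight at
  \<open>w - u\<close> is at most the weight at \<open>u + y\<close>. The remaining integral is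
  \<open>s\<close> itself.\<close>

lemma conv_small:
  assumes p1: "p \<le> 1" and N: "2 * real CARD('d) \<le> real N * p"
    and s: "(\<integral>\<^sup>+w. ennreal (g w * decay N (w + y)) \<partial>lborel) = ennreal s" "0 \<le> s"
  shows "ennreal (s powr p) \<le> ennreal (B N powr (1 - p)) * (\<integral>\<^sup>+w. ennreal (g w powr p * decay (2 * CARD('d)) (w + y)) \<partial>lborel)"
proof -
  note [measurable] = gm
  have b: "g w * decay N (w + y) \<le> B N * s" for w
  proof -
    have "ennreal (g w * decay N (w + y)) = ennreal (decay N (w + y)) * ennreal (g w)" using g0 by (simp add: ennreal_mult[symmetric] mult.commute)
    also have "\<dots> \<le> ennreal (decay N (w + y)) * (ennreal (B N) * (\<integral>\<^sup>+u. ennreal (g u * decay N (w - u)) \<partial>lborel))"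
      by (intro mult_left_mono repro) simp
    also have "\<dots> = ennreal (B N) * (\<integral>\<^sup>+u. ennreal (decay N (w + y)) * ennreal (g u * decay N (w - u)) \<partial>lborel)"
      by (subst nn_integral_cmult) (simp_all add: mult.left_commute)
    also have "\<dots> \<le> ennreal (B N) * (\<integral>\<^sup>+u. ennreal (g u * decay N (u + y)) \<partial>lborel)"
    proof (intro mult_left_mono nn_integral_mono)
      fix u
      have "decay N (w + y) * decay N (w - u) \<le> decay N (u + y)"
        using decay_mult_le_diff[of N "w + y" "w - u"] by (simp add: add.commute)
      then have "g u * (decay N (w + y) * decay N (w - u)) \<le> g u * decay N (u + y)" by (rule mult_left_mono[OF _ g0])
      then show "ennreal (decay N (w + y)) * ennreal (g u * decay N (w - u)) \<le> ennreal (g u * decay N (u + y))"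
        using g0[of u] by (simp add: ennreal_mult[symmetric] mult.left_commute ennreal_leI)
    qed simp
    also have "\<dots> = ennreal (B N * s)" using s B1[of N] by (simp add: ennreal_mult)
    finally show ?thesis using s B1[of N] by (subst (asm) ennreal_le_iff) auto
  qed
  have "ennreal (s powr p) \<le> ennreal (B N powr (1 - p)) * (\<integral>\<^sup>+w. ennreal ((g w * decay N (w + y)) powr p) \<partial>lborel)"
    by (rule nn_powr_small[OF p p1 _ _ s b B1]) (use g0 in auto)
  also have "\<dots> \<le> ennreal (B N powr (1 - p)) * (\<integral>\<^sup>+w. ennreal (g w powr p * decay (2 * CARD('d)) (w + y)) \<partial>lborel)"
  proof (intro mult_left_mono nn_integral_mono ennreal_leI)
    show "(g w * decay N (w + y)) powr p \<le> g w powr p * decay (2 * CARD('d)) (w + y)" for w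
      unfolding powr_mult by (intro mult_left_mono decay_powr_le N) auto
  qed simp
  finally show ?thesis .
qed

text \<open>For \<open>p < 1\<close> the estimate \<open>conv_small\<close> presupposes a finite convolution. Polynomial growth of \<open>g\<close>
  gives this only for a large exponent depending on \<open>g\<close>; that case shows that \<open>g\<close> is bounded,
  and then the fixed exponent can be used.\<close>

lemma conv_powr:
  assumes poly: "\<And>y. g y \<le> K * (1 + norm y) ^ M"
    and fin: "(\<integral>\<^sup>+w. ennreal (g w powr p) \<partial>lborel) < \<infinity>"
    and I: "\<And>y::real^'d. (\<integral>\<^sup>+x. ennreal (decay (2 * CARD('d)) (x + y)) \<partial>lborel) \<le> ennreal I" "0 < I"
  shows "\<exists>s\<ge>0. (\<integral>\<^sup>+w. ennreal (g w * decay (Np CARD('d) p) (w + y)) \<partial>lborel) = ennreal s \<and>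
    ennreal (s powr p) \<le> ennreal (max (2 * (2 * I) powr (p - 1)) (B (Np CARD('d) p) powr (1 - p))) *
      (\<integral>\<^sup>+w. ennreal (g w powr p * decay (2 * CARD('d)) (w + y)) \<partial>lborel)"
proof -
  note [measurable] = gm
  let ?N = "Np CARD('d) p" and ?D = "2 * CARD('d)"
  let ?J = "\<lambda>N y. \<integral>\<^sup>+w. ennreal (g w * decay N (w + y)) \<partial>lborel"
  let ?U = "\<lambda>y. \<integral>\<^sup>+w. ennreal (g w powr p * decay ?D (w + y)) \<partial>lborel"
  define V where "V = (\<integral>\<^sup>+w. ennreal (g w powr p) \<partial>lborel)"
  have UV: "?U y \<le> V" for y
    unfolding V_def by (intro nn_integral_mono ennreal_leI) (simp add: mult_left_le decay_le_1)
  have kd: "decay ?N x \<le> decay ?D x" for x :: "real^'d" by (rule decay_mono[OF Np_ge(1)[OF p]])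
  have NI: "(\<integral>\<^sup>+x. ennreal (decay ?N (x + y)) \<partial>lborel) \<le> ennreal I" for y :: "real^'d"
    by (rule order_trans[OF nn_integral_mono I(1)[of y]]) (intro ennreal_leI kd)
  have finite_bounded: "?J N y < \<infinity>" if bd: "\<And>y. g y * decay N (y + z) \<le> c * decay ?D (y + z')" and c: "0 \<le> c" and zy: "z = y" for N y z z' c
  proof -
    have "?J N y \<le> (\<integral>\<^sup>+w. ennreal c * ennreal (decay ?D (w + z')) \<partial>lborel)"
      using bd c unfolding zy by (intro nn_integral_mono) (simp add: ennreal_mult[symmetric] ennreal_leI)
    also have "\<dots> = ennreal c * (\<integral>\<^sup>+w. ennreal (decay ?D (w + z')) \<partial>lborel)" by (rule nn_integral_cmult) measurable
    also have "\<dots> \<le> ennreal c * ennreal I" by (intro mult_left_mono I) simp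
    also have "\<dots> < \<infinity>" by (simp add: ennreal_mult_less_top)
    finally show ?thesis .
  qed
  show ?thesis
  proof (cases "1 \<le> p")
    case True
    \<comment> \<open>For exponents at least 1 the integral is finite because g \<le> 1 + g^p and
      both parts are integrable against the weight.\<close>
    have "?J ?N y \<le> (\<integral>\<^sup>+w. ennreal (decay ?N (w + y)) + ennreal (g w powr p * decay ?D (w + y)) \<partial>lborel)"
    proof (rule nn_integral_mono)
      fix w
      have "g w \<le> 1 + g w powr p"
      proof (cases "g w \<le> 1")
        case True
        then show ?thesis by (simp add: add_increasing2)
      next
        case False
        then have "g w powr 1 \<le> g w powr p" using \<open>1 \<le> p\<close> by (intro powr_mono) auto
        then show ?thesis using False by simp
      qed
      then have "g w * decay ?N (w + y) \<le> (1 + g w powr p) * decay ?N (w + y)" by (rule mult_right_mono) simp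
      also have "\<dots> \<le> decay ?N (w + y) + g w powr p * decay ?D (w + y)"
        using mult_left_mono[OF kd[of "w + y"], of "g w powr p"] by (simp add: distrib_right)
      finally show "ennreal (g w * decay ?N (w + y)) \<le> ennreal (decay ?N (w + y)) + ennreal (g w powr p * decay ?D (w + y))"
        by (simp add: ennreal_plus[symmetric] ennreal_leI del: ennreal_plus)
    qed
    also have "\<dots> = (\<integral>\<^sup>+w. ennreal (decay ?N (w + y)) \<partial>lborel) + ?U y" by (rule nn_integral_add) measurable
    also have "\<dots> \<le> ennreal I + V" by (intro add_mono NI UV)
    also have "\<dots> < \<infinity>" using fin by (simp add: V_def)
    finally have J: "?J ?N y < \<infinity>" .
    define s where "s = enn2real (?J ?N y)"
    have s: "?J ?N y = ennreal s" "0 \<le> s" using J by (simp_all add: s_def)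
    have "ennreal (s powr p) \<le> ennreal (2 * (2 * I) powr (p - 1)) * (\<integral>\<^sup>+w. ennreal (g w powr p * decay ?N (w + y)) \<partial>lborel)"
      by (rule nn_powr_large[OF True _ _ g0 _ NI I(2) s]) auto
    also have "\<dots> \<le> ennreal (max (2 * (2 * I) powr (p - 1)) (B ?N powr (1 - p))) * ?U y"
      by (intro mult_mono nn_integral_mono ennreal_leI mult_left_mono kd) auto
    finally show ?thesis using s by blast
  next
    case False
    then have p1: "p \<le> 1" by simp
    have Nk: "2 * real CARD('d) \<le> real N * p" if "?N \<le> N" for N
    proof -
      have "real ?N * p \<le> real N * p" using that p by (intro mult_right_mono) auto
      then show ?thesis using Np_ge(2)[OF p p1, of "CARD('d)"] by linarith
    qed
    \<comment> \<open>Large enough for the power estimate and to absorb the polynomial growth of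
      \<open>g\<close>; it depends on \<open>g\<close> and so must not enter the final
      constant.\<close>
    define N' where "N' = max ?N (M + ?D)"
    have K0: "0 \<le> K" using poly[of 0] g0[of 0] by simp
    have J': "?J N' y < \<infinity>" for y
    proof (rule finite_bounded[where z=y and z'=y and c="K * (1 + norm y) ^ M"])
      fix w :: "real^'d"
      have "g w * decay N' (w + y) \<le> (K * (1 + norm w) ^ M) * decay (M + ?D) (w + y)"
        using K0 g0 by (intro mult_mono poly decay_mono) (auto simp: N'_def)
      also have "\<dots> = K * ((1 + norm w) ^ M * decay (M + ?D) (w + y))" by simp
      also have "\<dots> \<le> K * ((1 + norm y) ^ M * decay ?D (w + y))"
        using peetre_ineq[of w M ?D "w + y"] K0 by (intro mult_left_mono) auto
      finally show "g w * decay N' (w + y) \<le> K * (1 + norm y) ^ M * decay ?D (w + y)" by (simp add: mult.assoc)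
    qed (use K0 in auto)
    define v where "v = enn2real V"
    have v: "V = ennreal v" "0 \<le> v" using fin by (simp_all add: v_def V_def)
    \<comment> \<open>Obtained by solving the power estimate at exponent \<open>N'\<close> for the
      convolution; it bounds the convolution at every point.\<close>
    define H where "H = (B N' powr (1 - p) * v) powr (1 / p)"
    have JH: "?J N' y \<le> ennreal H" for y
    proof -
      define s where "s = enn2real (?J N' y)"
      have s: "?J N' y = ennreal s" "0 \<le> s" using J'[of y] by (simp_all add: s_def)
      have "ennreal (s powr p) \<le> ennreal (B N' powr (1 - p)) * ?U y"
        by (rule conv_small[OF p1 Nk s]) (simp add: N'_def)
      also have "\<dots> \<le> ennreal (B N' powr (1 - p)) * V" by (intro mult_left_mono UV) simp
      also have "\<dots> = ennreal (B N' powr (1 - p) * v)" using v by (simp add: ennreal_mult)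
      finally have "s powr p \<le> B N' powr (1 - p) * v" using v by (subst (asm) ennreal_le_iff) auto
      then have "(s powr p) powr (1 / p) \<le> H" unfolding H_def using p by (intro powr_mono2) auto
      then have "s \<le> H" using p s(2) by (simp add: powr_powr)
      then show ?thesis unfolding s(1) by (rule ennreal_leI)
    qed
    have H0: "0 \<le> H" by (simp add: H_def)
    \<comment> \<open>Reproduction at exponent \<open>N'\<close> turns the bound for the convolution
      into one for \<open>g\<close>, after which the integral with the fixed exponent is
      finite.\<close>
    have gH: "g w \<le> B N' * H" for w
    proof -
      have e: "decay N' (w - u) = decay N' (u + - w)" for u :: "real^'d"
        using decay_minus[of N' "w - u"] by simp
      have "ennreal (g w) \<le> ennreal (B N') * ?J N' (- w)"
        using repro[where y=w and N=N'] unfolding e .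
      also have "\<dots> \<le> ennreal (B N') * ennreal H" by (intro mult_left_mono JH) simp
      finally have "ennreal (g w) \<le> ennreal (B N' * H)" using B1[of N'] H0 by (simp add: ennreal_mult)
      then show ?thesis using B1[of N'] H0 by (subst (asm) ennreal_le_iff) auto
    qed
    have J: "?J ?N y < \<infinity>"
    proof (rule finite_bounded[where z=y and z'=y and c="B N' * H"])
      show "g w * decay ?N (w + y) \<le> B N' * H * decay ?D (w + y)" for w
        using B1[of N'] H0 by (intro mult_mono gH kd) auto
    qed (use B1[of N'] H0 in auto)
    define s where "s = enn2real (?J ?N y)"
    have s: "?J ?N y = ennreal s" "0 \<le> s" using J by (simp_all add: s_def)
    have "ennreal (s powr p) \<le> ennreal (B ?N powr (1 - p)) * ?U y"
      by (rule conv_small[OF p1 Nk s]) simp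
    also have "\<dots> \<le> ennreal (max (2 * (2 * I) powr (p - 1)) (B ?N powr (1 - p))) * ?U y"
      by (intro mult_right_mono ennreal_leI) auto
    finally show ?thesis using s by blast
  qed
qed

end

section \<open>Extended powers and sequence norms\<close>

lemma ennreal_powr_ennreal: "0 \<le> t \<Longrightarrow> ennreal_powr (ennreal t) s = ennreal (t powr s)"
  by (simp add: ennreal_powr_def)

lemma ennreal_powr_mono:
  assumes "x \<le> y" "0 \<le> s"
  shows "ennreal_powr x s \<le> ennreal_powr y s"
proof (cases "y = \<infinity>")
  case False
  then have "x \<noteq> \<infinity>" using assms(1) by (auto simp: top_unique)
  then show ?thesis using False assms unfolding ennreal_powr_def
    by (auto intro!: ennreal_leI powr_mono2 enn2real_mono simp: less_top)
qed (simp add: ennreal_powr_def)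

lemma ennreal_powr_cmult:
  assumes "0 < C"
  shows "ennreal_powr (ennreal C * x) s = ennreal (C powr s) * ennreal_powr x s"
proof (cases x)
  case (real t)
  then show ?thesis using assms
    by (simp add: ennreal_mult[symmetric] ennreal_powr_ennreal powr_mult)
next
  case top
  then show ?thesis using assms by (simp add: ennreal_powr_def ennreal_mult_top)
qed

text \<open>Passing to counting measure makes monotonicity, scalar factors and the exchange of sums
  available as facts on integrals.\<close>

lemma infsum_nn_integral:
  fixes f :: "'a \<Rightarrow> ennreal"
  assumes "countable A"
  shows "infsum f A = (\<integral>\<^sup>+x. f x \<partial>count_space A)"
proof (cases "finite A")
  case False
  let ?e = "from_nat_into A"
  have bij: "bij_betw ?e UNIV A" by (rule bij_betw_from_nat_into[OF assms False])
  have "(f has_sum infsum f A) A" by (intro has_sum_infsum nonneg_summable_on_complete) simp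
  then have "((\<lambda>i. f (?e i)) has_sum infsum f A) UNIV" unfolding has_sum_reindex_bij_betw[OF bij] .
  then have "(\<Sum>i. f (?e i)) = infsum f A" using has_sum_imp_sums sums_unique by metis
  then show ?thesis
    using nn_integral_bij_count_space[OF bij, of f] by (simp add: nn_integral_count_space_nat)
qed (simp add: nn_integral_count_space_finite)

lemma infsum_latt:
  fixes f :: "int^'d::finite \<Rightarrow> ennreal"
  shows "infsum f UNIV = (\<Sum>i. f (latt i))"
  using infsum_nn_integral[of UNIV f] nn_integral_bij_count_space[OF bij_latt, of f]
  by (simp add: nn_integral_count_space_nat)

lemma lp_norm_mono:
  assumes "countable I" "\<And>i. i \<in> I \<Longrightarrow> c i \<le> d i"
  shows "lp_norm p I c \<le> lp_norm p I d"
proof (cases "p = \<infinity>")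
  case True
  have "(SUP i\<in>I. c i) \<le> (SUP i\<in>I. d i)"
  proof (rule SUP_least)
    fix i assume i: "i \<in> I"
    show "c i \<le> (SUP i\<in>I. d i)" using assms(2)[OF i] SUP_upper[OF i, of d] by (rule order_trans)
  qed
  then show ?thesis using True by (simp add: lp_norm_def)
next
  case False
  have "(\<Sum>\<^sub>\<infinity>i\<in>I. ennreal_powr (c i) (enn2real p)) \<le> (\<Sum>\<^sub>\<infinity>i\<in>I. ennreal_powr (d i) (enn2real p))"
    unfolding infsum_nn_integral[OF assms(1)]
    by (rule nn_integral_mono) (use assms(2) in \<open>auto intro!: ennreal_powr_mono\<close>)
  then show ?thesis using False by (simp add: lp_norm_def ennreal_powr_mono inv_exponent_def)
qed

lemma inv_exponent_eq: "0 < r \<Longrightarrow> inv_exponent (ennreal r) = 1 / r"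
  by (simp add: inv_exponent_def inverse_ennreal divide_inverse)

lemma lp_norm_cmult:
  assumes "countable I" "0 < C" "0 < p"
  shows "lp_norm p I (\<lambda>i. ennreal C * c i) \<le> ennreal C * lp_norm p I c"
proof (cases p)
  case top
  have "(SUP i\<in>I. ennreal C * c i) \<le> ennreal C * (SUP i\<in>I. c i)"
    by (intro SUP_least mult_left_mono SUP_upper) auto
  then show ?thesis using top by (simp add: lp_norm_def)
next
  case (real r)
  have r: "0 < r" using real assms(3) by (cases "r = 0") auto
  have "(\<Sum>\<^sub>\<infinity>i\<in>I. ennreal_powr (ennreal C * c i) r) = ennreal (C powr r) * (\<Sum>\<^sub>\<infinity>i\<in>I. ennreal_powr (c i) r)"
    unfolding infsum_nn_integral[OF assms(1)] ennreal_powr_cmult[OF assms(2)] by (rule nn_integral_cmult) simp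
  then show ?thesis using real r assms(2)
    by (simp add: lp_norm_def inv_exponent_eq[OF r] ennreal_powr_cmult powr_powr)
qed

lemma sum_le_card_max:
  fixes x :: "'a \<Rightarrow> ennreal"
  assumes "finite A" "A \<noteq> {}"
  obtains k where "k \<in> A" "(\<Sum>i\<in>A. x i) \<le> of_nat (card A) * x k"
proof -
  have "Max (x ` A) \<in> x ` A" using assms by (intro Max_in) auto
  then obtain k where k: "k \<in> A" "x k = Max (x ` A)" by auto
  have "(\<Sum>i\<in>A. x i) \<le> of_nat (card A) * x k"
    by (rule sum_bounded_above) (use assms k in auto)
  with k(1) show thesis by (rule that)
qed

text \<open>A sum is at most the number of its terms times the largest one; this works for every
  positive exponent, convex or concave.\<close>

lemma ennreal_powr_sum_le:
  fixes x :: "'a \<Rightarrow> ennreal"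
  assumes A: "finite A" "card A \<le> N" and s: "0 < s" and N: "0 < N"
  shows "ennreal_powr (\<Sum>i\<in>A. x i) s \<le> ennreal (real N powr s) * (\<Sum>i\<in>A. ennreal_powr (x i) s)"
proof (cases "A = {}")
  case True
  then show ?thesis by (simp add: ennreal_powr_def)
next
  case False
  obtain k where k: "k \<in> A" "(\<Sum>i\<in>A. x i) \<le> of_nat (card A) * x k" by (rule sum_le_card_max[OF A(1) False]) (rule that)
  have "of_nat (card A) * x k \<le> ennreal (real N) * x k"
    using A(2) by (intro mult_right_mono) (auto simp: ennreal_of_nat_eq_real_of_nat intro!: ennreal_leI)
  then have "ennreal_powr (\<Sum>i\<in>A. x i) s \<le> ennreal_powr (ennreal (real N) * x k) s"
    using k(2) s by (intro ennreal_powr_mono) auto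
  also have "\<dots> = ennreal (real N powr s) * ennreal_powr (x k) s" by (rule ennreal_powr_cmult) (use N in simp)
  also have "\<dots> \<le> ennreal (real N powr s) * (\<Sum>i\<in>A. ennreal_powr (x i) s)"
    by (intro mult_left_mono member_le_sum) (use A k in auto)
  finally show ?thesis .
qed

text \<open>After raising to the power \<open>r\<close> and exchanging the sums, each
  \<open>k\<close> is counted once for every \<open>j\<close> having it as a neighbour; by symmetry
  these are among the neighbours of \<open>k\<close>, at most \<open>N\<close> of them.\<close>

lemma lp_norm_neighbours:
  fixes x :: "'j \<Rightarrow> ennreal" and nb :: "'j \<Rightarrow> 'j set"
  assumes J: "countable J" and N: "0 < N" "\<And>j. j \<in> J \<Longrightarrow> finite (nb j) \<and> card (nb j) \<le> N"
    and sym: "\<And>j k. j \<in> J \<Longrightarrow> k \<in> nb j \<Longrightarrow> k \<in> J \<and> j \<in> nb k" and q: "0 < q"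
  obtains C where "0 < C" "\<And>x. lp_norm q J (\<lambda>j. \<Sum>k\<in>nb j. x k) \<le> ennreal C * lp_norm q J x"
proof (cases q)
  case top
  have "lp_norm q J (\<lambda>j. \<Sum>k\<in>nb j. x k) \<le> ennreal (real N) * lp_norm q J x" for x
  proof -
    have "(\<Sum>k\<in>nb j. x k) \<le> ennreal (real N) * (SUP j\<in>J. x j)" if j: "j \<in> J" for j
    proof -
      have "(\<Sum>k\<in>nb j. x k) \<le> of_nat (card (nb j)) * (SUP j\<in>J. x j)"
        by (rule sum_bounded_above) (use sym[OF j] in \<open>auto intro: SUP_upper\<close>)
      also have "\<dots> \<le> ennreal (real N) * (SUP j\<in>J. x j)"
        using N(2)[OF j] by (intro mult_right_mono) (auto simp: ennreal_of_nat_eq_real_of_nat intro!: ennreal_leI)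
      finally show ?thesis .
    qed
    then have "(SUP j\<in>J. \<Sum>k\<in>nb j. x k) \<le> ennreal (real N) * (SUP j\<in>J. x j)" by (intro SUP_least)
    then show ?thesis using top by (simp add: lp_norm_def)
  qed
  note b = this
  show thesis by (rule that[OF _ b]) (use N in simp)
next
  case (real r)
  have r: "0 < r" using real q by (cases "r = 0") auto
  define C where "C = (real N powr r * real N) powr (1 / r)"
  have C0: "0 < C" using N by (simp add: C_def)
  have "lp_norm q J (\<lambda>j. \<Sum>k\<in>nb j. x k) \<le> ennreal C * lp_norm q J x" for x
  proof -
    define y where "y k = ennreal_powr (x k) r" for k
    let ?i = "\<lambda>j k. indicator J j * indicator (nb j) k :: ennreal"
    have cnt: "(\<integral>\<^sup>+j. ?i j k \<partial>count_space UNIV) \<le> ennreal (real N) * indicator J k" for k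
    proof (cases "k \<in> J")
      case True
      have "(\<integral>\<^sup>+j. ?i j k \<partial>count_space UNIV) \<le> (\<integral>\<^sup>+j. indicator (nb k) j \<partial>count_space UNIV)"
      proof (rule nn_integral_mono)
        fix j
        show "?i j k \<le> indicator (nb k) j"
        proof (cases "j \<in> J \<and> k \<in> nb j")
          case True
          then have "j \<in> nb k" using sym[of j k] by simp
          then show ?thesis by (simp add: indicator_def)
        qed (auto simp: indicator_def)
      qed
      also have "\<dots> = of_nat (card (nb k))" using N(2)[OF True] by simp
      also have "\<dots> \<le> ennreal (real N)" using N(2)[OF True] by (auto simp: ennreal_of_nat_eq_real_of_nat intro!: ennreal_leI)
      finally show ?thesis using True by simp
    next
      case False
      have z: "?i j k = 0" for j using sym[of j k] False by (auto simp: indicator_def)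
      show ?thesis unfolding z by simp
    qed
    have "(\<Sum>\<^sub>\<infinity>j\<in>J. ennreal_powr (\<Sum>k\<in>nb j. x k) r) = (\<integral>\<^sup>+j. ennreal_powr (\<Sum>k\<in>nb j. x k) r * indicator J j \<partial>count_space UNIV)"
      unfolding infsum_nn_integral[OF J] by (simp add: nn_integral_count_space_indicator)
    also have "\<dots> \<le> (\<integral>\<^sup>+j. ennreal (real N powr r) * (\<integral>\<^sup>+k. y k * ?i j k \<partial>count_space UNIV) \<partial>count_space UNIV)"
    proof (rule nn_integral_mono)
      fix j
      show "ennreal_powr (\<Sum>k\<in>nb j. x k) r * indicator J j \<le> ennreal (real N powr r) * (\<integral>\<^sup>+k. y k * ?i j k \<partial>count_space UNIV)"
      proof (cases "j \<in> J")
        case True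
        have "ennreal_powr (\<Sum>k\<in>nb j. x k) r \<le> ennreal (real N powr r) * (\<Sum>k\<in>nb j. y k)"
          unfolding y_def by (rule ennreal_powr_sum_le) (use N True r in auto)
        also have "(\<Sum>k\<in>nb j. y k) = (\<integral>\<^sup>+k. y k * indicator (nb j) k \<partial>count_space UNIV)"
          using N(2)[OF True] by (simp add: nn_integral_count_space_indicator[symmetric] nn_integral_count_space_finite)
        finally show ?thesis using True by simp
      qed simp
    qed
    also have "\<dots> = ennreal (real N powr r) * (\<integral>\<^sup>+j. (\<integral>\<^sup>+k. y k * ?i j k \<partial>count_space UNIV) \<partial>count_space UNIV)"
      by (rule nn_integral_cmult) simp
    also have "(\<integral>\<^sup>+j. (\<integral>\<^sup>+k. y k * ?i j k \<partial>count_space UNIV) \<partial>count_space UNIV) = (\<integral>\<^sup>+k. (\<integral>\<^sup>+j. y k * ?i j k \<partial>count_space UNIV) \<partial>count_space UNIV)"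
      using nn_integral_fst_count_space[of "\<lambda>(j,k). y k * ?i j k"] nn_integral_snd_count_space[of "\<lambda>(j,k). y k * ?i j k"] by simp
    also have "\<dots> = (\<integral>\<^sup>+k. y k * (\<integral>\<^sup>+j. ?i j k \<partial>count_space UNIV) \<partial>count_space UNIV)"
      by (intro nn_integral_cong nn_integral_cmult) simp
    also have "\<dots> \<le> (\<integral>\<^sup>+k. y k * (ennreal (real N) * indicator J k) \<partial>count_space UNIV)"
      by (intro nn_integral_mono mult_left_mono cnt) simp
    also have "\<dots> = (\<integral>\<^sup>+k. ennreal (real N) * (y k * indicator J k) \<partial>count_space UNIV)" by (simp add: mult.left_commute)
    also have "\<dots> = ennreal (real N) * (\<integral>\<^sup>+k. y k * indicator J k \<partial>count_space UNIV)" by (rule nn_integral_cmult) simp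
    also have "(\<integral>\<^sup>+k. y k * indicator J k \<partial>count_space UNIV) = (\<Sum>\<^sub>\<infinity>k\<in>J. y k)"
      unfolding infsum_nn_integral[OF J] by (simp add: nn_integral_count_space_indicator)
    finally have m: "(\<Sum>\<^sub>\<infinity>j\<in>J. ennreal_powr (\<Sum>k\<in>nb j. x k) r) \<le> ennreal (real N powr r * real N) * (\<Sum>\<^sub>\<infinity>k\<in>J. y k)"
      by (simp add: mult_left_mono ennreal_mult mult.assoc)
    have "ennreal_powr (\<Sum>\<^sub>\<infinity>j\<in>J. ennreal_powr (\<Sum>k\<in>nb j. x k) r) (1 / r) \<le> ennreal_powr (ennreal (real N powr r * real N) * (\<Sum>\<^sub>\<infinity>k\<in>J. y k)) (1 / r)"
      using m r by (intro ennreal_powr_mono) auto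
    also have "\<dots> = ennreal C * ennreal_powr (\<Sum>\<^sub>\<infinity>k\<in>J. y k) (1 / r)"
      unfolding C_def by (rule ennreal_powr_cmult) (use N in simp)
    finally show ?thesis using real r by (simp add: lp_norm_def inv_exponent_eq[OF r] y_def)
  qed
  note b = this
  show thesis by (rule that[OF C0 b])
qed

section \<open>Norm equivalence\<close>

context frame_setup
begin

lemma ennreal_mult2:
  assumes "0 \<le> x" "0 \<le> y"
  shows "ennreal x * (ennreal y * u) = ennreal (x * y) * u"
  using assms by (simp add: ennreal_mult mult.assoc)

lemma ennreal_mult3:
  assumes "0 \<le> x" "0 \<le> y" "0 \<le> v"
  shows "ennreal x * (ennreal y * (ennreal v * u)) = ennreal (x * y * v) * u"
  using assms by (simp add: ennreal_mult mult.assoc)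

text \<open>The modulus of the coefficient normalised for an exponent whose inverse is
  \<open>e\<close>; the value 0 belongs to the infinite exponent.\<close>

definition cp :: "real \<Rightarrow> 'd functional \<Rightarrow> 'j \<Rightarrow> int^'d \<Rightarrow> real" where
  "cp e f j n = Dt j powr (1/2 - e) * norm (cc f n j)"

lemma pairing_frame_p:
  assumes f: "f \<in> dist_mod_poly" and j: "j \<in> J"
  shows "pairing f (frame_system_p p J A b \<Phi> z l n j) = of_real (Dt j powr (1/2 - inv_exponent p)) * cc f n j"
proof -
  have "(\<lambda>x. cnj (frame_system_p p J A b \<Phi> z l n j x)) = fourier (\<lambda>x. of_real (Dt j powr (1/2 - inv_exponent p)) * En (- n) j x)"
    by (intro ext) (simp add: frame_system_p_def frame_En[OF j] det_A[OF j] abs_of_pos[OF Dt_pos[OF j]] cnj_inv_fourier cnj_En fourier_cmult)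
  then show ?thesis
    unfolding pairing_def cc_def by (simp add: dist_fourier_cmult[OF f ccinf0_Z0[OF En_ccinf0[OF j]]])
qed

lemma countable_J: "countable J"
  using sc by (simp add: structured_covering_def)

lemma prod_\<iota>: "j \<in> J \<Longrightarrow> (\<Prod>i\<in>UNIV. \<bar>\<iota> j $ i\<bar>) = 1 / Dt j"
  using \<tau>_pos[of j] by (simp add: \<iota>_def Dt_def prod_dividef abs_of_pos)

lemma dil_\<tau>\<iota>: "j \<in> J \<Longrightarrow> dil (\<tau> j) (dil (\<iota> j) y) = y"
  using \<tau>_pos[of j] by (simp add: dil_def \<iota>_def vec_eq_iff less_imp_neq[symmetric])

lemma nn_scale:
  assumes j: "j \<in> J" and F: "F \<in> borel_measurable borel"
  shows "(\<integral>\<^sup>+x. F x \<partial>lborel) = ennreal (1 / Dt j) * (\<integral>\<^sup>+y. F (dil (\<iota> j) y) \<partial>lborel)"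
proof -
  have "\<iota> j $ i \<noteq> 0" for i using \<tau>_pos[OF j, of i] by (simp add: \<iota>_def)
  from nn_integral_dil[of "\<iota> j" F 0, OF this F] show ?thesis by (simp add: prod_\<iota>[OF j])
qed

lemma nn_scale':
  assumes j: "j \<in> J" and F: "F \<in> borel_measurable borel"
  shows "(\<integral>\<^sup>+y. F (dil (\<iota> j) y) \<partial>lborel) = ennreal (Dt j) * (\<integral>\<^sup>+x. F x \<partial>lborel)"
  unfolding nn_scale[OF assms] using Dt_pos[OF j] by (simp add: mult.assoc[symmetric] ennreal_mult[symmetric])

text \<open>In the dilated variable the powers of \<open>Dt j\<close> from the frame functions and
  the substitution cancel against the normalisation, so the constant is free of \<open>j\<close>.
  The discrete estimate holds at each point, and integrating it uses the common bound
  \<open>I\<close> for the integrals of all translated weights.\<close>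

lemma synth_bound:
  assumes r: "0 < r"
  obtains C where "0 < C" "\<And>f j. f \<in> dist_mod_poly \<Longrightarrow> j \<in> J \<Longrightarrow>
    (\<integral>\<^sup>+x. ennreal (norm (G f j x) powr r) \<partial>lborel) \<le> ennreal C * (\<Sum>i. ennreal (cp (1 / r) f j (latt i) powr r))"
proof -
  let ?D = "2 * CARD('d)" and ?N = "Np CARD('d) r"
  obtain E where E: "0 \<le> E" "\<And>j n x. j \<in> J \<Longrightarrow> norm (\<eta> n j x) \<le> E * Dt j powr (1/2) * decay ?N (dil (\<tau> j) x + freq l n)"
    by (rule \<eta>_bound[where N="?N"]) (rule that)
  obtain C where C: "0 \<le> C" "\<And>a (y::real^'d). (\<And>i. 0 \<le> a i) \<Longrightarrow>
    summable (\<lambda>i. a i * decay ?N (y + freq l (latt i))) \<Longrightarrow>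
    ennreal ((\<Sum>i. a i * decay ?N (y + freq l (latt i))) powr r) \<le>
      ennreal C * (\<Sum>i. ennreal (a i powr r * decay ?D (y + freq l (latt i))))"
  proof (rule synth_powr[where 'd='d, OF l r])
    fix C assume h: "0 \<le> C" "\<And>a (y::real^'d). (\<And>i. 0 \<le> a i) \<Longrightarrow>
      summable (\<lambda>i. a i * decay ?N (y + freq l (latt i))) \<Longrightarrow>
      ennreal ((\<Sum>i. a i * decay ?N (y + freq l (latt i))) powr r) \<le>
        ennreal C * (\<Sum>i. ennreal (a i powr r * decay ?D (y + freq l (latt i))))"
    show thesis by (rule that[OF h])
  qed
  obtain L where L: "0 \<le> L" "\<And>y::real^'d. summable (\<lambda>i. decay ?D (y + freq l (latt i)))"
    "\<And>y::real^'d. (\<Sum>i. decay ?D (y + freq l (latt i))) \<le> L" by (rule lattice_sum[OF l]) (rule that)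
  obtain I where I: "0 < I" "\<And>y::real^'d. (\<integral>\<^sup>+x. ennreal (decay ?D (x + y)) \<partial>lborel) \<le> ennreal I"
    by (rule nn_decay) (rule that)
  define C1 where "C1 = C * E powr r * I + 1"
  have C1: "0 < C1" using C(1) I(1) by (simp add: C1_def add_nonneg_pos)
  have main: "(\<integral>\<^sup>+x. ennreal (norm (G f j x) powr r) \<partial>lborel) \<le> ennreal C1 * (\<Sum>i. ennreal (cp (1 / r) f j (latt i) powr r))"
    if f: "f \<in> dist_mod_poly" and j: "j \<in> J" for f j
  \<comment> \<open>An infinite right-hand side is treated separately because the discrete estimate
    presupposes summability.\<close>
  proof (cases "(\<Sum>i. ennreal (cp (1 / r) f j (latt i) powr r)) = \<top>")
    case True
    then show ?thesis using C1 by (simp add: ennreal_mult_top)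
  next
    case False
    note [measurable] = G_measurable[OF j]
    let ?S = "\<Sum>i. ennreal (cp (1 / r) f j (latt i) powr r)"
    have D0: "0 < Dt j" by (rule Dt_pos[OF j])
    define a where "a i = E * Dt j powr (1/2) * norm (cc f (latt i) j)" for i
    have a0: "0 \<le> a i" for i using E(1) by (simp add: a_def)
    have ac: "a i = E * Dt j powr (1 / r) * cp (1 / r) f j (latt i)" for i
    proof -
      have "Dt j powr (1/2) = Dt j powr (1 / r) * Dt j powr (1/2 - 1 / r)" by (simp add: powr_add[symmetric])
      then show ?thesis by (simp add: a_def cp_def mult.assoc)
    qed
    have cp0: "0 \<le> cp (1 / r) f j n" for n by (simp add: cp_def)
    define V where "V = enn2real ?S"
    have V: "?S = ennreal V" "0 \<le> V" using False by (simp_all add: V_def less_top)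
    \<comment> \<open>A finite sum of powers bounds each coefficient, which suffices for summability
      against the lattice weight.\<close>
    have cb: "cp (1 / r) f j (latt i) \<le> V powr (1 / r)" for i
    proof -
      have "(\<Sum>i\<in>{i}. ennreal (cp (1 / r) f j (latt i) powr r)) \<le> ?S"
        by (rule sum_le_suminf[OF summableI]) simp_all
      then have "ennreal (cp (1 / r) f j (latt i) powr r) \<le> ennreal V" unfolding V(1) by simp
      then have "cp (1 / r) f j (latt i) powr r \<le> V" using V(2) by (simp add: ennreal_le_iff)
      then have "(cp (1 / r) f j (latt i) powr r) powr (1 / r) \<le> V powr (1 / r)" using r by (intro powr_mono2) auto
      then show ?thesis using r cp0 by (simp add: powr_powr)
    qed
    have sm: "summable (\<lambda>i. a i * decay ?N (y + freq l (latt i)))" for y :: "real^'d"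
    proof (rule summable_comparison_test)
      show "summable (\<lambda>i. E * Dt j powr (1 / r) * V powr (1 / r) * decay ?D (y + freq l (latt i)))" by (rule summable_mult[OF L(2)])
      have "a i * decay ?N (y + freq l (latt i)) \<le> E * Dt j powr (1 / r) * V powr (1 / r) * decay ?D (y + freq l (latt i))" for i
        unfolding ac using E(1) by (intro mult_mono mult_left_mono cb decay_mono Np_ge(1)[OF r]) auto
      then show "\<exists>N. \<forall>i\<ge>N. norm (a i * decay ?N (y + freq l (latt i))) \<le> E * Dt j powr (1 / r) * V powr (1 / r) * decay ?D (y + freq l (latt i))"
        using a0 by (intro exI[of _ 0]) simp
    qed
    have Gle: "norm (G f j (dil (\<iota> j) y)) \<le> (\<Sum>i. a i * decay ?N (y + freq l (latt i)))" for y
    proof -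
      have "norm (G f j (dil (\<iota> j) y)) \<le> (\<Sum>i. norm (cc f (latt i) j * \<eta> (latt i) j (dil (\<iota> j) y)))"
        unfolding G_def by (rule summable_norm[OF G_summable[OF f j]])
      also have "\<dots> \<le> (\<Sum>i. a i * decay ?N (y + freq l (latt i)))"
      proof (rule suminf_le[OF _ G_summable[OF f j] sm])
        fix i
        have "norm (\<eta> (latt i) j (dil (\<iota> j) y)) \<le> E * Dt j powr (1/2) * decay ?N (y + freq l (latt i))"
          using E(2)[OF j, of "latt i" "dil (\<iota> j) y"] by (simp add: dil_\<tau>\<iota>[OF j])
        from mult_left_mono[OF this norm_ge_zero[of "cc f (latt i) j"]]
        show "norm (cc f (latt i) j * \<eta> (latt i) j (dil (\<iota> j) y)) \<le> a i * decay ?N (y + freq l (latt i))"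
          by (simp add: norm_mult a_def mult_ac)
      qed
      finally show ?thesis .
    qed
    have "(\<integral>\<^sup>+x. ennreal (norm (G f j x) powr r) \<partial>lborel) = ennreal (1 / Dt j) * (\<integral>\<^sup>+y. ennreal (norm (G f j (dil (\<iota> j) y)) powr r) \<partial>lborel)"
      by (rule nn_scale[OF j]) measurable
    also have "\<dots> \<le> ennreal (1 / Dt j) * (\<integral>\<^sup>+y. ennreal C * (\<Sum>i. ennreal (a i powr r * decay ?D (y + freq l (latt i :: int^'d)))) \<partial>lborel)"
    proof (intro mult_left_mono nn_integral_mono)
      fix y :: "real^'d"
      have "ennreal (norm (G f j (dil (\<iota> j) y)) powr r) \<le> ennreal ((\<Sum>i. a i * decay ?N (y + freq l (latt i :: int^'d))) powr r)"
        using Gle[of y] r by (intro ennreal_leI powr_mono2) auto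
      also have "\<dots> \<le> ennreal C * (\<Sum>i. ennreal (a i powr r * decay ?D (y + freq l (latt i :: int^'d))))"
        by (rule C(2)[OF a0 sm])
      finally show "ennreal (norm (G f j (dil (\<iota> j) y)) powr r) \<le> ennreal C * (\<Sum>i. ennreal (a i powr r * decay ?D (y + freq l (latt i :: int^'d))))" .
    qed simp
    finally have outer: "(\<integral>\<^sup>+x. ennreal (norm (G f j x) powr r) \<partial>lborel) \<le> ennreal (1 / Dt j) * (\<integral>\<^sup>+y. ennreal C * (\<Sum>i. ennreal (a i powr r * decay ?D (y + freq l (latt i :: int^'d)))) \<partial>lborel)" .
    have "(\<integral>\<^sup>+y. ennreal C * (\<Sum>i. ennreal (a i powr r * decay ?D (y + freq l (latt i :: int^'d)))) \<partial>lborel)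
        = ennreal C * (\<Sum>i. \<integral>\<^sup>+y. ennreal (a i powr r * decay ?D (y + freq l (latt i :: int^'d))) \<partial>lborel)"
      by (subst nn_integral_cmult, measurable) (subst nn_integral_suminf, measurable)
    also have "\<dots> \<le> ennreal C * (\<Sum>i. ennreal (a i powr r) * ennreal I)"
    proof (intro mult_left_mono suminf_le summableI)
      fix i
      have "(\<integral>\<^sup>+y. ennreal (a i powr r * decay ?D (y + freq l (latt i :: int^'d))) \<partial>lborel) = ennreal (a i powr r) * (\<integral>\<^sup>+y. ennreal (decay ?D (y + freq l (latt i :: int^'d))) \<partial>lborel)"
        by (subst nn_integral_cmult[symmetric]) (simp_all add: ennreal_mult)
      also have "\<dots> \<le> ennreal (a i powr r) * ennreal I" by (intro mult_left_mono I) simp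
      finally show "(\<integral>\<^sup>+y. ennreal (a i powr r * decay ?D (y + freq l (latt i :: int^'d))) \<partial>lborel) \<le> ennreal (a i powr r) * ennreal I" .
    qed simp
    also have "(\<Sum>i. ennreal (a i powr r) * ennreal I) = (\<Sum>i. ennreal (E powr r * Dt j * I) * ennreal (cp (1 / r) f j (latt i) powr r))"
    proof (rule suminf_cong)
      fix i
      have "a i powr r = E powr r * Dt j * cp (1 / r) f j (latt i) powr r"
        unfolding ac using r D0 E(1) by (simp add: powr_mult powr_powr)
      then show "ennreal (a i powr r) * ennreal I = ennreal (E powr r * Dt j * I) * ennreal (cp (1 / r) f j (latt i) powr r)"
        using I(1) D0 by (simp add: ennreal_mult[symmetric] mult_ac)
    qed
    also have "\<dots> = ennreal (E powr r * Dt j * I) * ?S" by simp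
    finally have inner: "(\<integral>\<^sup>+y. ennreal C * (\<Sum>i. ennreal (a i powr r * decay ?D (y + freq l (latt i :: int^'d)))) \<partial>lborel) \<le> ennreal C * (ennreal (E powr r * Dt j * I) * ?S)" .
    have "(\<integral>\<^sup>+x. ennreal (norm (G f j x) powr r) \<partial>lborel) \<le> ennreal (1 / Dt j) * (ennreal C * (ennreal (E powr r * Dt j * I) * ?S))"
      by (rule order_trans[OF outer mult_left_mono[OF inner]]) simp
    also have "\<dots> = ennreal (C * E powr r * I) * ?S"
    proof -
      have "1 / Dt j * (C * (E powr r * Dt j * I)) = C * E powr r * I" using D0 by simp
      moreover have "ennreal (1 / Dt j) * (ennreal C * (ennreal (E powr r * Dt j * I) * ?S)) = ennreal (1 / Dt j * (C * (E powr r * Dt j * I))) * ?S"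
        unfolding mult.assoc by (subst ennreal_mult3) (use D0 C(1) I(1) in \<open>auto simp: mult.assoc\<close>)
      ultimately show ?thesis by simp
    qed
    also have "\<dots> \<le> ennreal C1 * ?S" by (intro mult_right_mono ennreal_leI) (simp_all add: C1_def)
    finally show ?thesis .
  qed
  show thesis by (rule that[OF C1 main])
qed

lemma decay_neighbour:
  assumes j: "j \<in> J" and k: "k \<in> nb j"
  shows "decay N (dil (\<tau> k) (dil (\<iota> j) v)) \<le> Kr ^ N * decay N v"
    "1 + norm (dil (\<tau> k) (dil (\<iota> j) v)) \<le> Kr * (1 + norm v)" "Dt k \<le> Kr ^ CARD('d) * Dt j"
proof -
  have kJ: "k \<in> J" by (rule nb_J[OF k])
  have tj: "0 < \<tau> j $ i" and tk: "0 < \<tau> k $ i" for i using \<tau>_pos[OF j] \<tau>_pos[OF kJ] by auto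
  have r1: "\<tau> k $ i \<le> Kr * \<tau> j $ i" for i by (rule \<tau>_ratio[OF j k])
  have r2: "\<tau> j $ i \<le> Kr * \<tau> k $ i" for i by (rule \<tau>_ratio[OF kJ nb_sym[OF j k]])
  let ?u = "dil (\<tau> k) (dil (\<iota> j) v)"
  have v: "dil (\<chi> i. \<tau> j $ i / \<tau> k $ i) ?u = v"
    using tj tk by (simp add: dil_def \<iota>_def vec_eq_iff less_imp_neq[symmetric])
  have u: "?u = dil (\<chi> i. \<tau> k $ i / \<tau> j $ i) v" by (simp add: dil_def \<iota>_def vec_eq_iff)
  have b2: "\<bar>(\<chi> i. \<tau> j $ i / \<tau> k $ i) $ i\<bar> \<le> Kr" for i using r2[of i] tj[of i] tk[of i] by (simp add: pos_divide_le_eq)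
  have b1: "\<bar>(\<chi> i. \<tau> k $ i / \<tau> j $ i) $ i\<bar> \<le> Kr" for i using r1[of i] tj[of i] tk[of i] by (simp add: pos_divide_le_eq)
  show "decay N ?u \<le> Kr ^ N * decay N v" using decay_dil_le[OF b2 Kr_ge1, of N ?u] unfolding v .
  have "norm ?u \<le> Kr * norm v" unfolding u by (rule norm_dil_le[OF b1])
  then show "1 + norm ?u \<le> Kr * (1 + norm v)" using Kr_ge1 by (simp add: distrib_left)
  have "Dt k \<le> (\<Prod>i\<in>(UNIV::'d set). Kr * \<tau> j $ i)" unfolding Dt_def
    by (rule prod_mono) (use r1 tk less_imp_le in auto)
  then show "Dt k \<le> Kr ^ CARD('d) * Dt j" by (simp add: prod.distrib Dt_def)
qed

text \<open>For comparison with the coefficients of index \<open>j\<close>, the function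
  \<open>G f k\<close> is viewed in the dilated variable of \<open>j\<close> instead of its own. The
  Jacobians differ by a bounded factor, so the constant depends on \<open>N\<close> but not on
  \<open>f\<close>, \<open>j\<close> or \<open>k\<close>.\<close>

lemma repro_scaled:
  "\<exists>C\<ge>1. \<forall>f\<in>dist_mod_poly. \<forall>j\<in>J. \<forall>k\<in>nb j. \<forall>y. ennreal (norm (G f k (dil (\<iota> j) y))) \<le>
    ennreal C * (\<integral>\<^sup>+w. ennreal (norm (G f k (dil (\<iota> j) w)) * decay N (y - w)) \<partial>lborel)"
proof -
  obtain C where C: "0 \<le> C" "\<And>f k x. f \<in> dist_mod_poly \<Longrightarrow> k \<in> J \<Longrightarrow>
    ennreal (norm (G f k x)) \<le> ennreal (C * Dt k) * (\<integral>\<^sup>+y. ennreal (norm (G f k y) * decay N (dil (\<tau> k) (x - y))) \<partial>lborel)"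
    by (rule G_repro[where N=N]) (rule that)
  define C' where "C' = max 1 (C * Kr ^ CARD('d) * Kr ^ N)"
  have "ennreal (norm (G f k (dil (\<iota> j) y))) \<le> ennreal C' * (\<integral>\<^sup>+w. ennreal (norm (G f k (dil (\<iota> j) w)) * decay N (y - w)) \<partial>lborel)"
    if f: "f \<in> dist_mod_poly" and j: "j \<in> J" and k: "k \<in> nb j" for f j k y
  proof -
    have kJ: "k \<in> J" by (rule nb_J[OF k])
    note [measurable] = G_measurable[OF kJ]
    have [measurable]: "(\<lambda>w. decay N (dil (\<tau> k) (x - w))) \<in> borel_measurable borel" for x
      by (intro borel_measurable_continuous_onI continuous_on_compose2[OF continuous_on_decay[of UNIV]] continuous_intros) auto
    have [measurable]: "(\<lambda>w. dil (\<iota> j) w) \<in> borel_measurable borel" using measurable_dil[of "\<iota> j" 0] by simp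
    let ?J = "\<integral>\<^sup>+w. ennreal (norm (G f k (dil (\<iota> j) w)) * decay N (y - w)) \<partial>lborel"
    have D0: "0 < Dt j" "0 < Dt k" using Dt_pos j kJ by auto
    have "(\<integral>\<^sup>+x. ennreal (norm (G f k x) * decay N (dil (\<tau> k) (dil (\<iota> j) y - x))) \<partial>lborel)
      = ennreal (1 / Dt j) * (\<integral>\<^sup>+w. ennreal (norm (G f k (dil (\<iota> j) w)) * decay N (dil (\<tau> k) (dil (\<iota> j) y - dil (\<iota> j) w))) \<partial>lborel)"
      by (rule nn_scale[OF j]) measurable
    also have "\<dots> \<le> ennreal (1 / Dt j) * (\<integral>\<^sup>+w. ennreal (Kr ^ N) * ennreal (norm (G f k (dil (\<iota> j) w)) * decay N (y - w)) \<partial>lborel)"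
    proof (intro mult_left_mono nn_integral_mono)
      fix w
      have "decay N (dil (\<tau> k) (dil (\<iota> j) y - dil (\<iota> j) w)) \<le> Kr ^ N * decay N (y - w)"
        using decay_neighbour(1)[OF j k, of N "y - w"] by (simp add: linear_diff[OF linear_dil])
      from mult_left_mono[OF this norm_ge_zero[of "G f k (dil (\<iota> j) w)"]]
      show "ennreal (norm (G f k (dil (\<iota> j) w)) * decay N (dil (\<tau> k) (dil (\<iota> j) y - dil (\<iota> j) w))) \<le> ennreal (Kr ^ N) * ennreal (norm (G f k (dil (\<iota> j) w)) * decay N (y - w))"
        using Kr_ge1 by (simp add: ennreal_mult[symmetric] ennreal_leI mult.left_commute)
    qed simp
    also have "\<dots> = ennreal (1 / Dt j) * (ennreal (Kr ^ N) * ?J)" by (subst nn_integral_cmult) measurable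
    finally have "ennreal (norm (G f k (dil (\<iota> j) y))) \<le> ennreal (C * Dt k) * (ennreal (1 / Dt j) * (ennreal (Kr ^ N) * ?J))"
      by (intro order_trans[OF C(2)[OF f kJ]] mult_left_mono) auto
    also have "\<dots> = ennreal (C * Dt k * (1 / Dt j) * Kr ^ N) * ?J"
      by (rule ennreal_mult3) (use C(1) D0 Kr_ge1 in auto)
    also have "\<dots> \<le> ennreal C' * ?J"
    proof (intro mult_right_mono ennreal_leI)
      have "Dt k / Dt j \<le> Kr ^ CARD('d)" using decay_neighbour(3)[OF j k] D0 by (simp add: pos_divide_le_eq)
      then have "C * (Dt k / Dt j) * Kr ^ N \<le> C * Kr ^ CARD('d) * Kr ^ N"
        using C(1) Kr_ge1 by (intro mult_right_mono mult_left_mono) auto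
      then show "C * Dt k * (1 / Dt j) * Kr ^ N \<le> C'" by (simp add: C'_def)
    qed simp
    finally show ?thesis .
  qed
  then show ?thesis by (intro exI[of _ C'] conjI ballI allI) (auto simp: C'_def)
qed

text \<open>The coefficients are bounded by samples, at lattice points, of convolutions of the
  neighbouring functions with a decay weight. The power estimate turns these into integrals of |G|^r
  against lattice translates of a weight, and summing over the lattice removes the weight.\<close>

lemma analysis_bound:
  assumes r: "0 < r"
  obtains C where "0 < C" "\<And>f j. f \<in> dist_mod_poly \<Longrightarrow> j \<in> J \<Longrightarrow>
    (\<Sum>i. ennreal (cp (1 / r) f j (latt i) powr r)) \<le> ennreal C * (\<Sum>k\<in>nb j. \<integral>\<^sup>+x. ennreal (norm (G f k x) powr r) \<partial>lborel)"
proof -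
  let ?D = "2 * CARD('d)" and ?N = "Np CARD('d) r"
  obtain E where E: "0 \<le> E" "\<And>f j n. f \<in> dist_mod_poly \<Longrightarrow> j \<in> J \<Longrightarrow>
    ennreal (norm (cc f n j)) \<le> (\<Sum>k\<in>nb j. ennreal (E * Dt j powr (1/2)) * (\<integral>\<^sup>+y. ennreal (norm (G f k y) * decay ?N (dil (\<tau> j) y + freq l n)) \<partial>lborel))"
    by (rule cc_le[where N="?N"]) (rule that)
  \<comment> \<open>A constant for every decay order is chosen beforehand, because
    \<open>conv_powr\<close> uses an order that depends on the growth of the function.\<close>
  have "\<exists>B. \<forall>N. 1 \<le> B N \<and> (\<forall>f\<in>dist_mod_poly. \<forall>j\<in>J. \<forall>k\<in>nb j. \<forall>y. ennreal (norm (G f k (dil (\<iota> j) y))) \<le>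
    ennreal (B N) * (\<integral>\<^sup>+w. ennreal (norm (G f k (dil (\<iota> j) w)) * decay N (y - w)) \<partial>lborel))"
    by (rule choice) (use repro_scaled in blast)
  then obtain B where B: "\<And>N. 1 \<le> B N" "\<And>N f j k y. f \<in> dist_mod_poly \<Longrightarrow> j \<in> J \<Longrightarrow> k \<in> nb j \<Longrightarrow> ennreal (norm (G f k (dil (\<iota> j) y))) \<le>
    ennreal (B N) * (\<integral>\<^sup>+w. ennreal (norm (G f k (dil (\<iota> j) w)) * decay N (y - w)) \<partial>lborel)"
    by blast
  obtain L where L: "0 \<le> L" "\<And>y::real^'d. (\<Sum>i. ennreal (decay ?D (y + freq l (latt i)))) \<le> ennreal L"
    by (rule lattice_sum_nn[OF l]) (rule that)
  obtain I where I: "0 < I" "\<And>y::real^'d. (\<integral>\<^sup>+x. ennreal (decay ?D (x + y)) \<partial>lborel) \<le> ennreal I"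
    by (rule nn_decay) (rule that)
  obtain N0 where N0: "\<forall>j\<in>J. finite (nb j) \<and> card (nb j) \<le> N0" using nb_bound by blast
  define N where "N = N0 + 1"
  have N: "0 < N" "\<And>j. j \<in> J \<Longrightarrow> card (nb j) \<le> N" using N0 by (auto simp: N_def)
  define K where "K = max (2 * (2 * I) powr (r - 1)) (B ?N powr (1 - r))"
  have K0: "0 \<le> K" by (simp add: K_def le_max_iff_disj)
  define C1 where "C1 = E powr r * real N powr r * K * L + 1"
  have C1: "0 < C1" using K0 L(1) by (simp add: C1_def add_nonneg_pos)
  have main: "(\<Sum>i. ennreal (cp (1 / r) f j (latt i) powr r)) \<le> ennreal C1 * (\<Sum>k\<in>nb j. \<integral>\<^sup>+x. ennreal (norm (G f k x) powr r) \<partial>lborel)"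
    if f: "f \<in> dist_mod_poly" and j: "j \<in> J" for f j
  \<comment> \<open>If some neighbour has an infinite integral the right side is infinite; otherwise
    the finiteness hypothesis of \<open>conv_powr\<close> holds for every neighbour.\<close>
  proof (cases "\<exists>k\<in>nb j. (\<integral>\<^sup>+x. ennreal (norm (G f k x) powr r) \<partial>lborel) = \<top>")
    case True
    then obtain k where k: "k \<in> nb j" "(\<integral>\<^sup>+x. ennreal (norm (G f k x) powr r) \<partial>lborel) = \<top>" by blast
    have "(\<integral>\<^sup>+x. ennreal (norm (G f k x) powr r) \<partial>lborel) \<le> (\<Sum>k\<in>nb j. \<integral>\<^sup>+x. ennreal (norm (G f k x) powr r) \<partial>lborel)"
      by (rule member_le_sum[OF k(1)]) (use fin_nb[OF j] in auto)
    then have "(\<Sum>k\<in>nb j. \<integral>\<^sup>+x. ennreal (norm (G f k x) powr r) \<partial>lborel) = \<top>" unfolding k(2) by (simp add: top_unique)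
    then show ?thesis using C1 by (simp add: ennreal_mult_top)
  next
    case False
    have D0: "0 < Dt j" by (rule Dt_pos[OF j])
    have [measurable]: "(\<lambda>w. dil (\<iota> j) w) \<in> borel_measurable borel" using measurable_dil[of "\<iota> j" 0] by simp
    have dm[measurable]: "(\<lambda>w. decay M (dil (\<tau> j) w + v)) \<in> borel_measurable borel" for M v
      by (intro borel_measurable_continuous_onI continuous_on_compose2[OF continuous_on_decay[of UNIV]] continuous_intros) auto
    let ?W = "\<lambda>k. \<integral>\<^sup>+x. ennreal (norm (G f k x) powr r) \<partial>lborel"
    define g where "g k y = norm (G f k (dil (\<iota> j) y))" for k y
    let ?J = "\<lambda>k n. \<integral>\<^sup>+w. ennreal (g k w * decay ?N (w + freq l n)) \<partial>lborel"
    let ?U = "\<lambda>k n. \<integral>\<^sup>+w. ennreal (g k w powr r * decay ?D (w + freq l n)) \<partial>lborel"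
    have gm: "g k \<in> borel_measurable borel" if "k \<in> nb j" for k
    proof -
      note [measurable] = G_measurable[OF nb_J[OF that]]
      show ?thesis unfolding g_def[abs_def] by measurable
    qed
    have Wg: "(\<integral>\<^sup>+w. ennreal (g k w powr r) \<partial>lborel) = ennreal (Dt j) * ?W k" if k: "k \<in> nb j" for k
    proof -
      note [measurable] = G_measurable[OF nb_J[OF k]]
      show ?thesis unfolding g_def by (rule nn_scale'[OF j]) measurable
    qed
    have ex: "\<exists>s\<ge>0. ?J k n = ennreal s \<and> ennreal (s powr r) \<le> ennreal K * ?U k n" if k: "k \<in> nb j" for k n
    proof -
      obtain C M where C: "0 \<le> C" "\<And>x. norm (G f k x) \<le> C * (1 + norm (dil (\<tau> k) x)) ^ M"
        by (rule G_bound[OF f nb_J[OF k]]) (rule that)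
      have poly: "g k y \<le> C * Kr ^ M * (1 + norm y) ^ M" for y
      proof -
        have "g k y \<le> C * (1 + norm (dil (\<tau> k) (dil (\<iota> j) y))) ^ M" unfolding g_def by (rule C(2))
        also have "\<dots> \<le> C * (Kr * (1 + norm y)) ^ M"
          by (intro mult_left_mono power_mono decay_neighbour(2)[OF j k] C(1)) (simp add: add_nonneg_nonneg)
        finally show ?thesis by (simp only: power_mult_distrib mult.assoc)
      qed
      have fin: "(\<integral>\<^sup>+w. ennreal (g k w powr r) \<partial>lborel) < \<infinity>"
        unfolding Wg[OF k] using False k by (auto simp: ennreal_mult_less_top less_top)
      show ?thesis unfolding K_def
      proof (rule conv_powr[where B=B, OF r _ gm[OF k] B(1) _ poly fin I(2) I(1)])
        show "0 \<le> g k y" for y by (simp add: g_def)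
        show "ennreal (g k y) \<le> ennreal (B M) * (\<integral>\<^sup>+w. ennreal (g k w * decay M (y - w)) \<partial>lborel)" for M y
          unfolding g_def by (rule B(2)[OF f j k])
      qed
    qed
    \<comment> \<open>The powers of \<open>Dt j\<close> collected from normalisation, frame function
      and substitution: (1/2 - 1/r) + 1/2 - 1 = - 1/r.\<close>
    define t where "t = E * Dt j powr (- (1 / r))"
    have t0: "0 \<le> t" using E(1) by (simp add: t_def)
    have bound: "ennreal (cp (1 / r) f j n powr r) \<le> ennreal (E powr r / Dt j * real N powr r * K) * (\<Sum>k\<in>nb j. ?U k n)" for n
    proof -
      have "ennreal (norm (cc f n j)) \<le> (\<Sum>k\<in>nb j. ennreal (E * Dt j powr (- (1/2))) * ?J k n)"
      proof (rule order_trans[OF E(2)[OF f j]], rule sum_mono)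
        fix k assume k: "k \<in> nb j"
        note [measurable] = G_measurable[OF nb_J[OF k]]
        have "(\<integral>\<^sup>+y. ennreal (norm (G f k y) * decay ?N (dil (\<tau> j) y + freq l n)) \<partial>lborel) =
          ennreal (1 / Dt j) * (\<integral>\<^sup>+w. ennreal (norm (G f k (dil (\<iota> j) w)) * decay ?N (dil (\<tau> j) (dil (\<iota> j) w) + freq l n)) \<partial>lborel)"
          by (rule nn_scale[OF j]) measurable
        also have "\<dots> = ennreal (1 / Dt j) * ?J k n" by (simp add: g_def dil_\<tau>\<iota>[OF j])
        finally have e1: "(\<integral>\<^sup>+y. ennreal (norm (G f k y) * decay ?N (dil (\<tau> j) y + freq l n)) \<partial>lborel) = ennreal (1 / Dt j) * ?J k n" .
        have "Dt j powr (1/2) * (1 / Dt j) = Dt j powr (1/2 + - 1)" unfolding powr_add powr_neg_one[OF D0] ..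
        also have "1/2 + - 1 = - (1/2 :: real)" by simp
        finally have e2: "E * Dt j powr (1/2) * (1 / Dt j) = E * Dt j powr (- (1/2))" by (simp only: mult.assoc)
        have "ennreal (E * Dt j powr (1/2)) * (ennreal (1 / Dt j) * ?J k n) = ennreal (E * Dt j powr (1/2) * (1 / Dt j)) * ?J k n"
          using E(1) D0 by (subst (2) ennreal_mult) (auto simp: mult.assoc)
        then show "ennreal (E * Dt j powr (1/2)) * (\<integral>\<^sup>+y. ennreal (norm (G f k y) * decay ?N (dil (\<tau> j) y + freq l n)) \<partial>lborel) \<le> ennreal (E * Dt j powr (- (1/2))) * ?J k n"
          unfolding e1 e2 by simp
      qed
      then have c0: "ennreal (Dt j powr (1/2 - 1 / r)) * ennreal (norm (cc f n j)) \<le> ennreal (Dt j powr (1/2 - 1 / r)) * (ennreal (E * Dt j powr (- (1/2))) * (\<Sum>k\<in>nb j. ?J k n))"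
        by (intro mult_left_mono) (simp_all add: sum_distrib_left)
      have tq: "Dt j powr (1/2 - 1 / r) * (E * Dt j powr (- (1/2))) = t"
      proof -
        have "Dt j powr (1/2 - 1 / r) * Dt j powr (- (1/2)) = Dt j powr (- (1 / r))" unfolding powr_add[symmetric] by simp
        then show ?thesis by (simp add: t_def mult.left_commute)
      qed
      have "ennreal (Dt j powr (1/2 - 1 / r)) * (ennreal (E * Dt j powr (- (1/2))) * (\<Sum>k\<in>nb j. ?J k n)) = ennreal t * (\<Sum>k\<in>nb j. ?J k n)"
        unfolding tq[symmetric] by (rule ennreal_mult2) (use E(1) in auto)
      moreover have "ennreal (cp (1 / r) f j n) = ennreal (Dt j powr (1/2 - 1 / r)) * ennreal (norm (cc f n j))"
        by (simp add: cp_def ennreal_mult)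
      ultimately have c1: "ennreal (cp (1 / r) f j n) \<le> ennreal t * (\<Sum>k\<in>nb j. ?J k n)" using c0 by simp
      have "ennreal (cp (1 / r) f j n powr r) = ennreal_powr (ennreal (cp (1 / r) f j n)) r"
        by (simp add: ennreal_powr_ennreal cp_def)
      also have "\<dots> \<le> ennreal_powr (\<Sum>k\<in>nb j. ennreal t * ?J k n) r"
        using c1 r by (intro ennreal_powr_mono) (simp_all add: sum_distrib_left)
      also have "\<dots> \<le> ennreal (real N powr r) * (\<Sum>k\<in>nb j. ennreal_powr (ennreal t * ?J k n) r)"
        by (rule ennreal_powr_sum_le[OF fin_nb[OF j] N(2)[OF j] r N(1)])
      also have "\<dots> \<le> ennreal (real N powr r) * (\<Sum>k\<in>nb j. ennreal (t powr r * K) * ?U k n)"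
      proof (intro mult_left_mono sum_mono)
        fix k assume k: "k \<in> nb j"
        from ex[OF k, of n] obtain s where s: "0 \<le> s" "?J k n = ennreal s" "ennreal (s powr r) \<le> ennreal K * ?U k n" by blast
        have "ennreal_powr (ennreal t * ?J k n) r = ennreal (t powr r) * ennreal (s powr r)"
          unfolding s(2) using t0 s(1) by (simp add: ennreal_mult[symmetric] ennreal_powr_ennreal powr_mult)
        also have "\<dots> \<le> ennreal (t powr r) * (ennreal K * ?U k n)" by (intro mult_left_mono s(3)) simp
        finally show "ennreal_powr (ennreal t * ?J k n) r \<le> ennreal (t powr r * K) * ?U k n"
          using K0 by (simp add: ennreal_mult mult.assoc)
      qed simp
      also have "\<dots> = ennreal (real N powr r * (t powr r * K)) * (\<Sum>k\<in>nb j. ?U k n)"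
        using K0 by (simp add: sum_distrib_left[symmetric] ennreal_mult mult.assoc)
      also have "t powr r = E powr r / Dt j"
      proof -
        have e: "(Dt j powr (- (1 / r))) powr r = Dt j powr (- 1)" using r by (simp add: powr_powr)
        show ?thesis unfolding t_def powr_mult e powr_neg_one[OF D0] by simp
      qed
      finally show ?thesis by (simp add: mult_ac)
    qed
    have Usum: "(\<Sum>i. ?U k (latt i)) \<le> ennreal (L * Dt j) * ?W k" if k: "k \<in> nb j" for k
    proof -
      note [measurable] = gm[OF k]
      have "(\<Sum>i. ?U k (latt i)) = (\<integral>\<^sup>+w. (\<Sum>i. ennreal (g k w powr r * decay ?D (w + freq l (latt i)))) \<partial>lborel)"
        by (rule nn_integral_suminf[symmetric]) measurable
      also have "\<dots> \<le> (\<integral>\<^sup>+w. ennreal L * ennreal (g k w powr r) \<partial>lborel)"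
      proof (rule nn_integral_mono)
        fix w
        have "(\<Sum>i. ennreal (g k w powr r * decay ?D (w + freq l (latt i)))) = ennreal (g k w powr r) * (\<Sum>i. ennreal (decay ?D (w + freq l (latt i))))"
          by (simp add: ennreal_mult)
        also have "\<dots> \<le> ennreal (g k w powr r) * ennreal L" by (intro mult_left_mono L) simp
        finally show "(\<Sum>i. ennreal (g k w powr r * decay ?D (w + freq l (latt i)))) \<le> ennreal L * ennreal (g k w powr r)" by (simp add: mult.commute)
      qed
      also have "\<dots> = ennreal L * (ennreal (Dt j) * ?W k)" by (subst nn_integral_cmult) (simp_all add: Wg[OF k])
      finally show ?thesis using L(1) D0 by (simp add: ennreal_mult mult.assoc)
    qed
    \<comment> \<open>The factor 1 / \<open>Dt j\<close> cancels the Jacobian that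
      \<open>Usum\<close> brings in.\<close>
    define c where "c = E powr r / Dt j * real N powr r * K"
    have c0: "0 \<le> c" using K0 D0 by (simp add: c_def)
    have "(\<Sum>i. ennreal (cp (1 / r) f j (latt i) powr r)) \<le> (\<Sum>i. ennreal c * (\<Sum>k\<in>nb j. ?U k (latt i)))"
      unfolding c_def by (intro suminf_le bound summableI)
    also have "\<dots> = ennreal c * (\<Sum>k\<in>nb j. \<Sum>i. ?U k (latt i))"
      by (simp add: suminf_sum[OF summableI])
    also have "\<dots> \<le> ennreal c * (\<Sum>k\<in>nb j. ennreal (L * Dt j) * ?W k)"
      by (intro mult_left_mono sum_mono Usum) auto
    also have "\<dots> = ennreal (c * (L * Dt j)) * (\<Sum>k\<in>nb j. ?W k)"
      using c0 L(1) D0 by (simp add: sum_distrib_left[symmetric] ennreal_mult mult.assoc)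
    also have "\<dots> \<le> ennreal C1 * (\<Sum>k\<in>nb j. ?W k)"
      by (intro mult_right_mono ennreal_leI) (use D0 in \<open>simp_all add: c_def C1_def mult_ac\<close>)
    finally show ?thesis .
  qed
  show thesis by (rule that[OF C1 main])
qed

end

section \<open>The infinite exponent, and summation over the covering\<close>

context frame_setup
begin

text \<open>Pointwise triangle inequality: the supremum of the coefficients comes out of the series,
  and the lattice sum of the weights is bounded.\<close>

lemma synth_bound_sup:
  obtains C where "0 < C" "\<And>f j. f \<in> dist_mod_poly \<Longrightarrow> j \<in> J \<Longrightarrow>
    esssup lborel (\<lambda>x. ennreal (norm (G f j x))) \<le> ennreal C * (SUP n. ennreal (cp 0 f j n))"
proof -
  let ?D = "2 * CARD('d)"
  obtain E where E: "0 \<le> E" "\<And>j n x. j \<in> J \<Longrightarrow> norm (\<eta> n j x) \<le> E * Dt j powr (1/2) * decay ?D (dil (\<tau> j) x + freq l n)"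
    by (rule \<eta>_bound[where N="?D"]) (rule that)
  obtain L where L: "0 \<le> L" "\<And>y::real^'d. (\<Sum>i. ennreal (decay ?D (y + freq l (latt i)))) \<le> ennreal L"
    by (rule lattice_sum_nn[OF l]) (rule that)
  define C where "C = E * L + 1"
  have C: "0 < C" using E L by (simp add: C_def add_nonneg_pos)
  have main: "esssup lborel (\<lambda>x. ennreal (norm (G f j x))) \<le> ennreal C * (SUP n. ennreal (cp 0 f j n))"
    if f: "f \<in> dist_mod_poly" and j: "j \<in> J" for f j
  proof (rule esssup_I)
    note [measurable] = G_measurable[OF j]
    show "(\<lambda>x. ennreal (norm (G f j x))) \<in> borel_measurable lborel" by measurable
    let ?S = "SUP n. ennreal (cp 0 f j n)"
    have "ennreal (norm (G f j x)) \<le> ennreal C * ?S" for x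
    proof -
      let ?y = "dil (\<tau> j) x"
      have "norm (G f j x) \<le> (\<Sum>i. norm (cc f (latt i) j * \<eta> (latt i) j x))"
        unfolding G_def by (rule summable_norm[OF G_summable[OF f j]])
      then have "ennreal (norm (G f j x)) \<le> ennreal (\<Sum>i. norm (cc f (latt i) j * \<eta> (latt i) j x))" by (rule ennreal_leI)
      also have "\<dots> = (\<Sum>i. ennreal (norm (cc f (latt i) j * \<eta> (latt i) j x)))"
        by (rule suminf_ennreal2[OF _ G_summable[OF f j], symmetric]) simp
      also have "\<dots> \<le> (\<Sum>i. (?S * ennreal E) * ennreal (decay ?D (?y + freq l (latt i))))"
      proof (intro suminf_le summableI)
        fix i
        have "norm (cc f (latt i) j * \<eta> (latt i) j x) \<le> norm (cc f (latt i) j) * (E * Dt j powr (1/2) * decay ?D (?y + freq l (latt i)))"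
          unfolding norm_mult by (intro mult_left_mono E j) simp
        also have "\<dots> = cp 0 f j (latt i) * E * decay ?D (?y + freq l (latt i))" by (simp add: cp_def)
        finally have "ennreal (norm (cc f (latt i) j * \<eta> (latt i) j x)) \<le> ennreal (cp 0 f j (latt i) * E * decay ?D (?y + freq l (latt i)))"
          by (rule ennreal_leI)
        also have "\<dots> = ennreal (cp 0 f j (latt i)) * ennreal E * ennreal (decay ?D (?y + freq l (latt i)))"
          using E(1) by (simp add: ennreal_mult cp_def)
        also have "\<dots> \<le> (?S * ennreal E) * ennreal (decay ?D (?y + freq l (latt i)))"
          by (intro mult_right_mono SUP_upper) auto
        finally show "ennreal (norm (cc f (latt i) j * \<eta> (latt i) j x)) \<le> (?S * ennreal E) * ennreal (decay ?D (?y + freq l (latt i)))" .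
      qed
      also have "\<dots> = (?S * ennreal E) * (\<Sum>i. ennreal (decay ?D (?y + freq l (latt i))))" by simp
      also have "\<dots> \<le> (?S * ennreal E) * ennreal L" by (intro mult_left_mono L) simp
      also have "\<dots> = ennreal (E * L) * ?S" using E(1) L(1) by (simp add: ennreal_mult mult_ac)
      also have "\<dots> \<le> ennreal C * ?S" by (intro mult_right_mono ennreal_leI) (simp_all add: C_def)
      finally show ?thesis .
    qed
    then show "AE x in lborel. ennreal (norm (G f j x)) \<le> ennreal C * ?S" by (intro AE_I2)
  qed
  show thesis by (rule that[OF C main])
qed

text \<open>The essential supremum comes out of each integral, and the weight integrates to at most
  a multiple of 1 / \<open>Dt j\<close>, which the two factors \<open>Dt j powr (1/2)\<close>
  cancel.\<close>

lemma analysis_bound_sup: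
  obtains C where "0 < C" "\<And>f j n. f \<in> dist_mod_poly \<Longrightarrow> j \<in> J \<Longrightarrow>
    ennreal (cp 0 f j n) \<le> ennreal C * (\<Sum>k\<in>nb j. esssup lborel (\<lambda>x. ennreal (norm (G f k x))))"
proof -
  let ?D = "2 * CARD('d)"
  obtain E where E: "0 \<le> E" "\<And>f j n. f \<in> dist_mod_poly \<Longrightarrow> j \<in> J \<Longrightarrow>
    ennreal (norm (cc f n j)) \<le> (\<Sum>k\<in>nb j. ennreal (E * Dt j powr (1/2)) * (\<integral>\<^sup>+y. ennreal (norm (G f k y) * decay ?D (dil (\<tau> j) y + freq l n)) \<partial>lborel))"
    by (rule cc_le[where N="?D"]) (rule that)
  obtain I where I: "0 < I" "\<And>y::real^'d. (\<integral>\<^sup>+x. ennreal (decay ?D (x + y)) \<partial>lborel) \<le> ennreal I"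
    by (rule nn_decay) (rule that)
  define C where "C = E * I + 1"
  have C: "0 < C" using E I by (simp add: C_def add_nonneg_pos)
  have main: "ennreal (cp 0 f j n) \<le> ennreal C * (\<Sum>k\<in>nb j. esssup lborel (\<lambda>x. ennreal (norm (G f k x))))"
    if f: "f \<in> dist_mod_poly" and j: "j \<in> J" for f j n
  proof -
    let ?X = "\<lambda>k. esssup lborel (\<lambda>x. ennreal (norm (G f k x)))"
    have D0: "0 < Dt j" by (rule Dt_pos[OF j])
    have [measurable]: "(\<lambda>w. decay ?D (dil (\<tau> j) w + v)) \<in> borel_measurable borel" for v
      by (intro borel_measurable_continuous_onI continuous_on_compose2[OF continuous_on_decay[of UNIV]] continuous_intros) auto
    have dI: "(\<integral>\<^sup>+y. ennreal (decay ?D (dil (\<tau> j) y + freq l n)) \<partial>lborel) \<le> ennreal (1 / Dt j) * ennreal I"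
    proof -
      have "(\<integral>\<^sup>+y. ennreal (decay ?D (dil (\<tau> j) y + freq l n)) \<partial>lborel) = ennreal (1 / Dt j) * (\<integral>\<^sup>+w. ennreal (decay ?D (dil (\<tau> j) (dil (\<iota> j) w) + freq l n)) \<partial>lborel)"
        by (rule nn_scale[OF j]) measurable
      also have "\<dots> \<le> ennreal (1 / Dt j) * ennreal I" unfolding dil_\<tau>\<iota>[OF j] by (intro mult_left_mono I) simp
      finally show ?thesis .
    qed
    have c1: "ennreal (norm (cc f n j)) \<le> (\<Sum>k\<in>nb j. ennreal (E * Dt j powr (1/2)) * (ennreal (1 / Dt j) * (ennreal I * ?X k)))"
    proof (rule order_trans[OF E(2)[OF f j]], rule sum_mono, rule mult_left_mono)
      fix k assume k: "k \<in> nb j"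
      note [measurable] = G_measurable[OF nb_J[OF k]]
      have "(\<integral>\<^sup>+y. ennreal (norm (G f k y) * decay ?D (dil (\<tau> j) y + freq l n)) \<partial>lborel) \<le> (\<integral>\<^sup>+y. ?X k * ennreal (decay ?D (dil (\<tau> j) y + freq l n)) \<partial>lborel)"
      proof (rule nn_integral_mono_AE)
        have "AE y in lborel. ennreal (norm (G f k y)) \<le> ?X k" by (rule esssup_AE)
        then show "AE y in lborel. ennreal (norm (G f k y) * decay ?D (dil (\<tau> j) y + freq l n)) \<le> ?X k * ennreal (decay ?D (dil (\<tau> j) y + freq l n))"
          by eventually_elim (simp add: ennreal_mult mult_right_mono)
      qed
      also have "\<dots> = ?X k * (\<integral>\<^sup>+y. ennreal (decay ?D (dil (\<tau> j) y + freq l n)) \<partial>lborel)" by (rule nn_integral_cmult) measurable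
      also have "\<dots> \<le> ?X k * (ennreal (1 / Dt j) * ennreal I)" by (intro mult_left_mono dI) simp
      finally show "(\<integral>\<^sup>+y. ennreal (norm (G f k y) * decay ?D (dil (\<tau> j) y + freq l n)) \<partial>lborel) \<le> ennreal (1 / Dt j) * (ennreal I * ?X k)"
        by (simp add: mult_ac)
    qed simp
    have "Dt j powr (1/2) * Dt j powr (1/2) = Dt j" unfolding powr_add[symmetric] using D0 by simp
    then have d1: "Dt j powr (1/2) * (E * Dt j powr (1/2) * (1 / Dt j) * I) = E * I"
      using D0 by (simp add: field_simps)
    have "ennreal (cp 0 f j n) = ennreal (Dt j powr (1/2)) * ennreal (norm (cc f n j))" by (simp add: cp_def ennreal_mult)
    also have "\<dots> \<le> ennreal (Dt j powr (1/2)) * (\<Sum>k\<in>nb j. ennreal (E * Dt j powr (1/2)) * (ennreal (1 / Dt j) * (ennreal I * ?X k)))"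
      by (intro mult_left_mono c1) simp
    also have "(\<Sum>k\<in>nb j. ennreal (E * Dt j powr (1/2)) * (ennreal (1 / Dt j) * (ennreal I * ?X k))) = (\<Sum>k\<in>nb j. ennreal (E * Dt j powr (1/2) * (1 / Dt j) * I) * ?X k)"
      by (intro sum.cong refl ennreal_mult3) (use E(1) D0 I(1) in auto)
    also have "\<dots> = ennreal (E * Dt j powr (1/2) * (1 / Dt j) * I) * (\<Sum>k\<in>nb j. ?X k)" by (rule sum_distrib_left[symmetric])
    also have "ennreal (Dt j powr (1/2)) * (ennreal (E * Dt j powr (1/2) * (1 / Dt j) * I) * (\<Sum>k\<in>nb j. ?X k)) = ennreal (E * I) * (\<Sum>k\<in>nb j. ?X k)"
      unfolding d1[symmetric] by (rule ennreal_mult2) (use E(1) D0 I(1) in auto)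
    also have "\<dots> \<le> ennreal C * (\<Sum>k\<in>nb j. ?X k)" by (intro mult_right_mono ennreal_leI) (simp_all add: C_def)
    finally show ?thesis .
  qed
  show thesis by (rule that[OF C main])
qed

lemma norms_equiv:
  assumes p: "0 < p"
  obtains C where "0 < C"
    "\<And>f j. f \<in> dist_mod_poly \<Longrightarrow> j \<in> J \<Longrightarrow> Lp_norm p (G f j) \<le> ennreal C * lp_norm p UNIV (\<lambda>n. ennreal (cp (inv_exponent p) f j n))"
    "\<And>f j. f \<in> dist_mod_poly \<Longrightarrow> j \<in> J \<Longrightarrow> lp_norm p UNIV (\<lambda>n. ennreal (cp (inv_exponent p) f j n)) \<le> ennreal C * (\<Sum>k\<in>nb j. Lp_norm p (G f k))"
proof (cases p)
  case top
  have i0: "inv_exponent p = 0" using top by (simp add: inv_exponent_def)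
  obtain C1 where C1: "0 < C1" "\<And>f j. f \<in> dist_mod_poly \<Longrightarrow> j \<in> J \<Longrightarrow>
    esssup lborel (\<lambda>x. ennreal (norm (G f j x))) \<le> ennreal C1 * (SUP n. ennreal (cp 0 f j n))" by (rule synth_bound_sup) (rule that)
  obtain C2 where C2: "0 < C2" "\<And>f j n. f \<in> dist_mod_poly \<Longrightarrow> j \<in> J \<Longrightarrow>
    ennreal (cp 0 f j n) \<le> ennreal C2 * (\<Sum>k\<in>nb j. esssup lborel (\<lambda>x. ennreal (norm (G f k x))))" by (rule analysis_bound_sup) (rule that)
  show thesis
  proof (rule that[of "max C1 C2"])
    show "0 < max C1 C2" using C1 by simp
    fix f :: "'d functional" and j assume f: "f \<in> dist_mod_poly" and j: "j \<in> J"
    have "ennreal C1 * (SUP n. ennreal (cp 0 f j n)) \<le> ennreal (max C1 C2) * (SUP n. ennreal (cp 0 f j n))"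
      by (intro mult_right_mono ennreal_leI) auto
    then show "Lp_norm p (G f j) \<le> ennreal (max C1 C2) * lp_norm p UNIV (\<lambda>n. ennreal (cp (inv_exponent p) f j n))"
      using order_trans[OF C1(2)[OF f j]] unfolding i0 by (simp add: Lp_norm_def lp_norm_def top)
    have "ennreal C2 * (\<Sum>k\<in>nb j. esssup lborel (\<lambda>x. ennreal (norm (G f k x)))) \<le> ennreal (max C1 C2) * (\<Sum>k\<in>nb j. esssup lborel (\<lambda>x. ennreal (norm (G f k x))))"
      by (intro mult_right_mono ennreal_leI) auto
    then have "(SUP n. ennreal (cp 0 f j n)) \<le> ennreal (max C1 C2) * (\<Sum>k\<in>nb j. esssup lborel (\<lambda>x. ennreal (norm (G f k x))))"
      by (intro SUP_least order_trans[OF C2(2)[OF f j]])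
    then show "lp_norm p UNIV (\<lambda>n. ennreal (cp (inv_exponent p) f j n)) \<le> ennreal (max C1 C2) * (\<Sum>k\<in>nb j. Lp_norm p (G f k))"
      unfolding i0 by (simp add: Lp_norm_def lp_norm_def top)
  qed
next
  case (real r)
  have r: "0 < r" using real p by (cases "r = 0") auto
  have i0: "inv_exponent p = 1 / r" unfolding real(2) by (rule inv_exponent_eq[OF r])
  obtain C1 where C1: "0 < C1" "\<And>f j. f \<in> dist_mod_poly \<Longrightarrow> j \<in> J \<Longrightarrow>
    (\<integral>\<^sup>+x. ennreal (norm (G f j x) powr r) \<partial>lborel) \<le> ennreal C1 * (\<Sum>i. ennreal (cp (1 / r) f j (latt i) powr r))" by (rule synth_bound[OF r]) (rule that)
  obtain C2 where C2: "0 < C2" "\<And>f j. f \<in> dist_mod_poly \<Longrightarrow> j \<in> J \<Longrightarrow>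
    (\<Sum>i. ennreal (cp (1 / r) f j (latt i) powr r)) \<le> ennreal C2 * (\<Sum>k\<in>nb j. \<integral>\<^sup>+x. ennreal (norm (G f k x) powr r) \<partial>lborel)" by (rule analysis_bound[OF r]) (rule that)
  obtain N0 where N0: "\<forall>j\<in>J. finite (nb j) \<and> card (nb j) \<le> N0" using nb_bound by blast
  define N where "N = N0 + 1"
  have N: "0 < N" "\<And>j. j \<in> J \<Longrightarrow> card (nb j) \<le> N" using N0 by (auto simp: N_def)
  have X: "Lp_norm p (G f j) = ennreal_powr (\<integral>\<^sup>+x. ennreal (norm (G f j x) powr r) \<partial>lborel) (1 / r)" for f j
    using real by (simp add: Lp_norm_def inv_exponent_eq[OF r])
  have Y: "lp_norm p UNIV (\<lambda>n. ennreal (cp (inv_exponent p) f j n)) = ennreal_powr (\<Sum>i. ennreal (cp (1 / r) f j (latt i) powr r)) (1 / r)" for f j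
    unfolding i0 using real by (simp add: lp_norm_def inv_exponent_eq[OF r] infsum_latt ennreal_powr_ennreal cp_def)
  define C where "C = max (C1 powr (1 / r)) (C2 powr (1 / r) * real N powr (1 / r))"
  show thesis
  proof (rule that[of C])
    show "0 < C" using C1 by (simp add: C_def less_max_iff_disj)
    fix f :: "'d functional" and j assume f: "f \<in> dist_mod_poly" and j: "j \<in> J"
    have "ennreal_powr (\<integral>\<^sup>+x. ennreal (norm (G f j x) powr r) \<partial>lborel) (1 / r) \<le> ennreal_powr (ennreal C1 * (\<Sum>i. ennreal (cp (1 / r) f j (latt i) powr r))) (1 / r)"
      using r by (intro ennreal_powr_mono C1(2)[OF f j]) simp
    also have "\<dots> = ennreal (C1 powr (1 / r)) * ennreal_powr (\<Sum>i. ennreal (cp (1 / r) f j (latt i) powr r)) (1 / r)"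
      by (rule ennreal_powr_cmult[OF C1(1)])
    also have "\<dots> \<le> ennreal C * ennreal_powr (\<Sum>i. ennreal (cp (1 / r) f j (latt i) powr r)) (1 / r)"
      by (intro mult_right_mono ennreal_leI) (simp_all add: C_def)
    finally show "Lp_norm p (G f j) \<le> ennreal C * lp_norm p UNIV (\<lambda>n. ennreal (cp (inv_exponent p) f j n))" unfolding X Y .
    have "ennreal_powr (\<Sum>i. ennreal (cp (1 / r) f j (latt i) powr r)) (1 / r) \<le> ennreal_powr (ennreal C2 * (\<Sum>k\<in>nb j. \<integral>\<^sup>+x. ennreal (norm (G f k x) powr r) \<partial>lborel)) (1 / r)"
      using r by (intro ennreal_powr_mono C2(2)[OF f j]) simp
    also have "\<dots> = ennreal (C2 powr (1 / r)) * ennreal_powr (\<Sum>k\<in>nb j. \<integral>\<^sup>+x. ennreal (norm (G f k x) powr r) \<partial>lborel) (1 / r)"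
      by (rule ennreal_powr_cmult[OF C2(1)])
    also have "\<dots> \<le> ennreal (C2 powr (1 / r)) * (ennreal (real N powr (1 / r)) * (\<Sum>k\<in>nb j. ennreal_powr (\<integral>\<^sup>+x. ennreal (norm (G f k x) powr r) \<partial>lborel) (1 / r)))"
      using r by (intro mult_left_mono ennreal_powr_sum_le[OF fin_nb[OF j] N(2)[OF j] _ N(1)]) auto
    also have "\<dots> = ennreal (C2 powr (1 / r) * real N powr (1 / r)) * (\<Sum>k\<in>nb j. Lp_norm p (G f k))"
      unfolding X by (simp add: ennreal_mult mult.assoc)
    also have "\<dots> \<le> ennreal C * (\<Sum>k\<in>nb j. Lp_norm p (G f k))"
      by (intro mult_right_mono ennreal_leI) (simp_all add: C_def)
    finally show "lp_norm p UNIV (\<lambda>n. ennreal (cp (inv_exponent p) f j n)) \<le> ennreal C * (\<Sum>k\<in>nb j. Lp_norm p (G f k))" unfolding Y .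
  qed
qed

text \<open>A negative exponent reverses the comparison of the weights, so both directions of the
  ratio bound are used and the absolute value of \<open>\<beta>\<close> appears.\<close>

lemma weight_ratio:
  assumes j: "j \<in> J" and k: "k \<in> nb j"
  shows "h (\<xi> j) powr \<beta> \<le> (R\<^sup>2) powr \<bar>\<beta>\<bar> * h (\<xi> k) powr \<beta>"
proof -
  have kJ: "k \<in> J" by (rule nb_J[OF k])
  have p: "0 < h (\<xi> j)" "0 < h (\<xi> k)" using h_pos[OF \<xi>_nz[OF j]] h_pos[OF \<xi>_nz[OF kJ]] by auto
  have a: "h (\<xi> k) \<le> R\<^sup>2 * h (\<xi> j)" by (rule h_ratio[OF j k])
  have b: "h (\<xi> j) \<le> R\<^sup>2 * h (\<xi> k)" by (rule h_ratio[OF kJ nb_sym[OF j k]])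
  have R0: "0 < R\<^sup>2" using R_ge1 by simp
  show ?thesis
  proof (cases "0 \<le> \<beta>")
    case True
    have "h (\<xi> j) powr \<beta> \<le> (R\<^sup>2 * h (\<xi> k)) powr \<beta>" using b p True by (intro powr_mono2) auto
    then show ?thesis using True by (simp add: powr_mult)
  next
    case False
    have "(R\<^sup>2 * h (\<xi> j)) powr \<beta> \<le> h (\<xi> k) powr \<beta>" using a p False by (intro powr_mono2') auto
    then have "(R\<^sup>2) powr \<beta> * h (\<xi> j) powr \<beta> \<le> h (\<xi> k) powr \<beta>" by (simp add: powr_mult)
    then have "(R\<^sup>2) powr (- \<beta>) * ((R\<^sup>2) powr \<beta> * h (\<xi> j) powr \<beta>) \<le> (R\<^sup>2) powr (- \<beta>) * h (\<xi> k) powr \<beta>"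
      by (rule mult_left_mono) simp
    moreover have "(R\<^sup>2) powr (- \<beta>) * (R\<^sup>2) powr \<beta> = 1" using R0 by (simp add: powr_add[symmetric])
    ultimately show ?thesis using False by (simp add: mult.assoc[symmetric])
  qed
qed

text \<open>The intermediate functional \<open>u j\<close> is the multiplier piece. The determinant
  powers in the normalised coefficient and in front of the frame function cancel, so the series is
  the same for every exponent \<open>p\<close>.\<close>

lemma expansion:
  assumes f: "f \<in> dist_mod_poly"
  shows "\<exists>u. (\<forall>j\<in>J. u j \<in> dist_mod_poly \<and>
          dist_has_sum
            (\<lambda>n \<theta>. pairing f (frame_system_p p J A b \<Phi> z l n j) * of_real (\<bar>det (A j)\<bar> powr (inv_exponent p - 1/2)) *
                     dist_of_fun (frame_system J A b \<Phi> z l n j) \<theta>)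
            (u j) UNIV) \<and>
        dist_has_sum u f J"
proof (intro exI[of _ "\<lambda>j. multiplier (\<lambda>x. ph j x * ph j x) f"] conjI ballI)
  show "dist_has_sum (\<lambda>j. multiplier (\<lambda>x. ph j x * ph j x) f) f J"
    unfolding dist_has_sum_def using ph2_has_sum[OF f] by blast
  fix j assume j: "j \<in> J"
  show "multiplier (\<lambda>x. ph j x * ph j x) f \<in> dist_mod_poly" by (rule multiplier_dist[OF ph2_ccinf0[OF j] f])
  have D0: "0 < Dt j" by (rule Dt_pos[OF j])
  have c: "pairing f (frame_system_p p J A b \<Phi> z l n j) * of_real (\<bar>det (A j)\<bar> powr (inv_exponent p - 1/2)) = cc f n j" for n
  proof -
    have "Dt j powr (1/2 - inv_exponent p) * Dt j powr (inv_exponent p - 1/2) = 1"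
      unfolding powr_add[symmetric] using D0 by simp
    then have "complex_of_real (Dt j powr (1/2 - inv_exponent p)) * of_real (Dt j powr (inv_exponent p - 1/2)) = 1"
      unfolding of_real_mult[symmetric] by simp
    then show ?thesis
      unfolding pairing_frame_p[OF f j] det_A[OF j] abs_of_pos[OF D0] by (simp add: mult.commute mult.left_commute)
  qed
  show "dist_has_sum (\<lambda>n \<theta>. pairing f (frame_system_p p J A b \<Phi> z l n j) * of_real (\<bar>det (A j)\<bar> powr (inv_exponent p - 1/2)) *
      dist_of_fun (frame_system J A b \<Phi> z l n j) \<theta>) (multiplier (\<lambda>x. ph j x * ph j x) f) UNIV"
    unfolding dist_has_sum_def c
  proof
    fix \<theta> :: "real^'d \<Rightarrow> complex" assume "\<theta> \<in> S0"
    then have t: "\<theta> \<in> schwartz" by (simp add: S0_def)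
    have "dist_of_fun (frame_system J A b \<Phi> z l n j) \<theta> = (\<integral>x. En n j x * inv_fourier \<theta> x \<partial>lborel)" for n
      unfolding dist_of_fun_def frame_En[OF j] by (rule inv_fourier_mult_swap[OF En_schwartz[OF j] t])
    then show "((\<lambda>n. cc f n j * dist_of_fun (frame_system J A b \<Phi> z l n j) \<theta>) has_sum multiplier (\<lambda>x. ph j x * ph j x) f \<theta>) UNIV"
      using expand_has_sum[OF f j schwartz_smooth[OF inv_fourier_schwartz[OF t]]] by (simp add: multiplier_eq)
  qed
qed

text \<open>Coefficients at \<open>j\<close> see all neighbouring pieces. The weight is first moved
  from \<open>j\<close> to the neighbour, and bounded overlap then absorbs the sum over neighbours
  in the outer sequence norm; the opposite inequality needs only the single index.\<close>

lemma norm_equivalence: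
  assumes p: "0 < p" and q: "0 < q"
  shows "\<exists>c\<^sub>1>0. \<exists>c\<^sub>2>0. \<forall>f\<in>dist_mod_poly.
        (let F = decomp_norm p q \<beta> h J \<xi> \<phi> f;
             G = lp_norm q J (\<lambda>j. ennreal (h (\<xi> j) powr \<beta>) *
                   lp_norm p UNIV (\<lambda>n. ennreal (norm (pairing f (frame_system_p p J A b \<Phi> z l n j)))))
         in ennreal c\<^sub>1 * F \<le> G \<and> G \<le> ennreal c\<^sub>2 * F)"
proof -
  obtain C where C: "0 < C"
    "\<And>f j. f \<in> dist_mod_poly \<Longrightarrow> j \<in> J \<Longrightarrow> Lp_norm p (G f j) \<le> ennreal C * lp_norm p UNIV (\<lambda>n. ennreal (cp (inv_exponent p) f j n))"
    "\<And>f j. f \<in> dist_mod_poly \<Longrightarrow> j \<in> J \<Longrightarrow> lp_norm p UNIV (\<lambda>n. ennreal (cp (inv_exponent p) f j n)) \<le> ennreal C * (\<Sum>k\<in>nb j. Lp_norm p (G f k))"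
    by (rule norms_equiv[OF p]) (rule that)
  obtain N0 where N0: "\<forall>j\<in>J. finite (nb j) \<and> card (nb j) \<le> N0" using nb_bound by blast
  obtain C3 where C3: "0 < C3" "\<And>x. lp_norm q J (\<lambda>j. \<Sum>k\<in>nb j. x k) \<le> ennreal C3 * lp_norm q J x"
  proof (rule lp_norm_neighbours[OF countable_J, of "N0 + 1" nb q])
    show "finite (nb j) \<and> card (nb j) \<le> N0 + 1" if "j \<in> J" for j using N0 that by auto
    show "k \<in> J \<and> j \<in> nb k" if "j \<in> J" "k \<in> nb j" for j k using nb_J[OF that(2)] nb_sym[OF that] by blast
    fix C assume h: "0 < C" "\<And>x. lp_norm q J (\<lambda>j. \<Sum>k\<in>nb j. x k) \<le> ennreal C * lp_norm q J x"
    show thesis by (rule that[OF h])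
  qed (use q in auto)
  define H where "H = (R\<^sup>2) powr \<bar>\<beta>\<bar>"
  have H: "0 < H" using R_ge1 by (simp add: H_def)
  let ?w = "\<lambda>j. ennreal (h (\<xi> j) powr \<beta>)"
  have main: "ennreal (1 / C) * decomp_norm p q \<beta> h J \<xi> \<phi> f \<le> lp_norm q J (\<lambda>j. ?w j * lp_norm p UNIV (\<lambda>n. ennreal (norm (pairing f (frame_system_p p J A b \<Phi> z l n j)))))
    \<and> lp_norm q J (\<lambda>j. ?w j * lp_norm p UNIV (\<lambda>n. ennreal (norm (pairing f (frame_system_p p J A b \<Phi> z l n j))))) \<le> ennreal (C * H * C3) * decomp_norm p q \<beta> h J \<xi> \<phi> f"
    (is "_ * ?F \<le> ?G \<and> _") if f: "f \<in> dist_mod_poly" for f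
  proof -
    let ?X = "\<lambda>j. Lp_norm p (G f j)" and ?Y = "\<lambda>j. lp_norm p UNIV (\<lambda>n. ennreal (cp (inv_exponent p) f j n))"
    have X: "dist_Lp_norm p (multiplier (\<lambda>\<zeta>. complex_of_real ((\<phi> j \<zeta>)\<^sup>2)) f) = ?X j" if j: "j \<in> J" for j
      unfolding phi2_eq[OF j] by (rule dist_Lp_norm_represents[OF G_represents[OF f j]])
    have Y: "lp_norm p UNIV (\<lambda>n. ennreal (norm (pairing f (frame_system_p p J A b \<Phi> z l n j)))) = ?Y j" if j: "j \<in> J" for j
      unfolding pairing_frame_p[OF f j] by (simp add: norm_mult cp_def)
    have "?F \<le> lp_norm q J (\<lambda>j. ennreal C * (?w j * ?Y j))"
      unfolding decomp_norm_def
    proof (rule lp_norm_mono[OF countable_J])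
      fix j assume j: "j \<in> J"
      have "?w j * ?X j \<le> ?w j * (ennreal C * ?Y j)" by (intro mult_left_mono C(2)[OF f j]) simp
      then show "?w j * dist_Lp_norm p (multiplier (\<lambda>\<zeta>. complex_of_real ((\<phi> j \<zeta>)\<^sup>2)) f) \<le> ennreal C * (?w j * ?Y j)"
        unfolding X[OF j] by (simp add: mult.left_commute)
    qed
    also have "\<dots> \<le> ennreal C * lp_norm q J (\<lambda>j. ?w j * ?Y j)" by (rule lp_norm_cmult[OF countable_J C(1) q])
    also have "\<dots> \<le> ennreal C * ?G"
      by (intro mult_left_mono lp_norm_mono[OF countable_J]) (simp_all add: Y)
    finally have "ennreal (1 / C) * ?F \<le> ennreal (1 / C) * (ennreal C * ?G)" by (rule mult_left_mono) simp
    also have "\<dots> = ?G" using C(1) by (simp add: mult.assoc[symmetric] ennreal_mult[symmetric])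
    finally have 1: "ennreal (1 / C) * ?F \<le> ?G" .
    have "?G \<le> lp_norm q J (\<lambda>j. ennreal (C * H) * (\<Sum>k\<in>nb j. ?w k * ?X k))"
    proof (rule lp_norm_mono[OF countable_J])
      fix j assume j: "j \<in> J"
      have "?w j * ?Y j \<le> ?w j * (ennreal C * (\<Sum>k\<in>nb j. ?X k))" by (intro mult_left_mono C(3)[OF f j]) simp
      also have "\<dots> = ennreal C * (\<Sum>k\<in>nb j. ?w j * ?X k)" by (simp add: sum_distrib_left mult.left_commute)
      also have "\<dots> \<le> ennreal C * (\<Sum>k\<in>nb j. ennreal H * (?w k * ?X k))"
      proof (intro mult_left_mono sum_mono)
        fix k assume k: "k \<in> nb j"
        have "?w j \<le> ennreal H * ?w k"
          using ennreal_leI[OF weight_ratio[OF j k, of \<beta>]] H by (simp add: H_def ennreal_mult)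
        then have "?w j * ?X k \<le> ennreal H * ?w k * ?X k" by (rule mult_right_mono) simp
        then show "?w j * ?X k \<le> ennreal H * (?w k * ?X k)" by (simp add: mult.assoc)
      qed simp
      also have "\<dots> = ennreal (C * H) * (\<Sum>k\<in>nb j. ?w k * ?X k)"
        using C(1) H by (simp add: sum_distrib_left[symmetric] ennreal_mult mult.assoc)
      finally show "?w j * lp_norm p UNIV (\<lambda>n. ennreal (norm (pairing f (frame_system_p p J A b \<Phi> z l n j)))) \<le> ennreal (C * H) * (\<Sum>k\<in>nb j. ?w k * ?X k)"
        unfolding Y[OF j] .
    qed
    also have "\<dots> \<le> ennreal (C * H) * lp_norm q J (\<lambda>j. \<Sum>k\<in>nb j. ?w k * ?X k)"
      by (rule lp_norm_cmult[OF countable_J _ q]) (use C H in simp)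
    also have "\<dots> \<le> ennreal (C * H) * (ennreal C3 * lp_norm q J (\<lambda>j. ?w j * ?X j))"
      by (intro mult_left_mono C3(2)) simp
    also have "\<dots> \<le> ennreal (C * H) * (ennreal C3 * ?F)"
    proof (intro mult_left_mono)
      show "lp_norm q J (\<lambda>j. ?w j * ?X j) \<le> ?F"
        unfolding decomp_norm_def
      proof (rule lp_norm_mono[OF countable_J])
        fix j assume j: "j \<in> J"
        show "?w j * ?X j \<le> ?w j * dist_Lp_norm p (multiplier (\<lambda>\<zeta>. complex_of_real ((\<phi> j \<zeta>)\<^sup>2)) f)"
          unfolding X[OF j] ..
      qed
    qed simp_all
    also have "\<dots> = ennreal (C * H * C3) * ?F"
      using C(1) H C3(1) by (simp add: ennreal_mult mult.assoc)
    finally show ?thesis using 1 by blast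
  qed
  show ?thesis
  proof (intro exI conjI ballI)
    show "0 < 1 / C" "0 < C * H * C3" using C(1) H C3(1) by auto
    fix f :: "'d functional" assume "f \<in> dist_mod_poly"
    from main[OF this] show "let F = decomp_norm p q \<beta> h J \<xi> \<phi> f;
             G = lp_norm q J (\<lambda>j. ?w j * lp_norm p UNIV (\<lambda>n. ennreal (norm (pairing f (frame_system_p p J A b \<Phi> z l n j)))))
         in ennreal (1 / C) * F \<le> G \<and> G \<le> ennreal (C * H * C3) * F"
      unfolding Let_def .
  qed
qed

end

theorem proposition7p2:
  fixes a :: "real^'d::finite" and h :: "real^'d \<Rightarrow> real" and R \<delta>\<^sub>0 \<delta> :: real
    and J :: "'j set" and \<xi> :: "'j \<Rightarrow> real^'d"
    and A :: "'j \<Rightarrow> real^'d^'d" and b :: "'j \<Rightarrow> real^'d"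
    and P Q :: "(real^'d) set" and \<Phi> :: "real^'d \<Rightarrow> real"
    and z :: "real^'d" and l :: real
  assumes "anisotropy a"
    and "hybrid_regulation a h"
    and "moderate_with a R \<delta>\<^sub>0 h"
    and "0 < \<delta>" and "\<delta> < \<delta>\<^sub>0"
    and "ball_covering a h \<delta> J \<xi> A b P Q"
    and "bump P Q \<Phi>"
    and "0 < l" and "Q \<subseteq> cube z l"
  defines "\<phi> \<equiv> sqrt_system J A b \<Phi>"
    and "\<eta> \<equiv> frame_system J A b \<Phi> z l"
    and "\<eta>p \<equiv> (\<lambda>p. frame_system_p p J A b \<Phi> z l)"
  shows
    "(\<forall>p>0. \<forall>f\<in>dist_mod_poly. \<exists>u.
        (\<forall>j\<in>J. u j \<in> dist_mod_poly \<and>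
          dist_has_sum
            (\<lambda>n \<theta>. pairing f (\<eta>p p n j) * of_real (\<bar>det (A j)\<bar> powr (inv_exponent p - 1/2)) *
                     dist_of_fun (\<eta> n j) \<theta>)
            (u j) UNIV) \<and>
        dist_has_sum u f J) \<and>
     (\<forall>p>0. \<forall>q>0. \<forall>\<beta>. \<exists>c\<^sub>1>0. \<exists>c\<^sub>2>0. \<forall>f\<in>dist_mod_poly.
        (let F = decomp_norm p q \<beta> h J \<xi> \<phi> f;
             G = lp_norm q J (\<lambda>j. ennreal (h (\<xi> j) powr \<beta>) *
                   lp_norm p UNIV (\<lambda>n. ennreal (norm (pairing f (\<eta>p p n j)))))
         in ennreal c\<^sub>1 * F \<le> G \<and> G \<le> ennreal c\<^sub>2 * F))"
proof -
  interpret frame_setup a h R \<delta>\<^sub>0 \<delta> J \<xi> A b P Q \<Phi> z l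
    by unfold_locales (use assms(1-9) in auto)
  show ?thesis
    unfolding \<phi>_def \<eta>_def \<eta>p_def using expansion norm_equivalence by blast
qed

end
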